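(* For every $\ell\ge0$, the spectral triple $(\mathcal A_\ell^\infty,\mathcal H_\ell,D_\ell)$ is regular and has $\{1,2,\ldots,\ell+1\}$ as its dimension spectrum, with only simple poles.
   Context: **Basic notation.** $\mathbb N=\{0,1,2,\dots\}$. On $\ell_2(\mathbb N)$ and $\ell_2(\mathbb Z)$, with standard basis $(e_n)$, $S$ is the left shift $Se_n=e_{n-1}$ (with $Se_0=0$ on $\ell_2(\mathbb N)$); $p_0$ is the projection onto $\mathbb C e_0$. Put $\mathcal H_\ell=\ell_2(\mathbb N)^{\otimes \ell}\otimes\ell_2(\mathbb Z)$ with standard basis $(e_\gamma)_{\gamma\in\mathbb N^\ell\times\mathbb Z}$. **The algebra $\mathcal A_\ell^\infty$.** Define Fréchet algebras $(\mathcal A_\ell^\infty,(\|\cdot\|_m)_{m\in\mathbb N})$ of operators on $\mathcal H_\ell$ inductively: $\mathcal A_0^\infty=C^\infty(\mathbb T)$ acting on $\ell_2(\mathbb Z)$, i.e. all $\sum_{n\in\mathbb Z}a_n\mathbf z^n$ with $(a_n)$ rapidly decreasing and $\mathbf z=S^*$ the right shift, with $\|\sum a_n\mathbf z^n\|_m=\sum(1+|n|)^m|a_n|$. For $\ell\ge1$, with $\alpha_1=S\otimes I$, $\mathcal A_\ell^\infty$ is the set of all $$a=\sum_{j,k\in\mathbb N}\alpha_1^{*j}(p_0\otimes a_{jk})\alpha_1^k+\sum_{k\ge0}\lambda_k\alpha_1^k+\sum_{k>0}\lambda_{-k}\alpha_1^{*k}$$ with $a_{jk}\in\mathcal A_{\ell-1}^\infty$,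 $\sum_{j,k}(1+j+k)^n\|a_{jk}\|_m<\infty$ for all $n,m$, and $(\lambda_k)_{k\in\mathbb Z}$ rapidly decreasing; $\|a\|_m=\max_{r,s\le m}\big(\sum_{j,k}(1+j+k)^r\|a_{jk}\|_s\big)+\sum_{k\in\mathbb Z}(1+|k|)^m|\lambda_k|$. **The operator $D_\ell$.** $D_\ell e_\gamma=\big(\gamma_1+\dots+\gamma_\ell+|\gamma_{\ell+1}|\big)e_\gamma$ if $\gamma_{\ell+1}\ge0$ and $D_\ell e_\gamma=-\big(\gamma_1+\dots+\gamma_\ell+|\gamma_{\ell+1}|\big)e_\gamma$ if $\gamma_{\ell+1}<0$. **Spectral triples.** A spectral triple $(\mathcal A,\mathcal H,D)$ consists of a unital $*$-algebra $\mathcal A$ faithfully represented on a separable Hilbert space $\mathcal H$ and a self-adjoint $D$ with compact resolvent such that $[D,a]$ is bounded for all $a\in\mathcal A$. $\delta=[|D|,\cdot]$, with $Dom(\delta)$ the set of bounded $T$ leaving $Dom(|D|)$ invariant with $[|D|,T]$ extending to a bounded operator $\delta(T)$; $OP^0=\bigcap_nDom(\delta^n)$. The triple is regular if $\mathcal A+[D,\mathcal A]\subset OP^0$. If it is regular and $|D|^{-p}\in\mathcal L^{(1,\infty)}$ for some $p$, let $\mathcal B$ be the algebra generated by $\delta^n(\mathcal A)$ and $\delta^n([D,\mathcal A])$, $n\ge0$; it has discrete dimension spectrum $\Sigma\subset\mathbb C$ if $\Sigma$ is discrete and for every $b\in\mathcal B$ the function $Trace(b|D|^{-z})$, defined for $\mathrm{Re}\,z>p$,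 extends to a meromorphic function on $\mathbb C$ with poles only in $\Sigma$; that a given set is the dimension spectrum also means that each of its points is a pole for some $b\in\mathcal B$. The dimension spectrum is simple if all these poles are simple. Since $\ker D$ is finite dimensional, $|D|^{-z}$ is understood to be $0$ on $\ker D$. *)

theory Defs
  imports
    "HOL-Complex_Analysis.Complex_Analysis"
    "HOL-Library.Function_Algebras"
begin

section \<open>Operators on square summable families\<close>

text \<open>
  The library has no complex Hilbert spaces.  Every separable complex Hilbert space is
  (unitarily equivalent to) the space of square summable families over a countable set \<open>I\<close>,
  so the general notions below are stated for these.  Families are total functions vanishing
  outside \<open>I\<close>; sums and differences of vectors and of operators are the pointwise ones of
  \<^theory>\<open>HOL-Library.Function_Algebras\<close>.
\<close>

type_synonym 'i vec = "'i \<Rightarrow> complex"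
type_synonym 'i op = "'i vec \<Rightarrow> 'i vec"

text \<open>A possibly unbounded operator: its domain and its action.\<close>
type_synonym 'i unbounded_op = "'i vec set \<times> 'i op"

definition ell2 :: "'i set \<Rightarrow> 'i vec set" where
  "ell2 I = {\<psi>. (\<forall>i. i \<notin> I \<longrightarrow> \<psi> i = 0) \<and> (\<lambda>i. (cmod (\<psi> i))\<^sup>2) summable_on I}"

definition l2inner :: "'i set \<Rightarrow> 'i vec \<Rightarrow> 'i vec \<Rightarrow> complex" where
  "l2inner I \<phi> \<psi> = (\<Sum>\<^sub>\<infinity>i\<in>I. cnj (\<phi> i) * \<psi> i)"

definition l2norm :: "'i set \<Rightarrow> 'i vec \<Rightarrow> real" where
  "l2norm I \<psi> = sqrt (\<Sum>\<^sub>\<infinity>i\<in>I. (cmod (\<psi> i))\<^sup>2)"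

definition ket :: "'i \<Rightarrow> 'i vec" where
  "ket i = (\<lambda>j. if j = i then 1 else 0)"

definition scale_vec :: "complex \<Rightarrow> 'i vec \<Rightarrow> 'i vec" where
  "scale_vec c \<psi> = (\<lambda>i. c * \<psi> i)"

definition scale_op :: "complex \<Rightarrow> 'i op \<Rightarrow> 'i op" where
  "scale_op c T = (\<lambda>\<psi>. scale_vec c (T \<psi>))"

text \<open>
  A bounded operator is represented by a function that is \<open>0\<close> outside \<open>ell2 I\<close>, so that
  equality of functions is equality of operators.
\<close>

definition on_ell2 :: "'i set \<Rightarrow> 'i op \<Rightarrow> 'i op" where
  "on_ell2 I T = (\<lambda>\<psi>. if \<psi> \<in> ell2 I then T \<psi> else 0)"

definition linear_on_vecs :: "'i vec set \<Rightarrow> 'i op \<Rightarrow> bool" where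
  "linear_on_vecs V T \<longleftrightarrow>
     (\<forall>\<phi>\<in>V. \<forall>\<psi>\<in>V. T (\<phi> + \<psi>) = T \<phi> + T \<psi>) \<and>
     (\<forall>c. \<forall>\<psi>\<in>V. T (scale_vec c \<psi>) = scale_vec c (T \<psi>))"

definition bounded_ops :: "'i set \<Rightarrow> 'i op set" where
  "bounded_ops I = {T.
     (\<forall>\<psi>\<in>ell2 I. T \<psi> \<in> ell2 I) \<and> (\<forall>\<psi>. \<psi> \<notin> ell2 I \<longrightarrow> T \<psi> = 0) \<and>
     linear_on_vecs (ell2 I) T \<and>
     (\<exists>C. \<forall>\<psi>\<in>ell2 I. l2norm I (T \<psi>) \<le> C * l2norm I \<psi>)}"

definition opnorm :: "'i set \<Rightarrow> 'i op \<Rightarrow> real" where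
  "opnorm I T = (SUP \<psi>\<in>{\<psi>\<in>ell2 I. l2norm I \<psi> \<le> 1}. l2norm I (T \<psi>))"

definition is_adjoint :: "'i set \<Rightarrow> 'i op \<Rightarrow> 'i op \<Rightarrow> bool" where
  "is_adjoint I T U \<longleftrightarrow> (\<forall>\<phi>\<in>ell2 I. \<forall>\<psi>\<in>ell2 I. l2inner I (U \<phi>) \<psi> = l2inner I \<phi> (T \<psi>))"

definition compact_op :: "'i set \<Rightarrow> 'i op \<Rightarrow> bool" where
  "compact_op I T \<longleftrightarrow> T \<in> bounded_ops I \<and>
     (\<forall>f :: nat \<Rightarrow> 'i vec. (\<forall>n. f n \<in> ell2 I \<and> l2norm I (f n) \<le> 1) \<longrightarrow>
       (\<exists>r \<phi>. strict_mono r \<and> \<phi> \<in> ell2 I \<and> (\<lambda>n. l2norm I (T (f (r n)) - \<phi>)) \<longlonglongrightarrow> 0))"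

definition rank_le :: "'i set \<Rightarrow> 'i op \<Rightarrow> nat \<Rightarrow> bool" where
  "rank_le I F n \<longleftrightarrow> (\<exists>v :: nat \<Rightarrow> 'i vec. (\<forall>k<n. v k \<in> ell2 I) \<and>
     (\<forall>\<psi>\<in>ell2 I. \<exists>c. F \<psi> = (\<Sum>k<n. scale_vec (c k) (v k))))"

text \<open>The \<open>n\<close>-th singular value (counted from \<open>0\<close>) as the distance to the operators of rank
  at most \<open>n\<close>.\<close>

definition singular_value :: "'i set \<Rightarrow> 'i op \<Rightarrow> nat \<Rightarrow> real" where
  "singular_value I T n = (INF F\<in>{F \<in> bounded_ops I. rank_le I F n}. opnorm I (T - F))"

text \<open>The Dixmier ideal \<open>\<L>\<^sup>(\<^sup>1\<^sup>,\<^sup>\<infinity>\<^sup>)\<close>.\<close>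

definition dixmier_ideal :: "'i set \<Rightarrow> 'i op set" where
  "dixmier_ideal I = {T. compact_op I T \<and>
     (\<exists>C. \<forall>N\<ge>2. (\<Sum>n<N. singular_value I T n) \<le> C * ln (real N))}"

definition trace_class :: "'i set \<Rightarrow> 'i op \<Rightarrow> bool" where
  "trace_class I T \<longleftrightarrow> compact_op I T \<and> summable (singular_value I T)"

text \<open>Meaningful on trace class operators, where the value is independent of the basis.\<close>

definition op_trace :: "'i set \<Rightarrow> 'i op \<Rightarrow> complex" where
  "op_trace I T = (\<Sum>\<^sub>\<infinity>i\<in>I. l2inner I (ket i) (T (ket i)))"


section \<open>Self-adjoint operators with compact resolvent\<close>

text \<open>The conjuncts after density say that the domain of the adjoint is the domain of the
  operator and that the two agree there.\<close>

definition self_adjoint :: "'i set \<Rightarrow> 'i unbounded_op \<Rightarrow> bool" where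
  "self_adjoint I = (\<lambda>(dom, D).
     dom \<subseteq> ell2 I \<and> 0 \<in> dom \<and>
     (\<forall>\<phi>\<in>dom. \<forall>\<psi>\<in>dom. \<phi> + \<psi> \<in> dom) \<and> (\<forall>c. \<forall>\<psi>\<in>dom. scale_vec c \<psi> \<in> dom) \<and>
     (\<forall>\<psi>\<in>dom. D \<psi> \<in> ell2 I) \<and> linear_on_vecs dom D \<and>
     (\<forall>\<psi>\<in>ell2 I. \<forall>\<epsilon>>0. \<exists>\<phi>\<in>dom. l2norm I (\<psi> - \<phi>) < \<epsilon>) \<and>
     (\<forall>\<phi>\<in>dom. \<forall>\<psi>\<in>dom. l2inner I (D \<phi>) \<psi> = l2inner I \<phi> (D \<psi>)) \<and>
     (\<forall>\<phi>\<in>ell2 I. (\<exists>\<eta>\<in>ell2 I. \<forall>\<psi>\<in>dom. l2inner I \<eta> \<psi> = l2inner I \<phi> (D \<psi>)) \<longrightarrow> \<phi> \<in> dom))"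

text \<open>By the resolvent identity one compact resolvent makes all of them compact.\<close>

definition compact_resolvent :: "'i set \<Rightarrow> 'i unbounded_op \<Rightarrow> bool" where
  "compact_resolvent I = (\<lambda>(dom, D). \<exists>\<mu> R. compact_op I R \<and>
     (\<forall>\<psi>\<in>ell2 I. R \<psi> \<in> dom \<and> D (R \<psi>) - scale_vec \<mu> (R \<psi>) = \<psi>) \<and>
     (\<forall>\<psi>\<in>dom. R (D \<psi> - scale_vec \<mu> \<psi>) = \<psi>))"

text \<open>
  Functional calculus \<open>f(D) = (\<Sum>\<lambda>. f \<lambda> P\<^sub>\<lambda>)\<close>, where \<open>P\<^sub>\<lambda>\<close> is the orthogonal projection onto
  \<open>ker (D - \<lambda>)\<close> and \<open>\<lambda>\<close> ranges over the reals.  This is the Borel functional calculus when \<open>D\<close>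
  is self-adjoint with compact resolvent, since such a \<open>D\<close> has an orthonormal basis of
  eigenvectors.
\<close>

definition eigenspace :: "'i unbounded_op \<Rightarrow> real \<Rightarrow> 'i vec set" where
  "eigenspace = (\<lambda>(dom, D) \<mu>. {\<psi>\<in>dom. D \<psi> = scale_vec (of_real \<mu>) \<psi>})"

definition eigenprojection :: "'i set \<Rightarrow> 'i unbounded_op \<Rightarrow> real \<Rightarrow> 'i op" where
  "eigenprojection I D \<mu> \<psi> =
     (THE \<phi>. \<phi> \<in> eigenspace D \<mu> \<and> (\<forall>\<eta>\<in>eigenspace D \<mu>. l2inner I \<eta> (\<psi> - \<phi>) = 0))"

definition functional_calculus :: "'i set \<Rightarrow> 'i unbounded_op \<Rightarrow> (real \<Rightarrow> complex) \<Rightarrow> 'i unbounded_op"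
  where
  "functional_calculus I D f =
     (let dom = {\<psi>\<in>ell2 I.
        (\<lambda>\<mu>. (cmod (f \<mu>) * l2norm I (eigenprojection I D \<mu> \<psi>))\<^sup>2) summable_on UNIV}
      in (dom, \<lambda>\<psi>. if \<psi> \<in> dom then (\<lambda>i. \<Sum>\<^sub>\<infinity>\<mu>. f \<mu> * eigenprojection I D \<mu> \<psi> i) else 0))"

definition abs_op :: "'i set \<Rightarrow> 'i unbounded_op \<Rightarrow> 'i unbounded_op" where
  "abs_op I D = functional_calculus I D (\<lambda>\<mu>. of_real \<bar>\<mu>\<bar>)"

text \<open>\<open>|D|\<^sup>-\<^sup>z\<close>, understood to be \<open>0\<close> on the kernel of \<open>D\<close>.\<close>

definition abs_neg_power :: "'i set \<Rightarrow> 'i unbounded_op \<Rightarrow> complex \<Rightarrow> 'i op" where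
  "abs_neg_power I D z =
     snd (functional_calculus I D (\<lambda>\<mu>. if \<mu> = 0 then 0 else of_real \<bar>\<mu>\<bar> powr (- z)))"


section \<open>Spectral triples\<close>

text \<open>\<open>T\<close> is the bounded extension of the commutator of the first argument with \<open>a\<close>; in
  particular \<open>a\<close> leaves the domain invariant.\<close>

definition extends_commutator :: "'i set \<Rightarrow> 'i unbounded_op \<Rightarrow> 'i op \<Rightarrow> 'i op \<Rightarrow> bool" where
  "extends_commutator I = (\<lambda>(dom, D) a T. T \<in> bounded_ops I \<and>
     (\<forall>\<psi>\<in>dom. a \<psi> \<in> dom \<and> T \<psi> = D (a \<psi>) - a (D \<psi>)))"

definition commutator :: "'i set \<Rightarrow> 'i unbounded_op \<Rightarrow> 'i op \<Rightarrow> 'i op" where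
  "commutator I D a = (THE T. extends_commutator I D a T)"

definition spectral_triple :: "'i op set \<Rightarrow> 'i set \<Rightarrow> 'i unbounded_op \<Rightarrow> bool" where
  "spectral_triple A I D \<longleftrightarrow>
     countable I \<and>
     A \<subseteq> bounded_ops I \<and> on_ell2 I id \<in> A \<and>
     (\<forall>a\<in>A. \<forall>b\<in>A. a + b \<in> A \<and> a \<circ> b \<in> A) \<and> (\<forall>c. \<forall>a\<in>A. scale_op c a \<in> A) \<and>
     (\<forall>a\<in>A. \<exists>b\<in>A. is_adjoint I a b) \<and>
     self_adjoint I D \<and> compact_resolvent I D \<and>
     (\<forall>a\<in>A. \<exists>T. extends_commutator I D a T)"

definition delta :: "'i set \<Rightarrow> 'i unbounded_op \<Rightarrow> 'i op \<Rightarrow> 'i op" where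
  "delta I D = commutator I (abs_op I D)"

primrec dom_delta_pow :: "'i set \<Rightarrow> 'i unbounded_op \<Rightarrow> nat \<Rightarrow> 'i op set" where
  "dom_delta_pow I D 0 = bounded_ops I"
| "dom_delta_pow I D (Suc n) =
     {T \<in> bounded_ops I. (\<exists>U. extends_commutator I (abs_op I D) T U) \<and>
        delta I D T \<in> dom_delta_pow I D n}"

definition OP0 :: "'i set \<Rightarrow> 'i unbounded_op \<Rightarrow> 'i op set" where
  "OP0 I D = (\<Inter>n. dom_delta_pow I D n)"

definition regular_triple :: "'i op set \<Rightarrow> 'i set \<Rightarrow> 'i unbounded_op \<Rightarrow> bool" where
  "regular_triple A I D \<longleftrightarrow> (\<forall>a\<in>A. \<forall>b\<in>A. a + commutator I D b \<in> OP0 I D)"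

inductive_set generated_algebra :: "'i op set \<Rightarrow> 'i op set" for G where
  generator: "g \<in> G \<Longrightarrow> g \<in> generated_algebra G"
| add: "a \<in> generated_algebra G \<Longrightarrow> b \<in> generated_algebra G \<Longrightarrow> a + b \<in> generated_algebra G"
| scale: "a \<in> generated_algebra G \<Longrightarrow> scale_op c a \<in> generated_algebra G"
| mult: "a \<in> generated_algebra G \<Longrightarrow> b \<in> generated_algebra G \<Longrightarrow> a \<circ> b \<in> generated_algebra G"

definition delta_algebra :: "'i op set \<Rightarrow> 'i set \<Rightarrow> 'i unbounded_op \<Rightarrow> 'i op set" where
  "delta_algebra A I D = generated_algebra
     (\<Union>n. (delta I D ^^ n) ` A \<union> (delta I D ^^ n) ` commutator I D ` A)"

text \<open>\<open>F\<close> is a meromorphic extension of \<open>Trace(b |D|\<^sup>-\<^sup>z)\<close>, defined for \<open>Re z > p\<close>, to the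
  complex plane.  The library's notion of meromorphy does not constrain the values of \<open>F\<close> at
  isolated points, which is immaterial for its poles.\<close>

definition zeta_extension :: "'i set \<Rightarrow> 'i unbounded_op \<Rightarrow> real \<Rightarrow> 'i op \<Rightarrow> (complex \<Rightarrow> complex) \<Rightarrow> bool"
  where
  "zeta_extension I D p b F \<longleftrightarrow> F meromorphic_on UNIV \<and>
     (\<forall>z. Re z > p \<longrightarrow> trace_class I (b \<circ> abs_neg_power I D z) \<and>
        F z = op_trace I (b \<circ> abs_neg_power I D z))"

definition summable_of_order :: "'i set \<Rightarrow> 'i unbounded_op \<Rightarrow> real \<Rightarrow> bool" where
  "summable_of_order I D p \<longleftrightarrow> abs_neg_power I D (of_real p) \<in> dixmier_ideal I"

definition has_dimension_spectrum ::
  "'i op set \<Rightarrow> 'i set \<Rightarrow> 'i unbounded_op \<Rightarrow> complex set \<Rightarrow> bool" where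
  "has_dimension_spectrum A I D \<Sigma> \<longleftrightarrow>
     regular_triple A I D \<and> discrete \<Sigma> \<and>
     (\<exists>p. summable_of_order I D p \<and>
        (\<forall>b\<in>delta_algebra A I D. \<exists>F. zeta_extension I D p b F \<and> {z. is_pole F z} \<subseteq> \<Sigma>) \<and>
        (\<forall>s\<in>\<Sigma>. \<exists>b\<in>delta_algebra A I D. \<exists>F. zeta_extension I D p b F \<and> is_pole F s))"

definition only_simple_poles :: "'i op set \<Rightarrow> 'i set \<Rightarrow> 'i unbounded_op \<Rightarrow> bool" where
  "only_simple_poles A I D \<longleftrightarrow>
     (\<forall>p b F s. summable_of_order I D p \<and> b \<in> delta_algebra A I D \<and>
        zeta_extension I D p b F \<and> is_pole F s \<longrightarrow> zorder F s = - 1)"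


section \<open>The spectral triples \<open>(\<A>\<^sub>l\<^sup>\<infinity>, \<H>\<^sub>l, D\<^sub>l)\<close>\<close>

text \<open>The basis vector \<open>e\<^sub>\<gamma>\<close> of \<open>\<H>\<^sub>l\<close> has index \<open>(g, n)\<close>, where \<open>g = [\<gamma>\<^sub>1, \<dots>, \<gamma>\<^sub>l]\<close> and
  \<open>n = \<gamma>\<^sub>l\<^sub>+\<^sub>1\<close>.\<close>

type_synonym idx = "nat list \<times> int"

definition H_idx :: "nat \<Rightarrow> idx set" where
  "H_idx l = {(g, n). length g = l}"

text \<open>\<open>z\<^sup>k\<close> maps \<open>e\<^sub>m\<close> to \<open>e\<^sub>m\<^sub>+\<^sub>k\<close>, hence acts on coefficients as follows.\<close>

definition z_power :: "int \<Rightarrow> idx op" where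
  "z_power k \<psi> = (\<lambda>(g, m). \<psi> (g, m - k))"

text \<open>\<open>\<alpha>\<^sub>1 = S \<otimes> I\<close> and its adjoint; the left shift \<open>S\<close> has \<open>(S \<psi>) x = \<psi> (x + 1)\<close>.\<close>

definition alpha1 :: "idx op" where
  "alpha1 \<psi> = (\<lambda>(g, n). case g of [] \<Rightarrow> 0 | x # xs \<Rightarrow> \<psi> (Suc x # xs, n))"

definition alpha1_adj :: "idx op" where
  "alpha1_adj \<psi> = (\<lambda>(g, n). case g of Suc x # xs \<Rightarrow> \<psi> (x # xs, n) | _ \<Rightarrow> 0)"

text \<open>\<open>p\<^sub>0 \<otimes> a\<close>\<close>

definition p0_tensor :: "idx op \<Rightarrow> idx op" where
  "p0_tensor a \<psi> = (\<lambda>(g, n). case g of 0 # xs \<Rightarrow> a (\<lambda>(ys, m). \<psi> (0 # ys, m)) (xs, n) | _ \<Rightarrow> 0)"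

definition rapidly_decreasing :: "(int \<Rightarrow> complex) \<Rightarrow> bool" where
  "rapidly_decreasing c \<longleftrightarrow> (\<forall>m::nat. (\<lambda>n. (1 + \<bar>real_of_int n\<bar>) ^ m * cmod (c n)) summable_on UNIV)"

definition rapid_norm :: "(int \<Rightarrow> complex) \<Rightarrow> nat \<Rightarrow> real" where
  "rapid_norm c m = (\<Sum>\<^sub>\<infinity>n. (1 + \<bar>real_of_int n\<bar>) ^ m * cmod (c n))"

text \<open>
  \<open>A_inf_norms l a N\<close> means that \<open>a\<close> belongs to \<open>\<A>\<^sub>l\<^sup>\<infinity>\<close> and has seminorms \<open>\<parallel>a\<parallel>\<^sub>m = N m\<close>;
  since the coefficients of \<open>a\<close> are determined by \<open>a\<close>, so is \<open>N\<close>.  The series of operators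
  converge absolutely in operator norm, so their sums may be computed coefficientwise.
\<close>

inductive A_inf_norms :: "nat \<Rightarrow> idx op \<Rightarrow> (nat \<Rightarrow> real) \<Rightarrow> bool" where
  base: "rapidly_decreasing c \<Longrightarrow>
    A_inf_norms 0 (on_ell2 (H_idx 0) (\<lambda>\<psi> \<gamma>. \<Sum>\<^sub>\<infinity>n. c n * z_power n \<psi> \<gamma>)) (rapid_norm c)"
| step: "(\<forall>j k. A_inf_norms l (a j k) (N j k)) \<Longrightarrow>
    (\<forall>n m. (\<lambda>(j, k). (1 + real j + real k) ^ n * N j k m) summable_on UNIV) \<Longrightarrow>
    rapidly_decreasing c \<Longrightarrow>
    A_inf_norms (Suc l)
      (on_ell2 (H_idx (Suc l)) (\<lambda>\<psi> \<gamma>.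
         (\<Sum>\<^sub>\<infinity>(j, k). (alpha1_adj ^^ j) (p0_tensor (a j k) ((alpha1 ^^ k) \<psi>)) \<gamma>) +
         (\<Sum>\<^sub>\<infinity>k. c (int k) * (alpha1 ^^ k) \<psi> \<gamma>) +
         (\<Sum>\<^sub>\<infinity>k\<in>{0<..}. c (- int k) * (alpha1_adj ^^ k) \<psi> \<gamma>)))
      (\<lambda>m. (MAX (r, s)\<in>{..m} \<times> {..m}. \<Sum>\<^sub>\<infinity>(j, k). (1 + real j + real k) ^ r * N j k s)
            + rapid_norm c m)"

definition A_inf :: "nat \<Rightarrow> idx op set" where
  "A_inf l = {a. \<exists>N. A_inf_norms l a N}"

definition dirac_eigenvalue :: "idx \<Rightarrow> real" where
  "dirac_eigenvalue = (\<lambda>(g, n).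
     (if n \<ge> 0 then 1 else - 1) * (real (sum_list g) + \<bar>real_of_int n\<bar>))"

text \<open>\<open>D\<^sub>l\<close> with its maximal (self-adjoint) domain.\<close>

definition Dirac :: "nat \<Rightarrow> idx unbounded_op" where
  "Dirac l =
     (let D = (\<lambda>\<psi> \<gamma>. of_real (dirac_eigenvalue \<gamma>) * \<psi> \<gamma>)
      in ({\<psi> \<in> ell2 (H_idx l). D \<psi> \<in> ell2 (H_idx l)}, D))"

end

theory Submission
  imports Defs
begin

text \<open>
  The operators of \<open>\<A>\<^sub>l\<^sup>\<infinity>\<close> are the rapidly convergent series of partial permutations of the basis
  \<open>e\<^sub>\<gamma>\<close> of the form \<open>E\<^sub>J\<^sub>K \<otimes> T \<otimes> I\<close>, where \<open>E\<^sub>J\<^sub>K\<close> is a matrix unit and \<open>T\<close> is a power of a shift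
  restricted to the rows above a threshold.  These partial permutations are closed under composition
  and inversion, which gives the algebra structure.  Splitting the last coordinate at \<open>0\<close> leads to
  a larger class of series whose generators are homogeneous for both \<open>D\<close> and \<open>|D|\<close>; that class is
  therefore invariant under \<open>[D, \<cdot>]\<close> and \<open>\<delta>\<close>, consists of bounded operators, and contains \<open>\<B>\<close>.

  The number of basis vectors with \<open>|D| = k\<close> fixed by a generator is, for large \<open>k\<close>, a polynomial
  in \<open>k\<close> of degree at most \<open>l\<close>.  Summing over the series, the trace of \<open>b\<close> on the eigenspace
  \<open>|D| = k\<close> is a polynomial of degree at most \<open>l\<close> plus a rapidly decreasing term, so
  \<open>Trace (b |D|\<^sup>-\<^sup>z)\<close> is a combination of \<open>\<zeta>(z), \<dots>, \<zeta>(z - l)\<close> plus an entire function.  The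
  continuation of \<open>\<zeta>\<close> comes from summing the Taylor expansion of \<open>(n + 1)\<^sup>1\<^sup>-\<^sup>s\<close>.  A projection onto
  the vectors whose first \<open>l - r\<close> coordinates vanish yields the pole at \<open>r + 1\<close>.
\<close>

section \<open>Square summable families, diagonal operators and their functional calculus, singular
  values\<close>

subsection \<open>Square summable families\<close>

text \<open>The obstacle is that no single family of generators does everything. The shifts in the
  definition of the algebra have the least possible threshold and are not closed under composition,
  because \<open>S^* S\<close> differs from the identity; and the bilateral translations are not
  homogeneous for \<open>|D|\<close>, because they cross 0. Hence there are three families:
  \<open>genA True\<close> matches the definition, \<open>genA False\<close> is closed under
  composition and inversion, \<open>genB\<close> is closed under composition and homogeneous. Every
  generator carries a weight \<open>a\<close> bounding its displacement and thresholds. Rewriting a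
  generator in another family takes at most linearly many terms of linearly larger weight, a
  commutator multiplies a coefficient by at most \<open>a\<close>, and comparing seminorms costs a
  factor in the exponent. Such losses are harmless because rapid decay asks for all powers of the
  weight at once. The exponent \<open>p\<close> in the dimension spectrum is only asserted to exist;
  it is taken as \<open>2 * l + 4\<close>, where crude bounds for the number of eigenvalues
  suffice.\<close>

lemma ell2_summable: "\<psi> \<in> ell2 I \<Longrightarrow> (\<lambda>i. (cmod (\<psi> i))\<^sup>2) summable_on I"
  by (simp add: ell2_def)

lemma ell2_outside: "\<psi> \<in> ell2 I \<Longrightarrow> i \<notin> I \<Longrightarrow> \<psi> i = 0"
  by (simp add: ell2_def)

lemma ell2_dominated:
  assumes "\<psi> \<in> ell2 I" and "\<And>i. i \<notin> I \<Longrightarrow> \<phi> i = 0"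
    and "\<And>i. i \<in> I \<Longrightarrow> cmod (\<phi> i) \<le> K * cmod (\<psi> i)"
  shows "\<phi> \<in> ell2 I"
proof -
  have "(\<lambda>i. (cmod (\<phi> i))\<^sup>2) summable_on I"
  proof (rule summable_on_comparison_test)
    show "(\<lambda>i. K\<^sup>2 * (cmod (\<psi> i))\<^sup>2) summable_on I"
      by (intro summable_on_cmult_right ell2_summable assms)
    show "(cmod (\<phi> i))\<^sup>2 \<le> K\<^sup>2 * (cmod (\<psi> i))\<^sup>2" if "i \<in> I" for i
      using power_mono[OF assms(3)[OF that], of 2] by (simp add: power_mult_distrib)
  qed auto
  then show ?thesis using assms by (auto simp: ell2_def)
qed

lemma ell2_zero [simp]: "0 \<in> ell2 I"
  by (simp add: ell2_def zero_fun_def)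

lemma cmod_add_power2_le: "(cmod (a + b))\<^sup>2 \<le> 2 * (cmod a)\<^sup>2 + 2 * (cmod b)\<^sup>2"
proof -
  have "(cmod (a + b))\<^sup>2 \<le> (cmod a + cmod b)\<^sup>2"
    by (intro power_mono norm_triangle_ineq norm_ge_zero)
  also have "\<dots> \<le> 2 * (cmod a)\<^sup>2 + 2 * (cmod b)\<^sup>2"
    using zero_le_power2[of "cmod a - cmod b"] by (simp add: power2_eq_square algebra_simps)
  finally show ?thesis .
qed

lemma cmod_diff_power2_le: "(cmod (a - b))\<^sup>2 \<le> 2 * (cmod a)\<^sup>2 + 2 * (cmod b)\<^sup>2"
  using cmod_add_power2_le[of a "- b"] by simp

lemma cmod_mult_le_power2: "cmod a * cmod b \<le> (cmod a)\<^sup>2 + (cmod b)\<^sup>2"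
  using sum_squares_bound[of "cmod a" "cmod b"]
    mult_nonneg_nonneg[OF norm_ge_zero[of a] norm_ge_zero[of b]] by linarith

lemma ell2_add:
  assumes "\<phi> \<in> ell2 I" "\<psi> \<in> ell2 I"
  shows "\<phi> + \<psi> \<in> ell2 I"
proof -
  have "(\<lambda>i. (cmod ((\<phi> + \<psi>) i))\<^sup>2) summable_on I"
  proof (rule summable_on_comparison_test)
    show "(\<lambda>i. 2 * (cmod (\<phi> i))\<^sup>2 + 2 * (cmod (\<psi> i))\<^sup>2) summable_on I"
      by (intro summable_on_add summable_on_cmult_right ell2_summable assms)
    show "(cmod ((\<phi> + \<psi>) i))\<^sup>2 \<le> 2 * (cmod (\<phi> i))\<^sup>2 + 2 * (cmod (\<psi> i))\<^sup>2" for i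
      using cmod_add_power2_le by simp
  qed auto
  then show ?thesis using assms by (auto simp: ell2_def plus_fun_def)
qed

lemma ell2_scale: "\<psi> \<in> ell2 I \<Longrightarrow> scale_vec c \<psi> \<in> ell2 I"
  by (rule ell2_dominated[where K = "cmod c"]) (auto simp: scale_vec_def norm_mult ell2_outside)

lemma ell2_diff: "\<phi> \<in> ell2 I \<Longrightarrow> \<psi> \<in> ell2 I \<Longrightarrow> \<phi> - \<psi> \<in> ell2 I"
  using ell2_add[of \<phi> I "scale_vec (-1) \<psi>"] ell2_scale[of \<psi> I "-1"]
  by (simp add: scale_vec_def plus_fun_def fun_diff_def)

lemma ell2_ket [simp]: "i \<in> I \<Longrightarrow> ket i \<in> ell2 I"
  unfolding ell2_def ket_def
  by (auto intro!: finite_nonzero_values_imp_summable_on finite_subset[of _ "{i}"] split: if_splits)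

lemma l2norm_nonneg [simp]: "0 \<le> l2norm I \<psi>"
  by (simp add: l2norm_def infsum_nonneg)

lemma l2norm_zero [simp]: "l2norm I 0 = 0"
proof -
  have "(\<lambda>i. (cmod ((0 :: 'a vec) i))\<^sup>2) = (\<lambda>_. 0)" by auto
  then show ?thesis unfolding l2norm_def by (simp only: infsum_0_simp real_sqrt_zero)
qed

lemma l2norm_power2: "(l2norm I \<psi>)\<^sup>2 = (\<Sum>\<^sub>\<infinity>i\<in>I. (cmod (\<psi> i))\<^sup>2)"
  by (simp add: l2norm_def infsum_nonneg)

lemma cmod_le_l2norm:
  assumes "\<psi> \<in> ell2 I"
  shows "cmod (\<psi> i) \<le> l2norm I \<psi>"
proof (cases "i \<in> I")
  case True
  have "(\<Sum>j\<in>{i}. (cmod (\<psi> j))\<^sup>2) \<le> (\<Sum>\<^sub>\<infinity>j\<in>I. (cmod (\<psi> j))\<^sup>2)"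
    by (intro finite_sum_le_infsum ell2_summable assms) (use True in auto)
  then have "(cmod (\<psi> i))\<^sup>2 \<le> (l2norm I \<psi>)\<^sup>2" by (simp add: l2norm_power2)
  then show ?thesis by (rule power2_le_imp_le) simp
next
  case False
  then show ?thesis using ell2_outside[OF assms] by simp
qed

lemma l2norm_mono:
  assumes "\<psi> \<in> ell2 I" "K \<ge> 0" and "\<And>i. i \<in> I \<Longrightarrow> cmod (\<phi> i) \<le> K * cmod (\<psi> i)"
  shows "l2norm I \<phi> \<le> K * l2norm I \<psi>"
proof (rule power2_le_imp_le)
  have le: "(cmod (\<phi> i))\<^sup>2 \<le> K\<^sup>2 * (cmod (\<psi> i))\<^sup>2" if "i \<in> I" for i
    using power_mono[OF assms(3)[OF that], of 2] by (simp add: power_mult_distrib)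
  have s: "(\<lambda>i. K\<^sup>2 * (cmod (\<psi> i))\<^sup>2) summable_on I"
    by (intro summable_on_cmult_right ell2_summable assms)
  have "(\<Sum>\<^sub>\<infinity>i\<in>I. (cmod (\<phi> i))\<^sup>2) \<le> (\<Sum>\<^sub>\<infinity>i\<in>I. K\<^sup>2 * (cmod (\<psi> i))\<^sup>2)"
    by (intro infsum_mono summable_on_comparison_test[OF s] s le) auto
  also have "\<dots> = K\<^sup>2 * (\<Sum>\<^sub>\<infinity>i\<in>I. (cmod (\<psi> i))\<^sup>2)"
    by (intro infsum_cmult_right')
  finally show "(l2norm I \<phi>)\<^sup>2 \<le> (K * l2norm I \<psi>)\<^sup>2"
    by (simp add: l2norm_power2 power_mult_distrib)
qed (use assms in simp)

lemma l2inner_abs_summable: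
  assumes "\<phi> \<in> ell2 I" "\<psi> \<in> ell2 I"
  shows "(\<lambda>i. cmod (\<phi> i) * cmod (\<psi> i)) summable_on I"
proof (rule summable_on_comparison_test)
  show "(\<lambda>i. (cmod (\<phi> i))\<^sup>2 + (cmod (\<psi> i))\<^sup>2) summable_on I"
    by (intro summable_on_add ell2_summable assms)
  show "cmod (\<phi> i) * cmod (\<psi> i) \<le> (cmod (\<phi> i))\<^sup>2 + (cmod (\<psi> i))\<^sup>2" for i
    by (rule cmod_mult_le_power2)
qed auto

lemma infsum_single:
  assumes "\<And>j. j \<in> A \<Longrightarrow> j \<noteq> i \<Longrightarrow> f j = 0"
  shows "infsum f A = (if i \<in> A then f i else (0 :: 'a :: {comm_monoid_add, t2_space}))"
proof -
  have "infsum f A = infsum f (A \<inter> {i})"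
    by (rule infsum_cong_neutral) (use assms in auto)
  then show ?thesis by auto
qed

lemma l2inner_ket_left: "i \<in> I \<Longrightarrow> l2inner I (ket i) \<psi> = \<psi> i"
  unfolding l2inner_def by (subst infsum_single[of _ i]) (auto simp: ket_def)

lemma l2inner_ket_right: "i \<in> I \<Longrightarrow> l2inner I \<phi> (ket i) = cnj (\<phi> i)"
  unfolding l2inner_def by (subst infsum_single[of _ i]) (auto simp: ket_def)

text \<open>Used with finite \<open>F\<close> for density arguments, and with a level set of the
  eigenvalue function, where it is a spectral projection.\<close>

definition trunc_vec :: "'i set \<Rightarrow> 'i vec \<Rightarrow> 'i vec" where
  "trunc_vec F \<psi> = (\<lambda>i. if i \<in> F then \<psi> i else 0)"

lemma trunc_vec_ell2: "\<psi> \<in> ell2 I \<Longrightarrow> trunc_vec F \<psi> \<in> ell2 I"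
  by (rule ell2_dominated[where K = 1]) (auto simp: trunc_vec_def ell2_outside)

lemma trunc_vec_approx:
  assumes "\<psi> \<in> ell2 I" "\<epsilon> > 0"
  shows "\<exists>F. finite F \<and> F \<subseteq> I \<and> l2norm I (\<psi> - trunc_vec F \<psi>) < \<epsilon>"
proof -
  let ?f = "\<lambda>i. (cmod (\<psi> i))\<^sup>2"
  obtain F where F: "finite F" "F \<subseteq> I" "dist (sum ?f F) (infsum ?f I) \<le> \<epsilon>\<^sup>2 / 2"
    using infsum_finite_approximation[OF ell2_summable[OF assms(1)], of "\<epsilon>\<^sup>2 / 2"] assms(2) by auto
  have "(\<Sum>\<^sub>\<infinity>i\<in>I. (cmod ((\<psi> - trunc_vec F \<psi>) i))\<^sup>2) = infsum ?f (I - F)"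
    by (rule infsum_cong_neutral) (auto simp: trunc_vec_def)
  also have "\<dots> = infsum ?f I - infsum ?f F"
    by (rule infsum_Diff) (use F ell2_summable[OF assms(1)] in auto)
  also have "\<dots> < \<epsilon>\<^sup>2"
  proof -
    have "infsum ?f I - sum ?f F \<le> \<epsilon>\<^sup>2 / 2" using F(3) unfolding dist_real_def by linarith
    moreover have "\<epsilon>\<^sup>2 > 0" using assms(2) by simp
    moreover have "infsum ?f F = sum ?f F" using F(1) by simp
    ultimately show ?thesis by linarith
  qed
  finally have "(l2norm I (\<psi> - trunc_vec F \<psi>))\<^sup>2 < \<epsilon>\<^sup>2" by (simp add: l2norm_power2)
  then have "l2norm I (\<psi> - trunc_vec F \<psi>) < \<epsilon>"
    using assms(2) by (simp add: power2_less_imp_less)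
  with F show ?thesis by blast
qed


subsection \<open>Bounded operators\<close>

lemma bounded_ops_ell2: "T \<in> bounded_ops I \<Longrightarrow> \<psi> \<in> ell2 I \<Longrightarrow> T \<psi> \<in> ell2 I"
  by (simp add: bounded_ops_def)

lemma bounded_ops_outside: "T \<in> bounded_ops I \<Longrightarrow> \<psi> \<notin> ell2 I \<Longrightarrow> T \<psi> = 0"
  by (simp add: bounded_ops_def)

lemma bounded_ops_add: "T \<in> bounded_ops I \<Longrightarrow> \<phi> \<in> ell2 I \<Longrightarrow> \<psi> \<in> ell2 I \<Longrightarrow> T (\<phi> + \<psi>) = T \<phi> + T \<psi>"
  by (simp add: bounded_ops_def linear_on_vecs_def)

lemma bounded_ops_scale: "T \<in> bounded_ops I \<Longrightarrow> \<psi> \<in> ell2 I \<Longrightarrow> T (scale_vec c \<psi>) = scale_vec c (T \<psi>)"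
  by (simp add: bounded_ops_def linear_on_vecs_def)

lemma bounded_ops_diff:
  assumes "T \<in> bounded_ops I" "\<phi> \<in> ell2 I" "\<psi> \<in> ell2 I"
  shows "T (\<phi> - \<psi>) = T \<phi> - T \<psi>"
proof -
  have eq: "a - b = a + scale_vec (-1) b" for a b :: "'a vec"
    by (simp add: scale_vec_def plus_fun_def fun_diff_def)
  show ?thesis unfolding eq
    by (simp only: bounded_ops_add[OF assms(1,2) ell2_scale[OF assms(3)]] bounded_ops_scale[OF assms(1,3)])
qed

lemma bounded_ops_bound:
  assumes "T \<in> bounded_ops I"
  obtains C where "C \<ge> 0" "\<And>\<psi>. \<psi> \<in> ell2 I \<Longrightarrow> l2norm I (T \<psi>) \<le> C * l2norm I \<psi>"
proof -
  obtain C where C: "\<And>\<psi>. \<psi> \<in> ell2 I \<Longrightarrow> l2norm I (T \<psi>) \<le> C * l2norm I \<psi>"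
    using assms by (auto simp: bounded_ops_def)
  show ?thesis
  proof (rule that[of "max C 0"])
    show "l2norm I (T \<psi>) \<le> max C 0 * l2norm I \<psi>" if "\<psi> \<in> ell2 I" for \<psi>
      using C[OF that] mult_right_mono[of C "max C 0" "l2norm I \<psi>"] by simp
  qed simp
qed

lemma bounded_opsI:
  assumes "\<And>\<psi>. \<psi> \<in> ell2 I \<Longrightarrow> T \<psi> \<in> ell2 I" "\<And>\<psi>. \<psi> \<notin> ell2 I \<Longrightarrow> T \<psi> = 0"
    "\<And>\<phi> \<psi>. \<phi> \<in> ell2 I \<Longrightarrow> \<psi> \<in> ell2 I \<Longrightarrow> T (\<phi> + \<psi>) = T \<phi> + T \<psi>"
    "\<And>c \<psi>. \<psi> \<in> ell2 I \<Longrightarrow> T (scale_vec c \<psi>) = scale_vec c (T \<psi>)"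
    "\<And>\<psi>. \<psi> \<in> ell2 I \<Longrightarrow> l2norm I (T \<psi>) \<le> C * l2norm I \<psi>"
  shows "T \<in> bounded_ops I"
proof -
  have "\<exists>C. \<forall>\<psi>\<in>ell2 I. l2norm I (T \<psi>) \<le> C * l2norm I \<psi>"
    using assms(5) by blast
  then show ?thesis using assms(1-4) unfolding bounded_ops_def linear_on_vecs_def by blast
qed

lemma bounded_ops_comp:
  assumes "T \<in> bounded_ops I" "U \<in> bounded_ops I"
  shows "T \<circ> U \<in> bounded_ops I"
proof -
  obtain C where C: "C \<ge> 0" "\<And>\<psi>. \<psi> \<in> ell2 I \<Longrightarrow> l2norm I (T \<psi>) \<le> C * l2norm I \<psi>"
    using bounded_ops_bound[OF assms(1)] by blast
  obtain C' where C': "C' \<ge> 0" "\<And>\<psi>. \<psi> \<in> ell2 I \<Longrightarrow> l2norm I (U \<psi>) \<le> C' * l2norm I \<psi>"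
    using bounded_ops_bound[OF assms(2)] by blast
  have T0: "T 0 = 0"
    using bounded_ops_diff[OF assms(1), of 0 0] by simp
  show ?thesis
  proof (rule bounded_opsI[where C = "C * C'"])
    fix \<psi> assume "\<psi> \<in> ell2 I"
    then show "l2norm I ((T \<circ> U) \<psi>) \<le> C * C' * l2norm I \<psi>"
      using order_trans[OF C(2) mult_left_mono[OF C'(2) C(1)], of \<psi>] bounded_ops_ell2[OF assms(2)]
      by (simp add: mult.assoc)
    show "(T \<circ> U) \<psi> \<in> ell2 I" by (simp add: bounded_ops_ell2[OF assms(1)] bounded_ops_ell2[OF assms(2)] \<open>\<psi> \<in> ell2 I\<close>)
    show "(T \<circ> U) (scale_vec c \<psi>) = scale_vec c ((T \<circ> U) \<psi>)" for c
      using bounded_ops_scale[OF assms(1) bounded_ops_ell2[OF assms(2)], of \<psi>]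
        bounded_ops_scale[OF assms(2), of \<psi>] \<open>\<psi> \<in> ell2 I\<close> by (simp only: o_apply)
    show "(T \<circ> U) (\<phi> + \<psi>) = (T \<circ> U) \<phi> + (T \<circ> U) \<psi>" if "\<phi> \<in> ell2 I" for \<phi>
      using bounded_ops_add[OF assms(1) bounded_ops_ell2[OF assms(2)] bounded_ops_ell2[OF assms(2)], of \<phi> \<psi>]
        bounded_ops_add[OF assms(2), of \<phi> \<psi>] \<open>\<psi> \<in> ell2 I\<close> that by (simp only: o_apply)
  next
    show "(T \<circ> U) \<psi> = 0" if "\<psi> \<notin> ell2 I" for \<psi>
      using bounded_ops_outside[OF assms(2) that] T0 by (simp only: o_apply)
  qed
qed

text \<open>Finitely supported vectors are dense and both operators are bounded, so the difference
  at a coordinate is controlled by the norm of an arbitrarily small remainder.\<close>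

lemma bounded_ops_eqI:
  assumes T: "T \<in> bounded_ops I" and U: "U \<in> bounded_ops I"
    and eq: "\<And>F \<psi>. finite F \<Longrightarrow> \<psi> \<in> ell2 I \<Longrightarrow> T (trunc_vec F \<psi>) = U (trunc_vec F \<psi>)"
  shows "T = U"
proof
  fix \<psi>
  show "T \<psi> = U \<psi>"
  proof (cases "\<psi> \<in> ell2 I")
    case True
    obtain C where C: "C \<ge> 0" "\<And>\<psi>. \<psi> \<in> ell2 I \<Longrightarrow> l2norm I (T \<psi>) \<le> C * l2norm I \<psi>"
      using bounded_ops_bound[OF T] by blast
    obtain C' where C': "C' \<ge> 0" "\<And>\<psi>. \<psi> \<in> ell2 I \<Longrightarrow> l2norm I (U \<psi>) \<le> C' * l2norm I \<psi>"
      using bounded_ops_bound[OF U] by blast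
    show ?thesis
    proof
      fix i
      have "cmod (T \<psi> i - U \<psi> i) \<le> \<epsilon>" if \<epsilon>: "\<epsilon> > 0" for \<epsilon>
      proof -
        \<comment> \<open>The summand 1 keeps the denominator positive when both bounds are
          0.\<close>
        define \<delta> where "\<delta> = \<epsilon> / (C + C' + 1)"
        have \<delta>: "\<delta> > 0" using \<epsilon> C(1) C'(1) by (simp add: \<delta>_def)
        obtain F where F: "finite F" "l2norm I (\<psi> - trunc_vec F \<psi>) < \<delta>"
          using trunc_vec_approx[OF True \<delta>] by blast
        let ?d = "\<psi> - trunc_vec F \<psi>"
        have d: "?d \<in> ell2 I" by (intro ell2_diff trunc_vec_ell2 True)
        have "T \<psi> - U \<psi> = T ?d - U ?d"
          using eq[OF F(1) True] by (simp add: bounded_ops_diff[OF T] bounded_ops_diff[OF U] True trunc_vec_ell2)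
        then have "T \<psi> i - U \<psi> i = T ?d i - U ?d i"
          by (metis fun_diff_def)
        then have "cmod (T \<psi> i - U \<psi> i) \<le> cmod (T ?d i) + cmod (U ?d i)"
          by (simp add: norm_triangle_ineq4)
        also have "\<dots> \<le> C * l2norm I ?d + C' * l2norm I ?d"
          using order_trans[OF cmod_le_l2norm[OF bounded_ops_ell2[OF T d]] C(2)[OF d]]
            order_trans[OF cmod_le_l2norm[OF bounded_ops_ell2[OF U d]] C'(2)[OF d]] by (intro add_mono)
        also have "\<dots> = (C + C') * l2norm I ?d" by (simp add: algebra_simps)
        also have "\<dots> \<le> (C + C' + 1) * \<delta>"
          using F(2) C(1) C'(1) by (intro mult_mono) auto
        also have "\<dots> = \<epsilon>" using C(1) C'(1) by (simp add: \<delta>_def)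
        finally show ?thesis .
      qed
      then have "cmod (T \<psi> i - U \<psi> i) \<le> 0" using field_le_epsilon[of "cmod (T \<psi> i - U \<psi> i)" 0] by auto
      then show "T \<psi> i = U \<psi> i" by simp
    qed
  next
    case False
    then show ?thesis using T U by (simp add: bounded_ops_outside)
  qed
qed

subsection \<open>Operators that are diagonal in the standard basis\<close>

text \<open>Only the action on the domain is recorded: \<open>Dirac\<close> multiplies every vector
  by its eigenvalues, whereas the functional calculus returns 0 off the domain, and both have to
  qualify.\<close>

definition acts_diagonally :: "'i set \<Rightarrow> ('i \<Rightarrow> real) \<Rightarrow> 'i unbounded_op \<Rightarrow> bool" where
  "acts_diagonally I d D \<longleftrightarrow>
     fst D = {\<psi>\<in>ell2 I. (\<lambda>i. of_real (d i) * \<psi> i) \<in> ell2 I} \<and>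
     (\<forall>\<psi>\<in>fst D. snd D \<psi> = (\<lambda>i. of_real (d i) * \<psi> i))"

lemma acts_diagonally_dom:
  "acts_diagonally I d D \<Longrightarrow> \<psi> \<in> fst D \<longleftrightarrow> \<psi> \<in> ell2 I \<and> (\<lambda>i. of_real (d i) * \<psi> i) \<in> ell2 I"
  by (auto simp: acts_diagonally_def)

lemma acts_diagonally_apply:
  "acts_diagonally I d D \<Longrightarrow> \<psi> \<in> fst D \<Longrightarrow> snd D \<psi> = (\<lambda>i. of_real (d i) * \<psi> i)"
  by (auto simp: acts_diagonally_def)

lemma trunc_vec_dom:
  assumes D: "acts_diagonally I d D" and "finite F" "\<psi> \<in> ell2 I"
  shows "trunc_vec F \<psi> \<in> fst D"
proof -
  have "(\<lambda>i. of_real (d i) * trunc_vec F \<psi> i) \<in> ell2 I"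
    using assms(2,3) unfolding ell2_def trunc_vec_def
    by (auto intro!: finite_nonzero_values_imp_summable_on finite_subset[OF _ assms(2)] split: if_splits)
  then show ?thesis using trunc_vec_ell2[OF assms(3)] by (simp add: acts_diagonally_dom[OF D])
qed

lemma self_adjoint_diagonal:
  assumes D: "acts_diagonally I d D"
  shows "self_adjoint I D"
proof -
  let ?d = "\<lambda>\<psi> i. complex_of_real (d i) * \<psi> i"
  have dom: "\<psi> \<in> fst D \<longleftrightarrow> \<psi> \<in> ell2 I \<and> ?d \<psi> \<in> ell2 I" for \<psi>
    by (rule acts_diagonally_dom[OF D])
  note app = acts_diagonally_apply[OF D]
  have dadd: "?d (\<phi> + \<psi>) = ?d \<phi> + ?d \<psi>" for \<phi> \<psi> by (auto simp: plus_fun_def algebra_simps)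
  have dscale: "?d (scale_vec c \<psi>) = scale_vec c (?d \<psi>)" for c \<psi> by (auto simp: scale_vec_def)
  have dom_add: "\<phi> + \<psi> \<in> fst D" if "\<phi> \<in> fst D" "\<psi> \<in> fst D" for \<phi> \<psi>
    using that unfolding dom dadd by (auto intro: ell2_add)
  have dom_scale: "scale_vec c \<psi> \<in> fst D" if "\<psi> \<in> fst D" for c \<psi>
    using that unfolding dom dscale by (auto intro: ell2_scale)
  have lin: "linear_on_vecs (fst D) (snd D)"
    unfolding linear_on_vecs_def
    by (simp add: app dom_add dom_scale dadd dscale del: plus_fun_apply)
  have dense: "\<exists>\<phi>\<in>fst D. l2norm I (\<psi> - \<phi>) < \<epsilon>" if "\<psi> \<in> ell2 I" "\<epsilon> > 0" for \<psi> \<epsilon>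
    using trunc_vec_approx[OF that] trunc_vec_dom[OF D _ that(1)] by blast
  have sym: "l2inner I (snd D \<phi>) \<psi> = l2inner I \<phi> (snd D \<psi>)" if "\<phi> \<in> fst D" "\<psi> \<in> fst D" for \<phi> \<psi>
    using that by (simp add: app l2inner_def algebra_simps)
  have adj: "\<phi> \<in> fst D" if \<phi>: "\<phi> \<in> ell2 I" and \<eta>: "\<eta> \<in> ell2 I"
    and eq: "\<And>\<psi>. \<psi> \<in> fst D \<Longrightarrow> l2inner I \<eta> \<psi> = l2inner I \<phi> (snd D \<psi>)" for \<phi> \<eta>
  proof -
    \<comment> \<open>Testing the adjoint relation on \<open>ket i\<close>, which lies in the
      domain, determines \<open>\<eta>\<close> coordinate by coordinate.\<close>
    have "\<eta> i = of_real (d i) * \<phi> i" for i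
    proof (cases "i \<in> I")
      case True
      have dk: "?d (ket i) = scale_vec (of_real (d i)) (ket i)" by (auto simp: ket_def scale_vec_def)
      have "ket i \<in> fst D" unfolding dom dk using True by (simp add: ell2_scale)
      from eq[OF this] have "cnj (\<eta> i) = l2inner I \<phi> (scale_vec (of_real (d i)) (ket i))"
        using True by (simp add: l2inner_ket_right app[OF \<open>ket i \<in> fst D\<close>] dk)
      also have "\<dots> = cnj (\<phi> i) * of_real (d i)"
        unfolding l2inner_def by (subst infsum_single[of _ i]) (use True in \<open>auto simp: ket_def scale_vec_def\<close>)
      finally have "\<eta> i = cnj (cnj (\<phi> i) * of_real (d i))" by (metis complex_cnj_cnj)
      then show ?thesis by (simp add: mult.commute)
    next
      case False
      then show ?thesis using ell2_outside[OF \<phi>] ell2_outside[OF \<eta>] by simp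
    qed
    then have "\<eta> = ?d \<phi>" by auto
    then show ?thesis using \<phi> \<eta> by (simp add: dom)
  qed
  have "0 \<in> fst D" unfolding dom using ell2_zero[of I] by (simp add: zero_fun_def)
  have "self_adjoint I (fst D, snd D)"
    unfolding self_adjoint_def case_prod_conv
  proof (intro conjI ballI allI impI)
    show "fst D \<subseteq> ell2 I" by (auto simp: dom)
    show "snd D \<psi> \<in> ell2 I" if "\<psi> \<in> fst D" for \<psi> using that by (simp add: dom app)
    show "\<phi> \<in> fst D" if "\<phi> \<in> ell2 I" "\<exists>\<eta>\<in>ell2 I. \<forall>\<psi>\<in>fst D. l2inner I \<eta> \<psi> = l2inner I \<phi> (snd D \<psi>)" for \<phi>
      using that adj by blast
  qed (fact \<open>0 \<in> fst D\<close> lin dom_add dom_scale dense sym)+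
  then show ?thesis by simp
qed

lemma bounded_diagonal:
  assumes "\<And>i. i \<in> I \<Longrightarrow> cmod (c i) \<le> K"
  shows "on_ell2 I (\<lambda>\<psi> i. c i * \<psi> i) \<in> bounded_ops I"
proof (rule bounded_opsI[where C = "max K 0"])
  fix \<psi> assume \<psi>: "\<psi> \<in> ell2 I"
  have le: "cmod (c i * \<psi> i) \<le> max K 0 * cmod (\<psi> i)" if "i \<in> I" for i
    using assms[OF that] by (simp add: norm_mult mult_right_mono)
  show "on_ell2 I (\<lambda>\<psi> i. c i * \<psi> i) \<psi> \<in> ell2 I"
    using \<psi> ell2_dominated[OF \<psi> _ le] ell2_outside[OF \<psi>] by (simp add: on_ell2_def)
  show "l2norm I (on_ell2 I (\<lambda>\<psi> i. c i * \<psi> i) \<psi>) \<le> max K 0 * l2norm I \<psi>"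
    using \<psi> l2norm_mono[OF \<psi> _ le] by (simp add: on_ell2_def)
  show "on_ell2 I (\<lambda>\<psi> i. c i * \<psi> i) (scale_vec a \<psi>) = scale_vec a (on_ell2 I (\<lambda>\<psi> i. c i * \<psi> i) \<psi>)" for a
    using \<psi> ell2_scale[OF \<psi>] by (auto simp: on_ell2_def scale_vec_def)
  show "on_ell2 I (\<lambda>\<psi> i. c i * \<psi> i) (\<phi> + \<psi>) = on_ell2 I (\<lambda>\<psi> i. c i * \<psi> i) \<phi> + on_ell2 I (\<lambda>\<psi> i. c i * \<psi> i) \<psi>"
    if "\<phi> \<in> ell2 I" for \<phi>
    using \<psi> ell2_add[OF that \<psi>] that by (auto simp: on_ell2_def algebra_simps plus_fun_def)
qed (auto simp: on_ell2_def)

lemma compact_op_bounded_comp: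
  assumes T: "T \<in> bounded_ops I" and U: "compact_op I U"
  shows "compact_op I (T \<circ> U)"
proof -
  have Ub: "U \<in> bounded_ops I" using U by (simp add: compact_op_def)
  obtain C where C: "C \<ge> 0" "\<And>\<psi>. \<psi> \<in> ell2 I \<Longrightarrow> l2norm I (T \<psi>) \<le> C * l2norm I \<psi>"
    using bounded_ops_bound[OF T] by blast
  have "\<exists>r \<phi>. strict_mono r \<and> \<phi> \<in> ell2 I \<and> (\<lambda>n. l2norm I ((T \<circ> U) (f (r n)) - \<phi>)) \<longlonglongrightarrow> 0"
    if f: "\<forall>n. f n \<in> ell2 I \<and> l2norm I (f n) \<le> 1" for f :: "nat \<Rightarrow> 'a vec"
  proof -
    obtain r \<phi> where r: "strict_mono r" "\<phi> \<in> ell2 I" "(\<lambda>n. l2norm I (U (f (r n)) - \<phi>)) \<longlonglongrightarrow> 0"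
      using U f unfolding compact_op_def by blast
    have "(\<lambda>n. l2norm I ((T \<circ> U) (f (r n)) - T \<phi>)) \<longlonglongrightarrow> 0"
    proof (rule tendsto_sandwich[OF _ _ tendsto_const])
      show "(\<lambda>n. C * l2norm I (U (f (r n)) - \<phi>)) \<longlonglongrightarrow> 0"
        using tendsto_mult_right_zero[OF r(3)] .
      show "\<forall>\<^sub>F n in sequentially. l2norm I ((T \<circ> U) (f (r n)) - T \<phi>) \<le> C * l2norm I (U (f (r n)) - \<phi>)"
      proof (intro always_eventually allI)
        fix n
        have Uf: "U (f (r n)) \<in> ell2 I" using f bounded_ops_ell2[OF Ub] by blast
        show "l2norm I ((T \<circ> U) (f (r n)) - T \<phi>) \<le> C * l2norm I (U (f (r n)) - \<phi>)"
          using C(2)[OF ell2_diff[OF Uf r(2)]] unfolding bounded_ops_diff[OF T Uf r(2)] by (simp only: o_apply)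
      qed
    qed auto
    then show ?thesis using r bounded_ops_ell2[OF T] by blast
  qed
  then show ?thesis unfolding compact_op_def using bounded_ops_comp[OF T Ub] by blast
qed

text \<open>A bounded sequence has a coordinatewise convergent subsequence. On the finitely many
  coordinates with \<open>|c i| > \<epsilon>\<close> this makes the images converge; on the others
  the factor \<open>\<epsilon>\<close> makes them uniformly small.\<close>

lemma compact_diagonal:
  assumes I: "countable I" and c: "\<And>\<epsilon>. \<epsilon> > 0 \<Longrightarrow> finite {i\<in>I. cmod (c i) > \<epsilon>}"
  shows "compact_op I (on_ell2 I (\<lambda>\<psi> i. c i * \<psi> i))"
  unfolding compact_op_def
proof (intro conjI allI impI)
  let ?T = "on_ell2 I (\<lambda>\<psi> i. c i * \<psi> i)"
  have "cmod (c i) \<le> 1 + (\<Sum>j\<in>{i\<in>I. cmod (c i) > 1}. cmod (c j))" if "i \<in> I" for i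
  proof (cases "cmod (c i) > 1")
    case True
    then have "cmod (c i) \<le> (\<Sum>j\<in>{i\<in>I. cmod (c i) > 1}. cmod (c j))"
      using that by (intro member_le_sum c) auto
    then show ?thesis by simp
  next
    case False
    have "0 \<le> (\<Sum>j\<in>{i\<in>I. cmod (c i) > 1}. cmod (c j))" by (simp add: sum_nonneg)
    with False show ?thesis by linarith
  qed
  then show bdd: "?T \<in> bounded_ops I" by (rule bounded_diagonal)
  fix f :: "nat \<Rightarrow> 'a vec" assume f: "\<forall>n. f n \<in> ell2 I \<and> l2norm I (f n) \<le> 1"
  have f1: "cmod (f n i) \<le> 1" for n i
    using order_trans[OF cmod_le_l2norm[of "f n" I i], of 1] f by simp
  obtain r where r: "strict_mono (r :: nat \<Rightarrow> nat)" "\<And>i. i \<in> I \<Longrightarrow> \<exists>l. (\<lambda>n. f (r n) i) \<longlonglongrightarrow> l"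
    by (rule function_convergent_subsequence[of I f 1, OF I f1]) (rule that, auto)
  then obtain g0 where g0: "\<And>i. i \<in> I \<Longrightarrow> (\<lambda>n. f (r n) i) \<longlonglongrightarrow> g0 i" by metis
  define g where "g i = (if i \<in> I then g0 i else 0)" for i
  have fg: "(\<lambda>n. f (r n) i) \<longlonglongrightarrow> g i" if "i \<in> I" for i
    using g0[OF that] that by (simp add: g_def)
  have partial: "(\<Sum>i\<in>F. (cmod (\<psi> i))\<^sup>2) \<le> 1" if "finite F" "F \<subseteq> I" "\<psi> \<in> ell2 I" "l2norm I \<psi> \<le> 1" for F \<psi>
  proof -
    have "(\<Sum>i\<in>F. (cmod (\<psi> i))\<^sup>2) \<le> (\<Sum>\<^sub>\<infinity>i\<in>I. (cmod (\<psi> i))\<^sup>2)"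
      by (intro finite_sum_le_infsum ell2_summable that) auto
    also have "\<dots> = (l2norm I \<psi>)\<^sup>2" by (simp add: l2norm_power2)
    also have "\<dots> \<le> 1" using that(4) by (simp add: power_le_one)
    finally show ?thesis .
  qed
  have gF: "(\<Sum>i\<in>F. (cmod (g i))\<^sup>2) \<le> 1" if "finite F" "F \<subseteq> I" for F
  proof (rule tendsto_upperbound)
    show "(\<lambda>n. \<Sum>i\<in>F. (cmod (f (r n) i))\<^sup>2) \<longlonglongrightarrow> (\<Sum>i\<in>F. (cmod (g i))\<^sup>2)"
      using that by (intro tendsto_intros fg) auto
    show "\<forall>\<^sub>F n in sequentially. (\<Sum>i\<in>F. (cmod (f (r n) i))\<^sup>2) \<le> 1"
      using f partial[OF that] by (intro always_eventually) blast
  qed auto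
  have g: "g \<in> ell2 I"
  proof -
    have "(\<lambda>i. (cmod (g i))\<^sup>2) summable_on I"
      by (intro nonneg_bdd_above_summable_on bdd_aboveI[where M = 1]) (auto intro: gF)
    then show ?thesis by (auto simp: ell2_def g_def)
  qed
  have g1: "l2norm I g \<le> 1"
  proof (rule power2_le_imp_le)
    have "(\<Sum>\<^sub>\<infinity>i\<in>I. (cmod (g i))\<^sup>2) \<le> 1"
      by (intro infsum_le_finite_sums ell2_summable g gF)
    then show "(l2norm I g)\<^sup>2 \<le> 1\<^sup>2" by (simp add: l2norm_power2)
  qed simp
  have "(\<lambda>n. (l2norm I (?T (f (r n)) - ?T g))\<^sup>2) \<longlonglongrightarrow> 0"
  proof (rule LIMSEQ_I)
    fix e :: real assume e: "e > 0"
    \<comment> \<open>Off the finite set the squared distance is at most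
      \<open>\<epsilon>\<^sup>2\<close> times 2 + 2, as both vectors lie in the unit ball; this is
      to be \<open>e / 2\<close>.\<close>
    define \<epsilon> where "\<epsilon> = sqrt (e / 8)"
    have \<epsilon>: "\<epsilon> > 0" "4 * \<epsilon>\<^sup>2 = e / 2" using e by (auto simp: \<epsilon>_def)
    define S where "S = {i\<in>I. cmod (c i) > \<epsilon>}"
    have S: "finite S" "S \<subseteq> I" using c[OF \<epsilon>(1)] by (auto simp: S_def)
    have "(\<lambda>n. \<Sum>i\<in>S. (cmod (c i * (f (r n) i - g i)))\<^sup>2) \<longlonglongrightarrow> (\<Sum>i\<in>S. (cmod (c i * (g i - g i)))\<^sup>2)"
      using S by (intro tendsto_intros fg) auto
    then have lim: "(\<lambda>n. \<Sum>i\<in>S. (cmod (c i * (f (r n) i - g i)))\<^sup>2) \<longlonglongrightarrow> 0" by simp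
    obtain N where N: "\<And>n. n \<ge> N \<Longrightarrow> norm ((\<Sum>i\<in>S. (cmod (c i * (f (r n) i - g i)))\<^sup>2) - 0) < e / 2"
      using LIMSEQ_D[OF lim, of "e / 2"] e by auto
    have "(l2norm I (?T (f (r n)) - ?T g))\<^sup>2 < e" if n: "n \<ge> N" for n
    proof -
      let ?h = "f (r n) - g"
      let ?q = "\<lambda>i. (cmod (c i * (f (r n) i - g i)))\<^sup>2"
      have fr: "f (r n) \<in> ell2 I" "l2norm I (f (r n)) \<le> 1" using f by auto
      have Td: "?T (f (r n)) - ?T g = (\<lambda>i. c i * (f (r n) i - g i))"
        using fr g by (auto simp: on_ell2_def fun_diff_def algebra_simps)
      have "(\<lambda>i. c i * (f (r n) i - g i)) \<in> ell2 I"
        unfolding Td[symmetric] by (intro ell2_diff bounded_ops_ell2[OF bdd] fr g)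
      then have sq: "?q summable_on I" by (rule ell2_summable)
      have sd: "(\<lambda>i. 2 * (cmod (f (r n) i))\<^sup>2 + 2 * (cmod (g i))\<^sup>2) summable_on I"
        by (intro summable_on_add summable_on_cmult_right ell2_summable fr g)
      have tail: "infsum ?q (I - S) \<le> (\<Sum>\<^sub>\<infinity>i\<in>I. \<epsilon>\<^sup>2 * (2 * (cmod (f (r n) i))\<^sup>2 + 2 * (cmod (g i))\<^sup>2))"
      proof (rule infsum_mono_neutral)
        show "?q summable_on I - S" by (rule summable_on_subset_banach[OF sq]) auto
        show "(\<lambda>i. \<epsilon>\<^sup>2 * (2 * (cmod (f (r n) i))\<^sup>2 + 2 * (cmod (g i))\<^sup>2)) summable_on I"
          by (intro summable_on_cmult_right sd)
        fix i assume "i \<in> (I - S) \<inter> I"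
        then have ci: "cmod (c i) \<le> \<epsilon>" by (auto simp: S_def)
        show "?q i \<le> \<epsilon>\<^sup>2 * (2 * (cmod (f (r n) i))\<^sup>2 + 2 * (cmod (g i))\<^sup>2)"
          unfolding norm_mult power_mult_distrib using ci cmod_diff_power2_le[of "f (r n) i" "g i"]
          by (intro mult_mono power_mono) auto
      qed auto
      have "(\<Sum>\<^sub>\<infinity>i\<in>I. \<epsilon>\<^sup>2 * (2 * (cmod (f (r n) i))\<^sup>2 + 2 * (cmod (g i))\<^sup>2)) =
          \<epsilon>\<^sup>2 * (2 * (\<Sum>\<^sub>\<infinity>i\<in>I. (cmod (f (r n) i))\<^sup>2) + 2 * (\<Sum>\<^sub>\<infinity>i\<in>I. (cmod (g i))\<^sup>2))"
        by (simp add: infsum_cmult_right' infsum_add summable_on_cmult_right ell2_summable fr g)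
      also have "\<dots> = \<epsilon>\<^sup>2 * (2 * (l2norm I (f (r n)))\<^sup>2 + 2 * (l2norm I g)\<^sup>2)"
        by (simp add: l2norm_power2)
      also have "\<dots> \<le> \<epsilon>\<^sup>2 * (2 * 1\<^sup>2 + 2 * 1\<^sup>2)"
        using fr g1 by (intro mult_left_mono add_mono power_mono) auto
      finally have "infsum ?q (I - S) \<le> 4 * \<epsilon>\<^sup>2" using tail by simp
      moreover have "infsum ?q (I - S) = infsum ?q I - infsum ?q S"
        by (rule infsum_Diff) (use S sq in auto)
      moreover have "infsum ?q S < e / 2"
        using N[OF n] S by (simp add: sum_nonneg)
      ultimately have "infsum ?q I < e" using \<epsilon> by linarith
      then show ?thesis unfolding Td l2norm_power2 by simp
    qed
    then show "\<exists>no. \<forall>n\<ge>no. norm ((l2norm I (?T (f (r n)) - ?T g))\<^sup>2 - 0) < e" by auto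
  qed
  then have "(\<lambda>n. sqrt ((l2norm I (?T (f (r n)) - ?T g))\<^sup>2)) \<longlonglongrightarrow> sqrt 0" by (rule tendsto_real_sqrt)
  then have "(\<lambda>n. l2norm I (?T (f (r n)) - ?T g)) \<longlonglongrightarrow> 0" by simp
  then show "\<exists>r \<phi>. strict_mono r \<and> \<phi> \<in> ell2 I \<and> (\<lambda>n. l2norm I (?T (f (r n)) - \<phi>)) \<longlonglongrightarrow> 0"
    using r(1) bounded_ops_ell2[OF bdd g] by blast
qed

lemma compact_resolvent_diagonal:
  assumes D: "acts_diagonally I d D" and "countable I" and fin: "\<And>K. finite {i\<in>I. \<bar>d i\<bar> \<le> K}"
  shows "compact_resolvent I D"
proof -
  \<comment> \<open>The resolvent at the imaginary unit: the spectrum is real, so the denominator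
    never vanishes.\<close>
  define c where "c i = 1 / (of_real (d i) - \<i>)" for i
  have nz: "complex_of_real (d i) - \<i> \<noteq> 0" for i by (auto simp: complex_eq_iff)
  have dle: "\<bar>d i\<bar> * cmod (c i) \<le> 1" for i
    using abs_Re_le_cmod[of "of_real (d i) - \<i>"] nz[of i] by (simp add: c_def norm_divide divide_le_eq)
  have c: "finite {i\<in>I. cmod (c i) > \<epsilon>}" if "\<epsilon> > 0" for \<epsilon>
  proof (rule finite_subset[OF _ fin[of "1 / \<epsilon>"]])
    have "\<bar>d i\<bar> \<le> 1 / \<epsilon>" if "cmod (c i) > \<epsilon>" for i
    proof -
      have "\<bar>d i\<bar> * \<epsilon> \<le> \<bar>d i\<bar> * cmod (c i)" using that by (intro mult_left_mono) auto
      then show ?thesis using dle[of i] \<open>\<epsilon> > 0\<close> by (simp add: field_simps)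
    qed
    then show "{i\<in>I. cmod (c i) > \<epsilon>} \<subseteq> {i\<in>I. \<bar>d i\<bar> \<le> 1 / \<epsilon>}" by auto
  qed
  let ?R = "on_ell2 I (\<lambda>\<psi> i. c i * \<psi> i)"
  have R: "compact_op I ?R" by (rule compact_diagonal[OF assms(2) c])
  then have Rb: "?R \<in> bounded_ops I" by (simp add: compact_op_def)
  obtain dm E where DE: "D = (dm, E)" by (cases D)
  have 1: "?R \<psi> \<in> fst D \<and> snd D (?R \<psi>) - scale_vec \<i> (?R \<psi>) = \<psi>" if \<psi>: "\<psi> \<in> ell2 I" for \<psi>
  proof -
    have "(\<lambda>i. of_real (d i) * ?R \<psi> i) \<in> ell2 I"
      by (rule ell2_dominated[OF \<psi>, where K = 1])
        (use \<psi> dle in \<open>auto simp: on_ell2_def ell2_outside norm_mult mult.assoc[symmetric] intro: mult_left_le_one_le mult_right_le_one_le\<close>)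
    then have dom: "?R \<psi> \<in> fst D" using bounded_ops_ell2[OF Rb \<psi>] by (simp add: acts_diagonally_dom[OF D])
    have "snd D (?R \<psi>) i - scale_vec \<i> (?R \<psi>) i = \<psi> i" for i
    proof -
      have "snd D (?R \<psi>) i - scale_vec \<i> (?R \<psi>) i = (of_real (d i) - \<i>) * c i * \<psi> i"
        unfolding acts_diagonally_apply[OF D dom] using \<psi> by (simp add: scale_vec_def on_ell2_def algebra_simps)
      then show ?thesis using nz[of i] by (simp add: c_def)
    qed
    then show ?thesis using dom by (auto simp: fun_diff_def)
  qed
  have 2: "?R (snd D \<psi> - scale_vec \<i> \<psi>) = \<psi>" if \<psi>: "\<psi> \<in> fst D" for \<psi>
  proof -
    have e: "\<psi> \<in> ell2 I" "snd D \<psi> \<in> ell2 I" using \<psi> acts_diagonally_apply[OF D \<psi>]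
      by (auto simp: acts_diagonally_dom[OF D])
    then have "snd D \<psi> - scale_vec \<i> \<psi> \<in> ell2 I" by (intro ell2_diff ell2_scale)
    moreover have "c i * ((snd D \<psi> - scale_vec \<i> \<psi>) i) = \<psi> i" for i
    proof -
      have "c i * ((snd D \<psi> - scale_vec \<i> \<psi>) i) = c i * (of_real (d i) - \<i>) * \<psi> i"
        by (simp add: acts_diagonally_apply[OF D \<psi>] scale_vec_def algebra_simps)
      then show ?thesis using nz[of i] by (simp add: c_def)
    qed
    ultimately show ?thesis unfolding on_ell2_def by auto
  qed
  show ?thesis
    unfolding compact_resolvent_def DE case_prod_conv
    by (intro exI[of _ \<i>] exI[of _ ?R] conjI ballI R)
      (use 1 2 in \<open>simp_all only: DE fst_conv snd_conv\<close>)
qed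

lemma acts_diagonally_eigenspace:
  assumes D: "acts_diagonally I d D"
  shows "\<psi> \<in> eigenspace D \<mu> \<longleftrightarrow> \<psi> \<in> ell2 I \<and> (\<forall>i. d i \<noteq> \<mu> \<longrightarrow> \<psi> i = 0)"
proof -
  have eig: "\<psi> \<in> eigenspace D \<mu> \<longleftrightarrow> \<psi> \<in> fst D \<and> snd D \<psi> = scale_vec (of_real \<mu>) \<psi>"
    by (cases D) (simp add: eigenspace_def)
  show ?thesis
  proof
    assume "\<psi> \<in> eigenspace D \<mu>"
    then have \<psi>: "\<psi> \<in> fst D" "snd D \<psi> = scale_vec (of_real \<mu>) \<psi>" by (auto simp: eig)
    have "complex_of_real (d i) * \<psi> i = of_real \<mu> * \<psi> i" for i
      using fun_cong[OF \<psi>(2), of i] unfolding acts_diagonally_apply[OF D \<psi>(1)] by (simp add: scale_vec_def)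
    then show "\<psi> \<in> ell2 I \<and> (\<forall>i. d i \<noteq> \<mu> \<longrightarrow> \<psi> i = 0)"
      using \<psi>(1) by (auto simp: acts_diagonally_dom[OF D])
  next
    assume *: "\<psi> \<in> ell2 I \<and> (\<forall>i. d i \<noteq> \<mu> \<longrightarrow> \<psi> i = 0)"
    have eq: "(\<lambda>i. of_real (d i) * \<psi> i) = scale_vec (of_real \<mu>) \<psi>"
    proof
      fix i show "of_real (d i) * \<psi> i = scale_vec (of_real \<mu>) \<psi> i"
        using * by (cases "d i = \<mu>") (auto simp: scale_vec_def)
    qed
    have dom: "\<psi> \<in> fst D" using * by (simp add: acts_diagonally_dom[OF D] eq ell2_scale)
    then show "\<psi> \<in> eigenspace D \<mu>" unfolding eig acts_diagonally_apply[OF D dom] eq by simp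
  qed
qed

lemma eigenprojection_diagonal:
  assumes D: "acts_diagonally I d D" and \<psi>: "\<psi> \<in> ell2 I"
  shows "eigenprojection I D \<mu> \<psi> = trunc_vec {i. d i = \<mu>} \<psi>"
  unfolding eigenprojection_def
proof (rule the_equality)
  note eig = acts_diagonally_eigenspace[OF D, of _ \<mu>]
  let ?p = "trunc_vec {i. d i = \<mu>} \<psi>"
  have "?p \<in> eigenspace D \<mu>"
    using trunc_vec_ell2[OF \<psi>, of "{i. d i = \<mu>}"] by (auto simp: eig trunc_vec_def)
  moreover have "l2inner I \<eta> (\<psi> - ?p) = 0" if "\<eta> \<in> eigenspace D \<mu>" for \<eta>
    unfolding l2inner_def using that by (intro infsum_0) (auto simp: eig trunc_vec_def)
  ultimately show "?p \<in> eigenspace D \<mu> \<and> (\<forall>\<eta>\<in>eigenspace D \<mu>. l2inner I \<eta> (\<psi> - ?p) = 0)" by blast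
  \<comment> \<open>Uniqueness: the basis vectors in the eigenspace detect every coordinate with
    \<open>d i = \<mu>\<close>.\<close>
  fix \<phi> assume \<phi>: "\<phi> \<in> eigenspace D \<mu> \<and> (\<forall>\<eta>\<in>eigenspace D \<mu>. l2inner I \<eta> (\<psi> - \<phi>) = 0)"
  show "\<phi> = ?p"
  proof
    fix i
    consider "i \<notin> I" | "d i \<noteq> \<mu>" | "i \<in> I" "d i = \<mu>" by blast
    then show "\<phi> i = ?p i"
    proof cases
      case 1
      then show ?thesis using \<phi> \<psi> by (auto simp: eig trunc_vec_def ell2_outside)
    next
      case 2
      then show ?thesis using \<phi> by (auto simp: eig trunc_vec_def)
    next
      case 3
      then have "ket i \<in> eigenspace D \<mu>" unfolding eig by (auto simp: ket_def intro: ell2_ket[unfolded ket_def])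
      then have "l2inner I (ket i) (\<psi> - \<phi>) = 0" using \<phi> by blast
      then show ?thesis using 3 by (simp add: l2inner_ket_left trunc_vec_def)
    qed
  qed
qed

text \<open>The functional calculus sums over all real \<open>\<mu>\<close>, an uncountable index
  set. Partitioning \<open>I\<close> into the fibres of \<open>d\<close> turns this into a sum over
  \<open>I\<close>, and nonnegativity makes the two summability conditions equivalent.\<close>

lemma fibre_summable_iff:
  fixes w q :: "'i \<Rightarrow> real"
  assumes "q summable_on I" "\<And>i. q i \<ge> 0"
  shows "(\<lambda>\<mu>. (f \<mu>)\<^sup>2 * (\<Sum>\<^sub>\<infinity>i\<in>{i\<in>I. d i = \<mu>}. q i)) summable_on UNIV \<longleftrightarrow>
    (\<lambda>i. (f (d i))\<^sup>2 * q i) summable_on I"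
proof -
  let ?B = "\<lambda>\<mu>. {i\<in>I. d i = \<mu>}"
  let ?g = "\<lambda>(\<mu>, i). (f \<mu>)\<^sup>2 * q i"
  have bij: "bij_betw (\<lambda>i. (d i, i)) I (Sigma UNIV ?B)"
    by (rule bij_betwI[of _ _ _ snd]) auto
  have "(\<lambda>i. (f (d i))\<^sup>2 * q i) summable_on I \<longleftrightarrow> ?g summable_on Sigma UNIV ?B"
    using summable_on_reindex_bij_betw[OF bij, of ?g] by simp
  also have "\<dots> \<longleftrightarrow> (\<lambda>x. norm (?g x)) summable_on Sigma UNIV ?B"
    by (rule summable_on_iff_abs_summable_on_real)
  also have "\<dots> \<longleftrightarrow> (\<forall>\<mu>\<in>UNIV. (\<lambda>i. norm (?g (\<mu>, i))) summable_on ?B \<mu>) \<and>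
      (\<lambda>\<mu>. norm (\<Sum>\<^sub>\<infinity>i\<in>?B \<mu>. norm (?g (\<mu>, i)))) summable_on UNIV"
    by (rule Infinite_Sum.abs_summable_on_Sigma_iff)
  also have "\<dots> \<longleftrightarrow> (\<lambda>\<mu>. (f \<mu>)\<^sup>2 * (\<Sum>\<^sub>\<infinity>i\<in>?B \<mu>. q i)) summable_on UNIV"
  proof -
    have "(\<lambda>i. norm (?g (\<mu>, i))) summable_on ?B \<mu>" for \<mu>
      using summable_on_subset_banach[OF assms(1), of "?B \<mu>"] assms(2)
      by (auto intro!: summable_on_cmult_right simp: abs_mult)
    moreover have "norm (\<Sum>\<^sub>\<infinity>i\<in>?B \<mu>. norm (?g (\<mu>, i))) = (f \<mu>)\<^sup>2 * (\<Sum>\<^sub>\<infinity>i\<in>?B \<mu>. q i)" for \<mu>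
      using assms(2) by (simp add: abs_mult infsum_cmult_right' infsum_nonneg)
    ultimately show ?thesis by simp
  qed
  finally show ?thesis by simp
qed

lemma functional_calculus_diagonal:
  assumes D: "acts_diagonally I d D"
  shows "functional_calculus I D f =
    ({\<psi>\<in>ell2 I. (\<lambda>i. f (d i) * \<psi> i) \<in> ell2 I},
     \<lambda>\<psi>. if \<psi> \<in> ell2 I \<and> (\<lambda>i. f (d i) * \<psi> i) \<in> ell2 I then (\<lambda>i. f (d i) * \<psi> i) else 0)"
proof -
  have dom: "(\<lambda>\<mu>. (cmod (f \<mu>) * l2norm I (eigenprojection I D \<mu> \<psi>))\<^sup>2) summable_on UNIV \<longleftrightarrow>
      (\<lambda>i. f (d i) * \<psi> i) \<in> ell2 I" if \<psi>: "\<psi> \<in> ell2 I" for \<psi>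
  proof -
    have "(l2norm I (eigenprojection I D \<mu> \<psi>))\<^sup>2 = (\<Sum>\<^sub>\<infinity>i\<in>{i\<in>I. d i = \<mu>}. (cmod (\<psi> i))\<^sup>2)" for \<mu>
      unfolding eigenprojection_diagonal[OF D \<psi>] l2norm_power2
      by (rule infsum_cong_neutral) (auto simp: trunc_vec_def)
    then have "(\<lambda>\<mu>. (cmod (f \<mu>) * l2norm I (eigenprojection I D \<mu> \<psi>))\<^sup>2) summable_on UNIV \<longleftrightarrow>
        (\<lambda>i. (cmod (f (d i)))\<^sup>2 * (cmod (\<psi> i))\<^sup>2) summable_on I"
      using fibre_summable_iff[OF ell2_summable[OF \<psi>], of "\<lambda>\<mu>. cmod (f \<mu>)" d]
      by (simp add: power_mult_distrib)
    then show ?thesis using ell2_outside[OF \<psi>] by (simp add: ell2_def norm_mult power_mult_distrib)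
  qed
  have act: "(\<Sum>\<^sub>\<infinity>\<mu>. f \<mu> * eigenprojection I D \<mu> \<psi> i) = f (d i) * \<psi> i" if "\<psi> \<in> ell2 I" for \<psi> i
    unfolding eigenprojection_diagonal[OF D that]
    by (subst infsum_single[of _ "d i"]) (auto simp: trunc_vec_def)
  show ?thesis
    unfolding functional_calculus_def Let_def by (auto simp: dom act fun_eq_iff)
qed

lemma abs_op_diagonal:
  assumes "acts_diagonally I d D"
  shows "acts_diagonally I (\<lambda>i. \<bar>d i\<bar>) (abs_op I D)"
  unfolding abs_op_def functional_calculus_diagonal[OF assms] by (simp add: acts_diagonally_def)

definition abs_power_coeff :: "complex \<Rightarrow> real \<Rightarrow> complex" where
  "abs_power_coeff z \<mu> = (if \<mu> = 0 then 0 else of_real \<bar>\<mu>\<bar> powr (- z))"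

lemma abs_neg_power_diagonal:
  assumes D: "acts_diagonally I d D" and K: "\<And>i. i \<in> I \<Longrightarrow> cmod (abs_power_coeff z (d i)) \<le> K"
  shows "abs_neg_power I D z = on_ell2 I (\<lambda>\<psi> i. abs_power_coeff z (d i) * \<psi> i)"
proof
  fix \<psi>
  have "(\<lambda>i. abs_power_coeff z (d i) * \<psi> i) \<in> ell2 I" if "\<psi> \<in> ell2 I"
    by (rule ell2_dominated[OF that, where K = K])
      (use K in \<open>auto simp: norm_mult ell2_outside[OF that] intro: mult_right_mono\<close>)
  then show "abs_neg_power I D z \<psi> = on_ell2 I (\<lambda>\<psi> i. abs_power_coeff z (d i) * \<psi> i) \<psi>"
    unfolding abs_neg_power_def functional_calculus_diagonal[OF D] on_ell2_def
    by (auto simp: abs_power_coeff_def[symmetric])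
qed


subsection \<open>Commutators\<close>

text \<open>Finitely supported vectors lie in the domain and determine a bounded operator. This
  makes the \<open>THE\<close> in \<open>commutator\<close> meaningful.\<close>

lemma extends_commutator_unique:
  assumes D: "acts_diagonally I d D" and T: "extends_commutator I D a T" and U: "extends_commutator I D a U"
  shows "T = U"
proof -
  obtain dm E where DE: "D = (dm, E)" by (cases D)
  show ?thesis
  proof (rule bounded_ops_eqI)
    show "T \<in> bounded_ops I" "U \<in> bounded_ops I" using T U by (auto simp: extends_commutator_def DE)
    fix F :: "'a set" and \<psi> assume "finite F" "\<psi> \<in> ell2 I"
    then have "trunc_vec F \<psi> \<in> dm" using trunc_vec_dom[OF D, of F \<psi>] by (simp add: DE)
    then show "T (trunc_vec F \<psi>) = U (trunc_vec F \<psi>)" using T U by (simp add: extends_commutator_def DE)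
  qed
qed

lemma commutator_eqI:
  assumes "acts_diagonally I d D" "extends_commutator I D a T"
  shows "commutator I D a = T"
  unfolding commutator_def using assms by (auto intro: the_equality extends_commutator_unique)


subsection \<open>Singular values\<close>

lemma l2norm_diff_power2_le:
  assumes "\<phi> \<in> ell2 I" "\<psi> \<in> ell2 I"
  shows "(l2norm I (\<phi> - \<psi>))\<^sup>2 \<le> 2 * (l2norm I \<phi>)\<^sup>2 + 2 * (l2norm I \<psi>)\<^sup>2"
proof -
  have le: "(cmod ((\<phi> - \<psi>) i))\<^sup>2 \<le> 2 * (cmod (\<phi> i))\<^sup>2 + 2 * (cmod (\<psi> i))\<^sup>2" for i
    using cmod_diff_power2_le by simp
  have "(\<Sum>\<^sub>\<infinity>i\<in>I. (cmod ((\<phi> - \<psi>) i))\<^sup>2) \<le> (\<Sum>\<^sub>\<infinity>i\<in>I. 2 * (cmod (\<phi> i))\<^sup>2 + 2 * (cmod (\<psi> i))\<^sup>2)"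
    by (intro infsum_mono le ell2_summable ell2_diff summable_on_add summable_on_cmult_right assms)
  also have "\<dots> = 2 * (\<Sum>\<^sub>\<infinity>i\<in>I. (cmod (\<phi> i))\<^sup>2) + 2 * (\<Sum>\<^sub>\<infinity>i\<in>I. (cmod (\<psi> i))\<^sup>2)"
    by (simp add: infsum_cmult_right' infsum_add summable_on_cmult_right ell2_summable assms)
  finally show ?thesis by (simp add: l2norm_power2)
qed

text \<open>\<open>opnorm\<close> is a supremum of reals, informative only for a set that is bounded
  above. Boundedness of both operators provides this, and the value at the vector 0 is then a lower
  bound.\<close>

lemma opnorm_diff_nonneg:
  assumes T: "T \<in> bounded_ops I" and U: "U \<in> bounded_ops I"
  shows "0 \<le> opnorm I (T - U)"
proof -
  obtain C where C: "C \<ge> 0" "\<And>\<psi>. \<psi> \<in> ell2 I \<Longrightarrow> l2norm I (T \<psi>) \<le> C * l2norm I \<psi>"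
    using bounded_ops_bound[OF T] by blast
  obtain C' where C': "C' \<ge> 0" "\<And>\<psi>. \<psi> \<in> ell2 I \<Longrightarrow> l2norm I (U \<psi>) \<le> C' * l2norm I \<psi>"
    using bounded_ops_bound[OF U] by blast
  have "l2norm I ((T - U) \<psi>) \<le> sqrt (2 * C\<^sup>2 + 2 * C'\<^sup>2)" if \<psi>: "\<psi> \<in> ell2 I" "l2norm I \<psi> \<le> 1" for \<psi>
  proof (rule real_le_rsqrt)
    have "(l2norm I (T \<psi> - U \<psi>))\<^sup>2 \<le> 2 * (l2norm I (T \<psi>))\<^sup>2 + 2 * (l2norm I (U \<psi>))\<^sup>2"
      by (intro l2norm_diff_power2_le bounded_ops_ell2[OF T] bounded_ops_ell2[OF U] \<psi>)
    also have "\<dots> \<le> 2 * (C * 1)\<^sup>2 + 2 * (C' * 1)\<^sup>2"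
    proof (intro add_mono mult_left_mono power_mono)
      show "l2norm I (T \<psi>) \<le> C * 1" using C(2)[OF \<psi>(1)] mult_left_mono[OF \<psi>(2) C(1)] by linarith
      show "l2norm I (U \<psi>) \<le> C' * 1" using C'(2)[OF \<psi>(1)] mult_left_mono[OF \<psi>(2) C'(1)] by linarith
    qed auto
    finally show "(l2norm I ((T - U) \<psi>))\<^sup>2 \<le> 2 * C\<^sup>2 + 2 * C'\<^sup>2" by (simp add: fun_diff_def)
  qed
  then have "bdd_above ((\<lambda>\<psi>. l2norm I ((T - U) \<psi>)) ` {\<psi>\<in>ell2 I. l2norm I \<psi> \<le> 1})"
    by (intro bdd_aboveI2) auto
  from cSUP_upper[OF _ this, of 0] have "l2norm I ((T - U) 0) \<le> opnorm I (T - U)"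
    unfolding opnorm_def by simp
  then show ?thesis by (rule order_trans[OF l2norm_nonneg])
qed

lemma singular_value_le:
  assumes T: "T \<in> bounded_ops I" and F: "F \<in> bounded_ops I" "rank_le I F n"
    and le: "\<And>\<psi>. \<psi> \<in> ell2 I \<Longrightarrow> l2norm I \<psi> \<le> 1 \<Longrightarrow> l2norm I (T \<psi> - F \<psi>) \<le> C"
  shows "singular_value I T n \<le> C"
proof -
  have "singular_value I T n \<le> opnorm I (T - F)"
    unfolding singular_value_def
    by (rule cINF_lower) (use F opnorm_diff_nonneg[OF T] in \<open>auto intro!: bdd_belowI2[where m = 0]\<close>)
  also have "\<dots> \<le> C"
    unfolding opnorm_def
  proof (rule cSUP_least)
    have "0 \<in> {\<psi>\<in>ell2 I. l2norm I \<psi> \<le> 1}"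
      by simp
    then show "{\<psi>\<in>ell2 I. l2norm I \<psi> \<le> 1} \<noteq> {}" by blast
  qed (use le in \<open>simp add: fun_diff_def\<close>)
  finally show ?thesis .
qed

lemma singular_value_nonneg:
  assumes T: "T \<in> bounded_ops I"
  shows "0 \<le> singular_value I T n"
proof -
  have "0 \<in> bounded_ops I"
    by (rule bounded_opsI[where C = 0]) (auto simp: l2norm_def scale_vec_def fun_eq_iff ell2_def)
  moreover have "rank_le I 0 n"
    unfolding rank_le_def
    by (intro exI[of _ "\<lambda>_. 0"]) (auto intro!: exI[of _ "\<lambda>_. 0"] simp: scale_vec_def fun_eq_iff)
  ultimately have "{F \<in> bounded_ops I. rank_le I F n} \<noteq> {}" by blast
  then show ?thesis
    unfolding singular_value_def by (rule cINF_greatest) (use opnorm_diff_nonneg[OF T] in auto)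
qed

lemma sum_vec_apply: "(\<Sum>i\<in>S. v i) j = (\<Sum>i\<in>S. (v i j :: 'a :: comm_monoid_add))"
  by (induction S rule: infinite_finite_induct) auto

lemma bounded_ops_sum:
  assumes T: "T \<in> bounded_ops I" and "finite S" "\<And>i. i \<in> S \<Longrightarrow> v i \<in> ell2 I"
  shows "T (\<Sum>i\<in>S. v i) = (\<Sum>i\<in>S. T (v i)) \<and> (\<Sum>i\<in>S. v i) \<in> ell2 I"
  using assms(2,3)
proof (induction S)
  case empty
  have "T 0 = 0" using bounded_ops_diff[OF T ell2_zero ell2_zero] by simp
  then show ?case unfolding sum.empty by (intro conjI ell2_zero)
next
  case (insert x S)
  then have IH: "T (\<Sum>i\<in>S. v i) = (\<Sum>i\<in>S. T (v i))" "(\<Sum>i\<in>S. v i) \<in> ell2 I" "v x \<in> ell2 I" by auto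
  show ?case
    unfolding sum.insert[OF insert.hyps] bounded_ops_add[OF T IH(3,2)] IH(1)
    by (intro conjI refl ell2_add[OF IH(3,2)])
qed

lemma rank_le_finite_support:
  assumes T: "T \<in> bounded_ops I" and S: "finite S" "S \<subseteq> I" "card S \<le> n"
    and F: "\<And>\<psi>. \<psi> \<in> ell2 I \<Longrightarrow> F \<psi> = T (trunc_vec S (\<lambda>i. c i * \<psi> i))"
  shows "rank_le I F n"
proof -
  obtain e where e: "bij_betw e {..<card S} S"
    using ex_bij_betw_nat_finite[OF S(1)] by (auto simp: atLeast0LessThan)
  \<comment> \<open>\<open>rank_le\<close> asks for \<open>n\<close> vectors, so the images of the
    basis vectors in \<open>S\<close> are padded with 0.\<close>
  define v where "v k = (if k < card S then T (ket (e k)) else 0)" for k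
  have eI: "e k \<in> I" if "k < card S" for k using e that S(2) by (auto simp: bij_betw_def)
  have vI: "v k \<in> ell2 I" for k
    using bounded_ops_ell2[OF T ell2_ket[OF eI]] by (simp add: v_def)
  have "F \<psi> = (\<Sum>k<n. scale_vec (c (e k) * \<psi> (e k)) (v k))" if "\<psi> \<in> ell2 I" for \<psi>
  proof -
    have "trunc_vec S (\<lambda>i. c i * \<psi> i) j = (\<Sum>i\<in>S. scale_vec (c i * \<psi> i) (ket i)) j" for j
      using S(1) by (simp add: trunc_vec_def scale_vec_def ket_def sum_vec_apply if_distrib[of "\<lambda>x. _ * x"] sum.delta cong: if_cong)
    then have "trunc_vec S (\<lambda>i. c i * \<psi> i) = (\<Sum>i\<in>S. scale_vec (c i * \<psi> i) (ket i))" by blast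
    also have "\<dots> = (\<Sum>k<card S. scale_vec (c (e k) * \<psi> (e k)) (ket (e k)))"
      by (rule sum.reindex_bij_betw[OF e, symmetric])
    finally have "F \<psi> = T (\<Sum>k<card S. scale_vec (c (e k) * \<psi> (e k)) (ket (e k)))"
      using F[OF that] by simp
    also have "\<dots> = (\<Sum>k<card S. T (scale_vec (c (e k) * \<psi> (e k)) (ket (e k))))"
      by (intro bounded_ops_sum[OF T, THEN conjunct1] ell2_scale ell2_ket eI) auto
    also have "\<dots> = (\<Sum>k<card S. scale_vec (c (e k) * \<psi> (e k)) (v k))"
      by (intro sum.cong refl) (simp add: v_def bounded_ops_scale[OF T ell2_ket[OF eI]])
    also have "\<dots> = (\<Sum>k<n. scale_vec (c (e k) * \<psi> (e k)) (v k))"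
      using S(3) by (intro sum.mono_neutral_left) (auto simp: v_def scale_vec_def)
    finally show ?thesis .
  qed
  then show ?thesis unfolding rank_le_def
    by (intro exI[of _ v] conjI allI impI ballI vI exI[of _ "\<lambda>k. c (e k) * _ (e k)"])
qed

text \<open>Keeping only the coefficients above \<open>s n\<close>, of which there are at most
  \<open>n\<close>, gives an operator of rank at most \<open>n\<close> whose distance is at most
  \<open>s n\<close> times a bound for \<open>T\<close>.\<close>

lemma trace_class_criterion:
  assumes T: "T \<in> bounded_ops I" and I: "countable I"
    and fin: "\<And>\<epsilon>. \<epsilon> > 0 \<Longrightarrow> finite {i\<in>I. cmod (c i) > \<epsilon>}"
    and s: "\<And>n. s n > 0" "summable s"
    and card: "\<And>n. card {i\<in>I. cmod (c i) > s n} \<le> n"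
  shows "trace_class I (T \<circ> on_ell2 I (\<lambda>\<psi> i. c i * \<psi> i))"
proof -
  let ?d = "\<lambda>c. on_ell2 I (\<lambda>\<psi> i. c i * \<psi> i)"
  obtain C where C: "C \<ge> 0" "\<And>\<psi>. \<psi> \<in> ell2 I \<Longrightarrow> l2norm I (T \<psi>) \<le> C * l2norm I \<psi>"
    using bounded_ops_bound[OF T] by blast
  have comp: "compact_op I (T \<circ> ?d c)" by (intro compact_op_bounded_comp T compact_diagonal I fin)
  then have Tb: "T \<circ> ?d c \<in> bounded_ops I" by (simp add: compact_op_def)
  have db: "?d c \<in> bounded_ops I" using compact_diagonal[OF I fin] by (simp add: compact_op_def)
  have "singular_value I (T \<circ> ?d c) n \<le> C * s n" for n
  proof -
    define S where "S = {i\<in>I. cmod (c i) > s n}"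
    have S: "finite S" "S \<subseteq> I" "card S \<le> n" using fin[OF s(1)] card by (auto simp: S_def)
    define F where "F = T \<circ> ?d (\<lambda>i. if i \<in> S then c i else 0)"
    have Feq: "F \<psi> = T (trunc_vec S (\<lambda>i. c i * \<psi> i))" if "\<psi> \<in> ell2 I" for \<psi>
    proof -
      have "(\<lambda>i. (if i \<in> S then c i else 0) * \<psi> i) = trunc_vec S (\<lambda>i. c i * \<psi> i)"
        by (auto simp: trunc_vec_def)
      then show ?thesis using that by (simp add: F_def on_ell2_def)
    qed
    have "?d (\<lambda>i. if i \<in> S then c i else 0) \<in> bounded_ops I"
    proof (rule bounded_diagonal)
      show "cmod (if i \<in> S then c i else 0) \<le> (\<Sum>j\<in>S. cmod (c j))" for i
        using S(1) by (auto intro: member_le_sum sum_nonneg)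
    qed
    then have Fb: "F \<in> bounded_ops I" unfolding F_def by (intro bounded_ops_comp T)
    have cd: "(\<lambda>i. c i * \<psi> i) \<in> ell2 I" if "\<psi> \<in> ell2 I" for \<psi>
      using bounded_ops_ell2[OF db that] that by (simp add: on_ell2_def)
    show ?thesis
    proof (rule singular_value_le[OF Tb Fb])
      show "rank_le I F n" by (rule rank_le_finite_support[OF T S Feq])
      fix \<psi> assume \<psi>: "\<psi> \<in> ell2 I" "l2norm I \<psi> \<le> 1"
      let ?w = "\<lambda>i. c i * \<psi> i"
      have "(T \<circ> ?d c) \<psi> - F \<psi> = T (?w - trunc_vec S ?w)"
        using \<psi> by (simp add: Feq bounded_ops_diff[OF T cd trunc_vec_ell2[OF cd]] on_ell2_def)
      then have "l2norm I ((T \<circ> ?d c) \<psi> - F \<psi>) \<le> C * l2norm I (?w - trunc_vec S ?w)"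
        using C(2)[OF ell2_diff[OF cd trunc_vec_ell2[OF cd]], OF \<psi>(1) \<psi>(1)] by simp
      also have "l2norm I (?w - trunc_vec S ?w) \<le> s n * l2norm I \<psi>"
        by (rule l2norm_mono[OF \<psi>(1)])
          (use s(1)[of n] in \<open>auto simp: trunc_vec_def S_def norm_mult intro: mult_right_mono\<close>)
      also have "\<dots> \<le> s n * 1" using \<psi>(2) s(1)[of n] by (intro mult_left_mono) auto
      finally show "l2norm I ((T \<circ> ?d c) \<psi> - F \<psi>) \<le> C * s n"
        using C(1) by (simp add: mult_left_mono)
    qed
  qed
  then have "norm (singular_value I (T \<circ> ?d c) n) \<le> C * s n" for n
    using singular_value_nonneg[OF Tb] by simp
  then have "summable (singular_value I (T \<circ> ?d c))"
    by (intro summable_comparison_test'[OF summable_mult[OF s(2), of C], of 0])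
  with comp show ?thesis by (simp add: trace_class_def)
qed

text \<open>The partial sums are bounded, and a constant is at most a multiple of
  \<open>ln N\<close> because \<open>ln N \<ge> ln 2 > 0\<close>.\<close>

lemma trace_class_imp_dixmier_ideal:
  assumes "trace_class I T"
  shows "T \<in> dixmier_ideal I"
proof -
  have T: "compact_op I T" "summable (singular_value I T)" using assms by (auto simp: trace_class_def)
  then have Tb: "T \<in> bounded_ops I" by (simp add: compact_op_def)
  define C where "C = suminf (singular_value I T)"
  have C: "C \<ge> 0" unfolding C_def by (intro suminf_nonneg T singular_value_nonneg Tb)
  have "(\<Sum>n<N. singular_value I T n) \<le> C / ln 2 * ln (real N)" if "N \<ge> 2" for N
  proof -
    have "(\<Sum>n<N. singular_value I T n) \<le> C" unfolding C_def
      by (intro sum_le_suminf T) (auto simp: singular_value_nonneg[OF Tb])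
    also have "C = C / ln 2 * ln 2" by simp
    also have "\<dots> \<le> C / ln 2 * ln (real N)" using that C by (intro mult_left_mono) auto
    finally show ?thesis .
  qed
  then have "\<exists>C. \<forall>N\<ge>2. (\<Sum>n<N. singular_value I T n) \<le> C * ln (real N)"
    by (intro exI[of _ "C / ln 2"]) simp
  then show ?thesis using T(1) by (simp add: dixmier_ideal_def)
qed

section \<open>Operators given by absolutely convergent series of partial permutations\<close>

subsection \<open>Summation over pairs\<close>

lemma has_sum_sum_fun:
  fixes g :: "'a \<Rightarrow> 'b \<Rightarrow> 'c :: topological_comm_monoid_add"
  assumes "\<And>a. a \<in> F \<Longrightarrow> (g a has_sum s a) A"
  shows "((\<lambda>x. \<Sum>a\<in>F. g a x) has_sum (\<Sum>a\<in>F. s a)) A"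
  using assms by (induction F rule: infinite_finite_induct) (auto intro!: has_sum_add)

text \<open>Tonelli's theorem in the form used for the double series below: the row sums only have
  to be dominated by a summable family.\<close>

lemma summable_on_prod_nonneg:
  fixes g :: "'x \<times> 'y \<Rightarrow> real"
  assumes "\<And>x y. g (x, y) \<ge> 0" "\<And>x. (\<lambda>y. g (x, y)) summable_on UNIV"
    "\<And>x. (\<Sum>\<^sub>\<infinity>y. g (x, y)) \<le> B x" "B summable_on UNIV"
  shows "g summable_on UNIV" "infsum g UNIV \<le> infsum B UNIV"
proof -
  have s: "(\<lambda>x. \<Sum>\<^sub>\<infinity>y. g (x, y)) summable_on UNIV"
    by (rule summable_on_comparison_test[OF assms(4)]) (auto simp: assms infsum_nonneg)
  have "(\<lambda>z. norm (g z)) summable_on (UNIV \<times> UNIV)"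
    by (rule iffD2[OF Infinite_Sum.abs_summable_on_Sigma_iff]) (use assms s in \<open>simp add: infsum_nonneg\<close>)
  moreover have "norm (g z) = g z" for z using assms(1) by (cases z) simp
  ultimately show g: "g summable_on UNIV" by simp
  have "infsum g UNIV = (\<Sum>\<^sub>\<infinity>x. \<Sum>\<^sub>\<infinity>y. g (x, y))"
    using infsum_Sigma_banach[of g UNIV "\<lambda>_. UNIV"] g by simp
  also have "\<dots> \<le> infsum B UNIV" by (rule infsum_mono[OF s assms(4,3)])
  finally show "infsum g UNIV \<le> infsum B UNIV" .
qed

lemma summable_on_sum_type:
  assumes "(\<lambda>x. g (Inl x)) summable_on UNIV" "(\<lambda>y. g (Inr y)) summable_on UNIV"
  shows "g summable_on UNIV"
    and "infsum g UNIV = (\<Sum>\<^sub>\<infinity>x. g (Inl x)) + (\<Sum>\<^sub>\<infinity>y. g (Inr y) :: 'a :: {topological_comm_monoid_add, t2_space})"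
proof -
  have "g summable_on range Inl" "g summable_on range Inr"
    using assms by (simp_all add: summable_on_reindex o_def)
  moreover have "range Inl \<inter> range Inr = ({} :: ('a + 'b) set)" by auto
  ultimately have "g summable_on (range Inl \<union> range Inr)"
    "infsum g (range Inl \<union> range Inr) = infsum g (range Inl) + infsum g (range Inr)"
    by (auto intro: summable_on_Un_disjoint infsum_Un_disjoint)
  then show "g summable_on UNIV"
    "infsum g UNIV = (\<Sum>\<^sub>\<infinity>x. g (Inl x)) + (\<Sum>\<^sub>\<infinity>y. g (Inr y))"
    by (simp_all add: UNIV_sum infsum_reindex o_def)
qed

text \<open>The nonnegative series of \<open>c x * (A * a x - S)\<^sup>2\<close> expands to
  \<open>A * (A * Q - S\<^sup>2)\<close>. If \<open>A = 0\<close>, all weights vanish.\<close>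

lemma weighted_cauchy_schwarz:
  fixes c a :: "'x \<Rightarrow> real"
  assumes c: "\<And>x. c x \<ge> 0" "c summable_on UNIV" and a: "\<And>x. \<bar>a x\<bar> \<le> K"
  shows "(\<Sum>\<^sub>\<infinity>x. c x * a x)\<^sup>2 \<le> (\<Sum>\<^sub>\<infinity>x. c x) * (\<Sum>\<^sub>\<infinity>x. c x * (a x)\<^sup>2)"
proof -
  define A where "A = (\<Sum>\<^sub>\<infinity>x. c x)"
  define S where "S = (\<Sum>\<^sub>\<infinity>x. c x * a x)"
  define Q where "Q = (\<Sum>\<^sub>\<infinity>x. c x * (a x)\<^sup>2)"
  have sK: "(\<lambda>x. c x * b x) summable_on UNIV" if "\<And>x. \<bar>b x\<bar> \<le> K'" for b :: "'x \<Rightarrow> real" and K'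
  proof (rule abs_summable_summable, rule summable_on_comparison_test)
    show "(\<lambda>x. c x * K') summable_on UNIV" by (intro summable_on_cmult_left c)
    show "norm (c x * b x) \<le> c x * K'" for x
      using c(1)[of x] that[of x] by (simp add: abs_mult mult_left_mono)
  qed auto
  have sS: "(\<lambda>x. c x * a x) summable_on UNIV" by (rule sK[OF a])
  have "\<bar>(a x)\<^sup>2\<bar> \<le> K\<^sup>2" for x using power_mono[OF a[of x], of 2] by simp
  then have sQ: "(\<lambda>x. c x * (a x)\<^sup>2) summable_on UNIV" by (rule sK)
  have "0 \<le> (\<Sum>\<^sub>\<infinity>x. c x * (A * a x - S)\<^sup>2)" using c(1) by (intro infsum_nonneg) auto
  also have "\<dots> = (\<Sum>\<^sub>\<infinity>x. A\<^sup>2 * (c x * (a x)\<^sup>2) + (- 2 * A * S) * (c x * a x) + S\<^sup>2 * c x)"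
    by (intro infsum_cong) (simp add: power2_eq_square algebra_simps)
  also have "\<dots> = A\<^sup>2 * Q + (- 2 * A * S) * S + S\<^sup>2 * A"
    by (intro infsumI has_sum_add has_sum_cmult_right) (simp_all add: A_def S_def Q_def sS sQ c)
  also have "\<dots> = A * (A * Q - S\<^sup>2)" by (simp add: power2_eq_square algebra_simps)
  finally have le: "0 \<le> A * (A * Q - S\<^sup>2)" .
  have "A \<ge> 0" unfolding A_def by (intro infsum_nonneg c)
  show ?thesis
  proof (cases "A = 0")
    case True
    have "c x = 0" for x
    proof -
      have "(\<Sum>x\<in>{x}. c x) \<le> A" unfolding A_def by (intro finite_sum_le_infsum c) auto
      then show ?thesis using c(1)[of x] True by simp
    qed
    then show ?thesis by simp
  next
    case False
    then show ?thesis using le \<open>A \<ge> 0\<close> unfolding A_def S_def Q_def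
      by (simp add: zero_le_mult_iff)
  qed
qed


subsection \<open>Absolutely convergent combinations of partial permutations\<close>

text \<open>The matrix with entry 1 at \<open>(\<gamma>, \<gamma>')\<close> when
  \<open>f \<gamma> = Some \<gamma>'\<close>. Since \<open>f\<close> assigns columns to rows,
  composition is reversed: applying \<open>act g\<close> and then \<open>act f\<close> amounts to
  \<open>act (g \<circ>\<^sub>m f)\<close>.\<close>

definition act :: "('i \<Rightarrow> 'i option) \<Rightarrow> 'i op" where
  "act f \<psi> \<gamma> = (case f \<gamma> of None \<Rightarrow> 0 | Some \<gamma>' \<Rightarrow> \<psi> \<gamma>')"

definition partial_perm :: "'i set \<Rightarrow> ('i \<Rightarrow> 'i option) \<Rightarrow> bool" where
  "partial_perm I f \<longleftrightarrow> (\<forall>\<gamma> \<gamma>'. f \<gamma> = Some \<gamma>' \<longrightarrow> \<gamma> \<in> I \<and> \<gamma>' \<in> I) \<and>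
     (\<forall>\<gamma> \<eta> \<gamma>'. f \<gamma> = Some \<gamma>' \<and> f \<eta> = Some \<gamma>' \<longrightarrow> \<gamma> = \<eta>)"

definition perm_series :: "'i set \<Rightarrow> ('x \<Rightarrow> complex) \<Rightarrow> ('x \<Rightarrow> 'i \<Rightarrow> 'i option) \<Rightarrow> 'i op" where
  "perm_series I c f = on_ell2 I (\<lambda>\<psi> \<gamma>. \<Sum>\<^sub>\<infinity>x. c x * act (f x) \<psi> \<gamma>)"

lemma act_bound: "\<psi> \<in> ell2 I \<Longrightarrow> cmod (act f \<psi> \<gamma>) \<le> l2norm I \<psi>"
  by (auto simp: act_def cmod_le_l2norm split: option.split)

lemma act_outside: "partial_perm I f \<Longrightarrow> \<gamma> \<notin> I \<Longrightarrow> act f \<psi> \<gamma> = 0"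
  by (auto simp: act_def partial_perm_def split: option.split)

lemma norm_series_summable:
  assumes "(\<lambda>x. cmod (c x)) summable_on UNIV" "\<psi> \<in> ell2 I"
  shows "(\<lambda>x. norm (c x * act (f x) \<psi> \<gamma>)) summable_on UNIV"
proof (rule summable_on_comparison_test)
  show "(\<lambda>x. cmod (c x) * l2norm I \<psi>) summable_on UNIV" by (intro summable_on_cmult_left assms)
  show "norm (c x * act (f x) \<psi> \<gamma>) \<le> cmod (c x) * l2norm I \<psi>" for x
    unfolding norm_mult by (intro mult_left_mono act_bound assms) auto
qed auto

lemma series_summable:
  assumes "(\<lambda>x. cmod (c x)) summable_on UNIV" "\<psi> \<in> ell2 I"
  shows "(\<lambda>x. c x * act (f x) \<psi> \<gamma>) summable_on UNIV"
  by (rule abs_summable_summable[OF norm_series_summable[OF assms]])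

lemma sum_act_le:
  assumes f: "partial_perm I f" and F: "finite F" and \<psi>: "\<psi> \<in> ell2 I"
  shows "(\<Sum>\<gamma>\<in>F. (cmod (act f \<psi> \<gamma>))\<^sup>2) \<le> (l2norm I \<psi>)\<^sup>2"
proof -
  let ?h = "\<lambda>\<gamma>. the (f \<gamma>)"
  have "(\<Sum>\<gamma>\<in>F. (cmod (act f \<psi> \<gamma>))\<^sup>2) = (\<Sum>\<gamma>\<in>F \<inter> dom f. (cmod (act f \<psi> \<gamma>))\<^sup>2)"
    using F by (intro sum.mono_neutral_right) (auto simp: act_def split: option.split)
  also have "\<dots> = (\<Sum>\<gamma>\<in>F \<inter> dom f. (cmod (\<psi> (?h \<gamma>)))\<^sup>2)"
    by (intro sum.cong) (auto simp: act_def)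
  also have "\<dots> = (\<Sum>\<gamma>\<in>?h ` (F \<inter> dom f). (cmod (\<psi> \<gamma>))\<^sup>2)"
    by (subst sum.reindex) (use f in \<open>auto simp: inj_on_def partial_perm_def\<close>)
  also have "\<dots> \<le> (\<Sum>\<^sub>\<infinity>\<gamma>\<in>I. (cmod (\<psi> \<gamma>))\<^sup>2)"
    by (intro finite_sum_le_infsum ell2_summable \<psi>) (use f F in \<open>auto simp: partial_perm_def\<close>)
  finally show ?thesis by (simp add: l2norm_power2)
qed

text \<open>Cauchy-Schwarz with the weights \<open>|c x|\<close> bounds each square by
  \<open>A\<close> times a weighted sum of squares; after exchanging the sums, every partial
  permutation is a contraction. This yields the sum \<open>A\<close> of the \<open>|c x|\<close> as
  a bound for the operator norm.\<close>

lemma perm_series_partial_bound: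
  assumes c: "(\<lambda>x. cmod (c x)) summable_on UNIV" and f: "\<And>x. partial_perm I (f x)"
    and F: "finite F" and \<psi>: "\<psi> \<in> ell2 I"
  shows "(\<Sum>\<gamma>\<in>F. (cmod (\<Sum>\<^sub>\<infinity>x. c x * act (f x) \<psi> \<gamma>))\<^sup>2) \<le> ((\<Sum>\<^sub>\<infinity>x. cmod (c x)) * l2norm I \<psi>)\<^sup>2"
proof -
  define A where "A = (\<Sum>\<^sub>\<infinity>x. cmod (c x))"
  have A: "A \<ge> 0" unfolding A_def by (intro infsum_nonneg) auto
  have sQ: "(\<lambda>x. cmod (c x) * (cmod (act (f x) \<psi> \<gamma>))\<^sup>2) summable_on UNIV" for \<gamma>
  proof (rule summable_on_comparison_test)
    show "(\<lambda>x. cmod (c x) * (l2norm I \<psi>)\<^sup>2) summable_on UNIV" by (intro summable_on_cmult_left c)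
  qed (auto intro!: mult_left_mono power_mono act_bound \<psi>)
  have "(cmod (\<Sum>\<^sub>\<infinity>x. c x * act (f x) \<psi> \<gamma>))\<^sup>2 \<le> A * (\<Sum>\<^sub>\<infinity>x. cmod (c x) * (cmod (act (f x) \<psi> \<gamma>))\<^sup>2)" for \<gamma>
  proof -
    have "cmod (\<Sum>\<^sub>\<infinity>x. c x * act (f x) \<psi> \<gamma>) \<le> (\<Sum>\<^sub>\<infinity>x. norm (c x * act (f x) \<psi> \<gamma>))"
      by (rule norm_infsum_bound[OF norm_series_summable[OF c \<psi>]])
    then have "(cmod (\<Sum>\<^sub>\<infinity>x. c x * act (f x) \<psi> \<gamma>))\<^sup>2 \<le> (\<Sum>\<^sub>\<infinity>x. cmod (c x) * cmod (act (f x) \<psi> \<gamma>))\<^sup>2"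
      by (intro power_mono) (auto simp: norm_mult)
    also have "\<dots> \<le> A * (\<Sum>\<^sub>\<infinity>x. cmod (c x) * (cmod (act (f x) \<psi> \<gamma>))\<^sup>2)"
      unfolding A_def by (rule weighted_cauchy_schwarz[where K = "l2norm I \<psi>"]) (auto simp: c act_bound \<psi>)
    finally show ?thesis .
  qed
  then have "(\<Sum>\<gamma>\<in>F. (cmod (\<Sum>\<^sub>\<infinity>x. c x * act (f x) \<psi> \<gamma>))\<^sup>2) \<le>
      (\<Sum>\<gamma>\<in>F. A * (\<Sum>\<^sub>\<infinity>x. cmod (c x) * (cmod (act (f x) \<psi> \<gamma>))\<^sup>2))"
    by (intro sum_mono)
  also have "\<dots> = A * (\<Sum>\<^sub>\<infinity>x. \<Sum>\<gamma>\<in>F. cmod (c x) * (cmod (act (f x) \<psi> \<gamma>))\<^sup>2)"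
    unfolding sum_distrib_left[symmetric, of A]
    by (subst infsumI[OF has_sum_sum_fun[OF has_sum_infsum[OF sQ]]]) simp
  also have "\<dots> \<le> A * (\<Sum>\<^sub>\<infinity>x. cmod (c x) * (l2norm I \<psi>)\<^sup>2)"
  proof (intro mult_left_mono infsum_mono A)
    show "(\<lambda>x. \<Sum>\<gamma>\<in>F. cmod (c x) * (cmod (act (f x) \<psi> \<gamma>))\<^sup>2) summable_on UNIV"
      by (rule has_sum_imp_summable[OF has_sum_sum_fun[OF has_sum_infsum[OF sQ]]])
    show "(\<lambda>x. cmod (c x) * (l2norm I \<psi>)\<^sup>2) summable_on UNIV" by (intro summable_on_cmult_left c)
    show "(\<Sum>\<gamma>\<in>F. cmod (c x) * (cmod (act (f x) \<psi> \<gamma>))\<^sup>2) \<le> cmod (c x) * (l2norm I \<psi>)\<^sup>2" for x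
      unfolding sum_distrib_left[symmetric] by (intro mult_left_mono sum_act_le f F \<psi>) auto
  qed
  also have "\<dots> = (A * l2norm I \<psi>)\<^sup>2"
    by (simp add: infsum_cmult_left' A_def power2_eq_square)
  finally show ?thesis by (simp add: A_def)
qed

lemma perm_series_bounded:
  assumes c: "(\<lambda>x. cmod (c x)) summable_on UNIV" and f: "\<And>x. partial_perm I (f x)"
  shows "perm_series I c f \<in> bounded_ops I"
proof (rule bounded_opsI[where C = "\<Sum>\<^sub>\<infinity>x. cmod (c x)"])
  let ?s = "\<lambda>\<psi> \<gamma>. \<Sum>\<^sub>\<infinity>x. c x * act (f x) \<psi> \<gamma>"
  let ?A = "\<Sum>\<^sub>\<infinity>x. cmod (c x)"
  have A: "?A \<ge> 0" by (intro infsum_nonneg) auto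
  fix \<psi> assume \<psi>: "\<psi> \<in> ell2 I"
  have sq: "(\<lambda>\<gamma>. (cmod (?s \<psi> \<gamma>))\<^sup>2) summable_on I"
    by (intro nonneg_bdd_above_summable_on bdd_aboveI[where M = "(?A * l2norm I \<psi>)\<^sup>2"])
      (auto intro: perm_series_partial_bound[OF c f _ \<psi>])
  show "perm_series I c f \<psi> \<in> ell2 I"
    using \<psi> sq by (auto simp: perm_series_def on_ell2_def ell2_def act_outside[OF f])
  have "(l2norm I (?s \<psi>))\<^sup>2 \<le> (?A * l2norm I \<psi>)\<^sup>2"
    unfolding l2norm_power2 by (intro infsum_le_finite_sums sq perm_series_partial_bound[OF c f _ \<psi>])
  then have "l2norm I (?s \<psi>) \<le> ?A * l2norm I \<psi>"
    by (rule power2_le_imp_le) (simp add: A)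
  then show "l2norm I (perm_series I c f \<psi>) \<le> ?A * l2norm I \<psi>"
    using \<psi> by (simp add: perm_series_def on_ell2_def)
  have "?s (scale_vec a \<psi>) \<gamma> = a * ?s \<psi> \<gamma>" for a \<gamma>
  proof -
    have "c x * act (f x) (scale_vec a \<psi>) \<gamma> = a * (c x * act (f x) \<psi> \<gamma>)" for x
      by (simp add: act_def scale_vec_def split: option.split)
    then show ?thesis by (simp only: infsum_cmult_right')
  qed
  then show "perm_series I c f (scale_vec a \<psi>) = scale_vec a (perm_series I c f \<psi>)" for a
    using \<psi> ell2_scale[OF \<psi>] by (auto simp: perm_series_def on_ell2_def scale_vec_def)
  show "perm_series I c f (\<phi> + \<psi>) = perm_series I c f \<phi> + perm_series I c f \<psi>" if \<phi>: "\<phi> \<in> ell2 I" for \<phi>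
  proof
    fix \<gamma>
    have "c x * act (f x) (\<phi> + \<psi>) \<gamma> = c x * act (f x) \<phi> \<gamma> + c x * act (f x) \<psi> \<gamma>" for x
      by (simp add: act_def algebra_simps split: option.split)
    then have "?s (\<phi> + \<psi>) \<gamma> = (?s \<phi> + ?s \<psi>) \<gamma>" unfolding plus_fun_apply
      by (simp only: infsum_add[OF series_summable[OF c \<phi>] series_summable[OF c \<psi>]])
    then show "perm_series I c f (\<phi> + \<psi>) \<gamma> = (perm_series I c f \<phi> + perm_series I c f \<psi>) \<gamma>"
      by (simp only: perm_series_def on_ell2_def if_True \<psi> \<phi> ell2_add[OF \<phi> \<psi>])
  qed
qed (auto simp: perm_series_def on_ell2_def)

text \<open>If \<open>f x\<close> sends \<open>\<gamma>\<close> to \<open>\<gamma>'\<close>, then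
  \<open>d \<gamma> = e x + d \<gamma>'\<close>, so commuting with \<open>D\<close> multiplies the
  coefficient by \<open>e x\<close>. Read as a formula for \<open>d\<close> times the image vector,
  the same identity shows that the domain is preserved.\<close>

lemma perm_series_commutator:
  fixes e :: "'x \<Rightarrow> real"
  assumes D: "acts_diagonally I d D"
    and c: "(\<lambda>x. cmod (c x)) summable_on UNIV" and ce: "(\<lambda>x. cmod (c x * of_real (e x))) summable_on UNIV"
    and f: "\<And>x. partial_perm I (f x)"
    and deg: "\<And>x \<gamma> \<gamma>'. f x \<gamma> = Some \<gamma>' \<Longrightarrow> d \<gamma> - d \<gamma>' = e x"
  shows "extends_commutator I D (perm_series I c f) (perm_series I (\<lambda>x. c x * of_real (e x)) f)"
proof -
  obtain dm E where DE: "D = (dm, E)" by (cases D)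
  let ?a = "perm_series I c f" and ?U = "perm_series I (\<lambda>x. c x * of_real (e x)) f"
  have a: "?a \<in> bounded_ops I" and U: "?U \<in> bounded_ops I"
    by (rule perm_series_bounded[OF c f], rule perm_series_bounded[OF ce f])
  have "?a \<psi> \<in> dm \<and> ?U \<psi> = E (?a \<psi>) - ?a (E \<psi>)" if dm: "\<psi> \<in> dm" for \<psi>
  proof -
    have dom: "\<psi> \<in> fst D" using dm DE by simp
    have \<psi>: "\<psi> \<in> ell2 I" "E \<psi> \<in> ell2 I" and E: "E \<psi> = (\<lambda>i. of_real (d i) * \<psi> i)"
      using dom[unfolded acts_diagonally_dom[OF D]] acts_diagonally_apply[OF D dom] by (simp_all add: DE)
    have eq: "of_real (d \<gamma>) * ?a \<psi> \<gamma> = ?U \<psi> \<gamma> + ?a (E \<psi>) \<gamma>" for \<gamma>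
    proof -
      have "of_real (d \<gamma>) * (c x * act (f x) \<psi> \<gamma>) = c x * of_real (e x) * act (f x) \<psi> \<gamma> + c x * act (f x) (E \<psi>) \<gamma>" for x
      proof (cases "f x \<gamma>")
        case (Some \<gamma>')
        have "complex_of_real (d \<gamma>) = of_real (e x) + of_real (d \<gamma>')" using deg[OF Some] by (simp flip: of_real_add)
        then show ?thesis using Some by (simp add: act_def E algebra_simps)
      qed (simp add: act_def)
      then show ?thesis using \<psi>
        by (simp add: perm_series_def on_ell2_def infsum_cmult_right'[symmetric]
            infsum_add[OF series_summable[OF ce \<psi>(1)] series_summable[OF c \<psi>(2)]])
    qed
    then have eq': "(\<lambda>\<gamma>. of_real (d \<gamma>) * ?a \<psi> \<gamma>) = ?U \<psi> + ?a (E \<psi>)" by (simp add: fun_eq_iff)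
    have "(\<lambda>\<gamma>. of_real (d \<gamma>) * ?a \<psi> \<gamma>) \<in> ell2 I"
      unfolding eq' by (intro ell2_add bounded_ops_ell2[OF a] bounded_ops_ell2[OF U] \<psi>)
    then have ad: "?a \<psi> \<in> fst D" using bounded_ops_ell2[OF a \<psi>(1)] by (simp add: acts_diagonally_dom[OF D])
    have "E (?a \<psi>) = ?U \<psi> + ?a (E \<psi>)" using acts_diagonally_apply[OF D ad] unfolding eq' by (simp add: DE)
    then show ?thesis using ad DE by simp
  qed
  then show ?thesis unfolding extends_commutator_def DE case_prod_conv
    by (intro conjI ballI U) simp_all
qed

subsection \<open>Rapidly decreasing families\<close>

definition rapid :: "('x \<Rightarrow> complex) \<Rightarrow> ('x \<Rightarrow> nat) \<Rightarrow> bool" where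
  "rapid c a \<longleftrightarrow> (\<forall>m. (\<lambda>x. cmod (c x) * (1 + real (a x)) ^ m) summable_on UNIV)"

lemma rapidD: "rapid c a \<Longrightarrow> (\<lambda>x. cmod (c x) * (1 + real (a x)) ^ m) summable_on UNIV"
  by (simp add: rapid_def)

lemma rapid_summable: "rapid c a \<Longrightarrow> (\<lambda>x. cmod (c x)) summable_on UNIV"
  using rapidD[of c a 0] by simp

text \<open>Rapid decay survives polynomial growth of the coefficients and linear growth of the
  weight, both measured by the old weight.\<close>

lemma rapid_dominated:
  assumes c: "rapid c a" and le: "\<And>x. cmod (c' x) \<le> K * (1 + real (a x)) ^ k * cmod (c x)"
    and a': "\<And>x. 1 + real (a' x) \<le> L * (1 + real (a x))"
  shows "rapid c' a'"
  unfolding rapid_def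
proof
  fix m
  show "(\<lambda>x. cmod (c' x) * (1 + real (a' x)) ^ m) summable_on UNIV"
  proof (rule summable_on_comparison_test)
    show "(\<lambda>x. K * L ^ m * (cmod (c x) * (1 + real (a x)) ^ (k + m))) summable_on UNIV"
      by (intro summable_on_cmult_right rapidD c)
    fix x
    have "cmod (c' x) * (1 + real (a' x)) ^ m \<le> (K * (1 + real (a x)) ^ k * cmod (c x)) * (L * (1 + real (a x))) ^ m"
      using order_trans[OF norm_ge_zero le[of x]] by (intro mult_mono power_mono le a') auto
    then show "cmod (c' x) * (1 + real (a' x)) ^ m \<le> K * L ^ m * (cmod (c x) * (1 + real (a x)) ^ (k + m))"
      by (simp only: power_mult_distrib power_add mult_ac)
  qed auto
qed

text \<open>The index type is fixed to \<open>nat\<close> since a set cannot quantify over types;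
  series over other countable types are brought in by re-indexing.\<close>

definition rapid_series_ops :: "(nat \<Rightarrow> ('i \<Rightarrow> 'i option) \<Rightarrow> bool) \<Rightarrow> 'i set \<Rightarrow> 'i op set" where
  "rapid_series_ops G I =
     {perm_series I c f | (c :: nat \<Rightarrow> complex) f a. rapid c a \<and> (\<forall>x. G (a x) (f x))}"

lemma rapid_series_opsE:
  assumes "T \<in> rapid_series_ops G I"
  obtains c :: "nat \<Rightarrow> complex" and f a
  where "T = perm_series I c f" "rapid c a" "\<And>x. G (a x) (f x)"
  using assms by (auto simp: rapid_series_ops_def)

text \<open>Numbers that encode no index get coefficient 0 but keep the map and the weight at
  \<open>from_nat\<close>, so that a condition relating maps and weights still holds for every
  number.\<close>

lemma perm_series_reindex_nat:
  fixes c :: "'x :: countable \<Rightarrow> complex"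
  assumes c: "rapid c a"
  obtains c' :: "nat \<Rightarrow> complex" and f' a' where "perm_series I c f = perm_series I c' f'" "rapid c' a'"
    "\<And>n. \<exists>x. f' n = f x \<and> a' n = a x"
    "\<And>m. (\<Sum>\<^sub>\<infinity>n. cmod (c' n) * (1 + real (a' n)) ^ m) = (\<Sum>\<^sub>\<infinity>x. cmod (c x) * (1 + real (a x)) ^ m)"
proof -
  define c' where "c' n = (if n \<in> range (to_nat :: 'x \<Rightarrow> nat) then c (from_nat n) else 0)" for n
  define f' a' where "f' n = f (from_nat n :: 'x)" and "a' n = a (from_nat n :: 'x)" for n
  have summ: "(\<lambda>x. g (to_nat (x :: 'x))) summable_on UNIV \<longleftrightarrow> g summable_on UNIV"
    and inf: "(\<Sum>\<^sub>\<infinity>x. g (to_nat (x :: 'x))) = infsum g UNIV"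
    if "\<And>n. n \<notin> range (to_nat :: 'x \<Rightarrow> nat) \<Longrightarrow> g n = 0"
    for g :: "nat \<Rightarrow> 'b :: {topological_comm_monoid_add, t2_space}"
  proof -
    have "g summable_on range (to_nat :: 'x \<Rightarrow> nat) \<longleftrightarrow> g summable_on UNIV"
      by (rule summable_on_cong_neutral) (use that in auto)
    moreover have "infsum g (range (to_nat :: 'x \<Rightarrow> nat)) = infsum g UNIV"
      by (rule infsum_cong_neutral) (use that in auto)
    ultimately show "(\<lambda>x. g (to_nat (x :: 'x))) summable_on UNIV \<longleftrightarrow> g summable_on UNIV"
      "(\<Sum>\<^sub>\<infinity>x. g (to_nat (x :: 'x))) = infsum g UNIV"
      by (simp_all add: summable_on_reindex infsum_reindex o_def)
  qed
  have "(\<Sum>\<^sub>\<infinity>x. c x * act (f x) \<psi> \<gamma>) = (\<Sum>\<^sub>\<infinity>n. c' n * act (f' n) \<psi> \<gamma>)" for \<psi> \<gamma>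
    by (subst inf[symmetric]) (auto simp: c'_def f'_def)
  then have 1: "perm_series I c f = perm_series I c' f'" by (simp add: perm_series_def)
  have 2: "rapid c' a'"
    unfolding rapid_def
  proof
    fix m
    show "(\<lambda>n. cmod (c' n) * (1 + real (a' n)) ^ m) summable_on UNIV"
      using rapidD[OF c, of m] by (subst summ[symmetric]) (auto simp: c'_def a'_def)
  qed
  have 3: "(\<Sum>\<^sub>\<infinity>n. cmod (c' n) * (1 + real (a' n)) ^ m) = (\<Sum>\<^sub>\<infinity>x. cmod (c x) * (1 + real (a x)) ^ m)" for m
    by (subst inf[symmetric]) (auto simp: c'_def a'_def)
  show ?thesis by (rule that[OF 1 2 _ 3]) (auto simp: f'_def a'_def)
qed

lemma rapid_series_opsI:
  fixes c :: "'x :: countable \<Rightarrow> complex"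
  assumes c: "rapid c a" and G: "\<And>x. G (a x) (f x)"
  shows "perm_series I c f \<in> rapid_series_ops G I"
proof -
  obtain c' :: "nat \<Rightarrow> complex" and f' a' where 1: "perm_series I c f = perm_series I c' f'" "rapid c' a'"
    and 2: "\<And>n. \<exists>x. f' n = f x \<and> a' n = a x"
    by (rule perm_series_reindex_nat[OF c, of I f]) (rule that)
  have "\<forall>n. G (a' n) (f' n)"
  proof
    fix n obtain x where "f' n = f x" "a' n = a x" using 2 by blast
    then show "G (a' n) (f' n)" using G by simp
  qed
  then show ?thesis unfolding rapid_series_ops_def using 1 by blast
qed

lemma rapid_series_ops_single:
  assumes "G a f"
  shows "on_ell2 I (act f) \<in> rapid_series_ops G I"
proof -
  have "rapid (\<lambda>_ :: unit. 1) (\<lambda>_. a)" unfolding rapid_def by simp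
  from rapid_series_opsI[OF this, of G "\<lambda>_. f" I] assms
  have "perm_series I (\<lambda>_ :: unit. 1) (\<lambda>_. f) \<in> rapid_series_ops G I" by simp
  moreover have "perm_series I (\<lambda>_ :: unit. 1) (\<lambda>_. f) = on_ell2 I (act f)"
    by (simp add: perm_series_def on_ell2_def fun_eq_iff UNIV_unit)
  ultimately show ?thesis by simp
qed

lemma rapid_series_ops_scale:
  assumes "T \<in> rapid_series_ops G I"
  shows "scale_op s T \<in> rapid_series_ops G I"
proof -
  obtain c :: "nat \<Rightarrow> complex" and f a where T: "T = perm_series I c f" "rapid c a" "\<And>x. G (a x) (f x)"
    using assms by (rule rapid_series_opsE) (rule that)
  have "rapid (\<lambda>x. s * c x) a"
    by (rule rapid_dominated[OF T(2), where K = "cmod s" and k = 0 and L = 1]) (auto simp: norm_mult)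
  moreover have "scale_op s T = perm_series I (\<lambda>x. s * c x) f"
    unfolding T(1) scale_op_def perm_series_def on_ell2_def scale_vec_def
    by (auto simp: fun_eq_iff mult.assoc infsum_cmult_right')
  ultimately show ?thesis using rapid_series_opsI[of "\<lambda>x. s * c x" a G f I] T(3) by simp
qed

lemma rapid_series_ops_add:
  assumes "T \<in> rapid_series_ops G I" "U \<in> rapid_series_ops G I"
  shows "T + U \<in> rapid_series_ops G I"
proof -
  obtain c :: "nat \<Rightarrow> complex" and f a where T: "T = perm_series I c f" "rapid c a" "\<And>x. G (a x) (f x)"
    using assms(1) by (rule rapid_series_opsE) (rule that)
  obtain c' :: "nat \<Rightarrow> complex" and f' a' where U: "U = perm_series I c' f'" "rapid c' a'" "\<And>x. G (a' x) (f' x)"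
    using assms(2) by (rule rapid_series_opsE) (rule that)
  have "rapid (case_sum c c') (case_sum a a')"
    unfolding rapid_def
    by (intro allI summable_on_sum_type) (simp_all add: rapidD[OF T(2)] rapidD[OF U(2)])
  moreover have "G (case_sum a a' x) (case_sum f f' x)" for x
    using T(3) U(3) by (cases x) auto
  ultimately have "perm_series I (case_sum c c') (case_sum f f') \<in> rapid_series_ops G I"
    by (rule rapid_series_opsI)
  moreover have "perm_series I (case_sum c c') (case_sum f f') = T + U"
  proof
    fix \<psi>
    show "perm_series I (case_sum c c') (case_sum f f') \<psi> = (T + U) \<psi>"
    proof (cases "\<psi> \<in> ell2 I")
      case True
      have "(\<Sum>\<^sub>\<infinity>x. case_sum c c' x * act (case_sum f f' x) \<psi> \<gamma>) =
          (\<Sum>\<^sub>\<infinity>x. c x * act (f x) \<psi> \<gamma>) + (\<Sum>\<^sub>\<infinity>x. c' x * act (f' x) \<psi> \<gamma>)" for \<gamma>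
        by (subst summable_on_sum_type(2))
          (simp_all add: series_summable[OF rapid_summable[OF T(2)] True] series_summable[OF rapid_summable[OF U(2)] True])
      then show ?thesis using True by (auto simp: T(1) U(1) perm_series_def on_ell2_def)
    next
      case False
      then show ?thesis by (auto simp: T(1) U(1) perm_series_def on_ell2_def)
    qed
  qed
  ultimately show ?thesis by simp
qed

lemma perm_series_comp:
  assumes c: "(\<lambda>x. cmod (c x)) summable_on UNIV" and c': "(\<lambda>x. cmod (c' x)) summable_on UNIV"
    and f': "\<And>y. partial_perm I (f' y)"
  shows "perm_series I c f \<circ> perm_series I c' f' =
    perm_series I (\<lambda>(x, y). c x * c' y) (\<lambda>(x, y). f' y \<circ>\<^sub>m f x)"
proof
  fix \<psi>
  show "(perm_series I c f \<circ> perm_series I c' f') \<psi> = perm_series I (\<lambda>(x, y). c x * c' y) (\<lambda>(x, y). f' y \<circ>\<^sub>m f x) \<psi>"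
  proof (cases "\<psi> \<in> ell2 I")
    case True
    let ?U = "perm_series I c' f'"
    have U: "?U \<psi> \<in> ell2 I" by (rule bounded_ops_ell2[OF perm_series_bounded[OF c' f'] True])
    have "(\<Sum>\<^sub>\<infinity>x. c x * act (f x) (?U \<psi>) \<gamma>) = (\<Sum>\<^sub>\<infinity>z. (case z of (x, y) \<Rightarrow> c x * c' y) * act (case z of (x, y) \<Rightarrow> f' y \<circ>\<^sub>m f x) \<psi> \<gamma>)" for \<gamma>
    proof -
      have inner: "c x * act (f x) (?U \<psi>) \<gamma> = (\<Sum>\<^sub>\<infinity>y. c x * c' y * act (f' y \<circ>\<^sub>m f x) \<psi> \<gamma>)" for x
        using True by (auto simp: act_def map_comp_def perm_series_def on_ell2_def mult.assoc infsum_cmult_right'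
            split: option.split)
      have "(\<lambda>z. norm ((case z of (x, y) \<Rightarrow> c x * c' y) * act (case z of (x, y) \<Rightarrow> f' y \<circ>\<^sub>m f x) \<psi> \<gamma>)) summable_on UNIV"
      proof (rule norm_series_summable[OF _ True])
        show "(\<lambda>z. cmod (case z of (x, y) \<Rightarrow> c x * c' y)) summable_on UNIV"
          by (rule summable_on_prod_nonneg(1)[where B = "\<lambda>x. cmod (c x) * (\<Sum>\<^sub>\<infinity>y. cmod (c' y))"])
            (auto simp: norm_mult infsum_cmult_right' intro!: summable_on_cmult_right summable_on_cmult_left c c')
      qed
      from abs_summable_summable[OF this]
      have "(\<lambda>z. (case z of (x, y) \<Rightarrow> c x * c' y) * act (case z of (x, y) \<Rightarrow> f' y \<circ>\<^sub>m f x) \<psi> \<gamma>) summable_on UNIV \<times> UNIV"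
        by simp
      from infsum_Sigma_banach[OF this] show ?thesis unfolding inner by simp
    qed
    then show ?thesis using True U unfolding o_apply
      by (simp add: perm_series_def on_ell2_def)
  next
    case False
    have "act (f x) 0 \<gamma> = 0" for x \<gamma> by (simp add: act_def split: option.split)
    then have "perm_series I c f 0 = 0" unfolding perm_series_def on_ell2_def by (auto simp: fun_eq_iff)
    then show ?thesis using False by (simp add: perm_series_def on_ell2_def)
  qed
qed

lemma rapid_series_ops_comp:
  assumes T: "T \<in> rapid_series_ops G I" and U: "U \<in> rapid_series_ops G I"
    and pp: "\<And>a f. G a f \<Longrightarrow> partial_perm I f"
    and G: "\<And>a f b g. G a f \<Longrightarrow> G b g \<Longrightarrow> G (a + b) (g \<circ>\<^sub>m f)"
  shows "T \<circ> U \<in> rapid_series_ops G I"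
proof -
  obtain c :: "nat \<Rightarrow> complex" and f a where T: "T = perm_series I c f" "rapid c a" "\<And>x. G (a x) (f x)"
    using T by (rule rapid_series_opsE) (rule that)
  obtain c' :: "nat \<Rightarrow> complex" and f' a' where U: "U = perm_series I c' f'" "rapid c' a'" "\<And>x. G (a' x) (f' x)"
    using U by (rule rapid_series_opsE) (rule that)
  have "rapid (\<lambda>(x, y). c x * c' y) (\<lambda>(x, y). a x + a' y)"
    unfolding rapid_def
  proof
    fix m
    let ?w = "\<lambda>x. cmod (c x) * (1 + real (a x)) ^ m" and ?w' = "\<lambda>y. cmod (c' y) * (1 + real (a' y)) ^ m"
    have "(\<lambda>(x :: nat, y :: nat). ?w x * ?w' y) summable_on UNIV"
      by (rule summable_on_prod_nonneg(1)[where B = "\<lambda>x. ?w x * (\<Sum>\<^sub>\<infinity>y. ?w' y)"])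
        (auto simp: infsum_cmult_right' intro!: summable_on_cmult_right summable_on_cmult_left rapidD T U)
    then show "(\<lambda>z :: nat \<times> nat. cmod (case z of (x, y) \<Rightarrow> c x * c' y) * (1 + real (case z of (x, y) \<Rightarrow> a x + a' y)) ^ m) summable_on UNIV"
    proof (rule summable_on_comparison_test)
      fix z :: "nat \<times> nat"
      obtain x y where z: "z = (x, y)" by (cases z)
      \<comment> \<open>Weights add under composition, and
        \<open>1 + a + a' \<le> (1 + a) * (1 + a')\<close> separates the two sums.\<close>
      have "(1 + real (a x + a' y)) ^ m \<le> ((1 + real (a x)) * (1 + real (a' y))) ^ m"
        by (intro power_mono) (auto simp: algebra_simps)
      from mult_left_mono[OF this, of "cmod (c x) * cmod (c' y)"]
      show "cmod (case z of (x, y) \<Rightarrow> c x * c' y) * (1 + real (case z of (x, y) \<Rightarrow> a x + a' y)) ^ m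
          \<le> (case z of (x, y) \<Rightarrow> ?w x * ?w' y)"
        by (simp add: z norm_mult power_mult_distrib mult_ac)
    qed (auto split: prod.split)
  qed
  moreover have "G ((\<lambda>(x, y). a x + a' y) z) ((\<lambda>(x, y). f' y \<circ>\<^sub>m f x) z)" for z
    using G T(3) U(3) by (cases z) simp
  ultimately have "perm_series I (\<lambda>(x, y). c x * c' y) (\<lambda>(x, y). f' y \<circ>\<^sub>m f x) \<in> rapid_series_ops G I"
    by (rule rapid_series_opsI)
  then show ?thesis
    unfolding T(1) U(1) using perm_series_comp[OF rapid_summable[OF T(2)] rapid_summable[OF U(2)] pp[OF U(3)]] by simp
qed

text \<open>One number \<open>b\<close> bounds both the length and the weights, because in the
  expansions below both grow linearly with the weight of the expanded map.\<close>

definition finite_combination :: "(nat \<Rightarrow> ('i \<Rightarrow> 'i option) \<Rightarrow> bool) \<Rightarrow> nat \<Rightarrow> ('i \<Rightarrow> 'i option) \<Rightarrow> bool" where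
  "finite_combination H b f \<longleftrightarrow> (\<exists>hs :: (complex \<times> ('i \<Rightarrow> 'i option)) list. length hs \<le> b \<and>
     (\<forall>(s, h)\<in>set hs. cmod s \<le> 1 \<and> H b h) \<and> act f = (\<lambda>\<psi> \<gamma>. \<Sum>(s, h)\<leftarrow>hs. s * act h \<psi> \<gamma>))"

lemma finite_combinationI:
  assumes "length hs \<le> b" "\<And>s h. (s, h) \<in> set hs \<Longrightarrow> cmod s \<le> 1 \<and> H b h"
    "\<And>\<psi> \<gamma>. act f \<psi> \<gamma> = (\<Sum>(s, h)\<leftarrow>hs. s * act h \<psi> \<gamma>)"
  shows "finite_combination H b f"
  unfolding finite_combination_def using assms by (intro exI[of _ hs]) (auto simp: fun_eq_iff)

text \<open>Replacing each generator by at most \<open>K * (a + 1)\<close> terms of that weight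
  costs, up to constants, one more power of \<open>1 + a\<close> in the weighted sums, which rapid
  decay absorbs.\<close>

lemma rapid_series_ops_expand:
  fixes H :: "nat \<Rightarrow> ('i \<Rightarrow> 'i option) \<Rightarrow> bool"
  assumes T: "T \<in> rapid_series_ops G I" and H0: "H 0 Map.empty"
    and ex: "\<And>a f. G a f \<Longrightarrow> finite_combination H (K * (a + 1)) f"
  shows "T \<in> rapid_series_ops H I"
proof -
  obtain c :: "nat \<Rightarrow> complex" and f a where T: "T = perm_series I c f" "rapid c a" "\<And>x. G (a x) (f x)"
    using T by (rule rapid_series_opsE) (rule that)
  have "\<forall>x. \<exists>hs :: (complex \<times> ('i \<Rightarrow> 'i option)) list. length hs \<le> K * (a x + 1) \<and>
      (\<forall>(s, h)\<in>set hs. cmod s \<le> 1 \<and> H (K * (a x + 1)) h) \<and> act (f x) = (\<lambda>\<psi> \<gamma>. \<Sum>(s, h)\<leftarrow>hs. s * act h \<psi> \<gamma>)"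
    using ex T(3) unfolding finite_combination_def by blast
  from choice[OF this] obtain hs :: "nat \<Rightarrow> (complex \<times> ('i \<Rightarrow> 'i option)) list" where
    hs: "\<And>x. length (hs x) \<le> K * (a x + 1)"
      "\<And>x s h. (s, h) \<in> set (hs x) \<Longrightarrow> cmod s \<le> 1 \<and> H (K * (a x + 1)) h"
      "\<And>x. act (f x) = (\<lambda>\<psi> \<gamma>. \<Sum>(s, h)\<leftarrow>hs x. s * act h \<psi> \<gamma>)" by fast
  \<comment> \<open>All lists are continued indefinitely with coefficient 0, the empty map and
    weight 0, which gives a series over pairs.\<close>
  define e where "e x j = (if j < length (hs x) then fst (hs x ! j) else 0)" for x j
  define g where "g x j = (if j < length (hs x) then snd (hs x ! j) else Map.empty)" for x j
  define b where "b x j = (if j < length (hs x) then K * (a x + 1) else 0)" for x j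
  have e1: "cmod (e x j) \<le> 1" for x j
    using hs(2)[of "fst (hs x ! j)" "snd (hs x ! j)" x] by (auto simp: e_def)
  have Hg: "H (b x j) (g x j)" for x j
    using hs(2)[of "fst (hs x ! j)" "snd (hs x ! j)" x] H0 by (auto simp: g_def b_def)
  have supp: "(\<Sum>\<^sub>\<infinity>j. q j) = (\<Sum>j<length (hs x). q j) \<and> q summable_on UNIV" if "\<And>j. j \<ge> length (hs x) \<Longrightarrow> q j = 0"
    for x and q :: "nat \<Rightarrow> 'c :: {topological_comm_monoid_add, t2_space}"
  proof -
    have "(q has_sum (\<Sum>j<length (hs x). q j)) UNIV"
      by (rule has_sum_finite_neutralI[of "{..<length (hs x)}"]) (use that in auto)
    then show ?thesis by (auto simp: has_sum_iff)
  qed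
  have "rapid (\<lambda>(x, j). c x * e x j) (\<lambda>(x, j). b x j)"
    unfolding rapid_def
  proof
    fix m
    let ?g = "\<lambda>z. cmod (case z of (x, j) \<Rightarrow> c x * e x j) * (1 + real (case z of (x, j) \<Rightarrow> b x j)) ^ m"
    let ?B = "\<lambda>x. real K * real (1 + K) ^ m * (cmod (c x) * (1 + real (a x)) ^ (1 + m))"
    show "?g summable_on UNIV"
    proof (rule summable_on_prod_nonneg(1)[where B = ?B])
      have z: "j \<ge> length (hs x) \<Longrightarrow> ?g (x, j) = 0" for x j by (simp add: e_def)
      show "(\<lambda>j. ?g (x, j)) summable_on UNIV" for x using supp[of x "\<lambda>j. ?g (x, j)"] z by blast
      show "(\<Sum>\<^sub>\<infinity>j. ?g (x, j)) \<le> ?B x" for x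
      proof -
        have "(\<Sum>\<^sub>\<infinity>j. ?g (x, j)) = (\<Sum>j<length (hs x). ?g (x, j))" using supp[of x "\<lambda>j. ?g (x, j)"] z by blast
        also have "\<dots> \<le> (\<Sum>j<length (hs x). cmod (c x) * (real (1 + K) * (1 + real (a x))) ^ m)"
        proof (rule sum_mono)
          fix j assume "j \<in> {..<length (hs x)}"
          have "1 + real (b x j) \<le> real (1 + K) * (1 + real (a x))" by (simp add: b_def algebra_simps)
          then have "(1 + real (b x j)) ^ m \<le> (real (1 + K) * (1 + real (a x))) ^ m" by (intro power_mono) auto
          moreover have "cmod (c x * e x j) \<le> cmod (c x)"
            using mult_left_mono[OF e1[of x j], of "cmod (c x)"] by (simp add: norm_mult)
          ultimately show "?g (x, j) \<le> cmod (c x) * (real (1 + K) * (1 + real (a x))) ^ m"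
            unfolding prod.case by (intro mult_mono) auto
        qed
        also have "\<dots> = real (length (hs x)) * (cmod (c x) * (real (1 + K) * (1 + real (a x))) ^ m)" by simp
        also have "\<dots> \<le> (real K * (1 + real (a x))) * (cmod (c x) * (real (1 + K) * (1 + real (a x))) ^ m)"
        proof (rule mult_right_mono)
          have "real (length (hs x)) \<le> real (K * (a x + 1))" using hs(1) of_nat_le_iff by blast
          then show "real (length (hs x)) \<le> real K * (1 + real (a x))" by (simp add: algebra_simps)
        qed auto
        also have "\<dots> = ?B x" by (simp only: power_mult_distrib power_add power_one_right mult_ac)
        finally show ?thesis .
      qed
      show "?B summable_on UNIV" by (intro summable_on_cmult_right rapidD T)
    qed auto
  qed
  note r = this
  have "H ((\<lambda>(x, j). b x j) z) ((\<lambda>(x, j). g x j) z)" for z using Hg by (cases z) simp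
  with r have "perm_series I (\<lambda>(x, j). c x * e x j) (\<lambda>(x, j). g x j) \<in> rapid_series_ops H I"
    by (rule rapid_series_opsI)
  moreover have "perm_series I (\<lambda>(x, j). c x * e x j) (\<lambda>(x, j). g x j) = T"
  proof
    fix \<psi>
    show "perm_series I (\<lambda>(x, j). c x * e x j) (\<lambda>(x, j). g x j) \<psi> = T \<psi>"
    proof (cases "\<psi> \<in> ell2 I")
      case True
      have "(\<Sum>\<^sub>\<infinity>z. (case z of (x, j) \<Rightarrow> c x * e x j) * act (case z of (x, j) \<Rightarrow> g x j) \<psi> \<gamma>) = (\<Sum>\<^sub>\<infinity>x. c x * act (f x) \<psi> \<gamma>)" for \<gamma>
      proof -
        let ?h = "\<lambda>z. (case z of (x, j) \<Rightarrow> c x * e x j) * act (case z of (x, j) \<Rightarrow> g x j) \<psi> \<gamma>"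
        have "?h summable_on UNIV \<times> UNIV" using series_summable[OF rapid_summable[OF r] True] by simp
        from infsum_Sigma_banach[OF this] have "infsum ?h UNIV = (\<Sum>\<^sub>\<infinity>x. \<Sum>\<^sub>\<infinity>j. c x * e x j * act (g x j) \<psi> \<gamma>)" by simp
        also have "\<dots> = (\<Sum>\<^sub>\<infinity>x. c x * act (f x) \<psi> \<gamma>)"
        proof (intro infsum_cong)
          fix x
          have "(\<Sum>\<^sub>\<infinity>j. c x * e x j * act (g x j) \<psi> \<gamma>) = (\<Sum>j<length (hs x). c x * e x j * act (g x j) \<psi> \<gamma>)"
            using supp[of x "\<lambda>j. c x * e x j * act (g x j) \<psi> \<gamma>"] by (simp add: e_def)
          also have "\<dots> = c x * (\<Sum>j<length (hs x). fst (hs x ! j) * act (snd (hs x ! j)) \<psi> \<gamma>)"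
            by (simp add: sum_distrib_left e_def g_def mult.assoc)
          also have "(\<Sum>j<length (hs x). fst (hs x ! j) * act (snd (hs x ! j)) \<psi> \<gamma>) = act (f x) \<psi> \<gamma>"
            by (simp add: hs(3) sum_list_sum_nth atLeast0LessThan case_prod_beta)
          finally show "(\<Sum>\<^sub>\<infinity>j. c x * e x j * act (g x j) \<psi> \<gamma>) = c x * act (f x) \<psi> \<gamma>" .
        qed
        finally show ?thesis .
      qed
      then show ?thesis using True by (simp add: T(1) perm_series_def on_ell2_def)
    qed (simp add: T(1) perm_series_def on_ell2_def)
  qed
  ultimately show ?thesis by simp
qed

lemma rapid_series_ops_bounded:
  assumes T: "T \<in> rapid_series_ops G I" and pp: "\<And>a f. G a f \<Longrightarrow> partial_perm I f"
  shows "T \<in> bounded_ops I"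
proof -
  obtain c :: "nat \<Rightarrow> complex" and f a where T: "T = perm_series I c f" "rapid c a" "\<And>x. G (a x) (f x)"
    using T by (rule rapid_series_opsE) (rule that)
  show ?thesis unfolding T(1) by (rule perm_series_bounded[OF rapid_summable[OF T(2)] pp[OF T(3)]])
qed

text \<open>Homogeneity of the generators makes the class invariant under the commutator.\<close>

lemma rapid_series_ops_commutator:
  assumes T: "T \<in> rapid_series_ops G I" and pp: "\<And>a f. G a f \<Longrightarrow> partial_perm I f"
    and D: "acts_diagonally I d D"
    and deg: "\<And>a f. G a f \<Longrightarrow> \<exists>e. \<bar>e\<bar> \<le> real a \<and> (\<forall>\<gamma> \<gamma>'. f \<gamma> = Some \<gamma>' \<longrightarrow> d \<gamma> - d \<gamma>' = e)"
  shows "\<exists>U \<in> rapid_series_ops G I. extends_commutator I D T U"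
proof -
  obtain c :: "nat \<Rightarrow> complex" and f a where T: "T = perm_series I c f" "rapid c a" "\<And>x. G (a x) (f x)"
    using T by (rule rapid_series_opsE) (rule that)
  have "\<forall>x. \<exists>e. \<bar>e\<bar> \<le> real (a x) \<and> (\<forall>\<gamma> \<gamma>'. f x \<gamma> = Some \<gamma>' \<longrightarrow> d \<gamma> - d \<gamma>' = e)" using deg T(3) by blast
  from choice[OF this] obtain e where e: "\<And>x. \<bar>e x\<bar> \<le> real (a x)" "\<And>x \<gamma> \<gamma>'. f x \<gamma> = Some \<gamma>' \<Longrightarrow> d \<gamma> - d \<gamma>' = e x"
    by blast
  have r: "rapid (\<lambda>x. c x * of_real (e x)) a"
  proof (rule rapid_dominated[OF T(2), where K = 1 and k = 1 and L = 1])
    show "cmod (c x * of_real (e x)) \<le> 1 * (1 + real (a x)) ^ 1 * cmod (c x)" for x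
      using mult_right_mono[of "\<bar>e x\<bar>" "1 + real (a x)" "cmod (c x)"] e(1)[of x] by (simp add: norm_mult mult.commute)
  qed simp
  have "extends_commutator I D T (perm_series I (\<lambda>x. c x * of_real (e x)) f)"
    unfolding T(1) by (rule perm_series_commutator[OF D rapid_summable[OF T(2)] rapid_summable[OF r] pp[OF T(3)] e(2)])
  then show ?thesis using rapid_series_opsI[where f = f and G = G and I = I, OF r T(3)] by blast
qed

section \<open>The generating partial permutations: composition, inversion, homogeneity\<close>

subsection \<open>Generators\<close>

text \<open>A generator is given by its action on row indices: \<open>act f \<psi> \<gamma>\<close> is \<open>\<psi> (f \<gamma>)\<close>.\<close>

definition base_map :: "(int \<Rightarrow> int option) \<Rightarrow> idx \<Rightarrow> idx option" where
  "base_map u = (\<lambda>(g, m). if g = [] then map_option (Pair []) (u m) else None)"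

text \<open>With \<open>p = UNIV\<close> and \<open>t = nat (- n)\<close> this acts on vectors over
  \<open>H_idx (Suc l)\<close> as the power \<open>n\<close> of \<open>alpha1\<close> if
  \<open>n \<ge> 0\<close>, and as the power \<open>- n\<close> of \<open>alpha1_adj\<close>
  otherwise.\<close>

definition shift_map :: "nat \<Rightarrow> int set \<Rightarrow> int \<Rightarrow> nat \<Rightarrow> idx \<Rightarrow> idx option" where
  "shift_map l p n t = (\<lambda>(g, m). case g of [] \<Rightarrow> None | x # xs \<Rightarrow>
     if length xs = l \<and> m \<in> p \<and> t \<le> x then Some (nat (int x + n) # xs, m) else None)"

text \<open>The index map of a summand with \<open>alpha1_adj ^^ j\<close> on the left,
  \<open>p0_tensor\<close> of the action of \<open>f\<close> in the middle and
  \<open>alpha1 ^^ k\<close> on the right: a matrix unit in the first coordinate.\<close>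

definition corner_map :: "nat \<Rightarrow> nat \<Rightarrow> (idx \<Rightarrow> idx option) \<Rightarrow> idx \<Rightarrow> idx option" where
  "corner_map j k f = (\<lambda>(g, m). case g of [] \<Rightarrow> None | x # xs \<Rightarrow>
     if x = j then map_option (\<lambda>(ys, m'). (k # ys, m')) (f (xs, m)) else None)"

text \<open>\<open>Z\<close> provides the weighted maps in the last coordinate, and \<open>P\<close> the sets to which the
  unilateral shifts are restricted there.  The threshold \<open>t\<close> makes the generators closed under
  composition; it is minimal if \<open>strict\<close> holds.  The fourth argument is a bound for the weight.\<close>

inductive gen :: "bool \<Rightarrow> (nat \<Rightarrow> (int \<Rightarrow> int option) \<Rightarrow> bool) \<Rightarrow> int set set \<Rightarrow>
    nat \<Rightarrow> nat \<Rightarrow> (idx \<Rightarrow> idx option) \<Rightarrow> bool" for strict Z P where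
  gen_empty: "gen strict Z P l a Map.empty"
| gen_base: "Z a u \<Longrightarrow> gen strict Z P 0 a (base_map u)"
| gen_shift: "p \<in> P \<Longrightarrow> \<bar>n\<bar> \<le> int a \<Longrightarrow> t \<le> a \<Longrightarrow> 0 \<le> int t + n \<Longrightarrow> (strict \<Longrightarrow> t = nat (- n)) \<Longrightarrow>
    gen strict Z P (Suc l) a (shift_map l p n t)"
| gen_corner: "gen strict Z P l a f \<Longrightarrow> j + k + a \<le> b \<Longrightarrow> gen strict Z P (Suc l) b (corner_map j k f)"

lemma act_corner_map:
  "act (corner_map j k f) \<psi> (x # xs, m) = (if x = j then act f (\<lambda>(ys, m'). \<psi> (k # ys, m')) (xs, m) else 0)"
  "act (corner_map j k f) \<psi> ([], m) = 0"
  by (auto simp: act_def corner_map_def split: option.split)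

lemma act_shift_map:
  "act (shift_map l p n t) \<psi> (x # xs, m) =
     (if length xs = l \<and> m \<in> p \<and> t \<le> x then \<psi> (nat (int x + n) # xs, m) else 0)"
  "act (shift_map l p n t) \<psi> ([], m) = 0"
  by (auto simp: act_def shift_map_def)

lemma act_base_map:
  "act (base_map u) \<psi> (g, m) = (if g = [] then case u m of None \<Rightarrow> 0 | Some m' \<Rightarrow> \<psi> ([], m') else 0)"
  by (auto simp: act_def base_map_def split: option.split)

lemma act_empty [simp]: "act Map.empty \<psi> \<gamma> = 0"
  by (simp add: act_def)

lemma gen_partial_perm:
  assumes "gen s Z P l a f" and Z: "\<And>a u m m' n. Z a u \<Longrightarrow> u m = Some n \<Longrightarrow> u m' = Some n \<Longrightarrow> m = m'"
  shows "partial_perm (H_idx l) f"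
  using assms(1)
proof (induction rule: gen.induct)
  case gen_empty
  then show ?case by (simp add: partial_perm_def)
next
  case gen_base
  then show ?case by (auto simp: partial_perm_def base_map_def H_idx_def split: if_splits dest: Z)
next
  case (gen_shift p n a t l)
  then show ?case
    by (auto simp: partial_perm_def shift_map_def H_idx_def split: if_splits list.splits)
next
  case (gen_corner l a f j k b)
  have len: "length xs = l \<and> length ys = l" if "f (xs, m) = Some (ys, m')" for xs m ys m'
    using gen_corner.IH that by (force simp: partial_perm_def H_idx_def)
  have inj: "xs = xs' \<and> m = m''" if "f (xs, m) = Some \<gamma>" "f (xs', m'') = Some \<gamma>" for xs m xs' m'' \<gamma>
    using gen_corner.IH that unfolding partial_perm_def by blast
  show ?case
    by (auto simp: partial_perm_def corner_map_def H_idx_def split: if_splits list.splits dest: len inj)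
qed


subsection \<open>Composition of generators\<close>

text \<open>When a corner is composed with a shift confined to \<open>p\<close>, the confinement
  passes to the last coordinate of the corner. The generators therefore have to be closed under
  restricting rows and columns.\<close>

definition restrict_rows :: "int set \<Rightarrow> (idx \<Rightarrow> idx option) \<Rightarrow> idx \<Rightarrow> idx option" where
  "restrict_rows p f = (\<lambda>(g, m). if m \<in> p then f (g, m) else None)"

definition restrict_cols :: "int set \<Rightarrow> (idx \<Rightarrow> idx option) \<Rightarrow> idx \<Rightarrow> idx option" where
  "restrict_cols p f \<gamma> = (case f \<gamma> of None \<Rightarrow> None | Some (g, m) \<Rightarrow> if m \<in> p then Some (g, m) else None)"

text \<open>Instantiated twice: by translations with \<open>P = {UNIV}\<close>, and by maps of half
  lines with the two half lines as \<open>P\<close>. Opposite half lines are disjoint, hence the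
  first alternative in \<open>P_inter\<close>, for which the empty generator is provided.\<close>

locale composable =
  fixes Z :: "nat \<Rightarrow> (int \<Rightarrow> int option) \<Rightarrow> bool" and P :: "int set set"
  assumes Z_mono: "Z a u \<Longrightarrow> a \<le> b \<Longrightarrow> Z b u"
    and Z_inj: "Z a u \<Longrightarrow> u m = Some n \<Longrightarrow> u m' = Some n \<Longrightarrow> m = m'"
    and Z_comp: "Z a u \<Longrightarrow> Z b v \<Longrightarrow> Z (a + b) (v \<circ>\<^sub>m u)"
    and Z_rows: "Z a u \<Longrightarrow> p \<in> P \<Longrightarrow> Z a (\<lambda>m. if m \<in> p then u m else None)"
    and Z_cols: "Z a u \<Longrightarrow> p \<in> P \<Longrightarrow> Z a (\<lambda>m. case u m of None \<Rightarrow> None | Some n \<Rightarrow> if n \<in> p then Some n else None)"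
    and P_inter: "p \<in> P \<Longrightarrow> q \<in> P \<Longrightarrow> p \<inter> q = {} \<or> p \<inter> q \<in> P"
begin

abbreviation "G \<equiv> gen False Z P"

lemma G_shift_inter:
  assumes "p \<in> P" "q \<in> P" "\<bar>n\<bar> \<le> int a" "t \<le> a" "0 \<le> int t + n"
  shows "G (Suc l) a (shift_map l (p \<inter> q) n t)"
proof (cases "p \<inter> q = {}")
  case True
  then have "shift_map l (p \<inter> q) n t = Map.empty"
    by (auto simp: shift_map_def fun_eq_iff split: list.split)
  then show ?thesis by (simp add: gen_empty)
next
  case False
  then show ?thesis using assms P_inter by (intro gen_shift) auto
qed

lemma G_restrict_rows: "G l a f \<Longrightarrow> p \<in> P \<Longrightarrow> G l a (restrict_rows p f)"
proof (induction rule: gen.induct)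
  case (gen_empty l a)
  have "restrict_rows p Map.empty = Map.empty" by (auto simp: restrict_rows_def)
  then show ?case by (simp add: gen.gen_empty)
next
  case (gen_base a u)
  have "restrict_rows p (base_map u) = base_map (\<lambda>m. if m \<in> p then u m else None)"
    by (auto simp: restrict_rows_def base_map_def fun_eq_iff)
  then show ?case using gen_base by (simp add: gen.gen_base Z_rows)
next
  case (gen_shift q n a t l)
  have "restrict_rows p (shift_map l q n t) = shift_map l (p \<inter> q) n t"
    by (auto simp: restrict_rows_def shift_map_def fun_eq_iff split: list.split)
  then show ?case using gen_shift by (simp add: G_shift_inter)
next
  case (gen_corner l a f j k b)
  have "restrict_rows p (corner_map j k f) = corner_map j k (restrict_rows p f)"
    by (auto simp: restrict_rows_def corner_map_def fun_eq_iff split: list.split)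
  then show ?case using gen_corner by (auto intro: gen.gen_corner)
qed

lemma G_restrict_cols: "G l a f \<Longrightarrow> p \<in> P \<Longrightarrow> G l a (restrict_cols p f)"
proof (induction rule: gen.induct)
  case (gen_empty l a)
  have "restrict_cols p Map.empty = Map.empty" by (auto simp: restrict_cols_def)
  then show ?case by (simp add: gen.gen_empty)
next
  case (gen_base a u)
  have "restrict_cols p (base_map u) =
      base_map (\<lambda>m. case u m of None \<Rightarrow> None | Some n \<Rightarrow> if n \<in> p then Some n else None)"
    by (auto simp: restrict_cols_def base_map_def fun_eq_iff split: option.split)
  then show ?case using gen_base by (simp add: gen.gen_base Z_cols)
next
  case (gen_shift q n a t l)
  have "restrict_cols p (shift_map l q n t) = shift_map l (p \<inter> q) n t"
    by (auto simp: restrict_cols_def shift_map_def fun_eq_iff split: list.split)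
  then show ?case using gen_shift by (simp add: G_shift_inter)
next
  case (gen_corner l a f j k b)
  have "restrict_cols p (corner_map j k f) = corner_map j k (restrict_cols p f)"
    by (auto simp: restrict_cols_def corner_map_def fun_eq_iff split: list.split option.split)
  then show ?case using gen_corner by (auto intro: gen.gen_corner)
qed

text \<open>A product of two generators is again a single generator, possibly empty, so no sums
  arise. Here the thresholds are essential: moving the row index down by \<open>n\<close> and up
  again is the identity only on the rows from \<open>n\<close> on.\<close>

lemma G_comp: "G l a f \<Longrightarrow> G l b h \<Longrightarrow> G l (a + b) (h \<circ>\<^sub>m f)"
proof (induction arbitrary: b h rule: gen.induct)
  case (gen_empty l a)
  have "h \<circ>\<^sub>m Map.empty = Map.empty" by (auto simp: map_comp_def)
  then show ?case by (simp add: gen.gen_empty)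
next
  case (gen_base a u)
  from \<open>G 0 b h\<close> show ?case
  proof cases
    case gen_empty
    have "h \<circ>\<^sub>m base_map u = Map.empty" by (auto simp: gen_empty map_comp_def split: option.split)
    then show ?thesis by (simp add: gen.gen_empty)
  next
    case (gen_base v)
    have "h \<circ>\<^sub>m base_map u = base_map (v \<circ>\<^sub>m u)"
      by (auto simp: gen_base base_map_def map_comp_def fun_eq_iff split: option.split)
    then show ?thesis using Z_comp[OF \<open>Z a u\<close> \<open>Z b v\<close>] by (simp add: gen.gen_base)
  qed
next
  case (gen_shift p n a t l)
  from \<open>G (Suc l) b h\<close> show ?case
  proof cases
    case gen_empty
    have "h \<circ>\<^sub>m shift_map l p n t = Map.empty" by (auto simp: gen_empty map_comp_def split: option.split)
    then show ?thesis by (simp add: gen.gen_empty)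
  next
    case (gen_shift q n' t')
    \<comment> \<open>The first shift requires \<open>x \<ge> t\<close>, the second
      \<open>x + n \<ge> t'\<close>.\<close>
    have "h \<circ>\<^sub>m shift_map l p n t = shift_map l (p \<inter> q) (n + n') (max t (nat (int t' - n)))"
      using \<open>0 \<le> int t + n\<close>
      by (auto simp: gen_shift shift_map_def map_comp_def fun_eq_iff add.assoc split: option.split list.split)
    then show ?thesis using gen_shift \<open>p \<in> P\<close> \<open>\<bar>n\<bar> \<le> int a\<close> \<open>t \<le> a\<close> \<open>0 \<le> int t + n\<close>
      by (auto intro!: G_shift_inter)
  next
    case (gen_corner a' f' j k)
    show ?thesis
    \<comment> \<open>The shift reaches row \<open>j\<close> of the corner only from row
      \<open>j - n\<close>, which is above the threshold exactly if
      \<open>t + n \<le> j\<close>.\<close>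
    proof (cases "int t + n \<le> int j")
      case True
      have "h \<circ>\<^sub>m shift_map l p n t = corner_map (nat (int j - n)) k (restrict_rows p f')"
      proof
        fix \<gamma> :: idx
        obtain g m where \<gamma>: "\<gamma> = (g, m)" by (cases \<gamma>)
        have len: "length xs = l" if "f' (xs, m) = Some \<eta>" for xs \<eta>
          using gen_partial_perm[OF gen_corner(2)] Z_inj that unfolding partial_perm_def H_idx_def by blast
        have ne: "f' (xs, m) = None" if "length xs \<noteq> l" for xs
          using that len by (cases "f' (xs, m)") auto
        show "(h \<circ>\<^sub>m shift_map l p n t) \<gamma> = corner_map (nat (int j - n)) k (restrict_rows p f') \<gamma>"
          using True \<open>0 \<le> int t + n\<close>
          by (cases g) (auto simp: \<gamma> gen_corner(1) shift_map_def corner_map_def restrict_rows_def map_comp_def ne)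
      qed
      moreover have "nat (int j - n) + k + a' \<le> a + b"
        using gen_corner(3) True \<open>\<bar>n\<bar> \<le> int a\<close> by linarith
      ultimately show ?thesis
        using gen.gen_corner[OF G_restrict_rows[OF gen_corner(2) \<open>p \<in> P\<close>]] by simp
    next
      case False
      then have "h \<circ>\<^sub>m shift_map l p n t = Map.empty"
        using \<open>0 \<le> int t + n\<close>
        by (auto simp: gen_corner shift_map_def corner_map_def map_comp_def fun_eq_iff
            split: option.split list.split if_splits)
      then show ?thesis by (simp add: gen.gen_empty)
    qed
  qed
next
  case (gen_corner l a f j k c)
  note IH = gen_corner.IH and f = gen_corner.hyps(1) and c = gen_corner.hyps(2)
  have len: "length ys = l" if "f \<gamma> = Some (ys, m)" for \<gamma> ys m
    using gen_partial_perm[OF f] Z_inj that unfolding partial_perm_def H_idx_def by blast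
  from \<open>G (Suc l) b h\<close> show ?case
  proof cases
    case gen_empty
    have "h \<circ>\<^sub>m corner_map j k f = Map.empty" by (auto simp: gen_empty map_comp_def split: option.split)
    then show ?thesis by (simp add: gen.gen_empty)
  next
    case (gen_shift q n' t')
    show ?thesis
    \<comment> \<open>The corner feeds its column \<open>k\<close> into the shift, so one comparison
      with the threshold decides.\<close>
    proof (cases "t' \<le> k")
      case True
      have "h \<circ>\<^sub>m corner_map j k f = corner_map j (nat (int k + n')) (restrict_cols q f)"
        using True by (auto simp: gen_shift(1) shift_map_def corner_map_def restrict_cols_def map_comp_def fun_eq_iff
            split: option.split list.split dest: len)
      moreover have "j + nat (int k + n') + a \<le> c + b"
        using c \<open>\<bar>n'\<bar> \<le> int b\<close> by linarith
      ultimately show ?thesis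
        using gen.gen_corner[OF G_restrict_cols[OF f \<open>q \<in> P\<close>]] by simp
    next
      case False
      then have "h \<circ>\<^sub>m corner_map j k f = Map.empty"
        by (auto simp: gen_shift(1) shift_map_def corner_map_def map_comp_def fun_eq_iff split: option.split list.split)
      then show ?thesis by (simp add: gen.gen_empty)
    qed
  next
    case (gen_corner a' f' j' k')
    show ?thesis
    proof (cases "k = j'")
      case True
      have "h \<circ>\<^sub>m corner_map j k f = corner_map j k' (f' \<circ>\<^sub>m f)"
        using True by (auto simp: gen_corner(1) corner_map_def map_comp_def fun_eq_iff split: option.split list.split)
      moreover have "j + k' + (a + a') \<le> c + b" using c gen_corner(3) by linarith
      ultimately show ?thesis using gen.gen_corner[OF IH[OF gen_corner(2)]] by simp
    next
      case False
      then have "h \<circ>\<^sub>m corner_map j k f = Map.empty"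
        by (auto simp: gen_corner(1) corner_map_def map_comp_def fun_eq_iff split: option.split list.split)
      then show ?thesis by (simp add: gen.gen_empty)
    qed
  qed
qed

end

subsection \<open>The generators of \<open>\<A>\<^sub>l\<^sup>\<infinity>\<close>\<close>

definition translation :: "nat \<Rightarrow> (int \<Rightarrow> int option) \<Rightarrow> bool" where
  "translation a u \<longleftrightarrow> (\<exists>n. \<bar>n\<bar> \<le> int a \<and> u = (\<lambda>m. Some (m + n)))"

abbreviation "genA s \<equiv> gen s translation {UNIV}"

interpretation A: composable translation "{UNIV}"
proof
  fix a b u v
  assume "translation a u" "translation b v"
  then obtain n k where "\<bar>n\<bar> \<le> int a" "u = (\<lambda>m. Some (m + n))" "\<bar>k\<bar> \<le> int b" "v = (\<lambda>m. Some (m + k))"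
    by (auto simp: translation_def)
  then show "translation (a + b) (v \<circ>\<^sub>m u)"
    unfolding translation_def by (intro exI[of _ "n + k"]) (auto simp: map_comp_def)
qed (force simp: translation_def)+

lemma genA_partial_perm: "genA s l a f \<Longrightarrow> partial_perm (H_idx l) f"
  by (erule gen_partial_perm) (auto simp: translation_def)

definition idx_id :: "nat \<Rightarrow> idx \<Rightarrow> idx option" where
  "idx_id l \<gamma> = (if \<gamma> \<in> H_idx l then Some \<gamma> else None)"

lemma act_idx_id: "act (idx_id l) \<psi> \<gamma> = (if \<gamma> \<in> H_idx l then \<psi> \<gamma> else 0)"
  by (simp add: act_def idx_id_def)

lemma genA_id: "genA s l 0 (idx_id l)"
proof (cases l)
  case 0
  have "idx_id 0 = base_map (\<lambda>m. Some (m + 0))"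
    by (auto simp: idx_id_def base_map_def H_idx_def fun_eq_iff)
  then show ?thesis using gen_base[of translation 0 "\<lambda>m. Some (m + 0)"] 0 by (auto simp: translation_def)
next
  case (Suc k)
  have "idx_id (Suc k) = shift_map k UNIV 0 0"
    by (auto simp: idx_id_def shift_map_def H_idx_def fun_eq_iff split: list.split)
  then show ?thesis using Suc by (auto intro: gen_shift)
qed

text \<open>Inverting a shift moves its threshold from \<open>t\<close> to \<open>t + n\<close>,
  which can be as large as \<open>2 * a\<close>.\<close>

lemma genA_inverse:
  "genA False l a f \<Longrightarrow> \<exists>f'. genA False l (2 * a) f' \<and> (\<forall>\<gamma> \<gamma>'. f \<gamma> = Some \<gamma>' \<longleftrightarrow> f' \<gamma>' = Some \<gamma>)"
proof (induction rule: gen.induct)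
  case (gen_empty l a)
  then show ?case by (intro exI[of _ Map.empty]) (auto intro: gen.gen_empty)
next
  case (gen_base a u)
  then obtain n where n: "\<bar>n\<bar> \<le> int a" "u = (\<lambda>m. Some (m + n))" by (auto simp: translation_def)
  then have "translation (2 * a) (\<lambda>m. Some (m + - n))" unfolding translation_def by (intro exI[of _ "-n"]) auto
  then have "genA False 0 (2 * a) (base_map (\<lambda>m. Some (m + - n)))" by (rule gen.gen_base)
  then show ?case
    by (intro exI[of _ "base_map (\<lambda>m. Some (m + - n))"] conjI allI)
      (auto simp: n base_map_def split: if_splits)
next
  case (gen_shift p n a t l)
  show ?case
  proof (intro exI[of _ "shift_map l p (- n) (nat (int t + n))"] conjI allI)
    show "genA False (Suc l) (2 * a) (shift_map l p (- n) (nat (int t + n)))"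
      using gen_shift by (intro gen.gen_shift) auto
    show "shift_map l p n t \<gamma> = Some \<gamma>' \<longleftrightarrow> shift_map l p (- n) (nat (int t + n)) \<gamma>' = Some \<gamma>" for \<gamma> \<gamma>'
      using gen_shift by (auto simp: shift_map_def split: list.splits if_splits prod.splits)
  qed
next
  case (gen_corner l a f j k b)
  then obtain f' where f': "genA False l (2 * a) f'" "\<And>\<gamma> \<gamma>'. f \<gamma> = Some \<gamma>' \<longleftrightarrow> f' \<gamma>' = Some \<gamma>" by blast
  show ?case
  proof (intro exI[of _ "corner_map k j f'"] conjI allI)
    show "genA False (Suc l) (2 * b) (corner_map k j f')"
      using gen_corner.hyps by (intro gen.gen_corner[OF f'(1)]) auto
    show "corner_map j k f \<gamma> = Some \<gamma>' \<longleftrightarrow> corner_map k j f' \<gamma>' = Some \<gamma>" for \<gamma> \<gamma>'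
      by (auto simp: corner_map_def f'(2) split: list.splits if_splits prod.splits)
  qed
qed

lemma finite_combination_corner:
  assumes "finite_combination (gen s Z P l) a f" "j + k + a \<le> b"
  shows "finite_combination (gen s Z P (Suc l)) b (corner_map j k f)"
proof -
  obtain hs :: "(complex \<times> (idx \<Rightarrow> idx option)) list" where hs: "length hs \<le> a"
    "\<forall>(s', h)\<in>set hs. cmod s' \<le> 1 \<and> gen s Z P l a h" "act f = (\<lambda>\<psi> \<gamma>. \<Sum>(s, h)\<leftarrow>hs. s * act h \<psi> \<gamma>)"
    using assms(1) unfolding finite_combination_def by blast
  show ?thesis
  proof (rule finite_combinationI[where hs = "map (\<lambda>(s, h). (s, corner_map j k h)) hs"])
    fix \<psi> and \<gamma> :: idx
    obtain g m where \<gamma>: "\<gamma> = (g, m)" by (cases \<gamma>)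
    show "act (corner_map j k f) \<psi> \<gamma> = (\<Sum>(s, h)\<leftarrow>map (\<lambda>(s, h). (s, corner_map j k h)) hs. s * act h \<psi> \<gamma>)"
      by (cases g) (auto simp: \<gamma> o_def split_def act_corner_map hs(3))
  next
    show "length (map (\<lambda>(s, h). (s, corner_map j k h)) hs) \<le> b" using hs(1) assms(2) by simp
  next
    fix s' h' assume "(s', h') \<in> set (map (\<lambda>(s, h). (s, corner_map j k h)) hs)"
    then obtain h where "(s', h) \<in> set hs" "h' = corner_map j k h" by auto
    then show "cmod s' \<le> 1 \<and> gen s Z P (Suc l) b h'" using hs(2) gen.gen_corner[OF _ assms(2)] by blast
  qed
qed

text \<open>\<open>S\<^sup>n\<close> restricted to the rows above a threshold differs from \<open>S\<^sup>n\<close> by finitely many matrix units.\<close>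

lemma genA_strict_expansion: "genA False l a f \<Longrightarrow> finite_combination (genA True l) (3 * (a + 1)) f"
proof (induction rule: gen.induct)
  case (gen_empty l a)
  show ?case by (rule finite_combinationI[where hs = "[]"]) auto
next
  case (gen_base a u)
  then have "genA True 0 (3 * (a + 1)) (base_map u)"
    using A.Z_mono[of a u "3 * (a + 1)"] by (intro gen.gen_base) simp
  then show ?case by (intro finite_combinationI[where hs = "[(1, base_map u)]"]) auto
next
  case (gen_shift p n a t l)
  then have p: "p = UNIV" by simp
  define t0 where "t0 = nat (- n)"
  have t0: "t0 \<le> t" using gen_shift by (simp add: t0_def)
  \<comment> \<open>A matrix unit in row \<open>x\<close> and column \<open>x + n\<close> of the
    first coordinate. For \<open>x < t \<le> a\<close> its weight \<open>2 * x + n\<close> stays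
    below \<open>3 * a\<close>, the origin of the factor 3.\<close>
  define c where "c x = corner_map x (nat (int x + n)) (idx_id l)" for x
  define hs where "hs = (1 :: complex, shift_map l UNIV n t0) # map (\<lambda>x. (- 1, c x)) [t0..<t]"
  have 1: "genA True (Suc l) (3 * (a + 1)) (shift_map l UNIV n t0)"
    using gen_shift t0 by (intro gen.gen_shift) (auto simp: t0_def)
  have 2: "genA True (Suc l) (3 * (a + 1)) (c x)" if "x \<in> {t0..<t}" for x
    unfolding c_def using that gen_shift by (intro gen.gen_corner[OF genA_id]) auto
  have "act (shift_map l p n t) \<psi> \<gamma> = (\<Sum>(s, h)\<leftarrow>hs. s * act h \<psi> \<gamma>)" for \<psi> \<gamma>
  proof -
    obtain g m where \<gamma>: "\<gamma> = (g, m)" by (cases \<gamma>)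
    have "(\<Sum>(s, h)\<leftarrow>hs. s * act h \<psi> \<gamma>) = act (shift_map l UNIV n t0) \<psi> \<gamma> - (\<Sum>x\<in>{t0..<t}. act (c x) \<psi> \<gamma>)"
      by (simp add: hs_def o_def interv_sum_list_conv_sum_set_nat sum_negf)
    also have "\<dots> = act (shift_map l p n t) \<psi> \<gamma>"
    proof (cases g)
      case (Cons y ys)
      have "(\<Sum>x\<in>{t0..<t}. act (c x) \<psi> \<gamma>) =
          (\<Sum>x\<in>{t0..<t}. if x = y then (if length ys = l then \<psi> (nat (int y + n) # ys, m) else 0) else 0)"
        by (intro sum.cong) (auto simp: c_def \<gamma> Cons act_corner_map act_idx_id H_idx_def)
      then show ?thesis using t0 by (auto simp: \<gamma> Cons p act_shift_map)
    qed (simp add: \<gamma> act_shift_map c_def act_corner_map)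
    finally show ?thesis by simp
  qed
  moreover have "length hs \<le> 3 * (a + 1)" using gen_shift by (simp add: hs_def)
  moreover have "cmod s \<le> 1 \<and> genA True (Suc l) (3 * (a + 1)) h" if "(s, h) \<in> set hs" for s h
    using that 1 2 by (auto simp: hs_def)
  ultimately show ?case by (intro finite_combinationI[where hs = hs])
next
  case (gen_corner l a f j k b)
  then show ?case by (intro finite_combination_corner[OF gen_corner.IH]) simp
qed


subsection \<open>Homogeneous generators\<close>

text \<open>The translations are split so that every generator has constant degree with respect to
  both \<open>D\<^sub>l\<close> and \<open>|D\<^sub>l|\<close>; rank one maps connect the two half lines.\<close>

definition half_start :: "int \<Rightarrow> int" where
  "half_start \<sigma> = (if \<sigma> = 1 then 0 else 1)"

text \<open>On the half line of sign \<open>\<sigma>\<close> the number \<open>\<sigma> * m\<close>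
  is \<open>|m|\<close>, so the map moves away from 0 by \<open>n\<close>. The half line of sign 1
  contains 0, in accordance with the sign convention of \<open>D\<close>.\<close>

definition half_shift :: "int \<Rightarrow> int \<Rightarrow> int \<Rightarrow> int \<Rightarrow> int option" where
  "half_shift \<sigma> n t m = (if t \<le> \<sigma> * m then Some (m + \<sigma> * n) else None)"

definition rank_one_map :: "int \<Rightarrow> int \<Rightarrow> int \<Rightarrow> int option" where
  "rank_one_map m0 m1 m = (if m = m0 then Some m1 else None)"

text \<open>The two conditions with \<open>half_start\<close> keep the rows and the columns of a
  shift on one half line.\<close>

inductive half_map :: "nat \<Rightarrow> (int \<Rightarrow> int option) \<Rightarrow> bool" where
  half_map_empty: "half_map a Map.empty"
| half_map_shift: "\<sigma> = 1 \<or> \<sigma> = - 1 \<Longrightarrow> \<bar>n\<bar> \<le> int a \<Longrightarrow> half_start \<sigma> \<le> t \<Longrightarrow> half_start \<sigma> \<le> t + n \<Longrightarrow> t \<le> int a \<Longrightarrow>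
    half_map a (half_shift \<sigma> n t)"
| half_map_rank_one: "\<bar>m0\<bar> + \<bar>m1\<bar> \<le> int a \<Longrightarrow> half_map a (rank_one_map m0 m1)"

abbreviation "genB \<equiv> gen False half_map {{0..}, {..<0}}"

lemma half_map_rank_one_cong: "u = rank_one_map m0 m1 \<Longrightarrow> \<bar>m0\<bar> + \<bar>m1\<bar> \<le> int a \<Longrightarrow> half_map a u"
  by (simp add: half_map_rank_one)

lemma half_map_empty_cong: "(\<And>m. u m = None) \<Longrightarrow> half_map a u"
proof -
  assume "\<And>m. u m = None"
  then have "u = Map.empty" by (simp add: fun_eq_iff)
  then show ?thesis by (simp add: half_map_empty)
qed

lemma half_map_comp:
  assumes "half_map a u" "half_map b v"
  shows "half_map (a + b) (v \<circ>\<^sub>m u)"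
  using assms(1)
proof cases
  case half_map_empty
  then show ?thesis by (intro half_map_empty_cong) (auto simp: map_comp_def)
next
  case u: (half_map_shift \<sigma> n t)
  from assms(2) show ?thesis
  proof cases
    case half_map_empty
    then show ?thesis by (intro half_map_empty_cong) (auto simp: map_comp_def split: option.split)
  next
    case v: (half_map_shift \<sigma>' n' t')
    show ?thesis
    proof (cases "\<sigma> = \<sigma>'")
      case True
      have "v \<circ>\<^sub>m u = half_shift \<sigma> (n + n') (max t (t' - n))"
        using u(2) by (elim disjE) (auto simp: u(1) v True[symmetric] half_shift_def map_comp_def fun_eq_iff)
      then show ?thesis using u v True by (auto intro!: half_map_shift)
    next
      case False
      then show ?thesis using u v
        by (intro half_map_empty_cong) (auto simp: half_shift_def map_comp_def half_start_def)
    qed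
  next
    case v: (half_map_rank_one m0 m1)
    show ?thesis
    proof (cases "t \<le> \<sigma> * (m0 - \<sigma> * n)")
      case True
      then have "v \<circ>\<^sub>m u = rank_one_map (m0 - \<sigma> * n) m1"
        using u(2) by (auto simp: u v half_shift_def rank_one_map_def map_comp_def fun_eq_iff)
      then show ?thesis by (rule half_map_rank_one_cong) (use u v in auto)
    next
      case False
      then show ?thesis using u(2)
        by (intro half_map_empty_cong) (auto simp: u v half_shift_def rank_one_map_def map_comp_def)
    qed
  qed
next
  case u: (half_map_rank_one m0 m1)
  from assms(2) show ?thesis
  proof cases
    case half_map_empty
    then show ?thesis by (intro half_map_empty_cong) (auto simp: map_comp_def split: option.split)
  next
    case v: (half_map_shift \<sigma>' n' t')
    show ?thesis
    proof (cases "t' \<le> \<sigma>' * m1")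
      case True
      then have "v \<circ>\<^sub>m u = rank_one_map m0 (m1 + \<sigma>' * n')"
        by (auto simp: u v half_shift_def rank_one_map_def map_comp_def fun_eq_iff)
      then show ?thesis by (rule half_map_rank_one_cong) (use u v in auto)
    next
      case False
      then show ?thesis
        by (intro half_map_empty_cong) (auto simp: u v half_shift_def rank_one_map_def map_comp_def)
    qed
  next
    case v: (half_map_rank_one m0' m1')
    show ?thesis
    proof (cases "m1 = m0'")
      case True
      then have "v \<circ>\<^sub>m u = rank_one_map m0 m1'"
        by (auto simp: u v rank_one_map_def map_comp_def fun_eq_iff)
      then show ?thesis by (rule half_map_rank_one_cong) (use u v in auto)
    next
      case False
      then show ?thesis
        by (intro half_map_empty_cong) (auto simp: u v rank_one_map_def map_comp_def)
    qed
  qed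
qed

text \<open>Restricting the rows to a half line thus either changes nothing or leaves the empty map,
  so the class needs no further maps. The next lemma does the same for columns.\<close>

lemma half_map_row_sign:
  "half_map a u \<Longrightarrow> (\<forall>m. u m \<noteq> None \<longrightarrow> m \<ge> 0) \<or> (\<forall>m. u m \<noteq> None \<longrightarrow> m < 0)"
  by (erule half_map.cases) (auto simp: half_shift_def half_start_def rank_one_map_def)

lemma half_map_col_sign:
  "half_map a u \<Longrightarrow> (\<forall>m n. u m = Some n \<longrightarrow> n \<ge> 0) \<or> (\<forall>m n. u m = Some n \<longrightarrow> n < 0)"
  by (erule half_map.cases) (auto simp: half_shift_def half_start_def rank_one_map_def)

interpretation B: composable half_map "{{0..}, {..<0}}"
proof
  fix a b :: nat and u v :: "int \<Rightarrow> int option" and m m' n :: int and p q :: "int set"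
  show "half_map a u \<Longrightarrow> a \<le> b \<Longrightarrow> half_map b u"
    by (auto elim!: half_map.cases intro!: half_map.intros)
  show "half_map a u \<Longrightarrow> u m = Some n \<Longrightarrow> u m' = Some n \<Longrightarrow> m = m'"
    by (auto elim!: half_map.cases simp: half_shift_def rank_one_map_def split: if_splits)
  show "half_map a u \<Longrightarrow> half_map b v \<Longrightarrow> half_map (a + b) (v \<circ>\<^sub>m u)"
    by (rule half_map_comp)
  show "p \<in> {{0..}, {..<0}} \<Longrightarrow> q \<in> {{0..}, {..<0}} \<Longrightarrow> p \<inter> q = {} \<or> p \<inter> q \<in> {{0..}, {..<0}}"
    by auto
  have *: "half_map a w" if w: "w = u \<or> w = Map.empty" and u: "half_map a u" for w
    using w u half_map_empty by blast
  show "half_map a (\<lambda>m. if m \<in> p then u m else None)" if u: "half_map a u" and p: "p \<in> {{0..}, {..<0}}"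
  proof (rule *[OF _ u])
    have "(\<forall>m. m \<notin> p \<longrightarrow> u m = None) \<or> (\<forall>m. m \<in> p \<longrightarrow> u m = None)"
      using half_map_row_sign[OF u] p by force
    then show "(\<lambda>m. if m \<in> p then u m else None) = u \<or> (\<lambda>m. if m \<in> p then u m else None) = Map.empty"
      by (auto simp: fun_eq_iff)
  qed
  show "half_map a (\<lambda>m. case u m of None \<Rightarrow> None | Some n \<Rightarrow> if n \<in> p then Some n else None)"
    if u: "half_map a u" and p: "p \<in> {{0..}, {..<0}}"
  proof (rule *[OF _ u])
    have "(\<forall>m n. u m = Some n \<longrightarrow> n \<in> p) \<or> (\<forall>m n. u m = Some n \<longrightarrow> n \<notin> p)"
      using half_map_col_sign[OF u] p by force
    then show "(\<lambda>m. case u m of None \<Rightarrow> None | Some n \<Rightarrow> if n \<in> p then Some n else None) = u \<or>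
        (\<lambda>m. case u m of None \<Rightarrow> None | Some n \<Rightarrow> if n \<in> p then Some n else None) = Map.empty"
      by (auto simp: fun_eq_iff split: option.split)
  qed
qed

lemma genB_partial_perm: "genB l a f \<Longrightarrow> partial_perm (H_idx l) f"
  by (erule gen_partial_perm) (rule B.Z_inj)

text \<open>A translation by \<open>n\<close> splits into its parts within the two half lines and
  the \<open>|n|\<close> rows from which it crosses 0; the latter give rank one maps. Unilateral
  shifts are merely split by the sign of the last coordinate.\<close>

lemma genA_half_expansion: "genA False l a f \<Longrightarrow> finite_combination (genB l) (2 * (a + 1)) f"
proof (induction rule: gen.induct)
  case (gen_empty l a)
  show ?case by (rule finite_combinationI[where hs = "[]"]) auto
next
  case (gen_base a u)
  then obtain n where n: "\<bar>n\<bar> \<le> int a" "u = (\<lambda>m. Some (m + n))" by (auto simp: translation_def)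
  \<comment> \<open>The rows that cross 0: from \<open>- n\<close> to \<open>- 1\<close> if
    \<open>n > 0\<close>, from 0 to \<open>- n - 1\<close> if \<open>n < 0\<close>.\<close>
  define ms where "ms = [min 0 (- n)..max 0 (- n) - 1]"
  define u1 where "u1 = half_shift 1 n (max 0 (- n))"
  \<comment> \<open>On the negative half line \<open>- m\<close> is measured, so the displacement
    changes sign; \<open>m < 0\<close> and \<open>m + n < 0\<close> become
    \<open>- m \<ge> 1\<close> and \<open>- m \<ge> 1 + n\<close>.\<close>
  define u2 where "u2 = half_shift (- 1) (- n) (max 1 (1 + n))"
  define hs where "hs = (1 :: complex, base_map u1) # (1, base_map u2) # map (\<lambda>m. (1, base_map (rank_one_map m (m + n)))) ms"
  have "half_map (2 * (a + 1)) u1" "half_map (2 * (a + 1)) u2"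
    unfolding u1_def u2_def using n(1) by (auto intro!: half_map_shift simp: half_start_def)
  moreover have "half_map (2 * (a + 1)) (rank_one_map m (m + n))" if "m \<in> set ms" for m
    using that n(1) by (intro half_map_rank_one) (auto simp: ms_def)
  ultimately have "cmod s \<le> 1 \<and> genB 0 (2 * (a + 1)) h" if "(s, h) \<in> set hs" for s h
    using that by (auto simp: hs_def intro: gen.gen_base)
  moreover have "length hs \<le> 2 * (a + 1)" using n(1) by (auto simp: hs_def ms_def)
  moreover have "act (base_map u) \<psi> \<gamma> = (\<Sum>(s, h)\<leftarrow>hs. s * act h \<psi> \<gamma>)" for \<psi> \<gamma>
  proof -
    obtain g m where \<gamma>: "\<gamma> = (g, m)" by (cases \<gamma>)
    have "(\<Sum>(s, h)\<leftarrow>hs. s * act h \<psi> \<gamma>) = act (base_map u1) \<psi> \<gamma> + (act (base_map u2) \<psi> \<gamma> +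
        (\<Sum>k\<leftarrow>ms. act (base_map (rank_one_map k (k + n))) \<psi> \<gamma>))"
      by (simp add: hs_def o_def)
    also have "(\<Sum>k\<leftarrow>ms. act (base_map (rank_one_map k (k + n))) \<psi> \<gamma>) =
        (\<Sum>k\<in>set ms. act (base_map (rank_one_map k (k + n))) \<psi> \<gamma>)"
      by (rule sum_list_distinct_conv_sum_set) (simp add: ms_def)
    also have "\<dots> = (\<Sum>k\<in>set ms. if k = m then (if g = [] then \<psi> ([], m + n) else 0) else 0)"
      by (intro sum.cong) (auto simp: \<gamma> act_base_map rank_one_map_def)
    also have "\<dots> = (if m \<in> set ms \<and> g = [] then \<psi> ([], m + n) else 0)" by simp
    also have "act (base_map u1) \<psi> \<gamma> + (act (base_map u2) \<psi> \<gamma> + (if m \<in> set ms \<and> g = [] then \<psi> ([], m + n) else 0)) =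
        act (base_map u) \<psi> \<gamma>"
      by (auto simp: \<gamma> act_base_map n(2) u1_def u2_def half_shift_def ms_def)
    finally show ?thesis by simp
  qed
  ultimately show ?case by (intro finite_combinationI[where hs = hs])
next
  case (gen_shift p n a t l)
  define hs where "hs = [(1 :: complex, shift_map l {0..} n t), (1, shift_map l {..<0} n t)]"
  have "genB (Suc l) (2 * (a + 1)) (shift_map l {0..} n t)" "genB (Suc l) (2 * (a + 1)) (shift_map l {..<0} n t)"
    using gen_shift by (intro gen.gen_shift; auto)+
  then have "cmod s \<le> 1 \<and> genB (Suc l) (2 * (a + 1)) h" if "(s, h) \<in> set hs" for s h
    using that by (auto simp: hs_def)
  moreover have "act (shift_map l p n t) \<psi> \<gamma> = (\<Sum>(s, h)\<leftarrow>hs. s * act h \<psi> \<gamma>)" for \<psi> \<gamma>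
  proof -
    obtain g m where \<gamma>: "\<gamma> = (g, m)" by (cases \<gamma>)
    show ?thesis using \<open>p \<in> {UNIV}\<close> by (cases g) (auto simp: \<gamma> hs_def act_shift_map)
  qed
  moreover have "length hs \<le> 2 * (a + 1)" by (simp add: hs_def)
  ultimately show ?case by (intro finite_combinationI[where hs = hs])
next
  case (gen_corner l a f j k b)
  then show ?case by (intro finite_combination_corner[OF gen_corner.IH]) simp
qed

definition row_sign :: "int \<Rightarrow> real" where
  "row_sign m = (if m \<ge> 0 then 1 else - 1)"

lemma dirac_eigenvalue_Cons:
  "dirac_eigenvalue (x # xs, m) = row_sign m * real x + dirac_eigenvalue (xs, m)"
  by (simp add: dirac_eigenvalue_def row_sign_def algebra_simps)

lemma abs_dirac_eigenvalue: "\<bar>dirac_eigenvalue (g, m)\<bar> = real (sum_list g) + \<bar>real_of_int m\<bar>"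
  by (simp add: dirac_eigenvalue_def abs_mult)

text \<open>The signs \<open>\<sigma>\<close> of the rows and \<open>\<tau>\<close> of the columns
  are recorded for the induction: prefixing \<open>j\<close> and \<open>k\<close> changes the degree
  for \<open>D\<close> by \<open>\<sigma> * j - \<tau> * k\<close>, a constant only if the signs are
  constant. The empty map is given the value 0 for all four.\<close>

definition homogeneous :: "nat \<Rightarrow> (idx \<Rightarrow> idx option) \<Rightarrow> real \<Rightarrow> real \<Rightarrow> real \<Rightarrow> real \<Rightarrow> bool" where
  "homogeneous a f d e \<sigma> \<tau> \<longleftrightarrow> \<bar>d\<bar> \<le> real a \<and> \<bar>e\<bar> \<le> real a \<and> \<bar>\<sigma>\<bar> \<le> 1 \<and> \<bar>\<tau>\<bar> \<le> 1 \<and>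
    (\<forall>g m g' m'. f (g, m) = Some (g', m') \<longrightarrow> row_sign m = \<sigma> \<and> row_sign m' = \<tau> \<and>
       dirac_eigenvalue (g, m) - dirac_eigenvalue (g', m') = d \<and>
       \<bar>dirac_eigenvalue (g, m)\<bar> - \<bar>dirac_eigenvalue (g', m')\<bar> = e)"

lemma homogeneousI:
  assumes "\<bar>d\<bar> \<le> real a" "\<bar>e\<bar> \<le> real a" "\<bar>\<sigma>\<bar> \<le> 1" "\<bar>\<tau>\<bar> \<le> 1"
    "\<And>g m g' m'. f (g, m) = Some (g', m') \<Longrightarrow> row_sign m = \<sigma> \<and> row_sign m' = \<tau> \<and>
       dirac_eigenvalue (g, m) - dirac_eigenvalue (g', m') = d \<and>
       \<bar>dirac_eigenvalue (g, m)\<bar> - \<bar>dirac_eigenvalue (g', m')\<bar> = e"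
  shows "\<exists>d e \<sigma> \<tau>. homogeneous a f d e \<sigma> \<tau>"
  using assms unfolding homogeneous_def by blast

lemma genB_homogeneous: "genB l a f \<Longrightarrow> \<exists>d e \<sigma> \<tau>. homogeneous a f d e \<sigma> \<tau>"
proof (induction rule: gen.induct)
  case (gen_empty l a)
  show ?case by (rule homogeneousI[where d = 0 and e = 0 and \<sigma> = 0 and \<tau> = 0]) auto
next
  case (gen_base a u)
  then show ?case
  proof cases
    case half_map_empty
    show ?thesis by (rule homogeneousI[where d = 0 and e = 0 and \<sigma> = 0 and \<tau> = 0]) (auto simp: half_map_empty base_map_def split: if_splits)
  next
    case (half_map_shift \<sigma> n t)
    show ?thesis
    proof (rule homogeneousI[where d = "- real_of_int (\<sigma> * n)" and e = "- real_of_int n"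
          and \<sigma> = "real_of_int \<sigma>" and \<tau> = "real_of_int \<sigma>"])
      show "\<bar>- real_of_int (\<sigma> * n)\<bar> \<le> real a" "\<bar>- real_of_int n\<bar> \<le> real a" "\<bar>real_of_int \<sigma>\<bar> \<le> 1" "\<bar>real_of_int \<sigma>\<bar> \<le> 1"
        using half_map_shift by auto
      fix g m g' m' assume "base_map u (g, m) = Some (g', m')"
      then have x: "g = []" "g' = []" "t \<le> \<sigma> * m" "m' = m + \<sigma> * n"
        by (auto simp: half_map_shift(1) base_map_def half_shift_def split: if_splits)
      have "\<sigma> = 1 \<and> 0 \<le> m \<and> 0 \<le> m + n \<or> \<sigma> = - 1 \<and> m < 0 \<and> m - n < 0"
        using half_map_shift x(3) by (auto simp: half_start_def)
      then show "row_sign m = real_of_int \<sigma> \<and> row_sign m' = real_of_int \<sigma> \<and>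
          dirac_eigenvalue (g, m) - dirac_eigenvalue (g', m') = - real_of_int (\<sigma> * n) \<and>
          \<bar>dirac_eigenvalue (g, m)\<bar> - \<bar>dirac_eigenvalue (g', m')\<bar> = - real_of_int n"
        unfolding abs_dirac_eigenvalue x by (elim disjE) (simp_all add: row_sign_def dirac_eigenvalue_def)
    qed
  next
    case (half_map_rank_one m0 m1)
    show ?thesis
    proof (rule homogeneousI[where d = "dirac_eigenvalue ([], m0) - dirac_eigenvalue ([], m1)"
          and e = "\<bar>dirac_eigenvalue ([], m0)\<bar> - \<bar>dirac_eigenvalue ([], m1)\<bar>"
          and \<sigma> = "row_sign m0" and \<tau> = "row_sign m1"])
      have "\<bar>real_of_int m0\<bar> + \<bar>real_of_int m1\<bar> \<le> real a" using half_map_rank_one(2) by linarith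
      then have "\<bar>dirac_eigenvalue ([], m0)\<bar> + \<bar>dirac_eigenvalue ([], m1)\<bar> \<le> real a"
        unfolding abs_dirac_eigenvalue by simp
      then show "\<bar>dirac_eigenvalue ([], m0) - dirac_eigenvalue ([], m1)\<bar> \<le> real a"
        "\<bar>\<bar>dirac_eigenvalue ([], m0)\<bar> - \<bar>dirac_eigenvalue ([], m1)\<bar>\<bar> \<le> real a" by linarith+
    qed (auto simp: half_map_rank_one(1) base_map_def rank_one_map_def row_sign_def split: if_splits)
  qed
next
  case (gen_shift p n a t l)
  define \<sigma> :: real where "\<sigma> = (if p = {0..} then 1 else - 1)"
  have p: "row_sign m = \<sigma>" if "m \<in> p" for m using that gen_shift(1) by (auto simp: row_sign_def \<sigma>_def)
  show ?case
  proof (rule homogeneousI[where d = "- \<sigma> * of_int n" and e = "- of_int n" and \<sigma> = \<sigma> and \<tau> = \<sigma>])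
    show "\<bar>- \<sigma> * of_int n\<bar> \<le> real a" "\<bar>- of_int n\<bar> \<le> real a" "\<bar>\<sigma>\<bar> \<le> 1" "\<bar>\<sigma>\<bar> \<le> 1"
      using gen_shift by (auto simp: \<sigma>_def abs_mult)
    fix g m g' m' assume f: "shift_map l p n t (g, m) = Some (g', m')"
    then obtain x xs where x: "g = x # xs" "m \<in> p" "t \<le> x" "m' = m" "g' = nat (int x + n) # xs"
      by (auto simp: shift_map_def split: list.splits if_splits)
    have "int x + n \<ge> 0" using x gen_shift by linarith
    then have rx: "real (nat (int x + n)) = real x + of_int n" by simp
    have "dirac_eigenvalue (g, m) - dirac_eigenvalue (g', m') = - \<sigma> * of_int n"
      unfolding x dirac_eigenvalue_Cons rx p[OF x(2)] by (simp add: algebra_simps)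
    moreover have "\<bar>dirac_eigenvalue (g, m)\<bar> - \<bar>dirac_eigenvalue (g', m')\<bar> = - of_int n"
      unfolding abs_dirac_eigenvalue x by (simp add: rx)
    ultimately show "row_sign m = \<sigma> \<and> row_sign m' = \<sigma> \<and>
        dirac_eigenvalue (g, m) - dirac_eigenvalue (g', m') = - \<sigma> * of_int n \<and>
        \<bar>dirac_eigenvalue (g, m)\<bar> - \<bar>dirac_eigenvalue (g', m')\<bar> = - of_int n"
      using p[OF x(2)] x(4) by blast
  qed
next
  case (gen_corner l a f j k b)
  then obtain d e \<sigma> \<tau> where "homogeneous a f d e \<sigma> \<tau>" by blast
  then have h: "\<bar>d\<bar> \<le> real a" "\<bar>e\<bar> \<le> real a" "\<bar>\<sigma>\<bar> \<le> 1" "\<bar>\<tau>\<bar> \<le> 1"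
    and h5: "\<And>g m g' m'. f (g, m) = Some (g', m') \<Longrightarrow> row_sign m = \<sigma> \<and> row_sign m' = \<tau> \<and>
       dirac_eigenvalue (g, m) - dirac_eigenvalue (g', m') = d \<and>
       \<bar>dirac_eigenvalue (g, m)\<bar> - \<bar>dirac_eigenvalue (g', m')\<bar> = e"
    unfolding homogeneous_def by auto
  show ?case
  proof (rule homogeneousI[where d = "\<sigma> * j - \<tau> * k + d" and e = "real j - real k + e", OF _ _ h(3,4)])
    have "\<bar>\<sigma> * real j\<bar> \<le> real j" "\<bar>\<tau> * real k\<bar> \<le> real k"
      using h mult_right_mono[of "\<bar>\<sigma>\<bar>" 1 "real j"] mult_right_mono[of "\<bar>\<tau>\<bar>" 1 "real k"] by (auto simp: abs_mult)
    then show "\<bar>\<sigma> * j - \<tau> * k + d\<bar> \<le> real b" "\<bar>real j - real k + e\<bar> \<le> real b"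
      using h gen_corner.hyps(2) by linarith+
    fix g m g' m' assume f: "corner_map j k f (g, m) = Some (g', m')"
    then obtain xs ys where x: "g = j # xs" "f (xs, m) = Some (ys, m')" "g' = k # ys"
      by (auto simp: corner_map_def split: list.splits if_splits)
    note h' = h5[OF x(2)]
    have "dirac_eigenvalue (g, m) - dirac_eigenvalue (g', m') = \<sigma> * j - \<tau> * k + d"
      using h' unfolding x dirac_eigenvalue_Cons by auto
    moreover have "\<bar>dirac_eigenvalue (g, m)\<bar> - \<bar>dirac_eigenvalue (g', m')\<bar> = real j - real k + e"
      using h' unfolding abs_dirac_eigenvalue x by simp
    ultimately show "row_sign m = \<sigma> \<and> row_sign m' = \<tau> \<and>
        dirac_eigenvalue (g, m) - dirac_eigenvalue (g', m') = \<sigma> * j - \<tau> * k + d \<and>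
        \<bar>dirac_eigenvalue (g, m)\<bar> - \<bar>dirac_eigenvalue (g', m')\<bar> = real j - real k + e"
      using h' by blast
  qed
qed

section \<open>Identification of the algebra with a class of rapidly convergent series\<close>

subsection \<open>Grouping\<close>

text \<open>Each \<open>x\<close> contributes to the single key \<open>h x\<close>, so the double
  series is absolutely summable and the order of summation may be exchanged.\<close>

lemma infsum_group:
  fixes g :: "'x \<Rightarrow> 'b :: banach" and h :: "'x \<Rightarrow> 'k"
  assumes g: "(\<lambda>x. norm (g x)) summable_on UNIV"
  shows "(\<lambda>(k, x). norm (if Q x \<and> h x = k then g x else 0)) summable_on UNIV"
    and "(\<Sum>\<^sub>\<infinity>k. \<Sum>\<^sub>\<infinity>x. if Q x \<and> h x = k then g x else 0) = (\<Sum>\<^sub>\<infinity>x. if Q x then g x else 0)"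
proof -
  let ?f = "\<lambda>x k. if Q x \<and> h x = k then g x else 0"
  have inner: "((\<lambda>k. norm (?f x k)) has_sum (if Q x then norm (g x) else 0)) UNIV" for x
    by (rule has_sum_finite_neutralI[of "{h x}"]) auto
  have "(\<lambda>z. norm (case z of (x, k) \<Rightarrow> ?f x k)) summable_on UNIV"
    by (rule summable_on_prod_nonneg(1)[OF _ _ _ g])
      (auto intro: has_sum_imp_summable[OF inner] simp: infsumI[OF inner])
  then have "(\<lambda>z. norm (case z of (x, k) \<Rightarrow> ?f x k)) summable_on prod.swap ` UNIV" by simp
  then have s: "(\<lambda>(k, x). norm (?f x k)) summable_on UNIV"
    by (subst (asm) summable_on_reindex) (auto simp: o_def split_def cong: if_cong)
  then show "(\<lambda>(k, x). norm (if Q x \<and> h x = k then g x else 0)) summable_on UNIV" .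
  have "(\<lambda>z. norm ((\<lambda>(k, x). ?f x k) z)) summable_on UNIV"
    using s by (simp add: split_def)
  from abs_summable_summable[OF this] have "(\<lambda>(k, x). ?f x k) summable_on UNIV \<times> UNIV" by simp
  from infsum_swap_banach[OF this]
  have "(\<Sum>\<^sub>\<infinity>k. \<Sum>\<^sub>\<infinity>x. ?f x k) = (\<Sum>\<^sub>\<infinity>x. \<Sum>\<^sub>\<infinity>k. ?f x k)" by simp
  also have "\<dots> = (\<Sum>\<^sub>\<infinity>x. if Q x then g x else 0)"
  proof (intro infsum_cong)
    show "(\<Sum>\<^sub>\<infinity>k. ?f x k) = (if Q x then g x else 0)" for x
      by (subst infsum_single[of _ "h x"]) auto
  qed
  finally show "(\<Sum>\<^sub>\<infinity>k. \<Sum>\<^sub>\<infinity>x. if Q x \<and> h x = k then g x else 0) = (\<Sum>\<^sub>\<infinity>x. if Q x then g x else 0)" by simp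
qed


subsection \<open>The inductive step of the definition of \<open>\<A>\<^sub>l\<^sup>\<infinity>\<close> as a series\<close>

lemma alpha1_power:
  "(alpha1 ^^ k) \<psi> (x # xs, m) = \<psi> ((x + k) # xs, m)"
  "(alpha1 ^^ k) \<psi> ([], m) = (if k = 0 then \<psi> ([], m) else 0)"
proof -
  show "(alpha1 ^^ k) \<psi> (x # xs, m) = \<psi> ((x + k) # xs, m)"
    by (induction k arbitrary: x) (auto simp: alpha1_def)
  show "(alpha1 ^^ k) \<psi> ([], m) = (if k = 0 then \<psi> ([], m) else 0)"
    by (cases k) (auto simp: alpha1_def)
qed

lemma alpha1_adj_power:
  "(alpha1_adj ^^ k) \<psi> (x # xs, m) = (if k \<le> x then \<psi> ((x - k) # xs, m) else 0)"
  "(alpha1_adj ^^ k) \<psi> ([], m) = (if k = 0 then \<psi> ([], m) else 0)"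
proof -
  show "(alpha1_adj ^^ k) \<psi> (x # xs, m) = (if k \<le> x then \<psi> ((x - k) # xs, m) else 0)"
  proof (induction k arbitrary: x)
    case (Suc k)
    then show ?case by (cases x) (auto simp: alpha1_adj_def)
  qed simp
  show "(alpha1_adj ^^ k) \<psi> ([], m) = (if k = 0 then \<psi> ([], m) else 0)"
    by (cases k) (auto simp: alpha1_adj_def)
qed

lemma p0_tensor_Cons:
  "p0_tensor a \<psi> (x # xs, m) = (if x = 0 then a (\<lambda>(ys, m). \<psi> (0 # ys, m)) (xs, m) else 0)"
  "p0_tensor a \<psi> ([], m) = 0"
  by (auto simp: p0_tensor_def split: nat.split)

definition slice :: "nat \<Rightarrow> idx vec \<Rightarrow> idx vec" where
  "slice k \<psi> = (\<lambda>(ys, m). \<psi> (k # ys, m))"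

lemma slice_ell2:
  assumes "\<psi> \<in> ell2 (H_idx (Suc l))"
  shows "slice k \<psi> \<in> ell2 (H_idx l)"
proof -
  let ?h = "\<lambda>(ys, m). (k # ys, m)"
  have "(\<lambda>\<gamma>. (cmod (\<psi> \<gamma>))\<^sup>2) summable_on ?h ` H_idx l"
    by (rule summable_on_subset_banach[OF ell2_summable[OF assms]]) (auto simp: H_idx_def)
  then have "(\<lambda>\<gamma>. (cmod (slice k \<psi> \<gamma>))\<^sup>2) summable_on H_idx l"
    by (subst (asm) summable_on_reindex) (auto simp: inj_on_def slice_def o_def split_def)
  moreover have "slice k \<psi> \<gamma> = 0" if "\<gamma> \<notin> H_idx l" for \<gamma>
    using that ell2_outside[OF assms] by (cases \<gamma>) (auto simp: slice_def H_idx_def)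
  ultimately show ?thesis by (simp add: ell2_def)
qed

text \<open>The operator of the rule \<open>A_inf_norms.step\<close>, named so that it can be
  rewritten as one series.\<close>

definition step_op :: "nat \<Rightarrow> (nat \<Rightarrow> nat \<Rightarrow> idx op) \<Rightarrow> (int \<Rightarrow> complex) \<Rightarrow> idx op" where
  "step_op l a c = on_ell2 (H_idx (Suc l)) (\<lambda>\<psi> \<gamma>.
         (\<Sum>\<^sub>\<infinity>(j, k). (alpha1_adj ^^ j) (p0_tensor (a j k) ((alpha1 ^^ k) \<psi>)) \<gamma>) +
         (\<Sum>\<^sub>\<infinity>k. c (int k) * (alpha1 ^^ k) \<psi> \<gamma>) +
         (\<Sum>\<^sub>\<infinity>k\<in>{0<..}. c (- int k) * (alpha1_adj ^^ k) \<psi> \<gamma>))"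

text \<open>The two one-sided series combine to one over the integers. On the empty index list only
  the power 0 could contribute, and there \<open>\<psi>\<close> vanishes.\<close>

lemma shift_part:
  assumes \<psi>: "\<psi> \<in> ell2 (H_idx (Suc l))" and C: "(\<lambda>n. cmod (C n)) summable_on UNIV"
  shows "(\<Sum>\<^sub>\<infinity>k. C (int k) * (alpha1 ^^ k) \<psi> \<gamma>) + (\<Sum>\<^sub>\<infinity>k\<in>{0<..}. C (- int k) * (alpha1_adj ^^ k) \<psi> \<gamma>) =
    (\<Sum>\<^sub>\<infinity>n. C n * act (shift_map l UNIV n (nat (- n))) \<psi> \<gamma>)"
proof -
  let ?t = "\<lambda>n. C n * act (shift_map l UNIV n (nat (- n))) \<psi> \<gamma>"
  obtain g m where \<gamma>: "\<gamma> = (g, m)" by (cases \<gamma>)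
  have out: "length g \<noteq> Suc l \<Longrightarrow> \<psi> (g, m) = 0" for g
    using ell2_outside[OF \<psi>] by (auto simp: H_idx_def)
  have s: "?t summable_on UNIV" by (rule series_summable[OF C \<psi>])
  have U: "(UNIV :: int set) = range int \<union> (\<lambda>k. - int k) ` {0<..}"
  proof (intro set_eqI iffI UNIV_I)
    fix n :: int
    show "n \<in> range int \<union> (\<lambda>k. - int k) ` {0<..}"
    proof (cases "n \<ge> 0")
      case True
      then have "n = int (nat n)" by simp
      then show ?thesis by blast
    next
      case False
      then have "n = - int (nat (- n))" "nat (- n) \<in> {0<..}" by auto
      then show ?thesis by blast
    qed
  qed
  have "infsum ?t UNIV = infsum ?t (range int) + infsum ?t ((\<lambda>k. - int k) ` {0<..})"
    by (subst U, rule infsum_Un_disjoint) (auto intro!: summable_on_subset_banach[OF s])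
  also have "infsum ?t (range int) = (\<Sum>\<^sub>\<infinity>k. C (int k) * (alpha1 ^^ k) \<psi> \<gamma>)"
  proof (subst infsum_reindex)
    show "inj_on int UNIV" by simp
    show "infsum (?t \<circ> int) UNIV = (\<Sum>\<^sub>\<infinity>k. C (int k) * (alpha1 ^^ k) \<psi> \<gamma>)"
    proof (intro infsum_cong)
      fix k :: nat
      show "(?t \<circ> int) k = C (int k) * (alpha1 ^^ k) \<psi> \<gamma>"
      proof (cases g)
        case Nil
        then show ?thesis using out[of "[]"] by (simp add: \<gamma> act_shift_map alpha1_power)
      next
        case (Cons x xs)
        have "nat (int x + int k) = x + k" by simp
        then show ?thesis by (auto simp: \<gamma> Cons act_shift_map alpha1_power out)
      qed
    qed
  qed
  also have "infsum ?t ((\<lambda>k. - int k) ` {0<..}) = (\<Sum>\<^sub>\<infinity>k\<in>{0<..}. C (- int k) * (alpha1_adj ^^ k) \<psi> \<gamma>)"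
  proof (subst infsum_reindex)
    show "inj_on (\<lambda>k. - int k) {0<..}" by (auto simp: inj_on_def)
    show "infsum (?t \<circ> (\<lambda>k. - int k)) {0<..} = (\<Sum>\<^sub>\<infinity>k\<in>{0<..}. C (- int k) * (alpha1_adj ^^ k) \<psi> \<gamma>)"
    proof (intro infsum_cong)
      fix k :: nat assume k: "k \<in> {0<..}"
      show "(?t \<circ> (\<lambda>k. - int k)) k = C (- int k) * (alpha1_adj ^^ k) \<psi> \<gamma>"
      proof (cases g)
        case (Cons x xs)
        have "k \<le> x \<Longrightarrow> nat (int x - int k) = x - k" by simp
        then show ?thesis by (auto simp: \<gamma> Cons act_shift_map alpha1_adj_power out)
      qed (use k in \<open>simp add: \<gamma> act_shift_map alpha1_adj_power\<close>)
    qed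
  qed
  finally show ?thesis by simp
qed

text \<open>In row \<open>j\<close> the summand acts on the slice of \<open>\<psi>\<close> with
  first coordinate \<open>k\<close>; Fubini then merges the sum over \<open>(j, k)\<close> with the
  inner series.\<close>

lemma corner_part:
  assumes \<psi>: "\<psi> \<in> ell2 (H_idx (Suc l))"
    and c: "(\<lambda>((j, k), i). cmod (c j k i)) summable_on (UNIV :: ((nat \<times> nat) \<times> 'x) set)"
  shows "(\<Sum>\<^sub>\<infinity>(j, k). (alpha1_adj ^^ j) (p0_tensor (perm_series (H_idx l) (c j k) (f j k)) ((alpha1 ^^ k) \<psi>)) \<gamma>) =
    (\<Sum>\<^sub>\<infinity>z. (case z of ((j, k), i) \<Rightarrow> c j k i) * act (case z of ((j, k), i) \<Rightarrow> corner_map j k (f j k i)) \<psi> \<gamma>)"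
proof -
  let ?h = "\<lambda>z. (case z of ((j, k), i) \<Rightarrow> c j k i) * act (case z of ((j, k), i) \<Rightarrow> corner_map j k (f j k i)) \<psi> \<gamma>"
  obtain g m where \<gamma>: "\<gamma> = (g, m)" by (cases \<gamma>)
  have eq: "(alpha1_adj ^^ j) (p0_tensor (perm_series (H_idx l) (c j k) (f j k)) ((alpha1 ^^ k) \<psi>)) \<gamma> =
      (\<Sum>\<^sub>\<infinity>i. c j k i * act (corner_map j k (f j k i)) \<psi> \<gamma>)" for j k
  proof (cases g)
    case (Cons x xs)
    have sl: "(\<lambda>(ys, m). (alpha1 ^^ k) \<psi> (0 # ys, m)) = slice k \<psi>"
      by (auto simp: slice_def alpha1_power)
    show ?thesis
      using slice_ell2[OF \<psi>, of k]
      by (auto simp: \<gamma> Cons alpha1_adj_power p0_tensor_Cons sl act_corner_map perm_series_def on_ell2_def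
          slice_def[symmetric])
  qed (auto simp: \<gamma> alpha1_adj_power p0_tensor_Cons act_corner_map)
  have "(\<lambda>z. cmod (case z of ((j, k), i) \<Rightarrow> c j k i)) summable_on UNIV" using c by (simp add: split_def)
  from series_summable[OF this \<psi>] have "?h summable_on UNIV \<times> UNIV" by simp
  from infsum_Sigma_banach[OF this] show ?thesis unfolding eq by (simp add: split_def)
qed

lemma step_op_series:
  fixes f :: "nat \<Rightarrow> nat \<Rightarrow> 'x \<Rightarrow> idx \<Rightarrow> idx option"
  assumes c: "(\<lambda>((j, k), i). cmod (c j k i)) summable_on (UNIV :: ((nat \<times> nat) \<times> 'x) set)"
    and C: "(\<lambda>n. cmod (C n)) summable_on UNIV"
  shows "step_op l (\<lambda>j k. perm_series (H_idx l) (c j k) (f j k)) C =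
    perm_series (H_idx (Suc l)) (case_sum (\<lambda>((j, k), i). c j k i) C)
      (case_sum (\<lambda>((j, k), i). corner_map j k (f j k i)) (\<lambda>n. shift_map l UNIV n (nat (- n))))"
proof
  fix \<psi>
  show "step_op l (\<lambda>j k. perm_series (H_idx l) (c j k) (f j k)) C \<psi> =
    perm_series (H_idx (Suc l)) (case_sum (\<lambda>((j, k), i). c j k i) C)
      (case_sum (\<lambda>((j, k), i). corner_map j k (f j k i)) (\<lambda>n. shift_map l UNIV n (nat (- n)))) \<psi>"
  proof (cases "\<psi> \<in> ell2 (H_idx (Suc l))")
    case True
    define cc where "cc = (\<lambda>((j, k), i :: 'x). c j k i)"
    define ff where "ff = (\<lambda>((j, k), i :: 'x). corner_map j k (f j k i))"
    have cc: "(\<lambda>z. cmod (cc z)) summable_on UNIV" using c by (simp add: cc_def split_def)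
    show ?thesis
    proof
      fix \<gamma>
      have "(\<Sum>\<^sub>\<infinity>z. case_sum cc C z * act (case_sum ff (\<lambda>n. shift_map l UNIV n (nat (- n))) z) \<psi> \<gamma>) =
          (\<Sum>\<^sub>\<infinity>z. cc z * act (ff z) \<psi> \<gamma>) + (\<Sum>\<^sub>\<infinity>n. C n * act (shift_map l UNIV n (nat (- n))) \<psi> \<gamma>)"
        by (subst summable_on_sum_type(2)) (simp_all add: series_summable[OF cc True] series_summable[OF C True])
      moreover have "step_op l (\<lambda>j k. perm_series (H_idx l) (c j k) (f j k)) C \<psi> \<gamma> =
          (\<Sum>\<^sub>\<infinity>z. cc z * act (ff z) \<psi> \<gamma>) + (\<Sum>\<^sub>\<infinity>n. C n * act (shift_map l UNIV n (nat (- n))) \<psi> \<gamma>)"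
      proof -
        have "(\<Sum>\<^sub>\<infinity>(j, k). (alpha1_adj ^^ j) (p0_tensor (perm_series (H_idx l) (c j k) (f j k)) ((alpha1 ^^ k) \<psi>)) \<gamma>) =
            (\<Sum>\<^sub>\<infinity>z. cc z * act (ff z) \<psi> \<gamma>)"
          using corner_part[OF True c, of f \<gamma>] by (simp add: cc_def ff_def split_def)
        then show ?thesis
          unfolding step_op_def on_ell2_def shift_part[OF True C, symmetric] using True by (simp add: add.assoc)
      qed
      ultimately show "step_op l (\<lambda>j k. perm_series (H_idx l) (c j k) (f j k)) C \<psi> \<gamma> =
        perm_series (H_idx (Suc l)) (case_sum (\<lambda>((j, k), i). c j k i) C)
          (case_sum (\<lambda>((j, k), i). corner_map j k (f j k i)) (\<lambda>n. shift_map l UNIV n (nat (- n)))) \<psi> \<gamma>"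
        using True unfolding cc_def[symmetric] ff_def[symmetric] by (simp add: perm_series_def on_ell2_def)
    qed
  next
    case False
    then show ?thesis by (simp add: step_op_def perm_series_def on_ell2_def)
  qed
qed

subsection \<open>The algebra \<open>\<A>\<^sub>l\<^sup>\<infinity>\<close> as a class of series\<close>

lemma rapidly_decreasing_iff: "rapidly_decreasing c \<longleftrightarrow> rapid c (\<lambda>n. nat \<bar>n\<bar>)"
  by (simp add: rapidly_decreasing_def rapid_def mult.commute)

lemma rapid_norm_eq: "rapid_norm c m = (\<Sum>\<^sub>\<infinity>n. cmod (c n) * (1 + real (nat \<bar>n\<bar>)) ^ m)"
  by (simp add: rapid_norm_def mult.commute)

text \<open>In row \<open>m\<close> the operator \<open>z_power n\<close> reads column
  \<open>m - n\<close>, whence the sign of the translation.\<close>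

lemma translation_series:
  "on_ell2 (H_idx 0) (\<lambda>\<psi> \<gamma>. \<Sum>\<^sub>\<infinity>n. c n * z_power n \<psi> \<gamma>) =
    perm_series (H_idx 0) c (\<lambda>n. base_map (\<lambda>m. Some (m + - n)))"
proof
  fix \<psi>
  show "on_ell2 (H_idx 0) (\<lambda>\<psi> \<gamma>. \<Sum>\<^sub>\<infinity>n. c n * z_power n \<psi> \<gamma>) \<psi> =
    perm_series (H_idx 0) c (\<lambda>n. base_map (\<lambda>m. Some (m + - n))) \<psi>"
  proof (cases "\<psi> \<in> ell2 (H_idx 0)")
    case True
    have "z_power n \<psi> \<gamma> = act (base_map (\<lambda>m. Some (m + - n))) \<psi> \<gamma>" for n \<gamma>
      using ell2_outside[OF True] by (cases \<gamma>) (auto simp: z_power_def act_base_map H_idx_def)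
    then show ?thesis using True by (simp only: perm_series_def on_ell2_def if_True)
  qed (simp add: perm_series_def on_ell2_def)
qed

text \<open>The bound by \<open>N\<close> is carried along because the inductive step of the
  definition controls the \<open>a j k\<close> through their seminorms: membership of each
  \<open>a j k\<close> alone would not make the combined series converge.\<close>

definition series_norms :: "nat \<Rightarrow> idx op \<Rightarrow> (nat \<Rightarrow> real) \<Rightarrow> bool" where
  "series_norms l T N \<longleftrightarrow> (\<exists>(c :: nat \<Rightarrow> complex) f a. T = perm_series (H_idx l) c f \<and> rapid c a \<and>
     (\<forall>x. genA True l (a x) (f x)) \<and> (\<forall>m. (\<Sum>\<^sub>\<infinity>x. cmod (c x) * (1 + real (a x)) ^ m) \<le> N m))"

lemma series_normsI:
  fixes c :: "'x :: countable \<Rightarrow> complex"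
  assumes "rapid c a" "\<And>x. genA True l (a x) (f x)" "\<And>m. (\<Sum>\<^sub>\<infinity>x. cmod (c x) * (1 + real (a x)) ^ m) \<le> N m"
  shows "series_norms l (perm_series (H_idx l) c f) N"
proof -
  obtain c' :: "nat \<Rightarrow> complex" and f' a' where 1: "perm_series (H_idx l) c f = perm_series (H_idx l) c' f'" "rapid c' a'"
    and 2: "\<And>n. \<exists>x. f' n = f x \<and> a' n = a x"
    and 3: "\<And>m. (\<Sum>\<^sub>\<infinity>n. cmod (c' n) * (1 + real (a' n)) ^ m) = (\<Sum>\<^sub>\<infinity>x. cmod (c x) * (1 + real (a x)) ^ m)"
    by (rule perm_series_reindex_nat[OF assms(1), of "H_idx l" f]) (rule that)
  have "\<forall>n. genA True l (a' n) (f' n)"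
  proof
    fix n obtain x where "f' n = f x" "a' n = a x" using 2 by blast
    then show "genA True l (a' n) (f' n)" using assms(2) by simp
  qed
  then show ?thesis unfolding series_norms_def using 1 3 assms(3) by (intro exI[of _ c'] exI[of _ f'] exI[of _ a']) auto
qed

lemma A_inf_norms_imp_series: "A_inf_norms l T N \<Longrightarrow> series_norms l T N"
proof (induction rule: A_inf_norms.induct)
  case (base c)
  have "genA True 0 (nat \<bar>n\<bar>) (base_map (\<lambda>m. Some (m + - n)))" for n :: int
    by (rule gen_base) (auto simp: translation_def intro!: exI[of _ "- n"])
  then show ?case
    unfolding translation_series using base
    by (intro series_normsI[where a = "\<lambda>n. nat \<bar>n\<bar>"]) (simp_all only: rapidly_decreasing_iff rapid_norm_eq order_refl)
next
  case (step l a N C)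
  \<comment> \<open>Coefficients, maps and weights are packed into one tuple, so that a single
    application of \<open>choice\<close> selects representations for all pairs
    \<open>(j, k)\<close>.\<close>
  define R where "R p q \<longleftrightarrow> a (fst p) (snd p) = perm_series (H_idx l) (fst q) (fst (snd q)) \<and> rapid (fst q) (snd (snd q)) \<and>
     (\<forall>x. genA True l (snd (snd q) x) (fst (snd q) x)) \<and>
     (\<forall>m. (\<Sum>\<^sub>\<infinity>x. cmod (fst q x) * (1 + real (snd (snd q) x)) ^ m) \<le> N (fst p) (snd p) m)"
    for p and q :: "(nat \<Rightarrow> complex) \<times> (nat \<Rightarrow> idx \<Rightarrow> idx option) \<times> (nat \<Rightarrow> nat)"
  have "\<exists>q. R p q" for p
  proof -
    have "series_norms l (a (fst p) (snd p)) (N (fst p) (snd p))" using step.IH by blast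
    then obtain c :: "nat \<Rightarrow> complex" and f w where "a (fst p) (snd p) = perm_series (H_idx l) c f \<and> rapid c w \<and>
     (\<forall>x. genA True l (w x) (f x)) \<and> (\<forall>m. (\<Sum>\<^sub>\<infinity>x. cmod (c x) * (1 + real (w x)) ^ m) \<le> N (fst p) (snd p) m)"
      unfolding series_norms_def by blast
    then have "R p (c, f, w)" by (simp add: R_def)
    then show ?thesis by blast
  qed
  then have "\<forall>p. \<exists>q. R p q" by blast
  from choice[OF this] obtain F where F: "\<forall>p. R p (F p)" ..
  define c f w where "c j k = fst (F (j, k))" and "f j k = fst (snd (F (j, k)))" and "w j k = snd (snd (F (j, k)))" for j k
  have a: "a j k = perm_series (H_idx l) (c j k) (f j k)"
    and c: "rapid (c j k) (w j k)" and g: "genA True l (w j k x) (f j k x)"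
    and le: "(\<Sum>\<^sub>\<infinity>x. cmod (c j k x) * (1 + real (w j k x)) ^ m) \<le> N j k m" for j k x m
    using F[rule_format, of "(j, k)"] by (simp_all add: R_def c_def f_def w_def)
  \<comment> \<open>A corner raises the weight by \<open>j + k\<close>, and
    \<open>1 + j + k + w \<le> (1 + j + k) * (1 + w)\<close> splits the weighted sums into the
    factors that occur in the seminorms.\<close>
  define w' where "w' = (\<lambda>((j, k), i). j + k + w j k i)"
  have le': "(\<Sum>\<^sub>\<infinity>i. cmod (c j k i) * (1 + real (j + k + w j k i)) ^ m) \<le> (1 + real j + real k) ^ m * N j k m"
    and s': "(\<lambda>i. cmod (c j k i) * (1 + real (j + k + w j k i)) ^ m) summable_on UNIV" for j k m
  proof -
    have t: "cmod (c j k i) * (1 + real (j + k + w j k i)) ^ m \<le>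
        (1 + real j + real k) ^ m * (cmod (c j k i) * (1 + real (w j k i)) ^ m)" for i
    proof -
      have "(1 + real (j + k + w j k i)) ^ m \<le> ((1 + real j + real k) * (1 + real (w j k i))) ^ m"
        by (intro power_mono) (auto simp: algebra_simps)
      from mult_left_mono[OF this, of "cmod (c j k i)"] show ?thesis by (simp add: power_mult_distrib mult_ac)
    qed
    have s: "(\<lambda>i. (1 + real j + real k) ^ m * (cmod (c j k i) * (1 + real (w j k i)) ^ m)) summable_on UNIV"
      by (intro summable_on_cmult_right rapidD c)
    show s': "(\<lambda>i. cmod (c j k i) * (1 + real (j + k + w j k i)) ^ m) summable_on UNIV"
      by (rule summable_on_comparison_test[OF s t]) auto
    have "(\<Sum>\<^sub>\<infinity>i. cmod (c j k i) * (1 + real (j + k + w j k i)) ^ m) \<le>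
        (\<Sum>\<^sub>\<infinity>i. (1 + real j + real k) ^ m * (cmod (c j k i) * (1 + real (w j k i)) ^ m))"
      by (rule infsum_mono[OF s' s t])
    also have "\<dots> \<le> (1 + real j + real k) ^ m * N j k m"
      unfolding infsum_cmult_right' by (intro mult_left_mono le) auto
    finally show "(\<Sum>\<^sub>\<infinity>i. cmod (c j k i) * (1 + real (j + k + w j k i)) ^ m) \<le> (1 + real j + real k) ^ m * N j k m" .
  qed
  let ?B = "\<lambda>m (j, k). (1 + real j + real k) ^ m * N j k m"
  let ?g = "\<lambda>m ((j, k), i). cmod (c j k i) * (1 + real (j + k + w j k i)) ^ m"
  have B: "?B m summable_on UNIV" for m using step.hyps(1) by blast
  have S: "?g m summable_on UNIV" and I: "infsum (?g m) UNIV \<le> infsum (?B m) UNIV" for m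
    by (rule summable_on_prod_nonneg[where B = "?B m"]; use s' le' B in \<open>auto split: prod.split\<close>)+
  \<comment> \<open>The entry \<open>r = s = m\<close> of the maximum.\<close>
  have Max: "infsum (?B m) UNIV \<le> (MAX (r, s)\<in>{..m} \<times> {..m}. \<Sum>\<^sub>\<infinity>(j, k). (1 + real j + real k) ^ r * N j k s)" for m
    by (rule Max_ge) (auto intro!: image_eqI[of _ _ "(m, m)"])
  have C: "rapid C (\<lambda>n. nat \<bar>n\<bar>)" using step.hyps(2) by (simp only: rapidly_decreasing_iff)
  define cc where "cc = case_sum (\<lambda>((j, k), i). c j k i) C"
  define ff where "ff = case_sum (\<lambda>((j, k), i). corner_map j k (f j k i)) (\<lambda>n. shift_map l UNIV n (nat (- n)))"
  define ww where "ww = case_sum w' (\<lambda>n. nat \<bar>n\<bar>)"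
  have part1: "(\<lambda>z. cmod (cc (Inl z)) * (1 + real (ww (Inl z))) ^ m) = ?g m" for m
    by (auto simp: cc_def ww_def w'_def)
  have part2: "(\<lambda>z. cmod (cc (Inr z)) * (1 + real (ww (Inr z))) ^ m) = (\<lambda>n. cmod (C n) * (1 + real (nat \<bar>n\<bar>)) ^ m)" for m
    by (auto simp: cc_def ww_def)
  have r1: "rapid cc ww"
    unfolding rapid_def by (intro allI summable_on_sum_type) (simp_all only: part1 part2 S rapidD[OF C])
  have r2: "genA True (Suc l) (ww z) (ff z)" for z
  proof (cases z)
    case (Inl y)
    obtain p i where "y = (p, i)" by (cases y)
    moreover obtain j k where "p = (j, k)" by (cases p)
    ultimately have y: "y = ((j, k), i)" by simp
    show ?thesis by (simp add: Inl y ww_def ff_def w'_def gen_corner[OF g])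
  next
    case (Inr n)
    show ?thesis by (auto simp: Inr ww_def ff_def intro!: gen_shift)
  qed
  have r3: "(\<Sum>\<^sub>\<infinity>z. cmod (cc z) * (1 + real (ww z)) ^ m) \<le>
      (MAX (r, s)\<in>{..m} \<times> {..m}. \<Sum>\<^sub>\<infinity>(j, k). (1 + real j + real k) ^ r * N j k s) + rapid_norm C m" for m
  proof (subst summable_on_sum_type(2))
    show "(\<lambda>z. cmod (cc (Inl z)) * (1 + real (ww (Inl z))) ^ m) summable_on UNIV" unfolding part1 by (rule S)
    show "(\<lambda>z. cmod (cc (Inr z)) * (1 + real (ww (Inr z))) ^ m) summable_on UNIV" unfolding part2 by (rule rapidD[OF C])
    show "(\<Sum>\<^sub>\<infinity>z. cmod (cc (Inl z)) * (1 + real (ww (Inl z))) ^ m) + (\<Sum>\<^sub>\<infinity>z. cmod (cc (Inr z)) * (1 + real (ww (Inr z))) ^ m) \<le>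
      (MAX (r, s)\<in>{..m} \<times> {..m}. \<Sum>\<^sub>\<infinity>(j, k). (1 + real j + real k) ^ r * N j k s) + rapid_norm C m"
      unfolding part1 part2 rapid_norm_eq using order_trans[OF I Max] by simp
  qed
  have "series_norms (Suc l) (perm_series (H_idx (Suc l)) cc ff)
      (\<lambda>m. (MAX (r, s)\<in>{..m} \<times> {..m}. \<Sum>\<^sub>\<infinity>(j, k). (1 + real j + real k) ^ r * N j k s) + rapid_norm C m)"
    by (rule series_normsI[where a = ww]) (rule r1, rule r2, rule r3)
  moreover have "perm_series (H_idx (Suc l)) cc ff = step_op l a C"
  proof -
    have "(\<lambda>((j, k), i). cmod (c j k i)) summable_on UNIV" using S[of 0] by simp
    moreover have "a = (\<lambda>j k. perm_series (H_idx l) (c j k) (f j k))" by (intro ext a)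
    ultimately show ?thesis
      unfolding cc_def ff_def by (simp only: step_op_series[OF _ rapid_summable[OF C]])
  qed
  ultimately show ?case unfolding step_op_def by simp
qed

lemma genA_strict_cases:
  assumes "genA True (Suc l) a f"
  shows "f = Map.empty \<or> (\<exists>n. \<bar>n\<bar> \<le> int a \<and> f = shift_map l UNIV n (nat (- n))) \<or>
    (\<exists>j k h b. genA True l b h \<and> j + k + b \<le> a \<and> f = corner_map j k h)"
  using assms
proof cases
  case (gen_corner b h j k)
  then show ?thesis by blast
qed auto

lemma group_dominated:
  fixes g :: "'x \<Rightarrow> real"
  assumes g: "g summable_on UNIV" "\<And>x. g x \<ge> 0"
    and b: "\<And>k. 0 \<le> b k" "\<And>k. b k \<le> (\<Sum>\<^sub>\<infinity>x. if Q x \<and> h x = k then g x else 0)"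
  shows "b summable_on UNIV" "infsum b UNIV \<le> (\<Sum>\<^sub>\<infinity>x. if Q x then g x else 0)"
proof -
  have g': "(\<lambda>x. norm (g x)) summable_on UNIV" using g by simp
  have "norm (if Q x \<and> h x = k then g x else 0) = (if Q x \<and> h x = k then g x else 0)" for x k using g(2) by simp
  with infsum_group(1)[OF g', of Q h]
  have "(\<lambda>(k, x). if Q x \<and> h x = k then g x else 0) summable_on UNIV \<times> UNIV" by simp
  from summable_on_Sigma_banach[OF this]
  have s: "(\<lambda>k. \<Sum>\<^sub>\<infinity>x. if Q x \<and> h x = k then g x else 0) summable_on UNIV" by simp
  show "b summable_on UNIV" by (rule summable_on_comparison_test[OF s b(2,1)])
  then have "infsum b UNIV \<le> (\<Sum>\<^sub>\<infinity>k. \<Sum>\<^sub>\<infinity>x. if Q x \<and> h x = k then g x else 0)"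
    by (rule infsum_mono[OF _ s b(2)])
  then show "infsum b UNIV \<le> (\<Sum>\<^sub>\<infinity>x. if Q x then g x else 0)"
    unfolding infsum_group(2)[OF g'] .
qed

lemma summable_on_If:
  fixes g :: "'x \<Rightarrow> 'b :: banach"
  assumes "(\<lambda>x. norm (g x)) summable_on UNIV"
  shows "(\<lambda>x. norm (if P x then g x else 0)) summable_on UNIV"
  by (rule summable_on_comparison_test[OF assms]) auto

lemma group_norm_le:
  fixes c :: "'x \<Rightarrow> complex"
  assumes c: "(\<lambda>x. cmod (c x)) summable_on UNIV" and g: "g summable_on UNIV" "\<And>x. 0 \<le> g x"
    and w: "0 \<le> w" "\<And>x. Q x \<Longrightarrow> cmod (c x) * w \<le> g x"
  shows "cmod (\<Sum>\<^sub>\<infinity>x. if Q x then c x else 0) * w \<le> (\<Sum>\<^sub>\<infinity>x. if Q x then g x else 0)"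
proof -
  have s: "(\<lambda>x. cmod (if Q x then c x else 0)) summable_on UNIV" by (rule summable_on_If[OF c])
  have "cmod (\<Sum>\<^sub>\<infinity>x. if Q x then c x else 0) * w \<le> (\<Sum>\<^sub>\<infinity>x. cmod (if Q x then c x else 0)) * w"
    by (intro mult_right_mono norm_infsum_bound s w)
  also have "\<dots> = (\<Sum>\<^sub>\<infinity>x. cmod (if Q x then c x else 0) * w)" by (simp add: infsum_cmult_left')
  also have "\<dots> \<le> (\<Sum>\<^sub>\<infinity>x. if Q x then g x else 0)"
  proof (rule infsum_mono)
    show "(\<lambda>x. cmod (if Q x then c x else 0) * w) summable_on UNIV" by (intro summable_on_cmult_left s)
    show "(\<lambda>x. if Q x then g x else 0) summable_on UNIV"
      by (rule summable_on_comparison_test[OF g(1)]) (use g(2) in auto)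
  qed (use w in auto)
  finally show ?thesis .
qed

lemma series_group:
  fixes c :: "'x \<Rightarrow> complex"
  assumes c: "(\<lambda>x. cmod (c x)) summable_on UNIV" and \<psi>: "\<psi> \<in> ell2 I" and F: "\<And>x. Q x \<Longrightarrow> f x = F (h x)"
  shows "(\<Sum>\<^sub>\<infinity>k. (\<Sum>\<^sub>\<infinity>x. if Q x \<and> h x = k then c x else 0) * act (F k) \<psi> \<gamma>) =
    (\<Sum>\<^sub>\<infinity>x. if Q x then c x * act (f x) \<psi> \<gamma> else 0)"
proof -
  have "(\<Sum>\<^sub>\<infinity>x. if Q x \<and> h x = k then c x else 0) * act (F k) \<psi> \<gamma> =
      (\<Sum>\<^sub>\<infinity>x. if Q x \<and> h x = k then c x * act (f x) \<psi> \<gamma> else 0)" for k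
    unfolding infsum_cmult_left'[symmetric] by (intro infsum_cong) (auto simp: F)
  then show ?thesis by (simp only: infsum_group(2)[OF norm_series_summable[OF c \<psi>]])
qed

lemma A_inf_norms_nonneg: "A_inf_norms l T N \<Longrightarrow> 0 \<le> N m"
proof -
  assume "A_inf_norms l T N"
  then obtain c :: "nat \<Rightarrow> complex" and a where "(\<Sum>\<^sub>\<infinity>x. cmod (c x) * (1 + real (a x)) ^ m) \<le> N m"
    using A_inf_norms_imp_series unfolding series_norms_def by blast
  moreover have "0 \<le> (\<Sum>\<^sub>\<infinity>x. cmod (c x) * (1 + real (a x)) ^ m)" by (intro infsum_nonneg) auto
  ultimately show ?thesis by simp
qed

lemma infsum_disjoint_le:
  fixes g :: "'x \<Rightarrow> real"
  assumes g: "g summable_on UNIV" "\<And>x. 0 \<le> g x" and Q: "\<And>x. \<not> (Q x \<and> R x)"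
  shows "(\<Sum>\<^sub>\<infinity>x. if Q x then g x else 0) + (\<Sum>\<^sub>\<infinity>x. if R x then g x else 0) \<le> infsum g UNIV"
proof -
  have s: "(\<lambda>x. if P x then g x else 0) summable_on UNIV" for P
    by (rule summable_on_comparison_test[OF g(1)]) (use g(2) in auto)
  have "(\<Sum>\<^sub>\<infinity>x. if Q x then g x else 0) + (\<Sum>\<^sub>\<infinity>x. if R x then g x else 0) =
      (\<Sum>\<^sub>\<infinity>x. (if Q x then g x else 0) + (if R x then g x else 0))"
    by (rule infsum_add[OF s s, symmetric])
  also have "\<dots> \<le> infsum g UNIV"
    by (rule infsum_mono[OF summable_on_add[OF s s] g(1)]) (use g(2) Q in auto)
  finally show ?thesis .
qed

text \<open>Equal shifts, and corners at the same position \<open>(j, k)\<close>, are collected; the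
  corners are then treated by induction. A seminorm of the new level combines
  \<open>(1 + j + k) ^ r\<close> with a seminorm of index \<open>s\<close> of the old one, where
  \<open>r, s \<le> m\<close>, so the exponent grows from \<open>Suc l * m\<close> by at most
  \<open>m\<close>. This is the origin of the factor \<open>Suc l\<close>.\<close>

lemma series_imp_A_inf_norms:
  fixes c :: "nat \<Rightarrow> complex"
  assumes "rapid c a" "\<And>x. genA True l (a x) (f x)"
  shows "\<exists>N. A_inf_norms l (perm_series (H_idx l) c f) N \<and>
    (\<forall>m. N m \<le> (\<Sum>\<^sub>\<infinity>x. cmod (c x) * (1 + real (a x)) ^ (Suc l * m)))"
  using assms
proof (induction l arbitrary: c a f)
  case 0
  note c = rapid_summable[OF 0(1)] and ca = rapidD[OF 0(1)]
  define Q where "Q x \<longleftrightarrow> f x \<noteq> Map.empty" for x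
  have "\<forall>x. \<exists>n. Q x \<longrightarrow> \<bar>n\<bar> \<le> int (a x) \<and> f x = base_map (\<lambda>m. Some (m + - n))"
  proof
    fix x
    from 0(2)[of x] show "\<exists>n. Q x \<longrightarrow> \<bar>n\<bar> \<le> int (a x) \<and> f x = base_map (\<lambda>m. Some (m + - n))"
    proof cases
      case (gen_base u)
      then obtain n where "\<bar>n\<bar> \<le> int (a x)" "u = (\<lambda>m. Some (m + n))" by (auto simp: translation_def)
      then show ?thesis using gen_base by (intro exI[of _ "- n"]) simp
    qed (simp_all add: Q_def)
  qed
  from choice[OF this] obtain h where h: "\<And>x. Q x \<Longrightarrow> \<bar>h x\<bar> \<le> int (a x)" "\<And>x. Q x \<Longrightarrow> f x = base_map (\<lambda>m. Some (m + - h x))"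
    by blast
  define C where "C k = (\<Sum>\<^sub>\<infinity>x. if Q x \<and> h x = k then c x else 0)" for k
  have le: "cmod (C k) * (1 + real (nat \<bar>k\<bar>)) ^ m \<le>
      (\<Sum>\<^sub>\<infinity>x. if Q x \<and> h x = k then cmod (c x) * (1 + real (a x)) ^ m else 0)" for k m
    unfolding C_def
  proof (rule group_norm_le[OF c ca])
    fix x assume "Q x \<and> h x = k"
    then have "1 + real (nat \<bar>k\<bar>) \<le> 1 + real (a x)" using h(1)[of x] by auto
    then show "cmod (c x) * (1 + real (nat \<bar>k\<bar>)) ^ m \<le> cmod (c x) * (1 + real (a x)) ^ m"
      by (intro mult_left_mono power_mono) auto
  qed auto
  have C: "rapid C (\<lambda>k. nat \<bar>k\<bar>)"
    unfolding rapid_def by (intro allI group_dominated(1)[OF ca _ _ le]) auto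
  have N: "rapid_norm C m \<le> (\<Sum>\<^sub>\<infinity>x. cmod (c x) * (1 + real (a x)) ^ m)" for m
  proof -
    have "rapid_norm C m \<le> (\<Sum>\<^sub>\<infinity>x. if Q x then cmod (c x) * (1 + real (a x)) ^ m else 0)"
      unfolding rapid_norm_eq by (intro group_dominated(2)[OF ca _ _ le]) auto
    also have "\<dots> \<le> (\<Sum>\<^sub>\<infinity>x. cmod (c x) * (1 + real (a x)) ^ m)"
      by (intro infsum_mono ca summable_on_comparison_test[OF ca]) auto
    finally show ?thesis .
  qed
  have "perm_series (H_idx 0) C (\<lambda>n. base_map (\<lambda>m. Some (m + - n))) = perm_series (H_idx 0) c f"
  proof
    fix \<psi>
    show "perm_series (H_idx 0) C (\<lambda>n. base_map (\<lambda>m. Some (m + - n))) \<psi> = perm_series (H_idx 0) c f \<psi>"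
    proof (cases "\<psi> \<in> ell2 (H_idx 0)")
      case True
      have "(\<Sum>\<^sub>\<infinity>n. C n * act (base_map (\<lambda>m. Some (m + - n))) \<psi> \<gamma>) = (\<Sum>\<^sub>\<infinity>x. c x * act (f x) \<psi> \<gamma>)" for \<gamma>
      proof -
        have "(\<Sum>\<^sub>\<infinity>n. C n * act (base_map (\<lambda>m. Some (m + - n))) \<psi> \<gamma>) =
            (\<Sum>\<^sub>\<infinity>x. if Q x then c x * act (f x) \<psi> \<gamma> else 0)"
          unfolding C_def by (rule series_group[OF c True]) (rule h(2))
        also have "\<dots> = (\<Sum>\<^sub>\<infinity>x. c x * act (f x) \<psi> \<gamma>)" by (intro infsum_cong) (auto simp: Q_def)
        finally show ?thesis .
      qed
      then show ?thesis using True by (simp add: perm_series_def on_ell2_def)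
    qed (simp add: perm_series_def on_ell2_def)
  qed
  moreover have "A_inf_norms 0 (perm_series (H_idx 0) C (\<lambda>n. base_map (\<lambda>m. Some (m + - n)))) (rapid_norm C)"
    unfolding translation_series[symmetric] using C by (intro A_inf_norms.base) (simp only: rapidly_decreasing_iff)
  ultimately show ?case using N by (intro exI[of _ "rapid_norm C"]) simp
next
  case (Suc l)
  note c = rapid_summable[OF Suc.prems(1)] and ca = rapidD[OF Suc.prems(1)]
  define Q where "Q x \<longleftrightarrow> (\<exists>n. \<bar>n\<bar> \<le> int (a x) \<and> f x = shift_map l UNIV n (nat (- n)))" for x
  define R where "R x \<longleftrightarrow> \<not> Q x \<and> f x \<noteq> Map.empty" for x
  have "\<forall>x. \<exists>n. Q x \<longrightarrow> \<bar>n\<bar> \<le> int (a x) \<and> f x = shift_map l UNIV n (nat (- n))" by (auto simp: Q_def)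
  from choice[OF this] obtain h where h: "\<And>x. Q x \<Longrightarrow> \<bar>h x\<bar> \<le> int (a x)" "\<And>x. Q x \<Longrightarrow> f x = shift_map l UNIV (h x) (nat (- h x))"
    by blast
  define corner where "corner x r \<longleftrightarrow> genA True l (snd (snd r)) (fst (snd r)) \<and>
      fst (fst r) + snd (fst r) + snd (snd r) \<le> a x \<and> f x = corner_map (fst (fst r)) (snd (fst r)) (fst (snd r))"
    for x and r :: "(nat \<times> nat) \<times> (idx \<Rightarrow> idx option) \<times> nat"
  have "\<forall>x. \<exists>r. R x \<longrightarrow> corner x r"
  proof
    fix x
    have "\<exists>r. corner x r" if "R x"
    proof -
      obtain j k u b where "genA True l b u \<and> j + k + b \<le> a x \<and> f x = corner_map j k u"
        using genA_strict_cases[OF Suc.prems(2)[of x]] \<open>R x\<close> unfolding R_def Q_def by blast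
      then have "corner x ((j, k), u, b)" by (simp add: corner_def)
      then show ?thesis by blast
    qed
    then show "\<exists>r. R x \<longrightarrow> corner x r" by blast
  qed
  from choice[OF this] obtain r where r: "\<forall>x. R x \<longrightarrow> corner x (r x)" ..
  define q u b where "q x = fst (r x)" and "u x = fst (snd (r x))" and "b x = snd (snd (r x))" for x
  have ub: "genA True l (b x) (u x)" "fst (q x) + snd (q x) + b x \<le> a x" "f x = corner_map (fst (q x)) (snd (q x)) (u x)" if "R x" for x
    using r that by (auto simp: corner_def q_def u_def b_def)
  define C where "C k = (\<Sum>\<^sub>\<infinity>x. if Q x \<and> h x = k then c x else 0)" for k
  \<comment> \<open>The part of the series belonging to the corner \<open>(j, k)\<close>. All
    indices are kept, the foreign ones with coefficient 0, the empty map and weight 0, so that the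
    induction hypothesis for series over \<open>nat\<close> applies.\<close>
  define cc where "cc j k x = (if R x \<and> q x = (j, k) then c x else 0)" for j k x
  define ff where "ff j k x = (if R x \<and> q x = (j, k) then u x else Map.empty)" for j k x
  define ww where "ww j k x = (if R x \<and> q x = (j, k) then b x else 0)" for j k x
  have le: "cmod (C k) * (1 + real (nat \<bar>k\<bar>)) ^ m \<le>
      (\<Sum>\<^sub>\<infinity>x. if Q x \<and> h x = k then cmod (c x) * (1 + real (a x)) ^ m else 0)" for k m
    unfolding C_def
  proof (rule group_norm_le[OF c ca])
    fix x assume "Q x \<and> h x = k"
    then have "1 + real (nat \<bar>k\<bar>) \<le> 1 + real (a x)" using h(1)[of x] by auto
    then show "cmod (c x) * (1 + real (nat \<bar>k\<bar>)) ^ m \<le> cmod (c x) * (1 + real (a x)) ^ m"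
      by (intro mult_left_mono power_mono) auto
  qed auto
  have C: "rapid C (\<lambda>k. nat \<bar>k\<bar>)"
    unfolding rapid_def by (intro allI group_dominated(1)[OF ca _ _ le]) auto
  have NC: "rapid_norm C m \<le> (\<Sum>\<^sub>\<infinity>x. if Q x then cmod (c x) * (1 + real (a x)) ^ (Suc (Suc l) * m) else 0)" for m
  proof -
    have "rapid_norm C m \<le> (\<Sum>\<^sub>\<infinity>x. if Q x then cmod (c x) * (1 + real (a x)) ^ m else 0)"
      unfolding rapid_norm_eq by (intro group_dominated(2)[OF ca _ _ le]) auto
    also have "\<dots> \<le> (\<Sum>\<^sub>\<infinity>x. if Q x then cmod (c x) * (1 + real (a x)) ^ (Suc (Suc l) * m) else 0)"
    proof (rule infsum_mono)
      show "(\<lambda>x. if Q x then cmod (c x) * (1 + real (a x)) ^ k else 0) summable_on UNIV" for k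
        by (rule summable_on_comparison_test[OF ca[of k]]) auto
      show "(\<lambda>x. if Q x then cmod (c x) * (1 + real (a x)) ^ k else 0) summable_on UNIV" for k
        by (rule summable_on_comparison_test[OF ca[of k]]) auto
    qed (auto intro!: mult_left_mono power_increasing)
    finally show ?thesis .
  qed
  have rcc: "rapid (cc j k) (ww j k)" for j k
  proof (rule rapid_dominated[OF Suc.prems(1), where K = 1 and k = 0 and L = 1])
    show "1 + real (ww j k x) \<le> 1 * (1 + real (a x))" for x using ub(2)[of x] by (auto simp: ww_def)
  qed (auto simp: cc_def)
  have gff: "genA True l (ww j k x) (ff j k x)" for j k x
    using ub(1)[of x] by (auto simp: ww_def ff_def intro: gen_empty)
  define W where "W p N \<longleftrightarrow> A_inf_norms l (perm_series (H_idx l) (cc (fst p) (snd p)) (ff (fst p) (snd p))) N \<and>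
    (\<forall>m. N m \<le> (\<Sum>\<^sub>\<infinity>x. cmod (cc (fst p) (snd p) x) * (1 + real (ww (fst p) (snd p) x)) ^ (Suc l * m)))" for p N
  have "\<forall>p. \<exists>N. W p N" unfolding W_def by (intro allI Suc.IH[OF rcc gff])
  from choice[OF this] obtain NN where NN: "\<forall>p. W p (NN p)" ..
  define N where "N j k = NN (j, k)" for j k
  have N1: "A_inf_norms l (perm_series (H_idx l) (cc j k) (ff j k)) (N j k)"
    and N2: "N j k m \<le> (\<Sum>\<^sub>\<infinity>x. cmod (cc j k x) * (1 + real (ww j k x)) ^ (Suc l * m))" for j k m
    using NN[rule_format, of "(j, k)"] by (simp_all add: W_def N_def)
  have N0: "0 \<le> N j k m" for j k m by (rule A_inf_norms_nonneg[OF N1])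
  have Nle: "(1 + real j + real k) ^ n * N j k m \<le>
      (\<Sum>\<^sub>\<infinity>x. if R x \<and> q x = (j, k) then cmod (c x) * (1 + real (a x)) ^ (n + Suc l * m) else 0)" for j k n m
  proof -
    have "(1 + real j + real k) ^ n * N j k m \<le>
        (\<Sum>\<^sub>\<infinity>x. (1 + real j + real k) ^ n * (cmod (cc j k x) * (1 + real (ww j k x)) ^ (Suc l * m)))"
      unfolding infsum_cmult_right' by (intro mult_left_mono N2) auto
    also have "\<dots> \<le> (\<Sum>\<^sub>\<infinity>x. if R x \<and> q x = (j, k) then cmod (c x) * (1 + real (a x)) ^ (n + Suc l * m) else 0)"
    proof (rule infsum_mono)
      show "(\<lambda>x. (1 + real j + real k) ^ n * (cmod (cc j k x) * (1 + real (ww j k x)) ^ (Suc l * m))) summable_on UNIV"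
        by (intro summable_on_cmult_right rapidD rcc)
      show "(\<lambda>x. if R x \<and> q x = (j, k) then cmod (c x) * (1 + real (a x)) ^ (n + Suc l * m) else 0) summable_on UNIV"
        by (rule summable_on_comparison_test[OF ca[of "n + Suc l * m"]]) auto
      fix x
      show "(1 + real j + real k) ^ n * (cmod (cc j k x) * (1 + real (ww j k x)) ^ (Suc l * m)) \<le>
          (if R x \<and> q x = (j, k) then cmod (c x) * (1 + real (a x)) ^ (n + Suc l * m) else 0)"
      proof (cases "R x \<and> q x = (j, k)")
        case True
        then have "j + k + b x \<le> a x" using ub(2)[of x] by simp
        then have le: "1 + real j + real k \<le> 1 + real (a x)" "1 + real (b x) \<le> 1 + real (a x)" by linarith+
        have "(1 + real j + real k) ^ n * (1 + real (b x)) ^ (Suc l * m) \<le> (1 + real (a x)) ^ n * (1 + real (a x)) ^ (Suc l * m)"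
          using le by (intro mult_mono power_mono) auto
        from mult_left_mono[OF this, of "cmod (c x)"] True show ?thesis
          by (simp add: cc_def ww_def power_add mult_ac)
      next
        case False
        have "cc j k x = 0" unfolding cc_def if_not_P[OF False] ..
        then show ?thesis unfolding if_not_P[OF False] by simp
      qed
    qed
    finally show ?thesis .
  qed
  have Ns: "(\<lambda>(j, k). (1 + real j + real k) ^ n * N j k m) summable_on UNIV"
    and Ni: "(\<Sum>\<^sub>\<infinity>(j, k). (1 + real j + real k) ^ n * N j k m) \<le>
      (\<Sum>\<^sub>\<infinity>x. if R x then cmod (c x) * (1 + real (a x)) ^ (n + Suc l * m) else 0)" for n m
    by (rule group_dominated[OF ca[of "n + Suc l * m"], where Q = R and h = q]; use Nle N0 in \<open>auto split: prod.split\<close>)+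
  define M where "M m = (MAX (r, s)\<in>{..m} \<times> {..m}. \<Sum>\<^sub>\<infinity>(j, k). (1 + real j + real k) ^ r * N j k s) + rapid_norm C m" for m
  have "A_inf_norms (Suc l) (step_op l (\<lambda>j k. perm_series (H_idx l) (cc j k) (ff j k)) C) M"
    unfolding step_op_def M_def
    by (rule A_inf_norms.step) (use N1 Ns C in \<open>simp_all only: rapidly_decreasing_iff simp_thms\<close>)
  moreover have "step_op l (\<lambda>j k. perm_series (H_idx l) (cc j k) (ff j k)) C = perm_series (H_idx (Suc l)) c f"
  proof -
    have "(\<lambda>(p, x). norm (if R x \<and> q x = p then c x else 0)) summable_on UNIV" by (rule infsum_group(1)[OF c])
    then have s: "(\<lambda>((j, k), x). cmod (cc j k x)) summable_on UNIV"
      by (simp add: cc_def split_def)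
    show ?thesis
    proof
      fix \<psi>
      show "step_op l (\<lambda>j k. perm_series (H_idx l) (cc j k) (ff j k)) C \<psi> = perm_series (H_idx (Suc l)) c f \<psi>"
      proof (cases "\<psi> \<in> ell2 (H_idx (Suc l))")
        case True
        have "(\<Sum>\<^sub>\<infinity>(j, k). (alpha1_adj ^^ j) (p0_tensor (perm_series (H_idx l) (cc j k) (ff j k)) ((alpha1 ^^ k) \<psi>)) \<gamma>) +
            ((\<Sum>\<^sub>\<infinity>k. C (int k) * (alpha1 ^^ k) \<psi> \<gamma>) + (\<Sum>\<^sub>\<infinity>k\<in>{0<..}. C (- int k) * (alpha1_adj ^^ k) \<psi> \<gamma>)) =
            (\<Sum>\<^sub>\<infinity>x. c x * act (f x) \<psi> \<gamma>)" for \<gamma>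
        proof -
          let ?t = "\<lambda>z. (case z of ((j, k), i) \<Rightarrow> cc j k i) * act (case z of ((j, k), i) \<Rightarrow> corner_map j k (ff j k i)) \<psi> \<gamma>"
          have "(\<lambda>z. cmod (case z of ((j, k), i) \<Rightarrow> cc j k i)) summable_on UNIV" using s by (simp add: split_def)
          from series_summable[OF this True] have "?t summable_on UNIV \<times> UNIV" by simp
          from infsum_Sigma_banach[OF this]
          have "infsum ?t UNIV = (\<Sum>\<^sub>\<infinity>p. \<Sum>\<^sub>\<infinity>x. ?t (p, x))" by simp
          also have "\<dots> = (\<Sum>\<^sub>\<infinity>p. \<Sum>\<^sub>\<infinity>x. if R x \<and> q x = p then c x * act (f x) \<psi> \<gamma> else 0)"
            by (intro infsum_cong) (auto simp: cc_def ff_def ub(3) split: prod.split)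
          also have "\<dots> = (\<Sum>\<^sub>\<infinity>x. if R x then c x * act (f x) \<psi> \<gamma> else 0)"
            by (rule infsum_group(2)[OF norm_series_summable[OF c True]])
          finally have 1: "infsum ?t UNIV = (\<Sum>\<^sub>\<infinity>x. if R x then c x * act (f x) \<psi> \<gamma> else 0)" .
          have 2: "(\<Sum>\<^sub>\<infinity>n. C n * act (shift_map l UNIV n (nat (- n))) \<psi> \<gamma>) = (\<Sum>\<^sub>\<infinity>x. if Q x then c x * act (f x) \<psi> \<gamma> else 0)"
            unfolding C_def by (rule series_group[OF c True]) (rule h(2))
          have t: "(\<lambda>x. if P x then c x * act (f x) \<psi> \<gamma> else 0) summable_on UNIV" for P
            by (rule abs_summable_summable[OF summable_on_If[OF norm_series_summable[OF c True]]])
          have "(\<Sum>\<^sub>\<infinity>x. if R x then c x * act (f x) \<psi> \<gamma> else 0) + (\<Sum>\<^sub>\<infinity>x. if Q x then c x * act (f x) \<psi> \<gamma> else 0) =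
              (\<Sum>\<^sub>\<infinity>x. (if R x then c x * act (f x) \<psi> \<gamma> else 0) + (if Q x then c x * act (f x) \<psi> \<gamma> else 0))"
            by (rule infsum_add[OF t t, symmetric])
          also have "\<dots> = (\<Sum>\<^sub>\<infinity>x. c x * act (f x) \<psi> \<gamma>)"
            by (intro infsum_cong) (auto simp: R_def)
          finally show ?thesis
            unfolding corner_part[OF True s] shift_part[OF True rapid_summable[OF C]] 1 2 .
        qed
        then show ?thesis using True unfolding step_op_def by (simp add: perm_series_def[of "H_idx (Suc l)"] on_ell2_def add.assoc)
      qed (simp add: step_op_def perm_series_def on_ell2_def)
    qed
  qed
  moreover have "M m \<le> (\<Sum>\<^sub>\<infinity>x. cmod (c x) * (1 + real (a x)) ^ (Suc (Suc l) * m))" for m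
  proof -
    let ?g = "\<lambda>x. cmod (c x) * (1 + real (a x)) ^ (Suc (Suc l) * m)"
    have "(MAX (r, s)\<in>{..m} \<times> {..m}. \<Sum>\<^sub>\<infinity>(j, k). (1 + real j + real k) ^ r * N j k s) \<le> (\<Sum>\<^sub>\<infinity>x. if R x then ?g x else 0)"
    proof (rule Max.boundedI)
      fix y assume "y \<in> (\<lambda>(r, s). \<Sum>\<^sub>\<infinity>(j, k). (1 + real j + real k) ^ r * N j k s) ` ({..m} \<times> {..m})"
      then obtain r s where rs: "r \<le> m" "s \<le> m" "y = (\<Sum>\<^sub>\<infinity>(j, k). (1 + real j + real k) ^ r * N j k s)" by auto
      have "r + Suc l * s \<le> m + Suc l * m" using rs by (intro add_mono mult_left_mono) auto
      then have e: "r + Suc l * s \<le> Suc (Suc l) * m" by simp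
      have "y \<le> (\<Sum>\<^sub>\<infinity>x. if R x then cmod (c x) * (1 + real (a x)) ^ (r + Suc l * s) else 0)" unfolding rs by (rule Ni)
      also have "\<dots> \<le> (\<Sum>\<^sub>\<infinity>x. if R x then ?g x else 0)"
      proof (rule infsum_mono)
        show "(\<lambda>x. if R x then cmod (c x) * (1 + real (a x)) ^ (r + Suc l * s) else 0) summable_on UNIV"
          by (rule summable_on_comparison_test[OF ca[of "r + Suc l * s"]]) auto
        show "(\<lambda>x. if R x then ?g x else 0) summable_on UNIV"
          by (rule summable_on_comparison_test[OF ca[of "Suc (Suc l) * m"]]) auto
        show "(if R x then cmod (c x) * (1 + real (a x)) ^ (r + Suc l * s) else 0) \<le> (if R x then ?g x else 0)" for x
          using e by (auto intro!: mult_left_mono power_increasing simp del: mult_Suc)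
      qed
      finally show "y \<le> (\<Sum>\<^sub>\<infinity>x. if R x then ?g x else 0)" .
    qed auto
    then have "M m \<le> (\<Sum>\<^sub>\<infinity>x. if R x then ?g x else 0) + (\<Sum>\<^sub>\<infinity>x. if Q x then ?g x else 0)"
      unfolding M_def by (rule add_mono[OF _ NC])
    also have "\<dots> \<le> infsum ?g UNIV"
      by (rule infsum_disjoint_le[OF ca]) (auto simp: R_def)
    finally show ?thesis .
  qed
  ultimately show ?case by (intro exI[of _ M]) simp
qed

lemma gen_strict_imp: "gen s Z P l a f \<Longrightarrow> gen False Z P l a f"
  by (induction rule: gen.induct) (auto intro: gen.intros)

lemma rapid_series_ops_mono:
  assumes "\<And>a f. G a f \<Longrightarrow> H a f"
  shows "rapid_series_ops G I \<subseteq> rapid_series_ops H I"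
  using assms unfolding rapid_series_ops_def by blast

text \<open>The strict generators are those of the definition, the others are closed under
  composition; expanding the shifts with a higher threshold shows that both families yield the same
  operators.\<close>

lemma A_inf_eq: "A_inf l = rapid_series_ops (genA False l) (H_idx l)"
proof
  have "T \<in> rapid_series_ops (genA True l) (H_idx l)" if T: "T \<in> A_inf l" for T
  proof -
    obtain N where "A_inf_norms l T N" using T by (auto simp: A_inf_def)
    from A_inf_norms_imp_series[OF this] show ?thesis
      unfolding series_norms_def rapid_series_ops_def by blast
  qed
  then show "A_inf l \<subseteq> rapid_series_ops (genA False l) (H_idx l)"
    using rapid_series_ops_mono[of "genA True l" "genA False l" "H_idx l"] gen_strict_imp by blast
  show "rapid_series_ops (genA False l) (H_idx l) \<subseteq> A_inf l"
  proof
    fix T assume "T \<in> rapid_series_ops (genA False l) (H_idx l)"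
    then have "T \<in> rapid_series_ops (genA True l) (H_idx l)"
      by (rule rapid_series_ops_expand[where K = 3]) (rule gen_empty, rule genA_strict_expansion)
    then obtain c :: "nat \<Rightarrow> complex" and f a where T: "T = perm_series (H_idx l) c f" "rapid c a" "\<And>x. genA True l (a x) (f x)"
      by (rule rapid_series_opsE) (rule that)
    show "T \<in> A_inf l" using series_imp_A_inf_norms[OF T(2,3)] by (auto simp: A_inf_def T(1))
  qed
qed

section \<open>The involution, regularity and the axioms of a spectral triple\<close>

subsection \<open>Adjoints\<close>

lemma act_ell2:
  assumes f: "partial_perm I f" and \<psi>: "\<psi> \<in> ell2 I"
  shows "act f \<psi> \<in> ell2 I" "(l2norm I (act f \<psi>))\<^sup>2 \<le> (l2norm I \<psi>)\<^sup>2"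
proof -
  have s: "(\<lambda>\<gamma>. (cmod (act f \<psi> \<gamma>))\<^sup>2) summable_on I"
    by (intro nonneg_bdd_above_summable_on bdd_aboveI[where M = "(l2norm I \<psi>)\<^sup>2"]) (auto intro: sum_act_le[OF f _ \<psi>])
  then show "act f \<psi> \<in> ell2 I" by (simp add: ell2_def act_outside[OF f])
  show "(l2norm I (act f \<psi>))\<^sup>2 \<le> (l2norm I \<psi>)\<^sup>2"
    unfolding l2norm_power2[of I "act f \<psi>"] by (intro infsum_le_finite_sums s sum_act_le[OF f _ \<psi>])
qed

lemma l2inner_UNIV:
  assumes "\<phi> \<in> ell2 I"
  shows "l2inner I \<phi> \<psi> = (\<Sum>\<^sub>\<infinity>\<gamma>. cnj (\<phi> \<gamma>) * \<psi> \<gamma>)"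
  unfolding l2inner_def by (rule infsum_cong_neutral) (use ell2_outside[OF assms] in auto)

lemma l2_product_UNIV:
  assumes \<phi>: "\<phi> \<in> ell2 I" and \<psi>: "\<psi> \<in> ell2 I"
  shows "(\<lambda>\<gamma>. cmod (\<phi> \<gamma>) * cmod (\<psi> \<gamma>)) summable_on UNIV"
    "(\<Sum>\<^sub>\<infinity>\<gamma>. cmod (\<phi> \<gamma>) * cmod (\<psi> \<gamma>)) \<le> (l2norm I \<phi>)\<^sup>2 + (l2norm I \<psi>)\<^sup>2"
proof -
  note s = l2inner_abs_summable[OF \<phi> \<psi>]
  have "(\<lambda>\<gamma>. cmod (\<phi> \<gamma>) * cmod (\<psi> \<gamma>)) summable_on I \<longleftrightarrow> (\<lambda>\<gamma>. cmod (\<phi> \<gamma>) * cmod (\<psi> \<gamma>)) summable_on UNIV"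
    by (rule summable_on_cong_neutral) (use ell2_outside[OF \<phi>] in auto)
  then show "(\<lambda>\<gamma>. cmod (\<phi> \<gamma>) * cmod (\<psi> \<gamma>)) summable_on UNIV" using s by simp
  have "(\<Sum>\<^sub>\<infinity>\<gamma>. cmod (\<phi> \<gamma>) * cmod (\<psi> \<gamma>)) = (\<Sum>\<^sub>\<infinity>\<gamma>\<in>I. cmod (\<phi> \<gamma>) * cmod (\<psi> \<gamma>))"
    by (rule infsum_cong_neutral) (use ell2_outside[OF \<phi>] in auto)
  also have "\<dots> \<le> (\<Sum>\<^sub>\<infinity>\<gamma>\<in>I. (cmod (\<phi> \<gamma>))\<^sup>2 + (cmod (\<psi> \<gamma>))\<^sup>2)"
  proof (rule infsum_mono[OF s])
    show "(\<lambda>\<gamma>. (cmod (\<phi> \<gamma>))\<^sup>2 + (cmod (\<psi> \<gamma>))\<^sup>2) summable_on I"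
      by (intro summable_on_add ell2_summable \<phi> \<psi>)
    show "cmod (\<phi> i) * cmod (\<psi> i) \<le> (cmod (\<phi> i))\<^sup>2 + (cmod (\<psi> i))\<^sup>2" for i
      by (rule cmod_mult_le_power2)
  qed
  also have "\<dots> = (l2norm I \<phi>)\<^sup>2 + (l2norm I \<psi>)\<^sup>2"
    unfolding l2norm_power2 by (intro infsum_add ell2_summable \<phi> \<psi>)
  finally show "(\<Sum>\<^sub>\<infinity>\<gamma>. cmod (\<phi> \<gamma>) * cmod (\<psi> \<gamma>)) \<le> (l2norm I \<phi>)\<^sup>2 + (l2norm I \<psi>)\<^sup>2" .
qed

lemma series_inner:
  assumes c: "(\<lambda>x. cmod (c x)) summable_on UNIV" and f: "\<And>x. partial_perm I (f x)"
    and \<phi>: "\<phi> \<in> ell2 I" and \<psi>: "\<psi> \<in> ell2 I"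
  shows "(\<Sum>\<^sub>\<infinity>\<gamma>. \<phi> \<gamma> * (\<Sum>\<^sub>\<infinity>x. c x * act (f x) \<psi> \<gamma>)) = (\<Sum>\<^sub>\<infinity>x. c x * (\<Sum>\<^sub>\<infinity>\<gamma>. \<phi> \<gamma> * act (f x) \<psi> \<gamma>))"
proof -
  let ?h = "\<lambda>x \<gamma>. c x * (\<phi> \<gamma> * act (f x) \<psi> \<gamma>)"
  let ?K = "(l2norm I \<phi>)\<^sup>2 + (l2norm I \<psi>)\<^sup>2"
  note p = l2_product_UNIV[OF \<phi> act_ell2(1)[OF f \<psi>]]
  have "(\<lambda>z. norm (case z of (x, \<gamma>) \<Rightarrow> ?h x \<gamma>)) summable_on UNIV"
  proof (rule summable_on_prod_nonneg(1)[where B = "\<lambda>x. cmod (c x) * ?K"])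
    show "(\<lambda>\<gamma>. norm (case (x, \<gamma>) of (x, \<gamma>) \<Rightarrow> ?h x \<gamma>)) summable_on UNIV" for x
      by (simp add: norm_mult summable_on_cmult_right p(1))
    show "(\<Sum>\<^sub>\<infinity>\<gamma>. norm (case (x, \<gamma>) of (x, \<gamma>) \<Rightarrow> ?h x \<gamma>)) \<le> cmod (c x) * ?K" for x
      unfolding prod.case norm_mult infsum_cmult_right'
      by (intro mult_left_mono order_trans[OF p(2)] add_left_mono act_ell2(2) f \<psi>) auto
  qed (auto intro!: summable_on_cmult_left c)
  from abs_summable_summable[OF this] have "(\<lambda>(x, \<gamma>). ?h x \<gamma>) summable_on UNIV \<times> UNIV" by simp
  from infsum_swap_banach[OF this]
  have "(\<Sum>\<^sub>\<infinity>x. \<Sum>\<^sub>\<infinity>\<gamma>. ?h x \<gamma>) = (\<Sum>\<^sub>\<infinity>\<gamma>. \<Sum>\<^sub>\<infinity>x. ?h x \<gamma>)" by simp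
  moreover have "(\<Sum>\<^sub>\<infinity>x. ?h x \<gamma>) = \<phi> \<gamma> * (\<Sum>\<^sub>\<infinity>x. c x * act (f x) \<psi> \<gamma>)" for \<gamma>
    unfolding infsum_cmult_right'[symmetric] by (simp add: mult.left_commute)
  ultimately show ?thesis by (simp add: infsum_cmult_right')
qed

text \<open>Substitution of \<open>f \<gamma>\<close> for the summation index: the transpose of a
  partial permutation matrix belongs to the inverse map.\<close>

lemma act_inner_inverse:
  assumes inv: "\<And>\<gamma> \<gamma>'. f \<gamma> = Some \<gamma>' \<longleftrightarrow> f' \<gamma>' = Some \<gamma>"
  shows "(\<Sum>\<^sub>\<infinity>\<gamma>. \<phi> \<gamma> * act f \<psi> \<gamma>) = (\<Sum>\<^sub>\<infinity>\<gamma>. \<psi> \<gamma> * act f' \<phi> \<gamma> :: complex)"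
proof -
  have bij: "bij_betw (\<lambda>\<gamma>. the (f \<gamma>)) (dom f) (dom f')"
  proof (rule bij_betwI[where g = "\<lambda>\<gamma>. the (f' \<gamma>)"])
    show "(\<lambda>\<gamma>. the (f \<gamma>)) \<in> dom f \<rightarrow> dom f'"
    proof
      fix \<gamma> assume "\<gamma> \<in> dom f"
      then obtain \<gamma>' where "f \<gamma> = Some \<gamma>'" by blast
      moreover from this have "f' \<gamma>' = Some \<gamma>" using inv by blast
      ultimately show "the (f \<gamma>) \<in> dom f'" by auto
    qed
    show "(\<lambda>\<gamma>. the (f' \<gamma>)) \<in> dom f' \<rightarrow> dom f"
    proof
      fix \<gamma> assume "\<gamma> \<in> dom f'"
      then obtain \<gamma>' where "f' \<gamma> = Some \<gamma>'" by blast
      moreover from this have "f \<gamma>' = Some \<gamma>" using inv by blast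
      ultimately show "the (f' \<gamma>) \<in> dom f" by auto
    qed
    show "the (f' (the (f x))) = x" if "x \<in> dom f" for x using that inv by (metis domD option.sel)
    show "the (f (the (f' y))) = y" if "y \<in> dom f'" for y using that inv by (metis domD option.sel)
  qed
  have "(\<Sum>\<^sub>\<infinity>\<gamma>. \<phi> \<gamma> * act f \<psi> \<gamma>) = (\<Sum>\<^sub>\<infinity>\<gamma>\<in>dom f. \<psi> (the (f \<gamma>)) * act f' \<phi> (the (f \<gamma>)))"
  proof (rule infsum_cong_neutral)
    fix \<gamma> assume "\<gamma> \<in> UNIV \<inter> dom f"
    then obtain \<gamma>' where 1: "f \<gamma> = Some \<gamma>'" by blast
    then have "f' \<gamma>' = Some \<gamma>" using inv by blast
    with 1 show "\<phi> \<gamma> * act f \<psi> \<gamma> = \<psi> (the (f \<gamma>)) * act f' \<phi> (the (f \<gamma>))" by (simp add: act_def)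
  qed (auto simp: act_def domIff)
  also have "\<dots> = (\<Sum>\<^sub>\<infinity>\<gamma>\<in>dom f'. \<psi> \<gamma> * act f' \<phi> \<gamma>)"
    by (rule infsum_reindex_bij_betw[OF bij])
  also have "\<dots> = (\<Sum>\<^sub>\<infinity>\<gamma>. \<psi> \<gamma> * act f' \<phi> \<gamma>)"
    by (rule infsum_cong_neutral) (auto simp: act_def domIff)
  finally show ?thesis .
qed

lemma perm_series_adjoint:
  assumes c: "(\<lambda>x. cmod (c x)) summable_on UNIV" and f: "\<And>x. partial_perm I (f x)" and f': "\<And>x. partial_perm I (f' x)"
    and inv: "\<And>x \<gamma> \<gamma>'. f x \<gamma> = Some \<gamma>' \<longleftrightarrow> f' x \<gamma>' = Some \<gamma>"
  shows "is_adjoint I (perm_series I c f) (perm_series I (\<lambda>x. cnj (c x)) f')"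
  unfolding is_adjoint_def
proof (intro ballI)
  fix \<phi> \<psi> assume \<phi>: "\<phi> \<in> ell2 I" and \<psi>: "\<psi> \<in> ell2 I"
  let ?U = "perm_series I (\<lambda>x. cnj (c x)) f'"
  have c': "(\<lambda>x. cmod (cnj (c x))) summable_on UNIV" using c by simp
  have U: "?U \<phi> \<in> ell2 I" by (rule bounded_ops_ell2[OF perm_series_bounded[OF c' f'] \<phi>])
  have \<phi>': "(\<lambda>\<gamma>. cnj (\<phi> \<gamma>)) \<in> ell2 I" using \<phi> by (simp add: ell2_def)
  have cact: "cnj (act (f' x) \<phi> \<gamma>) = act (f' x) (\<lambda>\<gamma>. cnj (\<phi> \<gamma>)) \<gamma>" for x \<gamma>
    by (simp add: act_def split: option.split)
  have "l2inner I (?U \<phi>) \<psi> = (\<Sum>\<^sub>\<infinity>\<gamma>. \<psi> \<gamma> * (\<Sum>\<^sub>\<infinity>x. c x * act (f' x) (\<lambda>\<gamma>. cnj (\<phi> \<gamma>)) \<gamma>))"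
    unfolding l2inner_UNIV[OF U] using \<phi>
    by (intro infsum_cong) (simp add: perm_series_def on_ell2_def infsum_cnj[symmetric] cact mult.commute del: infsum_cnj)
  also have "\<dots> = (\<Sum>\<^sub>\<infinity>x. c x * (\<Sum>\<^sub>\<infinity>\<gamma>. \<psi> \<gamma> * act (f' x) (\<lambda>\<gamma>. cnj (\<phi> \<gamma>)) \<gamma>))"
    by (rule series_inner[OF c f' \<psi> \<phi>'])
  also have "\<dots> = (\<Sum>\<^sub>\<infinity>x. c x * (\<Sum>\<^sub>\<infinity>\<gamma>. cnj (\<phi> \<gamma>) * act (f x) \<psi> \<gamma>))"
    unfolding act_inner_inverse[OF inv] ..
  also have "\<dots> = (\<Sum>\<^sub>\<infinity>\<gamma>. cnj (\<phi> \<gamma>) * (\<Sum>\<^sub>\<infinity>x. c x * act (f x) \<psi> \<gamma>))"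
    by (rule series_inner[OF c f \<phi>' \<psi>, symmetric])
  also have "\<dots> = l2inner I \<phi> (perm_series I c f \<psi>)"
    unfolding l2inner_UNIV[OF \<phi>] using \<psi> by (simp add: perm_series_def on_ell2_def)
  finally show "l2inner I (?U \<phi>) \<psi> = l2inner I \<phi> (perm_series I c f \<psi>)" .
qed

lemma A_inf_adjoint:
  assumes "T \<in> A_inf l"
  shows "\<exists>U\<in>A_inf l. is_adjoint (H_idx l) T U"
proof -
  obtain c :: "nat \<Rightarrow> complex" and f a where T: "T = perm_series (H_idx l) c f" "rapid c a" "\<And>x. genA False l (a x) (f x)"
    using assms unfolding A_inf_eq by (rule rapid_series_opsE) (rule that)
  have "\<forall>x. \<exists>f'. genA False l (2 * a x) f' \<and> (\<forall>\<gamma> \<gamma>'. f x \<gamma> = Some \<gamma>' \<longleftrightarrow> f' \<gamma>' = Some \<gamma>)"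
    using genA_inverse[OF T(3)] by blast
  from choice[OF this] obtain f' where f': "\<And>x. genA False l (2 * a x) (f' x)"
    "\<And>x \<gamma> \<gamma>'. f x \<gamma> = Some \<gamma>' \<longleftrightarrow> f' x \<gamma>' = Some \<gamma>" by blast
  have "rapid (\<lambda>x. cnj (c x)) (\<lambda>x. 2 * a x)"
    by (rule rapid_dominated[OF T(2), where K = 1 and k = 0 and L = 2]) auto
  then have "perm_series (H_idx l) (\<lambda>x. cnj (c x)) f' \<in> A_inf l"
    unfolding A_inf_eq by (rule rapid_series_opsI) (rule f'(1))
  moreover have "is_adjoint (H_idx l) T (perm_series (H_idx l) (\<lambda>x. cnj (c x)) f')"
    unfolding T(1)
    by (rule perm_series_adjoint[OF rapid_summable[OF T(2)] genA_partial_perm[OF T(3)] genA_partial_perm[OF f'(1)] f'(2)])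
  ultimately show ?thesis by blast
qed


subsection \<open>Regularity\<close>

lemma Dirac_diagonal: "acts_diagonally (H_idx l) dirac_eigenvalue (Dirac l)"
  by (auto simp: acts_diagonally_def Dirac_def Let_def)

definition B_ops :: "nat \<Rightarrow> idx op set" where
  "B_ops l = rapid_series_ops (genB l) (H_idx l)"

lemma A_inf_subset_B_ops: "A_inf l \<subseteq> B_ops l"
proof
  fix T assume "T \<in> A_inf l"
  then have "T \<in> rapid_series_ops (genA False l) (H_idx l)" by (simp add: A_inf_eq)
  then show "T \<in> B_ops l" unfolding B_ops_def
    by (rule rapid_series_ops_expand[where K = 2]) (rule gen_empty, rule genA_half_expansion)
qed

lemma B_ops_bounded: "T \<in> B_ops l \<Longrightarrow> T \<in> bounded_ops (H_idx l)"
  unfolding B_ops_def by (rule rapid_series_ops_bounded[OF _ genB_partial_perm])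

lemma B_ops_commutator:
  assumes T: "T \<in> B_ops l"
  shows "\<exists>U\<in>B_ops l. extends_commutator (H_idx l) (Dirac l) T U"
  using T unfolding B_ops_def
proof (rule rapid_series_ops_commutator[OF _ genB_partial_perm Dirac_diagonal])
  fix a f assume "genB l a f"
  then obtain d e \<sigma> \<tau> where h: "homogeneous a f d e \<sigma> \<tau>" using genB_homogeneous by blast
  have "\<forall>\<gamma> \<gamma>'. f \<gamma> = Some \<gamma>' \<longrightarrow> dirac_eigenvalue \<gamma> - dirac_eigenvalue \<gamma>' = d"
    using h unfolding homogeneous_def split_paired_All by blast
  then show "\<exists>d. \<bar>d\<bar> \<le> real a \<and> (\<forall>\<gamma> \<gamma>'. f \<gamma> = Some \<gamma>' \<longrightarrow> dirac_eigenvalue \<gamma> - dirac_eigenvalue \<gamma>' = d)"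
    using h unfolding homogeneous_def by blast
qed

lemma B_ops_delta:
  assumes T: "T \<in> B_ops l"
  shows "\<exists>U\<in>B_ops l. extends_commutator (H_idx l) (abs_op (H_idx l) (Dirac l)) T U"
  using T unfolding B_ops_def
proof (rule rapid_series_ops_commutator[OF _ genB_partial_perm abs_op_diagonal[OF Dirac_diagonal]])
  fix a f assume "genB l a f"
  then obtain d e \<sigma> \<tau> where h: "homogeneous a f d e \<sigma> \<tau>" using genB_homogeneous by blast
  have "\<forall>\<gamma> \<gamma>'. f \<gamma> = Some \<gamma>' \<longrightarrow> \<bar>dirac_eigenvalue \<gamma>\<bar> - \<bar>dirac_eigenvalue \<gamma>'\<bar> = e"
    using h unfolding homogeneous_def split_paired_All by blast
  then show "\<exists>e. \<bar>e\<bar> \<le> real a \<and> (\<forall>\<gamma> \<gamma>'. f \<gamma> = Some \<gamma>' \<longrightarrow> \<bar>dirac_eigenvalue \<gamma>\<bar> - \<bar>dirac_eigenvalue \<gamma>'\<bar> = e)"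
    using h unfolding homogeneous_def by blast
qed

lemma commutator_B_ops: "T \<in> B_ops l \<Longrightarrow> commutator (H_idx l) (Dirac l) T \<in> B_ops l"
  using B_ops_commutator[of T l] commutator_eqI[OF Dirac_diagonal] by auto

lemma delta_B_ops: "T \<in> B_ops l \<Longrightarrow> delta (H_idx l) (Dirac l) T \<in> B_ops l"
  unfolding delta_def using B_ops_delta[of T l] commutator_eqI[OF abs_op_diagonal[OF Dirac_diagonal]] by auto

lemma B_ops_add: "T \<in> B_ops l \<Longrightarrow> U \<in> B_ops l \<Longrightarrow> T + U \<in> B_ops l"
  unfolding B_ops_def by (rule rapid_series_ops_add)

lemma B_ops_subset_OP0: "B_ops l \<subseteq> OP0 (H_idx l) (Dirac l)"
proof -
  have "T \<in> dom_delta_pow (H_idx l) (Dirac l) n" if "T \<in> B_ops l" for T n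
    using that
  proof (induction n arbitrary: T)
    case 0
    then show ?case by (simp add: B_ops_bounded)
  next
    case (Suc n)
    then show ?case using B_ops_delta[of T l] delta_B_ops[of T l] by (auto simp: B_ops_bounded)
  qed
  then show ?thesis by (auto simp: OP0_def)
qed

lemma regular_A_inf: "regular_triple (A_inf l) (H_idx l) (Dirac l)"
  unfolding regular_triple_def
proof (intro ballI)
  fix a b assume ab: "a \<in> A_inf l" "b \<in> A_inf l"
  then have "a \<in> B_ops l" "commutator (H_idx l) (Dirac l) b \<in> B_ops l"
    using A_inf_subset_B_ops commutator_B_ops by auto
  from B_ops_add[OF this] show "a + commutator (H_idx l) (Dirac l) b \<in> OP0 (H_idx l) (Dirac l)"
    using B_ops_subset_OP0 by blast
qed

lemma delta_algebra_subset_B_ops: "delta_algebra (A_inf l) (H_idx l) (Dirac l) \<subseteq> B_ops l"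
proof
  fix b assume "b \<in> delta_algebra (A_inf l) (H_idx l) (Dirac l)"
  then show "b \<in> B_ops l" unfolding delta_algebra_def
  proof (induction rule: generated_algebra.induct)
    case (generator g)
    have dn: "(delta (H_idx l) (Dirac l) ^^ n) T \<in> B_ops l" if "T \<in> B_ops l" for n T
      using that by (induction n) (auto intro: delta_B_ops)
    from generator show ?case using A_inf_subset_B_ops by (auto intro!: dn commutator_B_ops)
  next
    case (add a b)
    then show ?case by (blast intro: B_ops_add)
  next
    case (scale a c)
    then show ?case unfolding B_ops_def by (blast intro: rapid_series_ops_scale)
  next
    case (mult a b)
    show ?case using mult.IH unfolding B_ops_def
      by (rule rapid_series_ops_comp[where G = "genB l" and I = "H_idx l"]) (rule genB_partial_perm B.G_comp; assumption)+
  qed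
qed

text \<open>Each of the \<open>l\<close> natural coordinates takes at most \<open>M + 1\<close>
  values and the last one at most \<open>2 * M + 1\<close>.\<close>

lemma finite_dirac_le: "finite {\<gamma>\<in>H_idx l. \<bar>dirac_eigenvalue \<gamma>\<bar> \<le> real M}"
  "card {\<gamma>\<in>H_idx l. \<bar>dirac_eigenvalue \<gamma>\<bar> \<le> real M} \<le> 2 * (M + 1) ^ (l + 1)"
proof -
  let ?S = "{xs. set xs \<subseteq> {..M} \<and> length xs = l} \<times> {- int M..int M}"
  have sub: "{\<gamma>\<in>H_idx l. \<bar>dirac_eigenvalue \<gamma>\<bar> \<le> real M} \<subseteq> ?S"
  proof
    fix \<gamma> assume "\<gamma> \<in> {\<gamma>\<in>H_idx l. \<bar>dirac_eigenvalue \<gamma>\<bar> \<le> real M}"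
    then obtain g m where \<gamma>: "\<gamma> = (g, m)" "length g = l" "real (sum_list g) + \<bar>real_of_int m\<bar> \<le> real M"
      by (cases \<gamma>) (auto simp: H_idx_def abs_dirac_eigenvalue)
    have "\<bar>real_of_int m\<bar> \<le> real M" "real (sum_list g) \<le> real M" using \<gamma>(3) by linarith+
    moreover have "x \<le> sum_list g" if "x \<in> set g" for x using that by (rule member_le_sum_list) simp
    ultimately show "\<gamma> \<in> ?S" using \<gamma>(2) by (auto simp: \<gamma>(1) intro: order_trans)
  qed
  have fin: "finite ?S" by (intro finite_cartesian_product finite_lists_length_eq) auto
  then show "finite {\<gamma>\<in>H_idx l. \<bar>dirac_eigenvalue \<gamma>\<bar> \<le> real M}" by (rule finite_subset[OF sub])
  have "card {\<gamma>\<in>H_idx l. \<bar>dirac_eigenvalue \<gamma>\<bar> \<le> real M} \<le> card ?S" by (rule card_mono[OF fin sub])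
  also have "\<dots> = (M + 1) ^ l * (2 * M + 1)"
    by (simp add: card_cartesian_product card_lists_length_eq nat_add_distrib nat_mult_distrib)
  also have "\<dots> \<le> (M + 1) ^ l * (2 * (M + 1))" by (intro mult_left_mono) auto
  finally show "card {\<gamma>\<in>H_idx l. \<bar>dirac_eigenvalue \<gamma>\<bar> \<le> real M} \<le> 2 * (M + 1) ^ (l + 1)" by (simp add: algebra_simps)
qed

lemma countable_H_idx: "countable (H_idx l)"
  by (rule countableI_type[THEN countable_subset[rotated]]) auto

lemma finite_dirac_le': "finite {\<gamma>\<in>H_idx l. \<bar>dirac_eigenvalue \<gamma>\<bar> \<le> K}"
proof (rule finite_subset[OF _ finite_dirac_le(1)])
  have K: "K \<le> real (nat \<lceil>K\<rceil>)" by linarith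
  show "{\<gamma>\<in>H_idx l. \<bar>dirac_eigenvalue \<gamma>\<bar> \<le> K} \<subseteq> {\<gamma>\<in>H_idx l. \<bar>dirac_eigenvalue \<gamma>\<bar> \<le> real (nat \<lceil>K\<rceil>)}"
    by (rule Collect_mono) (use K in linarith)
qed

lemma spectral_triple_A_inf: "spectral_triple (A_inf l) (H_idx l) (Dirac l)"
  unfolding spectral_triple_def
proof (intro conjI ballI allI)
  show "countable (H_idx l)" by (rule countable_H_idx)
  show "A_inf l \<subseteq> bounded_ops (H_idx l)" using A_inf_subset_B_ops B_ops_bounded by blast
  show "on_ell2 (H_idx l) id \<in> A_inf l"
  proof -
    have "on_ell2 (H_idx l) (act (idx_id l)) \<in> A_inf l"
      unfolding A_inf_eq by (rule rapid_series_ops_single[where G = "genA False l" and a = 0, OF genA_id])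
    moreover have "act (idx_id l) \<psi> = \<psi>" if "\<psi> \<in> ell2 (H_idx l)" for \<psi>
      using ell2_outside[OF that] by (auto simp: act_idx_id fun_eq_iff)
    then have "on_ell2 (H_idx l) (act (idx_id l)) = on_ell2 (H_idx l) id"
      by (auto simp: on_ell2_def fun_eq_iff)
    ultimately show ?thesis by simp
  qed
  show "a + b \<in> A_inf l" if "a \<in> A_inf l" "b \<in> A_inf l" for a b
    using that unfolding A_inf_eq by (rule rapid_series_ops_add)
  show "a \<circ> b \<in> A_inf l" if "a \<in> A_inf l" "b \<in> A_inf l" for a b
    using that unfolding A_inf_eq
    by (rule rapid_series_ops_comp[where G = "genA False l" and I = "H_idx l"]) (rule genA_partial_perm A.G_comp; assumption)+
  show "scale_op c a \<in> A_inf l" if "a \<in> A_inf l" for a c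
    using that unfolding A_inf_eq by (rule rapid_series_ops_scale)
  show "\<exists>b\<in>A_inf l. is_adjoint (H_idx l) a b" if "a \<in> A_inf l" for a
    using that by (rule A_inf_adjoint)
  show "self_adjoint (H_idx l) (Dirac l)" by (rule self_adjoint_diagonal[OF Dirac_diagonal])
  show "compact_resolvent (H_idx l) (Dirac l)"
    by (rule compact_resolvent_diagonal[OF Dirac_diagonal countable_H_idx finite_dirac_le'])
  show "\<exists>T. extends_commutator (H_idx l) (Dirac l) a T" if "a \<in> A_inf l" for a
    using B_ops_commutator[of a l] A_inf_subset_B_ops that by blast
qed

section \<open>Counting fixed points and the asymptotics of the traces on eigenspaces\<close>

subsection \<open>Fixed points of generators\<close>

definition level :: "nat \<Rightarrow> nat \<Rightarrow> idx set" where
  "level l k = {\<gamma>\<in>H_idx l. \<bar>dirac_eigenvalue \<gamma>\<bar> = real k}"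

text \<open>The trace of \<open>act f\<close> on the eigenspace \<open>|D| = k\<close>: its diagonal
  entries are 1 at the fixed points of \<open>f\<close> and 0 elsewhere.\<close>

definition fixed_count :: "nat \<Rightarrow> (idx \<Rightarrow> idx option) \<Rightarrow> nat \<Rightarrow> nat" where
  "fixed_count l f k = card {\<gamma>\<in>level l k. f \<gamma> = Some \<gamma>}"

lemma level_iff: "(g, m) \<in> level l k \<longleftrightarrow> length g = l \<and> sum_list g + nat \<bar>m\<bar> = k"
proof -
  have "real (sum_list g) + \<bar>real_of_int m\<bar> = real k \<longleftrightarrow> sum_list g + nat \<bar>m\<bar> = k"
  proof -
    have "real (sum_list g) + \<bar>real_of_int m\<bar> = real (sum_list g + nat \<bar>m\<bar>)" by simp
    then show ?thesis by (simp only: of_nat_eq_iff)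
  qed
  then show ?thesis by (simp add: level_def H_idx_def abs_dirac_eigenvalue)
qed

lemma finite_level: "finite (level l k)"
  by (rule finite_subset[OF _ finite_dirac_le(1)[of l k]]) (auto simp: level_def)

lemma card_level: "card (level l k) \<le> 2 * (k + 1) ^ (l + 1)"
  by (rule order_trans[OF card_mono[OF finite_dirac_le(1)] finite_dirac_le(2)]) (auto simp: level_def)

lemma fixed_count_le: "fixed_count l f k \<le> 2 * (k + 1) ^ (l + 1)"
  unfolding fixed_count_def
  by (rule order_trans[OF card_mono[OF finite_level] card_level]) auto

lemma fixed_count_eq_0: "(\<And>\<gamma>. f \<gamma> \<noteq> Some \<gamma>) \<Longrightarrow> fixed_count l f k = 0"
  by (simp add: fixed_count_def)

text \<open>Three shapes occur: no fixed points, the number of ways to write \<open>k - b\<close> as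
  a sum of \<open>q + 1\<close> natural numbers, and a single vector. The bound \<open>a + 1\<close>
  for \<open>b\<close> allows for the negative half line, where \<open>|m|\<close> begins at
  1.\<close>

definition polynomial_count :: "nat \<Rightarrow> nat \<Rightarrow> (nat \<Rightarrow> nat) \<Rightarrow> bool" where
  "polynomial_count l a w \<longleftrightarrow> (\<forall>k. w k = 0) \<or>
     (\<exists>q\<le>l. \<exists>b\<le>a + 1. \<forall>k. w k = (if b \<le> k then (k - b + q) choose q else 0)) \<or>
     (\<exists>b\<le>a. \<forall>k. w k = (if k = b then 1 else 0))"

text \<open>Stars and bars: after \<open>t\<close> is subtracted from the first entry, the entries
  and \<open>m\<close> form \<open>l + 2\<close> natural numbers with sum
  \<open>k - t\<close>.\<close>

lemma count_positive:
  "card {(g, m). length g = Suc l \<and> t \<le> hd g \<and> 0 \<le> (m :: int) \<and> sum_list g + nat m = k} =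
    (if t \<le> k then (k - t + Suc l) choose (Suc l) else 0)"
proof (cases "t \<le> k")
  case True
  let ?A = "{(g, m). length g = Suc l \<and> t \<le> hd g \<and> 0 \<le> (m :: int) \<and> sum_list g + nat m = k}"
  let ?B = "{ys :: nat list. length ys = l + 2 \<and> sum_list ys = k - t}"
  have "bij_betw (\<lambda>(g, m). nat m # (hd g - t) # tl g) ?A ?B"
  proof (rule bij_betwI[where g = "\<lambda>ys. ((hd (tl ys) + t) # tl (tl ys), int (hd ys))"])
    show "(\<lambda>(g, m). nat m # (hd g - t) # tl g) \<in> ?A \<rightarrow> ?B"
      by (auto simp: length_Suc_conv)
    show "(\<lambda>ys. ((hd (tl ys) + t) # tl (tl ys), int (hd ys))) \<in> ?B \<rightarrow> ?A"
      using True by (auto simp: length_Suc_conv)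
    show "(\<lambda>ys. ((hd (tl ys) + t) # tl (tl ys), int (hd ys))) (case x of (g, m) \<Rightarrow> nat m # (hd g - t) # tl g) = x"
      if "x \<in> ?A" for x using that by (auto simp: length_Suc_conv)
    show "(case (\<lambda>ys. ((hd (tl ys) + t) # tl (tl ys), int (hd ys))) y of (g, m) \<Rightarrow> nat m # (hd g - t) # tl g) = y"
      if "y \<in> ?B" for y using that by (auto simp: length_Suc_conv)
  qed
  then have "card ?A = card ?B" by (rule bij_betw_same_card)
  also have "\<dots> = (k - t + (l + 2) - 1) choose (k - t)" by (rule card_length_sum_list)
  also have "\<dots> = (k - t + Suc l) choose (Suc l)"
    using binomial_symmetric[of "k - t" "k - t + Suc l"] by simp
  finally show ?thesis using True by simp
next
  case False
  then have "{(g, m). length g = Suc l \<and> t \<le> hd g \<and> 0 \<le> (m :: int) \<and> sum_list g + nat m = k} = {}"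
    by (auto simp: length_Suc_conv)
  then show ?thesis using False by (simp only: card.empty if_False)
qed

text \<open>The reflection of \<open>m\<close> to \<open>- m - 1\<close> turns level
  \<open>k\<close> of the negative half line into level \<open>k - 1\<close> of the nonnegative
  one.\<close>

lemma count_negative:
  "card {(g, m). length g = Suc l \<and> t \<le> hd g \<and> (m :: int) < 0 \<and> sum_list g + nat (- m) = k} =
    (if t + 1 \<le> k then (k - (t + 1) + Suc l) choose (Suc l) else 0)"
proof (cases k)
  case 0
  then have "{(g, m). length g = Suc l \<and> t \<le> hd g \<and> (m :: int) < 0 \<and> sum_list g + nat (- m) = k} = {}" by auto
  then show ?thesis using 0 by (simp only: card.empty) simp
next
  case (Suc k')
  let ?A = "{(g, m). length g = Suc l \<and> t \<le> hd g \<and> 0 \<le> (m :: int) \<and> sum_list g + nat m = k'}"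
  let ?B = "{(g, m). length g = Suc l \<and> t \<le> hd g \<and> (m :: int) < 0 \<and> sum_list g + nat (- m) = k}"
  have "bij_betw (\<lambda>(g, m). (g, - m - 1)) ?B ?A"
    by (rule bij_betwI[where g = "\<lambda>(g, m). (g, - m - 1)"]) (auto simp: Suc)
  then have "card ?B = card ?A" by (rule bij_betw_same_card)
  then show ?thesis unfolding count_positive by (simp add: Suc)
qed

lemma fixed_count_corner:
  "fixed_count (Suc l) (corner_map j j f) i = (if j \<le> i then fixed_count l f (i - j) else 0)"
proof (cases "j \<le> i")
  case i: True
  have "{\<gamma>\<in>level (Suc l) i. corner_map j j f \<gamma> = Some \<gamma>} =
      (\<lambda>(g, m). (j # g, m)) ` {\<gamma>\<in>level l (i - j). f \<gamma> = Some \<gamma>}" (is "?L = ?R")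
  proof (intro set_eqI iffI)
    fix \<gamma> assume L: "\<gamma> \<in> ?L"
    obtain g m where \<gamma>: "\<gamma> = (g, m)" by (cases \<gamma>)
    obtain xs where g: "g = j # xs" and f: "f (xs, m) = Some (xs, m)"
      using L by (cases g) (auto simp: \<gamma> corner_map_def split: if_splits)
    have "(xs, m) \<in> level l (i - j)" using L i by (auto simp: \<gamma> g level_iff)
    with f show "\<gamma> \<in> ?R" unfolding \<gamma> g by (intro image_eqI[of _ _ "(xs, m)"]) auto
  next
    fix \<gamma> assume "\<gamma> \<in> ?R"
    then show "\<gamma> \<in> ?L" using i by (auto simp: corner_map_def level_iff)
  qed
  moreover have "inj_on (\<lambda>(g, m). (j # g, m)) {\<gamma>\<in>level l (i - j). f \<gamma> = Some \<gamma>}" by (auto simp: inj_on_def)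
  ultimately show ?thesis using i by (simp add: fixed_count_def card_image)
next
  case False
  have "{\<gamma>\<in>level (Suc l) i. corner_map j j f \<gamma> = Some \<gamma>} = {}"
    using False by (auto simp: corner_map_def level_iff split: list.splits if_splits)
  then show ?thesis using False by (simp only: fixed_count_def card.empty if_False)
qed

text \<open>A basis vector can be fixed only if the displacement is 0: \<open>n = 0\<close> for
  shifts, equal endpoints for rank one maps, \<open>j = k\<close> for corners. Such a corner delays
  the count of its inner map by \<open>j\<close> levels.\<close>

lemma genB_polynomial_count: "genB l a f \<Longrightarrow> polynomial_count l a (fixed_count l f)"
proof (induction rule: gen.induct)
  case (gen_empty l a)
  have "fixed_count l Map.empty k = 0" for k by (rule fixed_count_eq_0) simp
  then show ?case by (simp add: polynomial_count_def)
next
  case (gen_base a u)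
  then show ?case
  proof cases
    case half_map_empty
    have "fixed_count 0 (base_map u) k = 0" for k
      by (rule fixed_count_eq_0) (auto simp: half_map_empty base_map_def split: if_splits)
    then show ?thesis by (simp add: polynomial_count_def)
  next
    case (half_map_shift \<sigma> n t)
    show ?thesis
    proof (cases "n = 0")
      case True
      have t0: "t \<ge> 0" using half_map_shift by (auto simp: half_start_def split: if_splits)
      have "fixed_count 0 (base_map u) k = (if nat t \<le> k then (k - nat t + 0) choose 0 else 0)" for k
      proof -
        have "{\<gamma>\<in>level 0 k. base_map u \<gamma> = Some \<gamma>} = (if nat t \<le> k then {([], \<sigma> * int k)} else {})"
          using half_map_shift(2,4) t0
          by (auto simp: half_map_shift(1) level_iff base_map_def half_shift_def True half_start_def split: if_splits)
        then show ?thesis by (simp add: fixed_count_def)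
      qed
      moreover have "nat t \<le> a + 1" using half_map_shift by linarith
      ultimately show ?thesis unfolding polynomial_count_def by blast
    next
      case False
      have "fixed_count 0 (base_map u) k = 0" for k
        by (rule fixed_count_eq_0) (use False half_map_shift in \<open>auto simp: base_map_def half_shift_def split: if_splits\<close>)
      then show ?thesis by (simp add: polynomial_count_def)
    qed
  next
    case (half_map_rank_one m0 m1)
    show ?thesis
    proof (cases "m0 = m1")
      case True
      have "fixed_count 0 (base_map u) k = (if k = nat \<bar>m0\<bar> then 1 else 0)" for k
      proof -
        have "{\<gamma>\<in>level 0 k. base_map u \<gamma> = Some \<gamma>} = (if k = nat \<bar>m0\<bar> then {([], m0)} else {})"
          by (auto simp: half_map_rank_one(1) level_iff base_map_def rank_one_map_def True split: if_splits)
        then show ?thesis by (simp add: fixed_count_def)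
      qed
      moreover have "nat \<bar>m0\<bar> \<le> a" using half_map_rank_one by linarith
      ultimately show ?thesis unfolding polynomial_count_def by blast
    next
      case False
      have "fixed_count 0 (base_map u) k = 0" for k
        by (rule fixed_count_eq_0) (use False half_map_rank_one in \<open>auto simp: base_map_def rank_one_map_def split: if_splits\<close>)
      then show ?thesis by (simp add: polynomial_count_def)
    qed
  qed
next
  case (gen_shift p n a t l)
  show ?case
  proof (cases "n = 0")
    case True
    have fx: "shift_map l p n t (g, m) = Some (g, m) \<longleftrightarrow> length g = Suc l \<and> t \<le> hd g \<and> m \<in> p" for g m
      by (cases g) (auto simp: shift_map_def True)
    consider "p = {0..}" | "p = {..<0}" using gen_shift(1) by blast
    then show ?thesis
    proof cases
      case 1
      have "{\<gamma>\<in>level (Suc l) k. shift_map l p n t \<gamma> = Some \<gamma>} =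
          {(g, m). length g = Suc l \<and> t \<le> hd g \<and> 0 \<le> (m :: int) \<and> sum_list g + nat m = k}" for k
        by (auto simp: fx[unfolded 1] level_iff 1)
      then have "fixed_count (Suc l) (shift_map l p n t) k = (if t \<le> k then (k - t + Suc l) choose (Suc l) else 0)" for k
        unfolding fixed_count_def by (simp only: count_positive)
      moreover have "t \<le> a + 1" using gen_shift by linarith
      ultimately show ?thesis unfolding polynomial_count_def by blast
    next
      case 2
      have "{\<gamma>\<in>level (Suc l) k. shift_map l p n t \<gamma> = Some \<gamma>} =
          {(g, m). length g = Suc l \<and> t \<le> hd g \<and> (m :: int) < 0 \<and> sum_list g + nat (- m) = k}" for k
        by (auto simp: fx[unfolded 2] level_iff 2)
      then have "fixed_count (Suc l) (shift_map l p n t) k = (if t + 1 \<le> k then (k - (t + 1) + Suc l) choose (Suc l) else 0)" for k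
        unfolding fixed_count_def by (simp only: count_negative)
      moreover have "t + 1 \<le> a + 1" using gen_shift by linarith
      ultimately show ?thesis unfolding polynomial_count_def by blast
    qed
  next
    case False
    have "nat (int x + n) \<noteq> x" if "t \<le> x" for x using False that gen_shift by linarith
    then have "fixed_count (Suc l) (shift_map l p n t) k = 0" for k
      by (intro fixed_count_eq_0) (auto simp: shift_map_def split: if_splits list.splits)
    then show ?thesis by (simp add: polynomial_count_def)
  qed
next
  case (gen_corner l a f j k b)
  show ?case
  proof (cases "j = k")
    case True
    have c: "fixed_count (Suc l) (corner_map j k f) i = (if j \<le> i then fixed_count l f (i - j) else 0)" for i
      using fixed_count_corner True by simp
    from gen_corner.IH consider "\<And>k. fixed_count l f k = 0"
      | q b' where "q \<le> l" "b' \<le> a + 1" "\<And>k. fixed_count l f k = (if b' \<le> k then (k - b' + q) choose q else 0)"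
      | b' where "b' \<le> a" "\<And>k. fixed_count l f k = (if k = b' then 1 else 0)"
      unfolding polynomial_count_def by blast
    then show ?thesis
    proof cases
      case 1
      then show ?thesis by (simp add: polynomial_count_def c)
    next
      case 2
      have "fixed_count (Suc l) (corner_map j k f) i = (if b' + j \<le> i then (i - (b' + j) + q) choose q else 0)" for i
        unfolding c 2 by (auto simp: add.commute)
      moreover have "b' + j \<le> b + 1" "q \<le> Suc l" using 2 gen_corner.hyps by linarith+
      ultimately show ?thesis unfolding polynomial_count_def by blast
    next
      case 3
      have "fixed_count (Suc l) (corner_map j k f) i = (if i = b' + j then 1 else 0)" for i
        unfolding c 3 by auto
      moreover have "b' + j \<le> b" using 3 gen_corner.hyps by linarith
      ultimately show ?thesis unfolding polynomial_count_def by blast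
    qed
  next
    case False
    have "fixed_count (Suc l) (corner_map j k f) i = 0" for i
      by (rule fixed_count_eq_0) (use False in \<open>auto simp: corner_map_def split: if_splits list.splits\<close>)
    then show ?thesis by (simp add: polynomial_count_def)
  qed
qed

lemma abs_gbinomial_le: "\<bar>(z :: real) gchoose n\<bar> \<le> (\<bar>z\<bar> + real n) ^ n"
proof -
  have "\<bar>z gchoose n\<bar> = \<bar>\<Prod>i = 0..<n. z - of_nat i\<bar> / fact n"
    by (simp add: gbinomial_prod_rev)
  also have "\<dots> \<le> \<bar>\<Prod>i = 0..<n. z - of_nat i\<bar> / 1"
    by (intro divide_left_mono) (auto simp: fact_ge_1)
  also have "\<dots> = (\<Prod>i = 0..<n. \<bar>z - of_nat i\<bar>)" by (simp add: abs_prod)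
  also have "\<dots> \<le> (\<Prod>i = 0..<n. \<bar>z\<bar> + real n)" by (intro prod_mono) auto
  also have "\<dots> = (\<bar>z\<bar> + real n) ^ n" by simp
  finally show ?thesis .
qed

text \<open>Vandermonde's identity writes \<open>(k - b + q) choose q\<close> in terms of the
  \<open>k choose j\<close>. The coefficients are generalised binomials of \<open>q - b\<close>,
  which may be negative, and grow polynomially in \<open>a\<close>. For \<open>k > a + 1\<close> the
  count has started and a single exceptional level has been passed.\<close>

lemma polynomial_count_expansion:
  assumes "polynomial_count l a w"
  shows "\<exists>p. (\<forall>j. \<bar>p j\<bar> \<le> (2 * real l + 1) ^ l * (1 + real a) ^ l) \<and>
    (\<forall>k>a + 1. real (w k) = (\<Sum>j\<le>l. p j * real (k choose j)))"
proof -
  let ?K = "(2 * real l + 1) ^ l * (1 + real a) ^ l"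
  have K: "0 \<le> ?K" by simp
  consider "\<And>k. w k = 0" | q b where "q \<le> l" "b \<le> a + 1" "\<And>k. w k = (if b \<le> k then (k - b + q) choose q else 0)"
    | b where "b \<le> a" "\<And>k. w k = (if k = b then 1 else 0)"
    using assms unfolding polynomial_count_def by blast
  then show ?thesis
  proof cases
    case 1
    then show ?thesis using K by (intro exI[of _ "\<lambda>_. 0"]) simp
  next
    case 2
    define p where "p j = (if j \<le> q then (real q - real b) gchoose (q - j) else 0)" for j
    have "\<bar>p j\<bar> \<le> ?K" for j
    proof (cases "j \<le> q")
      case True
      have "\<bar>p j\<bar> \<le> (\<bar>real q - real b\<bar> + real (q - j)) ^ (q - j)" unfolding p_def if_P[OF True] by (rule abs_gbinomial_le)
      also have "\<dots> \<le> ((2 * real l + 1) * (1 + real a)) ^ (q - j)"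
      proof (intro power_mono)
        have "\<bar>real q - real b\<bar> + real (q - j) \<le> 2 * real l + (1 + real a)" using 2(1,2) True by linarith
        also have "\<dots> \<le> (2 * real l + 1) * (1 + real a)" by (simp add: algebra_simps)
        finally show "\<bar>real q - real b\<bar> + real (q - j) \<le> (2 * real l + 1) * (1 + real a)" .
      qed auto
      also have "\<dots> \<le> ((2 * real l + 1) * (1 + real a)) ^ l"
        using 2(1) by (intro power_increasing) (auto simp: algebra_simps)
      finally show ?thesis by (simp only: power_mult_distrib)
    qed (simp add: p_def K)
    moreover have "real (w k) = (\<Sum>j\<le>l. p j * real (k choose j))" if "k > a + 1" for k
    proof -
      have k: "b \<le> k" using that 2 by linarith
      have "real (w k) = real (k - b + q) gchoose q" using k by (simp add: 2(3) binomial_gbinomial)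
      also have "real (k - b + q) = real k + (real q - real b)" using k by simp
      also have "(real k + (real q - real b)) gchoose q = (\<Sum>j = 0..q. (real k gchoose j) * ((real q - real b) gchoose (q - j)))"
        by (rule gbinomial_Vandermonde[symmetric])
      also have "\<dots> = (\<Sum>j\<le>l. p j * real (k choose j))"
        using 2(1) by (intro sum.mono_neutral_cong_left) (auto simp: p_def binomial_gbinomial)
      finally show ?thesis .
    qed
    ultimately show ?thesis by blast
  next
    case 3
    then show ?thesis using K by (intro exI[of _ "\<lambda>_. 0"]) auto
  qed
qed


subsection \<open>Asymptotics of the diagonal\<close>

definition level_trace :: "nat \<Rightarrow> idx op \<Rightarrow> nat \<Rightarrow> complex" where
  "level_trace l T k = (\<Sum>\<gamma>\<in>level l k. T (ket \<gamma>) \<gamma>)"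

definition rapidly_decaying :: "(nat \<Rightarrow> complex) \<Rightarrow> bool" where
  "rapidly_decaying E \<longleftrightarrow> (\<forall>m. \<exists>C. \<forall>k. cmod (E k) * (1 + real k) ^ m \<le> C)"

lemma level_trace_series:
  assumes c: "(\<lambda>x. cmod (c x)) summable_on UNIV"
  shows "level_trace l (perm_series (H_idx l) c f) k = (\<Sum>\<^sub>\<infinity>x. c x * of_nat (fixed_count l (f x) k))"
    and "(\<lambda>x. c x * of_nat (fixed_count l (f x) k)) summable_on UNIV"
proof -
  have kI: "ket \<gamma> \<in> ell2 (H_idx l)" if "\<gamma> \<in> level l k" for \<gamma> using that by (simp add: level_def)
  have "((\<lambda>x. \<Sum>\<gamma>\<in>level l k. c x * act (f x) (ket \<gamma>) \<gamma>) has_sum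
      (\<Sum>\<gamma>\<in>level l k. \<Sum>\<^sub>\<infinity>x. c x * act (f x) (ket \<gamma>) \<gamma>)) UNIV"
    by (rule has_sum_sum_fun, rule has_sum_infsum, rule series_summable[OF c kI])
  moreover have "(\<Sum>\<gamma>\<in>level l k. c x * act (f x) (ket \<gamma>) \<gamma>) = c x * of_nat (fixed_count l (f x) k)" for x
  proof -
    have "(\<Sum>\<gamma>\<in>level l k. act (f x) (ket \<gamma>) \<gamma>) = (\<Sum>\<gamma>\<in>level l k. if f x \<gamma> = Some \<gamma> then 1 else 0)"
      by (intro sum.cong) (auto simp: act_def ket_def split: option.split)
    also have "\<dots> = of_nat (fixed_count l (f x) k)"
      by (simp add: fixed_count_def sum.If_cases[OF finite_level] Int_def)
    finally show ?thesis by (simp add: sum_distrib_left[symmetric])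
  qed
  moreover have "level_trace l (perm_series (H_idx l) c f) k = (\<Sum>\<gamma>\<in>level l k. \<Sum>\<^sub>\<infinity>x. c x * act (f x) (ket \<gamma>) \<gamma>)"
    unfolding level_trace_def by (intro sum.cong refl) (simp add: perm_series_def on_ell2_def kI)
  ultimately have "((\<lambda>x. c x * of_nat (fixed_count l (f x) k)) has_sum level_trace l (perm_series (H_idx l) c f) k) UNIV"
    by simp
  then show "level_trace l (perm_series (H_idx l) c f) k = (\<Sum>\<^sub>\<infinity>x. c x * of_nat (fixed_count l (f x) k))"
    "(\<lambda>x. c x * of_nat (fixed_count l (f x) k)) summable_on UNIV"
    by (simp_all add: has_sum_iff)
qed

text \<open>For a generator of weight \<open>a\<close> the polynomial can be wrong only for
  \<open>k \<le> a + 1\<close>. There the error is polynomial in \<open>a\<close> and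
  \<open>1 + k \<le> 2 * (1 + a)\<close>, so any power of \<open>1 + k\<close> can be traded for one
  of \<open>1 + a\<close>, which the rapidly decreasing coefficients absorb.\<close>

lemma level_trace_expansion:
  assumes "T \<in> B_ops l"
  shows "\<exists>P E. rapidly_decaying E \<and> (\<forall>k. level_trace l T k = (\<Sum>j\<le>l. P j * of_nat (k choose j)) + E k)"
proof -
  obtain c :: "nat \<Rightarrow> complex" and f a where T: "T = perm_series (H_idx l) c f" "rapid c a" "\<And>x. genB l (a x) (f x)"
    using assms unfolding B_ops_def by (rule rapid_series_opsE) (rule that)
  define K where "K = (2 * real l + 1) ^ l"
  have K: "K \<ge> 0" by (simp add: K_def)
  have "\<forall>x. \<exists>p. (\<forall>j. \<bar>p j\<bar> \<le> K * (1 + real (a x)) ^ l) \<and>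
    (\<forall>k>a x + 1. real (fixed_count l (f x) k) = (\<Sum>j\<le>l. p j * real (k choose j)))"
    unfolding K_def using polynomial_count_expansion[OF genB_polynomial_count[OF T(3)]] by blast
  from choice[OF this] obtain p where p: "\<And>x j. \<bar>p x j\<bar> \<le> K * (1 + real (a x)) ^ l"
    "\<And>x k. k > a x + 1 \<Longrightarrow> real (fixed_count l (f x) k) = (\<Sum>j\<le>l. p x j * real (k choose j))" by blast
  have sp: "(\<lambda>x. c x * of_real (p x j)) summable_on UNIV" for j
  proof (rule abs_summable_summable, rule summable_on_comparison_test)
    show "(\<lambda>x. K * (cmod (c x) * (1 + real (a x)) ^ l)) summable_on UNIV"
      by (intro summable_on_cmult_right rapidD T)
    show "norm (c x * of_real (p x j)) \<le> K * (cmod (c x) * (1 + real (a x)) ^ l)" for x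
      using mult_left_mono[OF p(1)[of x j], of "cmod (c x)"] by (simp add: norm_mult mult_ac)
  qed auto
  define P where "P j = (\<Sum>\<^sub>\<infinity>x. c x * of_real (p x j))" for j
  define e where "e x k = real (fixed_count l (f x) k) - (\<Sum>j\<le>l. p x j * real (k choose j))" for x k
  define E where "E k = level_trace l T k - (\<Sum>j\<le>l. P j * of_nat (k choose j))" for k
  have E: "((\<lambda>x. c x * of_real (e x k)) has_sum E k) UNIV" for k
  proof -
    have "((\<lambda>x. \<Sum>j\<le>l. c x * of_real (p x j) * of_nat (k choose j)) has_sum (\<Sum>j\<le>l. P j * of_nat (k choose j))) UNIV"
      unfolding P_def by (intro has_sum_sum_fun has_sum_cmult_left has_sum_infsum sp)
    moreover have "((\<lambda>x. c x * of_nat (fixed_count l (f x) k)) has_sum level_trace l T k) UNIV"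
      using level_trace_series[OF rapid_summable[OF T(2)]] unfolding T(1) by (simp add: has_sum_iff)
    ultimately have "((\<lambda>x. c x * of_nat (fixed_count l (f x) k) + - (\<Sum>j\<le>l. c x * of_real (p x j) * of_nat (k choose j)))
        has_sum (level_trace l T k + - (\<Sum>j\<le>l. P j * of_nat (k choose j)))) UNIV"
      by (intro has_sum_add has_sum_uminusI)
    moreover have "c x * of_nat (fixed_count l (f x) k) + - (\<Sum>j\<le>l. c x * of_real (p x j) * of_nat (k choose j)) = c x * of_real (e x k)" for x
      by (simp add: e_def algebra_simps sum_distrib_left)
    ultimately show ?thesis by (simp add: E_def)
  qed
  have "rapidly_decaying E"
    unfolding rapidly_decaying_def
  proof
    fix m
    \<comment> \<open>The two summands bound the number of fixed points and the polynomial part;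
      \<open>M\<close> is at least both exponents \<open>l + 1\<close> and \<open>l + l\<close> that
      arise.\<close>
    define L where "L = 2 * 2 ^ (l + 1) + real (l + 1) * (K * 2 ^ l)"
    define M where "M = l + 1 + l"
    have eb: "\<bar>e x k\<bar> \<le> L * (1 + real (a x)) ^ M" if k: "k \<le> a x + 1" for x k
    proof -
      let ?a = "1 + real (a x)"
      have a1: "1 \<le> ?a" by simp
      have k1: "1 + real k \<le> 2 * ?a" using k by simp
      have "real (fixed_count l (f x) k) \<le> real (2 * (k + 1) ^ (l + 1))" using fixed_count_le of_nat_le_iff by blast
      also have "\<dots> = 2 * (1 + real k) ^ (l + 1)"
        by (simp only: of_nat_mult of_nat_power of_nat_add of_nat_1 of_nat_numeral add.commute)
      also have "\<dots> \<le> 2 * (2 * ?a) ^ (l + 1)" by (intro mult_left_mono power_mono k1) auto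
      also have "\<dots> = 2 * 2 ^ (l + 1) * ?a ^ (l + 1)" by (simp only: power_mult_distrib mult.assoc)
      also have "\<dots> \<le> 2 * 2 ^ (l + 1) * ?a ^ M" by (intro mult_left_mono power_increasing a1) (auto simp: M_def)
      finally have 1: "real (fixed_count l (f x) k) \<le> 2 * 2 ^ (l + 1) * ?a ^ M" .
      have "\<bar>\<Sum>j\<le>l. p x j * real (k choose j)\<bar> \<le> (\<Sum>j\<le>l. \<bar>p x j * real (k choose j)\<bar>)" by (rule sum_abs)
      also have "\<dots> \<le> (\<Sum>j\<le>l. K * 2 ^ l * ?a ^ M)"
      proof (rule sum_mono)
        fix j assume j: "j \<in> {..l}"
        have "real (k choose j) \<le> (1 + real k) ^ j"
        proof (cases "j \<le> k")
          case True
          have "real (k choose j) \<le> real (k ^ j)" using binomial_le_pow[OF True] of_nat_le_iff by blast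
          also have "\<dots> = real k ^ j" by simp
          also have "\<dots> \<le> (1 + real k) ^ j" by (intro power_mono) auto
          finally show ?thesis .
        qed (simp add: binomial_eq_0)
        also have "\<dots> \<le> (1 + real k) ^ l" using j by (intro power_increasing) auto
        also have "\<dots> \<le> (2 * ?a) ^ l" by (intro power_mono k1) auto
        finally have "\<bar>p x j\<bar> * real (k choose j) \<le> (K * ?a ^ l) * (2 * ?a) ^ l"
          using p(1)[of x j] K by (intro mult_mono) auto
        also have "\<dots> = K * 2 ^ l * ?a ^ (l + l)" by (simp only: power_mult_distrib power_add mult_ac)
        also have "\<dots> \<le> K * 2 ^ l * ?a ^ M" using K by (intro mult_left_mono power_increasing a1) (auto simp: M_def)
        finally show "\<bar>p x j * real (k choose j)\<bar> \<le> K * 2 ^ l * ?a ^ M" by (simp add: abs_mult)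
      qed
      also have "\<dots> = real (l + 1) * (K * 2 ^ l) * ?a ^ M" by simp
      finally have 2: "\<bar>\<Sum>j\<le>l. p x j * real (k choose j)\<bar> \<le> real (l + 1) * (K * 2 ^ l) * ?a ^ M" .
      have "\<bar>e x k\<bar> \<le> 2 * 2 ^ (l + 1) * ?a ^ M + real (l + 1) * (K * 2 ^ l) * ?a ^ M"
        unfolding e_def using 1 2 by linarith
      also have "\<dots> = L * ?a ^ M" by (simp only: L_def distrib_right)
      finally show ?thesis .
    qed
    let ?g = "\<lambda>x. L * 2 ^ m * (cmod (c x) * (1 + real (a x)) ^ (M + m))"
    have L: "L \<ge> 0" using K by (simp add: L_def)
    have le: "norm (c x * of_real (e x k)) * (1 + real k) ^ m \<le> ?g x" for x k
    proof (cases "k \<le> a x + 1")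
      case True
      have "(1 + real k) ^ m \<le> (2 * (1 + real (a x))) ^ m" using True by (intro power_mono) auto
      then have "\<bar>e x k\<bar> * (1 + real k) ^ m \<le> (L * (1 + real (a x)) ^ M) * (2 * (1 + real (a x))) ^ m"
        using eb[OF True] L by (intro mult_mono) auto
      from mult_left_mono[OF this norm_ge_zero[of "c x"]] show ?thesis
        by (simp only: norm_mult norm_of_real power_mult_distrib power_add mult_ac)
    next
      case False
      then have "e x k = 0" using p(2)[of x k] by (simp add: e_def)
      then show ?thesis using L by simp
    qed
    have g: "?g summable_on UNIV" by (intro summable_on_cmult_right rapidD T)
    have "cmod (E k) * (1 + real k) ^ m \<le> infsum ?g UNIV" for k
    proof -
      let ?t = "\<lambda>x. c x * of_real (e x k) * (1 + of_nat k) ^ m"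
      have n1: "norm (1 + of_nat k :: complex) = 1 + real k"
        using norm_of_nat[of "Suc k", where ?'a = complex] by simp
      have le': "norm (?t x) \<le> ?g x" for x using le[of x k] by (simp add: norm_mult norm_power n1)
      have s: "(\<lambda>x. norm (?t x)) summable_on UNIV" by (rule summable_on_comparison_test[OF g le']) auto
      have "E k * (1 + of_nat k) ^ m = infsum ?t UNIV"
        by (rule infsumI[symmetric]) (intro has_sum_cmult_left E)
      then have "norm (E k * (1 + of_nat k) ^ m) \<le> (\<Sum>\<^sub>\<infinity>x. norm (?t x))"
        using norm_infsum_bound[OF s] by simp
      also have "\<dots> \<le> infsum ?g UNIV" by (rule infsum_mono[OF s g le'])
      finally show ?thesis by (simp add: norm_mult norm_power n1)
    qed
    then show "\<exists>C. \<forall>k. cmod (E k) * (1 + real k) ^ m \<le> C" by blast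
  qed
  then show ?thesis by (intro exI[of _ P] exI[of _ E]) (simp add: E_def)
qed

section \<open>Meromorphic continuation of Dirichlet series with polynomial coefficients\<close>

subsection \<open>Continuation of the zeta function\<close>

lemma holomorphic_on_suminf:
  fixes f :: "nat \<Rightarrow> complex \<Rightarrow> complex"
  assumes S: "open S" and hol: "\<And>n. f n holomorphic_on S"
    and dom: "\<And>z. z \<in> S \<Longrightarrow> \<exists>d h. 0 < d \<and> summable h \<and> (\<forall>n. \<forall>w\<in>ball z d \<inter> S. norm (f n w) \<le> h n)"
  shows "(\<lambda>z. \<Sum>n. f n z) holomorphic_on S"
proof -
  have "\<exists>g g'. \<forall>x\<in>S. ((\<lambda>n. f n x) sums g x) \<and> ((\<lambda>n. deriv (f n) x) sums g' x) \<and>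
      (g has_field_derivative g' x) (at x)"
  proof (rule series_and_derivative_comparison_local[OF S])
    show "(f n has_field_derivative deriv (f n) x) (at x)" if "x \<in> S" for n x
      using holomorphic_derivI[OF hol S that] .
    show "\<exists>d h. 0 < d \<and> summable h \<and> (\<forall>\<^sub>F n in sequentially. \<forall>y\<in>ball x d \<inter> S. norm (f n y) \<le> h n)"
      if "x \<in> S" for x
      using dom[OF that] by (auto intro: always_eventually)
  qed
  then obtain g g' where g: "\<And>x. x \<in> S \<Longrightarrow> (\<lambda>n. f n x) sums g x"
      "\<And>x. x \<in> S \<Longrightarrow> (g has_field_derivative g' x) (at x)"
    by blast
  have "g holomorphic_on S"
    using g(2) by (auto simp: holomorphic_on_open[OF S])
  moreover have "(\<lambda>z. \<Sum>n. f n z) holomorphic_on S \<longleftrightarrow> g holomorphic_on S"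
    by (intro holomorphic_cong refl) (use g(1) in \<open>simp add: sums_iff\<close>)
  ultimately show ?thesis
    by simp
qed

lemma holomorphic_on_gbinomial [holomorphic_intros]:
  "f holomorphic_on S \<Longrightarrow> (\<lambda>z. f z gchoose k) holomorphic_on S"
  unfolding gbinomial_prod_rev by (intro holomorphic_intros) auto

lemma norm_of_nat_powr: "norm (of_nat n powr s :: complex) = real n powr Re s"
  by (subst norm_powr_real_powr) auto

text \<open>The term \<open>n = 0\<close> is 0 because \<open>0 powr x = 0\<close>.\<close>

definition dirichlet_zeta :: "complex \<Rightarrow> complex" where
  "dirichlet_zeta s = (\<Sum>n. of_nat n powr (- s))"

lemma summable_of_nat_powr:
  assumes "Re s > 1"
  shows "summable (\<lambda>n. of_nat n powr (- s) :: complex)"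
  by (rule summable_norm_cancel) (use assms in \<open>simp add: norm_of_nat_powr summable_real_powr_iff\<close>)

text \<open>The remainder of the Taylor expansion of \<open>(n + 1)\<^sup>1\<^sup>-\<^sup>s\<close> in powers of \<open>1/n\<close>; summing it over
  \<open>n\<close> expresses \<open>(s - 1) \<zeta>(s)\<close> by the values of \<open>\<zeta>\<close> at \<open>s + 1, s + 2, \<dots>\<close>.\<close>

definition shift_remainder :: "nat \<Rightarrow> nat \<Rightarrow> complex \<Rightarrow> complex" where
  "shift_remainder M n s = of_nat (Suc n) powr (1 - s) -
     (\<Sum>j\<le>M. ((1 - s) gchoose j) * of_nat n powr (1 - s - of_nat j))"

text \<open>Taylor's theorem for \<open>x powr (1 - s)\<close> on the segment from \<open>n\<close>
  to \<open>n + 1\<close>. The condition on \<open>s\<close> makes the exponent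
  \<open>- Re s - M\<close> nonpositive, so the modulus of the power in the derivative of order
  \<open>M + 1\<close> is largest at \<open>n\<close>.\<close>

lemma shift_remainder_bound:
  assumes "n > 0" and s: "Re s \<ge> - real M"
  shows "norm (shift_remainder M n s) \<le>
    real (Suc M) * norm ((1 - s) gchoose Suc M) * real n powr (- Re s - real M)"
proof -
  \<comment> \<open>\<open>f i\<close> is the derivative of order \<open>i\<close> of
    \<open>x powr (1 - s)\<close>; the falling factorial is written as \<open>fact i\<close> times a
    binomial coefficient.\<close>
  define f where "f = (\<lambda>i (x::complex). fact i * ((1 - s) gchoose i) * x powr (1 - s - of_nat i))"
  define B where "B = fact (Suc M) * norm ((1 - s) gchoose Suc M) * real n powr (- Re s - real M)"
  let ?S = "closed_segment (of_nat n) (of_nat (Suc n)) :: complex set"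
  have mem: "\<exists>r. x = of_real r \<and> r \<ge> real n" if "x \<in> ?S" for x
  proof -
    obtain u where u: "0 \<le> u" "u \<le> 1" "x = (1 - u) *\<^sub>R of_nat n + u *\<^sub>R of_nat (Suc n)"
      using \<open>x \<in> ?S\<close> by (auto simp: in_segment)
    have "x = of_real (real n + u)"
      by (simp add: u(3) scaleR_conv_of_real algebra_simps)
    with u(1) show ?thesis by (intro exI[of _ "real n + u"]) auto
  qed
  have "norm (f 0 (of_nat (Suc n)) - (\<Sum>i\<le>M. f i (of_nat n) * (of_nat (Suc n) - of_nat n) ^ i / fact i))
      \<le> B * norm (of_nat (Suc n) - of_nat n :: complex) ^ Suc M / fact M"
  proof (rule complex_Taylor[of ?S])
    show "(f i has_field_derivative f (Suc i) x) (at x within ?S)" if x: "x \<in> ?S" for i x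
    proof -
      obtain r where r: "x = of_real r" "r \<ge> real n" using mem[OF x] by blast
      then have "x \<notin> \<real>\<^sub>\<le>\<^sub>0" using \<open>n > 0\<close> by (auto simp: complex_nonpos_Reals_iff)
      then have "(f i has_field_derivative
          fact i * ((1 - s) gchoose i) * ((1 - s - of_nat i) * x powr (1 - s - of_nat i - 1))) (at x within ?S)"
        unfolding f_def
        by (rule has_field_derivative_at_within[OF DERIV_cmult[OF has_field_derivative_powr]])
      also have "fact i * ((1 - s) gchoose i) * ((1 - s - of_nat i) * x powr (1 - s - of_nat i - 1)) = f (Suc i) x"
      proof -
        have "(1 - s - of_nat i) * ((1 - s) gchoose i) = of_nat (Suc i) * ((1 - s) gchoose Suc i)"
          using gbinomial_mult_1[of "1 - s" i] by (simp only: left_diff_distrib) simp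
        moreover have "1 - s - of_nat i - 1 = 1 - s - of_nat (Suc i)" by simp
        ultimately show ?thesis unfolding f_def by (simp add: ac_simps)
      qed
      finally show ?thesis .
    qed
    show "norm (f (Suc M) x) \<le> B" if x: "x \<in> ?S" for x
    proof -
      obtain r where r: "x = of_real r" "r \<ge> real n" using mem[OF x] by blast
      have "norm (x powr (1 - s - of_nat (Suc M))) = r powr (- Re s - real M)"
        using r \<open>n > 0\<close> by (simp add: norm_powr_real_powr)
      also have "\<dots> \<le> real n powr (- Re s - real M)"
        using r \<open>n > 0\<close> s by (intro powr_mono2') auto
      finally show ?thesis
        unfolding f_def B_def norm_mult
        by (intro mult_mono) (auto simp del: fact_Suc)
    qed
  qed auto
  moreover have "f 0 (of_nat (Suc n)) - (\<Sum>i\<le>M. f i (of_nat n) * (of_nat (Suc n) - of_nat n) ^ i / fact i)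
      = shift_remainder M n s"
    by (simp add: f_def shift_remainder_def)
  moreover have "B * norm (of_nat (Suc n) - of_nat n :: complex) ^ Suc M / fact M =
      real (Suc M) * norm ((1 - s) gchoose Suc M) * real n powr (- Re s - real M)"
    by (simp add: B_def field_simps)
  ultimately show ?thesis by simp
qed

text \<open>By the Taylor bound the terms are of order \<open>n powr (- Re s - M)\<close>, locally
  uniformly in \<open>s\<close>, hence summable for \<open>Re s > 1 - M\<close>.\<close>

lemma holomorphic_on_suminf_shift_remainder:
  "(\<lambda>s. \<Sum>n. shift_remainder M (Suc n) s) holomorphic_on {s. Re s > 1 - real M}"
proof (rule holomorphic_on_suminf)
  show "open {s. Re s > 1 - real M}" by (rule open_halfspace_Re_gt)
  show "shift_remainder M (Suc n) holomorphic_on {s. Re s > 1 - real M}" for n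
    unfolding shift_remainder_def by (intro holomorphic_intros)
  fix z assume z: "z \<in> {s. Re s > 1 - real M}"
  \<comment> \<open>Half the distance to the boundary line, so that the ball of radius
    \<open>d\<close> keeps the distance \<open>d\<close> from it.\<close>
  define d where "d = (Re z - (1 - real M)) / 2"
  have "d > 0" using z by (simp add: d_def)
  have "compact ((\<lambda>s. (1 - s) gchoose Suc M) ` cball z d)"
    by (intro compact_continuous_image holomorphic_on_imp_continuous_on holomorphic_intros) auto
  then obtain K where K: "\<And>s. s \<in> cball z d \<Longrightarrow> norm ((1 - s) gchoose Suc M) \<le> K"
    using compact_imp_bounded bounded_iff by (metis (mono_tags, lifting) imageI)
  define h where "h n = real (Suc M) * K * real (Suc n) powr (- (1 - real M + d) - real M)" for n
  have "summable (\<lambda>n. real n powr (- (1 - real M + d) - real M))"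
    using \<open>d > 0\<close> by (simp add: summable_real_powr_iff)
  then have "summable (\<lambda>n. real (Suc n) powr (- (1 - real M + d) - real M))"
    by (rule iffD2[OF summable_Suc_iff])
  then have "summable h" unfolding h_def by (rule summable_mult)
  moreover have "norm (shift_remainder M (Suc n) w) \<le> h n" if w: "w \<in> ball z d" for n w
  proof -
    have "\<bar>Re z - Re w\<bar> < d" using w abs_Re_le_cmod[of "z - w"] by (auto simp: dist_norm)
    moreover have "Re z = 1 - real M + 2 * d" by (simp add: d_def field_simps)
    ultimately have Rew: "Re w \<ge> 1 - real M + d" by linarith
    have "norm (shift_remainder M (Suc n) w) \<le>
        real (Suc M) * norm ((1 - w) gchoose Suc M) * real (Suc n) powr (- Re w - real M)"
      using Rew \<open>d > 0\<close> by (intro shift_remainder_bound) auto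
    also have "\<dots> \<le> h n" unfolding h_def
      using w K[of w] Rew norm_ge_zero[of "(1 - w) gchoose Suc M"]
      by (intro mult_mono powr_mono mult_nonneg_nonneg) (auto simp del: norm_ge_zero intro: order_trans)
    finally show ?thesis .
  qed
  ultimately show "\<exists>d h. 0 < d \<and> summable h \<and>
      (\<forall>n. \<forall>w\<in>ball z d \<inter> {s. Re s > 1 - real M}. norm (shift_remainder M (Suc n) w) \<le> h n)"
    using \<open>d > 0\<close> by blast
qed

text \<open>The expansion is summed over \<open>n \<ge> 1\<close>: the differences telescope to
  \<open>- 1\<close>, the term \<open>j = 1\<close> gives \<open>(1 - s) \<zeta>(s)\<close>, and the
  others contain \<open>\<zeta>(s + i)\<close>. Their coefficients are rewritten so that only the
  products \<open>(s + i - 1) \<zeta>(s + i)\<close> appear, to which an induction applies.\<close>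

lemma zeta_recursion:
  assumes s: "Re s > 1"
  shows "(s - 1) * dirichlet_zeta s =
    1 - (\<Sum>i=1..M. ((1 - s) gchoose i) / of_nat (Suc i) * ((s + of_nat i - 1) * dirichlet_zeta (s + of_nat i)))
      + (\<Sum>n. shift_remainder (Suc M) (Suc n) s)"
proof -
  let ?z = "\<lambda>j. dirichlet_zeta (s + of_nat j - 1)"
  have zs: "(\<lambda>n. of_nat (Suc n) powr (1 - s - of_nat j)) sums ?z j" if "j \<ge> 1" for j
  proof -
    have "Re (s + of_nat j - 1) > 1" using s that by simp
    from summable_of_nat_powr[OF this]
    have "(\<lambda>n. of_nat n powr (- (s + of_nat j - 1)) :: complex) sums ?z j"
      unfolding dirichlet_zeta_def by (rule summable_sums)
    then have "(\<lambda>n. of_nat (Suc n) powr (- (s + of_nat j - 1)) :: complex) sums ?z j"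
      by (subst sums_Suc_iff) simp
    moreover have "- (s + of_nat j - 1) = 1 - s - of_nat j" by simp
    ultimately show ?thesis by (simp only:)
  qed
  have "(\<lambda>n. of_nat (Suc n) powr (1 - s) :: complex) \<longlonglongrightarrow> 0"
  proof (rule tendsto_norm_zero_cancel)
    have "(\<lambda>n. real (Suc n) powr (1 - Re s)) \<longlonglongrightarrow> 0"
      using s by (intro tendsto_neg_powr filterlim_compose[OF filterlim_real_sequentially] filterlim_Suc) auto
    then show "(\<lambda>n. norm (of_nat (Suc n) powr (1 - s) :: complex)) \<longlonglongrightarrow> 0"
      by (simp only: norm_of_nat_powr) simp
  qed
  from telescope_sums[OF this]
  have "(\<lambda>n. of_nat (Suc (Suc n)) powr (1 - s) - of_nat (Suc n) powr (1 - s) :: complex) sums (- 1)"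
    by simp
  moreover have "(\<lambda>n. \<Sum>j=1..Suc M. ((1 - s) gchoose j) * of_nat (Suc n) powr (1 - s - of_nat j)) sums
      (\<Sum>j=1..Suc M. ((1 - s) gchoose j) * ?z j)"
    by (intro sums_sum sums_mult zs) auto
  ultimately have "(\<lambda>n. of_nat (Suc (Suc n)) powr (1 - s) - of_nat (Suc n) powr (1 - s) -
      (\<Sum>j=1..Suc M. ((1 - s) gchoose j) * of_nat (Suc n) powr (1 - s - of_nat j))) sums
      (- 1 - (\<Sum>j=1..Suc M. ((1 - s) gchoose j) * ?z j))"
    by (rule sums_diff)
  moreover have "of_nat (Suc (Suc n)) powr (1 - s) - of_nat (Suc n) powr (1 - s) -
      (\<Sum>j=1..Suc M. ((1 - s) gchoose j) * of_nat (Suc n) powr (1 - s - of_nat j)) = shift_remainder (Suc M) (Suc n) s" for n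
    unfolding shift_remainder_def atMost_atLeast0 by (subst sum.atLeast_Suc_atMost[of 0]) (auto simp: algebra_simps)
  ultimately have "(\<Sum>n. shift_remainder (Suc M) (Suc n) s) = - 1 - (\<Sum>j=1..Suc M. ((1 - s) gchoose j) * ?z j)"
    by (simp add: sums_iff)
  also have "(\<Sum>j=1..Suc M. ((1 - s) gchoose j) * ?z j) =
      (1 - s) * dirichlet_zeta s + (\<Sum>j=Suc 1..Suc M. ((1 - s) gchoose j) * ?z j)"
    by (subst sum.atLeast_Suc_atMost) auto
  also have "(\<Sum>j=Suc 1..Suc M. ((1 - s) gchoose j) * ?z j) =
      (\<Sum>i=1..M. ((1 - s) gchoose Suc i) * dirichlet_zeta (s + of_nat i))"
    by (subst sum.shift_bounds_cl_Suc_ivl) simp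
  also have "\<dots> = (\<Sum>i=1..M. - (((1 - s) gchoose i) / of_nat (Suc i) * ((s + of_nat i - 1) * dirichlet_zeta (s + of_nat i))))"
  proof (rule sum.cong[OF refl])
    fix i
    have "((1 - s) gchoose Suc i) = - (((1 - s) gchoose i) / of_nat (Suc i) * (s + of_nat i - 1))"
      using gbinomial_mult_1[of "1 - s" i] by (simp add: field_simps del: of_nat_Suc)
    then show "((1 - s) gchoose Suc i) * dirichlet_zeta (s + of_nat i) =
        - (((1 - s) gchoose i) / of_nat (Suc i) * ((s + of_nat i - 1) * dirichlet_zeta (s + of_nat i)))" by simp
  qed
  finally have *: "(\<Sum>n. shift_remainder (Suc M) (Suc n) s) = - 1 - ((1 - s) * dirichlet_zeta s +
      - (\<Sum>i=1..M. ((1 - s) gchoose i) / of_nat (Suc i) * ((s + of_nat i - 1) * dirichlet_zeta (s + of_nat i))))"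
    unfolding sum_negf .
  have "(s - 1) * z = 1 - t + r" if "r = - 1 - ((1 - s) * z + - t)" for r z t
    using that by (simp add: algebra_simps)
  from this[OF *] show ?thesis .
qed

text \<open>The recursion extends the function by one unit to the left, since for
  \<open>i \<ge> 1\<close> the point \<open>s + i\<close> lies in the half-plane already treated.
  The value at 1 is asserted from \<open>M = 1\<close> on because the first half-plane does not
  contain 1.\<close>

lemma zeta_continuation_halfplane:
  "\<exists>G. G holomorphic_on {s. Re s > 1 - real M} \<and> (M > 0 \<longrightarrow> G 1 = 1) \<and> (\<forall>s. Re s > 1 \<longrightarrow> G s = (s - 1) * dirichlet_zeta s)"
proof (induction M)
  case 0
  have "dirichlet_zeta holomorphic_on {s. Re s > 1}"
    unfolding dirichlet_zeta_def
  proof (rule holomorphic_on_suminf)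
    show "open {s. Re s > 1}" by (rule open_halfspace_Re_gt)
    show "(\<lambda>s. of_nat n powr - s) holomorphic_on {s. Re s > 1}" for n by (intro holomorphic_intros)
    fix z assume z: "z \<in> {s. Re s > 1}"
    define d where "d = (Re z - 1) / 2"
    have "d > 0" using z by (simp add: d_def)
    have "norm (of_nat n powr - w :: complex) \<le> real n powr (- (1 + d))" if "w \<in> ball z d" for n w
    proof (cases "n = 0")
      case False
      have "\<bar>Re z - Re w\<bar> < d" using that abs_Re_le_cmod[of "z - w"] by (auto simp: dist_norm)
      moreover have "Re z = 1 + 2 * d" by (simp add: d_def field_simps)
      ultimately have "Re w \<ge> 1 + d" by linarith
      with False show ?thesis by (auto simp: norm_of_nat_powr intro!: powr_mono)
    qed auto
    moreover have "summable (\<lambda>n. real n powr (- (1 + d)))"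
      using \<open>d > 0\<close> by (simp add: summable_real_powr_iff)
    ultimately show "\<exists>d h. 0 < d \<and> summable h \<and> (\<forall>n. \<forall>w\<in>ball z d \<inter> {s. Re s > 1}. norm (of_nat n powr - w :: complex) \<le> h n)"
      using \<open>d > 0\<close> by blast
  qed
  then show ?case by (intro exI[of _ "\<lambda>s. (s - 1) * dirichlet_zeta s"]) (auto intro!: holomorphic_intros)
next
  case (Suc M)
  then obtain G where G: "G holomorphic_on {s. Re s > 1 - real M}"
    "\<And>s. Re s > 1 \<Longrightarrow> G s = (s - 1) * dirichlet_zeta s" by blast
  define H where "H s = 1 - (\<Sum>i=1..M. ((1 - s) gchoose i) / of_nat (Suc i) * G (s + of_nat i))
      + (\<Sum>n. shift_remainder (Suc M) (Suc n) s)" for s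
  have "(\<lambda>s. G (s + of_nat i)) holomorphic_on {s. Re s > 1 - real (Suc M)}" if "i \<ge> 1" for i
    using that by (intro holomorphic_on_compose_gen[OF _ G(1), unfolded o_def]) (auto intro!: holomorphic_intros)
  then have "H holomorphic_on {s. Re s > 1 - real (Suc M)}"
    unfolding H_def by (intro holomorphic_intros holomorphic_on_suminf_shift_remainder) (auto simp del: of_nat_Suc)
  moreover have "H s = (s - 1) * dirichlet_zeta s" if "Re s > 1" for s
    unfolding H_def zeta_recursion[OF that, of M]
    by (intro arg_cong2[where f = "(+)"] arg_cong2[where f = "(-)"] sum.cong refl) (use that in \<open>simp add: G(2)\<close>)
  \<comment> \<open>At \<open>s = 1\<close> the binomials \<open>0 gchoose i\<close> with
    \<open>i \<ge> 1\<close> and all remainders vanish.\<close>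
  moreover have "H 1 = 1"
    by (simp add: H_def shift_remainder_def gbinomial_0_left if_distrib[of "\<lambda>x. x * _"] cong: if_cong
        del: of_nat_Suc)
  ultimately show ?case by blast
qed

lemma zeta_continuation:
  "\<exists>G. G holomorphic_on UNIV \<and> G 1 = 1 \<and> (\<forall>s. Re s > 1 \<longrightarrow> G s = (s - 1) * dirichlet_zeta s)"
proof -
  let ?H = "\<lambda>M. {s. Re s > 1 - real M}"
  obtain G where G: "\<And>M. G M holomorphic_on ?H M" "\<And>M. M > 0 \<Longrightarrow> G M 1 = 1"
    "\<And>M s. Re s > 1 \<Longrightarrow> G M s = (s - 1) * dirichlet_zeta s"
    using zeta_continuation_halfplane by metis
  have eq: "G M s = G N s" if "M \<le> N" "s \<in> ?H M" for M N s
  proof (rule analytic_continuation_open[of "{s. Re s > 1}" "?H M" "G M" "G N"])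
    show "G N holomorphic_on ?H M" by (rule holomorphic_on_subset[OF G(1)]) (use that in auto)
    show "open (?H M)" "open {s. Re s > 1}" by (rule open_halfspace_Re_gt)+
    show "connected (?H M)" by (intro convex_connected convex_halfspace_Re_gt)
    have "2 \<in> {s. Re s > 1}" by simp
    then show "{s. Re s > 1} \<noteq> {}" by blast
    show "G M z = G N z" if "z \<in> {s. Re s > 1}" for z using that G(3) by simp
  qed (use that G in auto)
  \<comment> \<open>An index with \<open>Re s \<ge> 2 - N s\<close>, so that \<open>s\<close> lies
    in its half-plane; by the identity theorem every other admissible index gives the same
    value.\<close>
  define N where "N s = nat \<lceil>2 - Re s\<rceil>" for s
  define F where "F s = G (N s) s" for s
  have N: "s \<in> ?H (N s)" for s unfolding N_def by (auto; linarith)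
  have F: "F s = G M s" if "s \<in> ?H M" for s M
  proof (cases "M \<le> N s")
    case True
    then show ?thesis using eq[OF True that] by (simp add: F_def)
  next
    case False
    then have "N s \<le> M" by simp
    from eq[OF this N] show ?thesis by (simp add: F_def)
  qed
  have "F holomorphic_on ?H M" for M
  proof -
    have "F holomorphic_on ?H M \<longleftrightarrow> G M holomorphic_on ?H M"
      by (rule holomorphic_cong[OF refl F])
    then show ?thesis using G(1) by simp
  qed
  then have "F field_differentiable (at s)" for s
    using holomorphic_on_imp_differentiable_at[of F "?H (N s)" s] N[of s] open_halfspace_Re_gt by blast
  then have "F holomorphic_on UNIV" by (simp add: holomorphic_on_def field_differentiable_at_within)
  moreover have "F 1 = 1" using F[of 1 1] G(2)[of 1] by simp
  moreover have "F s = (s - 1) * dirichlet_zeta s" if "Re s > 1" for s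
    using F[of s 0] that G(3) by simp
  ultimately show ?thesis by blast
qed

subsection \<open>Zeta functions\<close>

text \<open>The entire function \<open>(s - 1) \<zeta>(s)\<close>. Its value 1 at 1 is the residue
  of \<open>\<zeta>\<close>, which guarantees that the expected poles are really present.\<close>

definition zeta_reg :: "complex \<Rightarrow> complex" where
  "zeta_reg = (SOME G. G holomorphic_on UNIV \<and> G 1 = 1 \<and> (\<forall>s. Re s > 1 \<longrightarrow> G s = (s - 1) * dirichlet_zeta s))"

lemma zeta_reg: "zeta_reg holomorphic_on UNIV" "zeta_reg 1 = 1" "Re s > 1 \<Longrightarrow> zeta_reg s = (s - 1) * dirichlet_zeta s"
  using someI_ex[OF zeta_continuation] unfolding zeta_reg_def by auto

lemma zeta_reg_holomorphic [holomorphic_intros]: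
  "f holomorphic_on S \<Longrightarrow> (\<lambda>z. zeta_reg (f z)) holomorphic_on S"
  using holomorphic_on_compose_gen[of f S zeta_reg UNIV] zeta_reg(1) by (simp add: o_def)

definition tail_series :: "(nat \<Rightarrow> complex) \<Rightarrow> complex \<Rightarrow> complex" where
  "tail_series E z = (\<Sum>n. E n * of_nat n powr (- z))"

text \<open>Decay of order \<open>M + 2\<close> provides one summable majorant for the whole
  half-plane \<open>Re w \<ge> - M\<close>.\<close>

lemma rapidly_decaying_bound:
  assumes "rapidly_decaying E"
  obtains C where "\<And>n w. Re w \<ge> - real M \<Longrightarrow> norm (E n * of_nat n powr (- w)) \<le> C * real n powr (- 2)"
proof -
  obtain C where C: "\<And>n. cmod (E n) * (1 + real n) ^ (M + 2) \<le> C"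
    using assms unfolding rapidly_decaying_def by blast
  show ?thesis
  proof (rule that[of C])
    fix n :: nat and w :: complex assume w: "Re w \<ge> - real M"
    show "norm (E n * of_nat n powr (- w)) \<le> C * real n powr (- 2)"
    proof (cases "n = 0")
      case False
      have "real n powr (- Re w) \<le> real n powr real (M + 2) * real n powr (- 2)"
        using False w by (subst powr_add[symmetric], intro powr_mono) auto
      also have "real n powr real (M + 2) = real n ^ (M + 2)" using False by (simp only: powr_realpow of_nat_0_less_iff neq0_conv)
      also have "\<dots> \<le> (1 + real n) ^ (M + 2)" by (intro power_mono) auto
      finally have "real n powr (- Re w) \<le> (1 + real n) ^ (M + 2) * real n powr (- 2)" by (simp add: mult_right_mono)
      from mult_left_mono[OF this norm_ge_zero[of "E n"]]
      have "norm (E n * of_nat n powr (- w)) \<le> cmod (E n) * (1 + real n) ^ (M + 2) * real n powr (- 2)"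
        by (simp add: norm_mult norm_of_nat_powr mult.assoc)
      also have "\<dots> \<le> C * real n powr (- 2)" by (intro mult_right_mono C) auto
      finally show ?thesis .
    qed auto
  qed
qed

lemma tail_series_holomorphic:
  assumes E: "rapidly_decaying E"
  shows "tail_series E holomorphic_on UNIV"
  unfolding tail_series_def
proof (rule holomorphic_on_suminf)
  show "(\<lambda>z. E n * of_nat n powr (- z)) holomorphic_on UNIV" for n by (intro holomorphic_intros)
  fix z :: complex
  define M where "M = nat \<lceil>\<bar>Re z\<bar> + 1\<rceil>"
  obtain C where C: "\<And>n w. Re w \<ge> - real M \<Longrightarrow> norm (E n * of_nat n powr (- w)) \<le> C * real n powr (- 2)"
    using rapidly_decaying_bound[OF E, of M] by blast
  have "Re w \<ge> - real M" if "w \<in> ball z 1" for w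
  proof -
    have "\<bar>Re z - Re w\<bar> < 1" using that abs_Re_le_cmod[of "z - w"] by (auto simp: dist_norm)
    then show ?thesis unfolding M_def by linarith
  qed
  then have "\<forall>n. \<forall>w\<in>ball z 1 \<inter> UNIV. norm (E n * of_nat n powr (- w)) \<le> C * real n powr (- 2)"
    using C by auto
  moreover have "summable (\<lambda>n. C * real n powr (- 2))" by (intro summable_mult) (simp add: summable_real_powr_iff)
  ultimately show "\<exists>d h. 0 < d \<and> summable h \<and> (\<forall>n. \<forall>w\<in>ball z d \<inter> UNIV. norm (E n * of_nat n powr (- w)) \<le> h n)"
    by (intro exI[of _ 1] exI[of _ "\<lambda>n. C * real n powr (- 2)"]) simp
qed auto

lemma tail_series_sums:
  assumes E: "rapidly_decaying E"
  shows "(\<lambda>n. E n * of_nat n powr (- z)) sums tail_series E z"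
proof -
  obtain C where C: "\<And>n w. Re w \<ge> - real (nat \<lceil>\<bar>Re z\<bar>\<rceil>) \<Longrightarrow> norm (E n * of_nat n powr (- w)) \<le> C * real n powr (- 2)"
    using rapidly_decaying_bound[OF E, of "nat \<lceil>\<bar>Re z\<bar>\<rceil>"] by blast
  have "Re z \<ge> - real (nat \<lceil>\<bar>Re z\<bar>\<rceil>)" by linarith
  note C' = C[OF this]
  have "summable (\<lambda>n. C * real n powr (- 2))" by (intro summable_mult) (simp add: summable_real_powr_iff)
  then have "summable (\<lambda>n. E n * of_nat n powr (- z))"
    by (rule summable_norm_cancel[OF summable_comparison_test'[where N = 0]]) (use C' in simp)
  then show ?thesis unfolding tail_series_def by (rule summable_sums)
qed

text \<open>The continuation of the Dirichlet series with coefficients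
  \<open>poly Q k + E k\<close>: a monomial of degree \<open>i\<close> contributes
  \<open>\<zeta>(z - i)\<close>, with its pole at \<open>i + 1\<close>. Level 0 contributes nothing,
  as \<open>0 powr x = 0\<close>, in accordance with the convention for the negative powers of
  \<open>|D|\<close> on the kernel.\<close>

definition zeta_sum :: "complex poly \<Rightarrow> (nat \<Rightarrow> complex) \<Rightarrow> complex \<Rightarrow> complex" where
  "zeta_sum Q E z = (\<Sum>i\<le>degree Q. coeff Q i * (zeta_reg (z - of_nat i) / (z - of_nat i - 1))) + tail_series E z"

lemma zeta_sum_sums:
  assumes E: "rapidly_decaying E" and z: "Re z > real (degree Q) + 1"
    and t: "\<And>k. t k = poly Q (of_nat k) + E k"
  shows "(\<lambda>k. t k * of_nat k powr (- z)) sums zeta_sum Q E z"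
proof -
  have 1: "(\<lambda>k. of_nat k ^ i * of_nat k powr (- z)) sums (zeta_reg (z - of_nat i) / (z - of_nat i - 1))"
    if i: "i \<le> degree Q" for i
  proof -
    have Re: "Re (z - of_nat i) > 1" using z i by simp
    have "of_nat k ^ i * of_nat k powr (- z) = (of_nat k powr (- (z - of_nat i)) :: complex)" for k
    proof (cases "k = 0")
      case False
      have "of_nat k powr (- (z - of_nat i)) = (of_nat k powr (of_nat i) * of_nat k powr (- z) :: complex)"
        by (subst powr_add[symmetric]) simp
      then show ?thesis using False by (simp add: powr_nat')
    qed simp
    moreover have "(\<lambda>k. of_nat k powr (- (z - of_nat i)) :: complex) sums dirichlet_zeta (z - of_nat i)"
      unfolding dirichlet_zeta_def using summable_of_nat_powr[OF Re] by (rule summable_sums)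
    moreover have "dirichlet_zeta (z - of_nat i) = zeta_reg (z - of_nat i) / (z - of_nat i - 1)"
    proof -
      have "z - of_nat i - 1 \<noteq> 0" using Re by (auto simp: complex_eq_iff)
      then show ?thesis by (simp add: zeta_reg(3)[OF Re])
    qed
    ultimately show ?thesis by simp
  qed
  have "(\<lambda>k. \<Sum>i\<le>degree Q. coeff Q i * (of_nat k ^ i * of_nat k powr (- z))) sums
      (\<Sum>i\<le>degree Q. coeff Q i * (zeta_reg (z - of_nat i) / (z - of_nat i - 1)))"
    by (intro sums_sum sums_mult 1) auto
  from sums_add[OF this tail_series_sums[OF E, of z]]
  show ?thesis
    by (simp add: zeta_sum_def t poly_altdef sum_distrib_right distrib_right mult.assoc)
qed

lemma zeta_sum_meromorphic:
  assumes "rapidly_decaying E"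
  shows "zeta_sum Q E meromorphic_on UNIV"
proof -
  have "zeta_reg analytic_on UNIV" "tail_series E analytic_on UNIV"
    using zeta_reg(1) tail_series_holomorphic[OF assms] by (simp_all add: analytic_on_open)
  then have "tail_series E meromorphic_on UNIV" by (intro analytic_on_imp_meromorphic_on)
  moreover have "(\<lambda>z. zeta_reg (z - of_nat i)) meromorphic_on UNIV" for i
    by (intro analytic_on_imp_meromorphic_on) (simp add: analytic_on_open holomorphic_intros)
  ultimately show ?thesis unfolding zeta_sum_def by (intro meromorphic_intros)
qed

text \<open>Only the summand with index \<open>i\<close> can be singular at \<open>i + 1\<close>,
  and \<open>zeta_reg 1 = 1\<close> makes \<open>coeff Q i\<close> the value of the regular factor
  there. The other possible poles are removed from the domain.\<close>

lemma zeta_sum_local: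
  assumes "rapidly_decaying E"
  obtains g where "g holomorphic_on - (of_nat ` ({..degree Q + 1} - {i + 1}))"
    "g (of_nat (i + 1)) = coeff Q i"
    "\<And>z. z \<noteq> of_nat (i + 1) \<Longrightarrow> zeta_sum Q E z = g z / (z - of_nat (i + 1))"
proof -
  define R where "R z = (\<Sum>j\<in>{..degree Q} - {i}. coeff Q j * (zeta_reg (z - of_nat j) / (z - of_nat j - 1))) + tail_series E z" for z
  define g where "g z = coeff Q i * zeta_reg (z - of_nat i) + (z - of_nat (i + 1)) * R z" for z
  have ne: "z - of_nat j - 1 \<noteq> 0" if "z \<in> - (of_nat ` ({..degree Q + 1} - {i + 1}))" "j \<in> {..degree Q} - {i}" for z :: complex and j
  proof
    assume "z - of_nat j - 1 = 0"
    then have "z = of_nat (j + 1)" by (simp add: algebra_simps)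
    then have "z \<in> of_nat ` ({..degree Q + 1} - {i + 1})" by (rule image_eqI) (use that in auto)
    then show False using that by blast
  qed
  have "tail_series E holomorphic_on - (of_nat ` ({..degree Q + 1} - {i + 1}))"
    using tail_series_holomorphic[OF assms] by (rule holomorphic_on_subset) auto
  then have "R holomorphic_on - (of_nat ` ({..degree Q + 1} - {i + 1}))"
    unfolding R_def by (intro holomorphic_intros ne) auto
  then have 1: "g holomorphic_on - (of_nat ` ({..degree Q + 1} - {i + 1}))"
    unfolding g_def by (intro holomorphic_intros)
  have 2: "g (of_nat (i + 1)) = coeff Q i" by (simp add: g_def zeta_reg(2))
  have 3: "zeta_sum Q E z = g z / (z - of_nat (i + 1))" if z: "z \<noteq> of_nat (i + 1)" for z
  proof -
    have "(\<Sum>j\<le>degree Q. coeff Q j * (zeta_reg (z - of_nat j) / (z - of_nat j - 1))) =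
        coeff Q i * (zeta_reg (z - of_nat i) / (z - of_nat i - 1)) +
        (\<Sum>j\<in>{..degree Q} - {i}. coeff Q j * (zeta_reg (z - of_nat j) / (z - of_nat j - 1)))"
    proof (cases "i \<le> degree Q")
      case True
      then show ?thesis by (intro sum.remove) auto
    next
      case False
      then have "{..degree Q} - {i} = {..degree Q}" by auto
      then show ?thesis using False by (simp add: coeff_eq_0)
    qed
    then have "zeta_sum Q E z = coeff Q i * (zeta_reg (z - of_nat i) / (z - of_nat (i + 1))) + R z"
      by (simp add: zeta_sum_def R_def algebra_simps)
    then show ?thesis using z by (simp add: g_def field_simps)
  qed
  show ?thesis by (rule that[OF 1 2 3])
qed

lemma open_Compl_of_nat: "finite S \<Longrightarrow> open (- (of_nat ` S :: complex set))"
  by (intro open_Compl finite_imp_closed finite_imageI)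

lemma zeta_sum_pole:
  assumes E: "rapidly_decaying E" and c: "coeff Q i \<noteq> 0"
  shows "is_pole (zeta_sum Q E) (of_nat (i + 1))" "zorder (zeta_sum Q E) (of_nat (i + 1)) = - 1"
proof -
  let ?s = "of_nat (i + 1) :: complex" and ?A = "- (of_nat ` ({..degree Q + 1} - {i + 1})) :: complex set"
  obtain g where g: "g holomorphic_on ?A" "g ?s = coeff Q i" "\<And>z. z \<noteq> ?s \<Longrightarrow> zeta_sum Q E z = g z / (z - ?s)"
    using zeta_sum_local[OF E, of Q i] by blast
  have A: "open ?A" by (intro open_Compl_of_nat) auto
  have sA: "?s \<in> ?A" by (auto simp del: of_nat_add of_nat_Suc)
  have ev: "\<forall>\<^sub>F z in at ?s. zeta_sum Q E z = g z / (z - ?s) ^ 1"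
    unfolding eventually_at_filter using g(3) by (intro always_eventually) auto
  have "is_pole (\<lambda>z. g z / (z - ?s) ^ 1) ?s"
    by (rule is_pole_basic[OF g(1) A sA]) (use g(2) c in auto)
  then show "is_pole (zeta_sum Q E) ?s" using is_pole_cong[OF ev refl] by simp
  have "zorder (\<lambda>z. g z / (z - ?s) ^ 1) ?s = - int 1"
    by (rule zorder_nonzero_div_power[OF A sA g(1)]) (use g(2) c in auto)
  then show "zorder (zeta_sum Q E) ?s = - 1" using zorder_cong[OF ev refl] by simp
qed

text \<open>After the summands with coefficient 0 are dropped, what remains is holomorphic off the
  points \<open>j + 1\<close> with \<open>coeff Q j \<noteq> 0\<close>.\<close>

lemma zeta_sum_pole_imp:
  assumes E: "rapidly_decaying E" and pole: "is_pole (zeta_sum Q E) s"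
  shows "\<exists>i. i \<le> degree Q \<and> coeff Q i \<noteq> 0 \<and> s = of_nat (i + 1)"
proof (rule ccontr)
  assume neg: "\<not> (\<exists>i. i \<le> degree Q \<and> coeff Q i \<noteq> 0 \<and> s = of_nat (i + 1))"
  define J where "J = {j. j \<le> degree Q \<and> coeff Q j \<noteq> 0}"
  let ?A = "- (of_nat ` (Suc ` J)) :: complex set"
  have eq: "zeta_sum Q E = (\<lambda>z. (\<Sum>j\<in>J. coeff Q j * (zeta_reg (z - of_nat j) / (z - of_nat j - 1))) + tail_series E z)"
    unfolding zeta_sum_def J_def by (intro ext arg_cong2[where f = "(+)"] sum.mono_neutral_right) auto
  have ne: "z - of_nat j - 1 \<noteq> 0" if "z \<in> ?A" "j \<in> J" for z j
  proof
    assume "z - of_nat j - 1 = 0"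
    then have "z = of_nat (Suc j)" by (simp add: algebra_simps)
    then show False using that by blast
  qed
  have "tail_series E holomorphic_on ?A"
    using tail_series_holomorphic[OF E] by (rule holomorphic_on_subset) auto
  then have "zeta_sum Q E holomorphic_on ?A"
    unfolding eq by (intro holomorphic_intros ne) auto
  moreover have "open ?A" by (intro open_Compl_of_nat) (simp add: J_def)
  moreover have "s \<in> ?A" using neg by (auto simp: J_def)
  ultimately show False using not_is_pole_holomorphic pole by blast
qed

text \<open>The coefficient of degree \<open>j\<close> is recorded because it produces the pole when
  the existence of poles is shown.\<close>

lemma binomial_poly:
  "\<exists>q :: complex poly. degree q \<le> j \<and> coeff q j = 1 / fact j \<and> (\<forall>x. poly q x = x gchoose j)"
proof (induction j)
  case 0
  then show ?case by (intro exI[of _ 1]) simp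
next
  case (Suc j)
  then obtain q :: "complex poly" where q: "degree q \<le> j" "coeff q j = 1 / fact j" "\<And>x. poly q x = x gchoose j" by blast
  define r where "r = smult (1 / of_nat (Suc j)) (pCons 0 q - smult (of_nat j) q)"
  have "degree (pCons 0 q - smult (of_nat j) q) \<le> Suc j"
    by (intro degree_diff_le) (use q(1) in \<open>auto intro: order_trans[OF degree_pCons_le] order_trans[OF degree_smult_le]\<close>)
  then have "degree r \<le> Suc j" unfolding r_def by (rule order_trans[OF degree_smult_le])
  moreover have "coeff r (Suc j) = 1 / fact (Suc j)"
    using coeff_eq_0[of q "Suc j"] q(1) by (simp add: r_def q(2))
  moreover have "poly r x = x gchoose Suc j" for x
  proof -
    have "of_nat (Suc j) * (x gchoose Suc j) = x * (x gchoose j) - of_nat j * (x gchoose j)"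
      using gbinomial_mult_1[of x j] by simp
    then show ?thesis by (simp add: r_def q(3) field_simps del: of_nat_Suc)
  qed
  ultimately show ?case by blast
qed

text \<open>Meromorphic functions may take arbitrary values at isolated points, so the difference is
  first normalised by \<open>remove_sings\<close>. The identity theorem makes the normalised
  difference 0, and equality returns on punctured neighbourhoods.\<close>

lemma meromorphic_unique:
  assumes F: "F meromorphic_on UNIV" and G: "G meromorphic_on UNIV" and eq: "\<And>z. Re z > R \<Longrightarrow> F z = G z"
  shows "\<forall>\<^sub>F z in at s. F z = G z"
proof -
  define h where "h z = F z - G z" for z
  have h: "h meromorphic_on UNIV" unfolding h_def by (intro meromorphic_intros F G)
  then have nice: "remove_sings h nicely_meromorphic_on UNIV" by (rule remove_sings_nicely_meromorphic)
  have zero: "remove_sings h z = 0" if "Re z > R" for z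
  proof -
    have "h holomorphic_on {z. Re z > R} \<longleftrightarrow> (\<lambda>_. 0) holomorphic_on {z. Re z > R}"
      by (rule holomorphic_cong[OF refl]) (simp add: h_def eq)
    then have "h analytic_on {z. Re z > R}" by (simp add: analytic_on_open open_halfspace_Re_gt)
    then have "h analytic_on {z}" using that by (simp add: analytic_on_subset)
    then show ?thesis using that by (simp add: h_def eq)
  qed
  let ?z = "of_real (R + 1) :: complex"
  have "\<forall>\<^sub>F z in at ?z. Re z > R"
    using eventually_at_in_open'[OF open_halfspace_Re_gt[of R], of ?z] by simp
  then have "\<forall>\<^sub>F z in at ?z. remove_sings h z = 0" by eventually_elim (rule zero)
  then have "\<exists>\<^sub>F z in at ?z. remove_sings h z = 0" by (intro eventually_frequently) auto
  then have "remove_sings h w = 0" for w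
    by (rule frequently_eq_meromorphic_imp_constant[OF _ nice]) auto
  moreover have "\<forall>\<^sub>F z in at s. remove_sings h z = h z"
    by (rule eventually_remove_sings_eq_at) (use h in \<open>auto intro: meromorphic_on_isolated_singularity meromorphic_on_subset\<close>)
  ultimately have "\<forall>\<^sub>F z in at s. h z = 0" by simp
  then show ?thesis by eventually_elim (simp add: h_def)
qed

section \<open>Traces of powers, the dimension spectrum and the order of the poles\<close>

subsection \<open>Traces\<close>

lemma dirac_level:
  assumes "\<gamma> \<in> H_idx l"
  obtains k where "\<bar>dirac_eigenvalue \<gamma>\<bar> = real k"
proof -
  obtain g m where "\<gamma> = (g, m)" by (cases \<gamma>)
  then have "\<bar>dirac_eigenvalue \<gamma>\<bar> = real (sum_list g + nat \<bar>m\<bar>)" by (simp add: abs_dirac_eigenvalue)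
  then show ?thesis by (rule that)
qed

text \<open>For \<open>k = 0\<close> both sides are 0: the left by the convention on the kernel, the
  right because \<open>0 powr x = 0\<close>.\<close>

lemma abs_power_coeff_level:
  "\<bar>\<mu>\<bar> = real k \<Longrightarrow> abs_power_coeff z \<mu> = of_nat k powr (- z)"
  by (auto simp: abs_power_coeff_def)

lemma abs_power_coeff_bound:
  assumes "\<gamma> \<in> H_idx l" "Re z \<ge> 0"
  shows "cmod (abs_power_coeff z (dirac_eigenvalue \<gamma>)) \<le> 1"
proof -
  obtain k where k: "\<bar>dirac_eigenvalue \<gamma>\<bar> = real k" using dirac_level[OF assms(1)] .
  show ?thesis
  proof (cases "k = 0")
    case False
    have "real k powr (- Re z) \<le> real k powr 0" using False assms(2) by (intro powr_mono) auto
    then show ?thesis using False by (simp add: abs_power_coeff_level[OF k] norm_of_nat_powr)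
  qed (simp add: abs_power_coeff_level[OF k])
qed

lemma abs_neg_power_Dirac:
  assumes "Re z \<ge> 0"
  shows "abs_neg_power (H_idx l) (Dirac l) z =
    on_ell2 (H_idx l) (\<lambda>\<psi> \<gamma>. abs_power_coeff z (dirac_eigenvalue \<gamma>) * \<psi> \<gamma>)"
  by (rule abs_neg_power_diagonal[OF Dirac_diagonal abs_power_coeff_bound[OF _ assms]])

text \<open>On level \<open>k\<close>, a coefficient above the bound forces
  \<open>2 ^ (l + 2) * k ^ (l + 1) < 1 + n\<close>, by taking square roots. If \<open>M\<close> is
  the largest such \<open>k\<close>, the number of vectors with \<open>|D| \<le> M\<close> is at
  most \<open>2 * (M + 1) ^ (l + 1) \<le> 2 ^ (l + 2) * M ^ (l + 1)\<close>, hence at most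
  \<open>n\<close>. The constant \<open>4 ^ (l + 2)\<close> is chosen to make the two expressions
  match.\<close>

lemma card_abs_power_coeff:
  assumes z: "Re z \<ge> 2 * real (l + 1)"
  shows "card {\<gamma>\<in>H_idx l. cmod (abs_power_coeff z (dirac_eigenvalue \<gamma>)) > 4 ^ (l + 2) / (1 + real n)\<^sup>2} \<le> n"
proof -
  let ?S = "{\<gamma>\<in>H_idx l. cmod (abs_power_coeff z (dirac_eigenvalue \<gamma>)) > 4 ^ (l + 2) / (1 + real n)\<^sup>2}"
  define J where "J = {k. 1 \<le> k \<and> 2 ^ (l + 2) * k ^ (l + 1) < 1 + n}"
  have finJ: "finite J"
  proof (rule finite_subset[of _ "{..n}"])
    show "J \<subseteq> {..n}"
    proof
      fix k assume k: "k \<in> J"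
      have "k \<le> k ^ (l + 1)" using k by (intro self_le_power) (auto simp: J_def)
      also have "\<dots> \<le> 2 ^ (l + 2) * k ^ (l + 1)" by simp
      also have "\<dots> < 1 + n" using k by (simp only: J_def mem_Collect_eq)
      finally show "k \<in> {..n}" by simp
    qed
  qed simp
  have inJ: "\<exists>k\<in>J. \<bar>dirac_eigenvalue \<gamma>\<bar> = real k" if \<gamma>: "\<gamma> \<in> ?S" for \<gamma>
  proof -
    have "\<gamma> \<in> H_idx l" using \<gamma> by simp
    then obtain k where k: "\<bar>dirac_eigenvalue \<gamma>\<bar> = real k" by (rule dirac_level)
    have gt: "real k powr (- Re z) > 4 ^ (l + 2) / (1 + real n)\<^sup>2"
      using \<gamma> by (simp add: abs_power_coeff_level[OF k] norm_of_nat_powr)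
    have k0: "k \<noteq> 0"
    proof
      assume "k = 0"
      then have "real k powr (- Re z) = 0" by simp
      moreover have "0 \<le> 4 ^ (l + 2) / (1 + real n)\<^sup>2" by (intro divide_nonneg_nonneg) auto
      ultimately show False using gt by linarith
    qed
    have "real k powr (- Re z) \<le> real k powr (- real (2 * (l + 1)))" using k0 z by (intro powr_mono) auto
    also have "\<dots> = 1 / real k ^ (2 * (l + 1))"
      using k0 by (simp only: powr_minus powr_realpow of_nat_0_less_iff neq0_conv inverse_eq_divide)
    finally have "4 ^ (l + 2) / (1 + real n)\<^sup>2 < 1 / real k ^ (2 * (l + 1))" using gt by linarith
    then have "4 ^ (l + 2) * real k ^ (2 * (l + 1)) < (1 + real n)\<^sup>2"
      using k0 by (simp add: field_simps)
    moreover have "4 ^ (l + 2) * real k ^ (2 * (l + 1)) = (2 ^ (l + 2) * real k ^ (l + 1))\<^sup>2"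
    proof -
      have "(4 :: real) ^ (l + 2) = (2 ^ (l + 2))\<^sup>2" by (subst power_mult[symmetric], subst mult.commute, subst power_mult) simp
      moreover have "real k ^ (2 * (l + 1)) = (real k ^ (l + 1))\<^sup>2" by (subst power_mult[symmetric]) (simp add: mult.commute)
      ultimately show ?thesis by (simp only: power_mult_distrib)
    qed
    ultimately have "2 ^ (l + 2) * real k ^ (l + 1) < 1 + real n"
      by (simp only:) (rule power2_less_imp_less, auto)
    then have "real (2 ^ (l + 2) * k ^ (l + 1)) < real (1 + n)" by simp
    then have "2 ^ (l + 2) * k ^ (l + 1) < 1 + n" by (simp only: of_nat_less_iff)
    then show ?thesis using k k0 by (auto simp: J_def)
  qed
  show ?thesis
  proof (cases "J = {}")
    case True
    then have "?S = {}" using inJ by blast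
    then show ?thesis by (simp only: card.empty)
  next
    case False
    define M where "M = Max J"
    have M: "M \<in> J" unfolding M_def by (rule Max_in[OF finJ False])
    have sub: "?S \<subseteq> {\<gamma>\<in>H_idx l. \<bar>dirac_eigenvalue \<gamma>\<bar> \<le> real M}"
    proof
      fix \<gamma> assume \<gamma>: "\<gamma> \<in> ?S"
      then obtain k where "k \<in> J" "\<bar>dirac_eigenvalue \<gamma>\<bar> = real k" using inJ by blast
      moreover from this have "k \<le> M" unfolding M_def by (intro Max_ge finJ)
      ultimately show "\<gamma> \<in> {\<gamma>\<in>H_idx l. \<bar>dirac_eigenvalue \<gamma>\<bar> \<le> real M}" using \<gamma> by simp
    qed
    have "card ?S \<le> card {\<gamma>\<in>H_idx l. \<bar>dirac_eigenvalue \<gamma>\<bar> \<le> real M}" by (rule card_mono[OF finite_dirac_le(1) sub])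
    also have "\<dots> \<le> 2 * (M + 1) ^ (l + 1)" by (rule finite_dirac_le(2))
    also have "\<dots> \<le> 2 * (2 * M) ^ (l + 1)" using M by (intro mult_left_mono power_mono) (auto simp: J_def)
    also have "\<dots> = 2 ^ (l + 2) * M ^ (l + 1)" by (simp add: power_mult_distrib)
    also have "\<dots> \<le> n" using M by (simp add: J_def)
    finally show ?thesis .
  qed
qed

lemma finite_abs_power_coeff:
  assumes z: "Re z \<ge> 1" and \<epsilon>: "\<epsilon> > 0"
  shows "finite {\<gamma>\<in>H_idx l. cmod (abs_power_coeff z (dirac_eigenvalue \<gamma>)) > \<epsilon>}"
proof (rule finite_subset[OF _ finite_dirac_le'[of l "1 / \<epsilon>"]], rule subsetI)
  fix \<gamma> assume \<gamma>: "\<gamma> \<in> {\<gamma>\<in>H_idx l. cmod (abs_power_coeff z (dirac_eigenvalue \<gamma>)) > \<epsilon>}"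
  then have "\<gamma> \<in> H_idx l" by simp
  then obtain k where k: "\<bar>dirac_eigenvalue \<gamma>\<bar> = real k" by (rule dirac_level)
  have gt: "real k powr (- Re z) > \<epsilon>" using \<gamma> by (simp add: abs_power_coeff_level[OF k] norm_of_nat_powr)
  then have k0: "k \<noteq> 0" using \<epsilon> by (intro notI) simp
  have "real k powr (- Re z) \<le> real k powr (- 1)" using k0 z by (intro powr_mono) auto
  also have "\<dots> = 1 / real k" by (simp add: powr_minus_divide)
  finally have "\<epsilon> < 1 / real k" using gt by linarith
  then have "real k \<le> 1 / \<epsilon>" using k0 \<epsilon> by (simp add: field_simps)
  then show "\<gamma> \<in> {\<gamma>\<in>H_idx l. \<bar>dirac_eigenvalue \<gamma>\<bar> \<le> 1 / \<epsilon>}" using \<gamma> k by simp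
qed

lemma trace_class_abs_power:
  assumes b: "b \<in> bounded_ops (H_idx l)" and z: "Re z \<ge> 2 * real (l + 1)"
  shows "trace_class (H_idx l) (b \<circ> abs_neg_power (H_idx l) (Dirac l) z)"
proof -
  have z1: "Re z \<ge> 1" using z by simp
  then have z0: "Re z \<ge> 0" by simp
  show ?thesis
    unfolding abs_neg_power_Dirac[OF z0]
  proof (rule trace_class_criterion[OF b countable_H_idx finite_abs_power_coeff[OF z1], where s = "\<lambda>n. 4 ^ (l + 2) / (1 + real n)\<^sup>2"])
    have "summable (\<lambda>n. real n powr (- 2))" by (simp add: summable_real_powr_iff)
    then have "summable (\<lambda>n. real (Suc n) powr (- 2))" by (rule iffD2[OF summable_Suc_iff])
    then have "summable (\<lambda>n. 4 ^ (l + 2) * real (Suc n) powr (- 2))" by (rule summable_mult)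
    moreover have eq: "4 ^ (l + 2) * real (Suc n) powr (- 2) = 4 ^ (l + 2) / (1 + real n)\<^sup>2" for n
      by (simp add: powr_minus_divide)
    ultimately show "summable (\<lambda>n. 4 ^ (l + 2) / (1 + real n)\<^sup>2)" by (simp only: eq)
  qed (use card_abs_power_coeff[OF z] in auto)
qed

text \<open>The value \<open>2 * l + 4\<close> exceeds both \<open>2 * (l + 1)\<close>, which makes
  the singular values of order \<open>1 / n\<^sup>2\<close>, and \<open>l + 3\<close>, which will
  make the trace converge absolutely level by level.\<close>

lemma summable_of_order_Dirac: "summable_of_order (H_idx l) (Dirac l) (2 * real l + 4)"
proof -
  let ?I = "H_idx l" and ?z = "of_real (2 * real l + 4) :: complex"
  let ?N = "abs_neg_power ?I (Dirac l) ?z"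
  have id: "on_ell2 ?I id \<in> bounded_ops ?I"
    using spectral_triple_A_inf[of l] by (auto simp: spectral_triple_def)
  have "trace_class ?I (on_ell2 ?I id \<circ> ?N)" by (rule trace_class_abs_power[OF id]) simp
  moreover have "on_ell2 ?I id \<circ> ?N = ?N"
  proof
    fix \<psi>
    have "?N \<psi> \<in> ell2 ?I"
    proof -
      have N: "?N = on_ell2 ?I (\<lambda>\<psi> \<gamma>. abs_power_coeff ?z (dirac_eigenvalue \<gamma>) * \<psi> \<gamma>)"
        by (rule abs_neg_power_Dirac) simp
      have Nb: "?N \<in> bounded_ops ?I"
        unfolding N by (rule bounded_diagonal[of _ _ 1]) (rule abs_power_coeff_bound, auto)
      show ?thesis
      proof (cases "\<psi> \<in> ell2 ?I")
        case True
        then show ?thesis by (rule bounded_ops_ell2[OF Nb])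
      next
        case False
        show ?thesis unfolding bounded_ops_outside[OF Nb False] by (rule ell2_zero)
      qed
    qed
    then show "(on_ell2 ?I id \<circ> ?N) \<psi> = ?N \<psi>" by (simp add: on_ell2_def)
  qed
  ultimately show ?thesis unfolding summable_of_order_def by (simp add: trace_class_imp_dixmier_ideal)
qed

text \<open>The basis is sorted by levels. For \<open>k \<ge> 1\<close> there are at most
  \<open>2 ^ (l + 2) * k ^ (l + 1)\<close> vectors on level \<open>k\<close>, each contributing at
  most \<open>C * k powr (- (l + 3))\<close>. The level sums are thus dominated by a multiple of
  \<open>k powr (- 2)\<close>, and Fubini applies.\<close>

lemma op_trace_abs_power:
  assumes b: "b \<in> bounded_ops (H_idx l)" and z: "Re z > 2 * real l + 4"
  shows "(\<lambda>k. level_trace l b k * of_nat k powr (- z)) sums op_trace (H_idx l) (b \<circ> abs_neg_power (H_idx l) (Dirac l) z)"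
proof -
  let ?I = "H_idx l"
  define t where "t \<gamma> = abs_power_coeff z (dirac_eigenvalue \<gamma>) * b (ket \<gamma>) \<gamma>" for \<gamma>
  have z0: "Re z \<ge> 0" using z by simp
  obtain C where C: "C \<ge> 0" "\<And>\<psi>. \<psi> \<in> ell2 ?I \<Longrightarrow> l2norm ?I (b \<psi>) \<le> C * l2norm ?I \<psi>"
    using bounded_ops_bound[OF b] by blast
  have bC: "cmod (b (ket \<gamma>) \<gamma>) \<le> C" if "\<gamma> \<in> ?I" for \<gamma>
  proof -
    have k1: "l2norm ?I (ket \<gamma>) = 1"
      unfolding l2norm_def by (subst infsum_single[of _ \<gamma>]) (use that in \<open>auto simp: ket_def\<close>)
    show ?thesis
      using order_trans[OF cmod_le_l2norm[OF bounded_ops_ell2[OF b ell2_ket[OF that]]] C(2)[OF ell2_ket[OF that]]] k1 by simp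
  qed
  have entry: "l2inner ?I (ket \<gamma>) ((b \<circ> abs_neg_power ?I (Dirac l) z) (ket \<gamma>)) = t \<gamma>" if \<gamma>: "\<gamma> \<in> ?I" for \<gamma>
  proof -
    have "(\<lambda>\<eta>. abs_power_coeff z (dirac_eigenvalue \<eta>) * ket \<gamma> \<eta>) = scale_vec (abs_power_coeff z (dirac_eigenvalue \<gamma>)) (ket \<gamma>)"
      by (auto simp: ket_def scale_vec_def)
    then have "(b \<circ> abs_neg_power ?I (Dirac l) z) (ket \<gamma>) = scale_vec (abs_power_coeff z (dirac_eigenvalue \<gamma>)) (b (ket \<gamma>))"
      using \<gamma> by (simp add: abs_neg_power_Dirac[OF z0] on_ell2_def bounded_ops_scale[OF b ell2_ket[OF \<gamma>]])
    then show ?thesis using \<gamma> by (simp add: l2inner_ket_left scale_vec_def t_def)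
  qed
  have tr: "op_trace ?I (b \<circ> abs_neg_power ?I (Dirac l) z) = infsum t ?I"
    unfolding op_trace_def by (intro infsum_cong entry)
  have bij: "bij_betw snd (Sigma UNIV (level l)) ?I"
    unfolding bij_betw_def
  proof
    show "inj_on snd (Sigma UNIV (level l))" by (auto simp: inj_on_def level_def)
    show "snd ` Sigma UNIV (level l) = ?I"
    proof (intro set_eqI iffI)
      fix \<gamma> assume \<gamma>: "\<gamma> \<in> ?I"
      then obtain k where "\<bar>dirac_eigenvalue \<gamma>\<bar> = real k" by (rule dirac_level)
      then have "(k, \<gamma>) \<in> Sigma UNIV (level l)" using \<gamma> by (simp add: level_def)
      then show "\<gamma> \<in> snd ` Sigma UNIV (level l)" by (rule image_eqI[rotated]) simp
    qed (auto simp: level_def)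
  qed
  have tl: "t \<gamma> = of_nat k powr (- z) * b (ket \<gamma>) \<gamma>" if "\<gamma> \<in> level l k" for \<gamma> k
    using that by (simp add: t_def abs_power_coeff_level level_def)
  have lt: "(\<Sum>\<^sub>\<infinity>\<gamma>\<in>level l k. t \<gamma>) = level_trace l b k * of_nat k powr (- z)" for k
    unfolding level_trace_def sum_distrib_right infsum_finite[OF finite_level]
    by (intro sum.cong) (simp_all add: tl mult.commute)
  let ?u = "\<lambda>k. 2 ^ (l + 2) * C * real k powr (- 2)"
  have inner: "(\<Sum>\<^sub>\<infinity>\<gamma>\<in>level l k. norm (t \<gamma>)) \<le> ?u k" for k
  proof (cases "k = 0")
    case True
    then show ?thesis using tl[of _ 0] by (auto simp: True intro!: infsum_0[THEN eq_refl])
  next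
    case False
    have "(\<Sum>\<^sub>\<infinity>\<gamma>\<in>level l k. norm (t \<gamma>)) = (\<Sum>\<gamma>\<in>level l k. norm (t \<gamma>))" by (simp add: finite_level)
    also have "\<dots> \<le> (\<Sum>\<gamma>\<in>level l k. real k powr (- Re z) * C)"
    proof (rule sum_mono)
      fix \<gamma> assume \<gamma>: "\<gamma> \<in> level l k"
      have "norm (t \<gamma>) = real k powr (- Re z) * cmod (b (ket \<gamma>) \<gamma>)" unfolding tl[OF \<gamma>] by (simp add: norm_mult norm_of_nat_powr)
      also have "\<dots> \<le> real k powr (- Re z) * C" using \<gamma> by (intro mult_left_mono bC) (auto simp: level_def)
      finally show "norm (t \<gamma>) \<le> real k powr (- Re z) * C" .
    qed
    also have "\<dots> = real (card (level l k)) * (real k powr (- Re z) * C)" by simp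
    also have "\<dots> \<le> (2 ^ (l + 2) * real k ^ (l + 1)) * (real k powr (- real (l + 3)) * C)"
    proof (intro mult_mono)
      have "card (level l k) \<le> 2 * (k + 1) ^ (l + 1)" by (rule card_level)
      also have "\<dots> \<le> 2 * (2 * k) ^ (l + 1)" using False by (intro mult_left_mono power_mono) auto
      also have "\<dots> = 2 ^ (l + 2) * k ^ (l + 1)" by (simp add: power_mult_distrib)
      finally have "real (card (level l k)) \<le> real (2 ^ (l + 2) * k ^ (l + 1))" by (simp only: of_nat_le_iff)
      then show "real (card (level l k)) \<le> 2 ^ (l + 2) * real k ^ (l + 1)" by simp
      show "real k powr (- Re z) \<le> real k powr (- real (l + 3))" using False z by (intro powr_mono) auto
    qed (use C in auto)
    also have "real k ^ (l + 1) = real k powr real (l + 1)" using False by (simp only: powr_realpow of_nat_0_less_iff neq0_conv)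
    also have "(2 ^ (l + 2) * real k powr real (l + 1)) * (real k powr (- real (l + 3)) * C) =
        2 ^ (l + 2) * C * (real k powr real (l + 1) * real k powr (- real (l + 3)))" by simp
    also have "real k powr real (l + 1) * real k powr (- real (l + 3)) = real k powr (- 2)"
      unfolding powr_add[symmetric] by simp
    finally show ?thesis .
  qed
  have "summable ?u" by (intro summable_mult) (simp add: summable_real_powr_iff)
  then have "?u summable_on UNIV" using C(1) by (intro summable_nonneg_imp_summable_on) auto
  then have outer: "(\<lambda>k. \<Sum>\<^sub>\<infinity>\<gamma>\<in>level l k. norm (t \<gamma>)) summable_on UNIV"
    by (rule summable_on_comparison_test[OF _ inner]) (auto intro: infsum_nonneg)
  have "(\<lambda>z. norm ((\<lambda>(k, \<gamma>). t \<gamma>) z)) summable_on Sigma UNIV (level l)"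
    by (rule iffD2[OF Infinite_Sum.abs_summable_on_Sigma_iff]) (use outer in \<open>simp add: finite_level sum_nonneg\<close>)
  from abs_summable_summable[OF this] have S: "(\<lambda>(k, \<gamma>). t \<gamma>) summable_on Sigma UNIV (level l)" .
  have "infsum t ?I = (\<Sum>\<^sub>\<infinity>(k, \<gamma>)\<in>Sigma UNIV (level l). t \<gamma>)"
    using infsum_reindex_bij_betw[OF bij, of t] by (simp add: split_def)
  also have "\<dots> = (\<Sum>\<^sub>\<infinity>k. \<Sum>\<^sub>\<infinity>\<gamma>\<in>level l k. t \<gamma>)"
    using infsum_Sigma'_banach[OF S] by simp
  also have "\<dots> = (\<Sum>\<^sub>\<infinity>k. level_trace l b k * of_nat k powr (- z))"
    unfolding lt ..
  finally have eq: "infsum t ?I = (\<Sum>\<^sub>\<infinity>k. level_trace l b k * of_nat k powr (- z))" .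
  have "(\<lambda>k. \<Sum>\<^sub>\<infinity>\<gamma>\<in>level l k. t \<gamma>) summable_on UNIV"
    using summable_on_Sigma_banach[OF S] by simp
  then have "(\<lambda>k. level_trace l b k * of_nat k powr (- z)) summable_on UNIV" unfolding lt .
  from has_sum_imp_sums[OF has_sum_infsum[OF this]] show ?thesis unfolding tr eq .
qed

lemma zeta_extension_zeta_sum:
  assumes b: "b \<in> B_ops l" and E: "rapidly_decaying E" and Q: "degree Q \<le> l"
    and t: "\<And>k. level_trace l b k = poly Q (of_nat k) + E k"
  shows "zeta_extension (H_idx l) (Dirac l) (2 * real l + 4) b (zeta_sum Q E)"
  unfolding zeta_extension_def
proof (intro conjI allI impI)
  show "zeta_sum Q E meromorphic_on UNIV" by (rule zeta_sum_meromorphic[OF E])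
  fix z assume z: "Re z > 2 * real l + 4"
  show "trace_class (H_idx l) (b \<circ> abs_neg_power (H_idx l) (Dirac l) z)"
    by (rule trace_class_abs_power[OF B_ops_bounded[OF b]]) (use z in simp)
  have "Re z > real (degree Q) + 1" using z Q by linarith
  from sums_unique2[OF zeta_sum_sums[OF E this t] op_trace_abs_power[OF B_ops_bounded[OF b] z]]
  show "zeta_sum Q E z = op_trace (H_idx l) (b \<circ> abs_neg_power (H_idx l) (Dirac l) z)" .
qed

lemma B_ops_level_trace_poly:
  assumes b: "b \<in> B_ops l"
  shows "\<exists>Q E. rapidly_decaying E \<and> degree Q \<le> l \<and> (\<forall>k. level_trace l b k = poly Q (of_nat k) + E k)"
proof -
  obtain P E where E: "rapidly_decaying E" and t: "\<And>k. level_trace l b k = (\<Sum>j\<le>l. P j * of_nat (k choose j)) + E k"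
    using level_trace_expansion[OF b] by blast
  have "\<forall>j. \<exists>q :: complex poly. degree q \<le> j \<and> (\<forall>x. poly q x = x gchoose j)" using binomial_poly by blast
  from choice[OF this] obtain q :: "nat \<Rightarrow> complex poly"
    where q: "\<forall>j. degree (q j) \<le> j \<and> (\<forall>x. poly (q j) x = x gchoose j)" ..
  define Q where "Q = (\<Sum>j\<le>l. smult (P j) (q j))"
  have "degree Q \<le> l" unfolding Q_def
  proof (rule degree_sum_le)
    fix j assume "j \<in> {..l}"
    have "degree (smult (P j) (q j)) \<le> degree (q j)" by (rule degree_smult_le)
    also have "\<dots> \<le> j" using q by simp
    also have "\<dots> \<le> l" using \<open>j \<in> {..l}\<close> by simp
    finally show "degree (smult (P j) (q j)) \<le> l" .
  qed simp
  moreover have "level_trace l b k = poly Q (of_nat k) + E k" for k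
    using q by (simp add: t Q_def poly_sum binomial_gbinomial)
  ultimately show ?thesis using E by blast
qed


subsection \<open>Existence of the poles\<close>

primrec corner_projection :: "nat \<Rightarrow> nat \<Rightarrow> idx \<Rightarrow> idx option" where
  "corner_projection r 0 = idx_id r"
| "corner_projection r (Suc d) = corner_map 0 0 (corner_projection r d)"

lemma genA_corner_projection: "genA False (r + d) 0 (corner_projection r d)"
  by (induction d) (auto intro: genA_id gen_corner)

text \<open>The two summands count the nonnegative and the negative half line. On level 0 the
  negative one is empty, whereas \<open>k - 1 = 0\<close> in the natural numbers would count one
  vector; hence the assumption on \<open>k\<close>.\<close>

lemma fixed_count_corner_projection:
  assumes "k \<ge> 1"
  shows "fixed_count (r + d) (corner_projection r d) k = ((k + r) choose r) + ((k - 1 + r) choose r)"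
proof (induction d)
  case 0
  have "{\<gamma>\<in>level r k. idx_id r \<gamma> = Some \<gamma>} = level r k" by (auto simp: idx_id_def level_def)
  then have eq: "fixed_count r (idx_id r) k = card (level r k)" by (simp add: fixed_count_def)
  show ?case
  proof (cases r)
    case 0
    have "level 0 k = {([], int k), ([], - int k)}" using assms by (auto simp: level_iff)
    then show ?thesis using eq assms 0 by simp
  next
    case (Suc l)
    let ?A = "{(g, m). length g = Suc l \<and> 0 \<le> hd g \<and> 0 \<le> (m :: int) \<and> sum_list g + nat m = k}"
    let ?B = "{(g, m). length g = Suc l \<and> 0 \<le> hd g \<and> (m :: int) < 0 \<and> sum_list g + nat (- m) = k}"
    have "level (Suc l) k = ?A \<union> ?B" by (auto simp: level_iff)
    moreover have "finite ?A" "finite ?B" by (rule finite_subset[OF _ finite_level[of "Suc l" k]], force simp: level_iff)+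
    ultimately have "card (level (Suc l) k) = card ?A + card ?B" by (simp only:) (rule card_Un_disjoint, auto)
    then show ?thesis using assms eq unfolding count_positive count_negative by (simp add: Suc)
  qed
next
  case (Suc d)
  then show ?case by (simp add: fixed_count_corner)
qed

lemma level_trace_act:
  "level_trace l (on_ell2 (H_idx l) (act f)) k = of_nat (fixed_count l f k)"
proof -
  have "level_trace l (on_ell2 (H_idx l) (act f)) k = (\<Sum>\<gamma>\<in>level l k. if f \<gamma> = Some \<gamma> then 1 else 0)"
    unfolding level_trace_def
    by (intro sum.cong) (auto simp: on_ell2_def act_def ket_def level_def intro: ell2_ket[unfolded ket_def] split: option.split)
  then show ?thesis by (simp add: fixed_count_def sum.If_cases[OF finite_level] Int_def)
qed

lemma A_inf_subset_delta_algebra: "A_inf l \<subseteq> delta_algebra (A_inf l) (H_idx l) (Dirac l)"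
proof
  fix a assume a: "a \<in> A_inf l"
  have "a \<in> (delta (H_idx l) (Dirac l) ^^ 0) ` A_inf l" using a by simp
  then show "a \<in> delta_algebra (A_inf l) (H_idx l) (Dirac l)"
    unfolding delta_algebra_def by (intro generated_algebra.generator) blast
qed

text \<open>For \<open>k \<ge> 1\<close> the level counts of the projection are a polynomial in
  \<open>k\<close> of degree \<open>r\<close> with leading coefficient \<open>2 / fact r\<close>,
  and a nonzero coefficient of degree \<open>r\<close> gives a pole at \<open>r + 1\<close>.\<close>

lemma pole_exists:
  assumes r: "r \<le> l"
  shows "\<exists>b\<in>delta_algebra (A_inf l) (H_idx l) (Dirac l). \<exists>F.
    zeta_extension (H_idx l) (Dirac l) (2 * real l + 4) b F \<and> is_pole F (of_nat (r + 1))"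
proof -
  define f where "f = corner_projection r (l - r)"
  define b where "b = on_ell2 (H_idx l) (act f)"
  have gf: "genA False l 0 f" using genA_corner_projection[of r "l - r"] r by (simp add: f_def)
  have bA: "b \<in> A_inf l"
    unfolding b_def A_inf_eq by (rule rapid_series_ops_single[where G = "genA False l" and a = 0, OF gf])
  obtain q :: "complex poly" where q: "degree q \<le> r" "coeff q r = 1 / fact r" "\<And>x. poly q x = x gchoose r"
    using binomial_poly by blast
  have dq: "degree q = r" using q(1,2) le_degree[of q r] by simp
  \<comment> \<open>Translating the argument changes neither the degree nor the leading
    coefficient.\<close>
  define s where "s c = pcompose q [:c, 1:]" for c
  have ds: "degree (s c) = r" and cs: "coeff (s c) r = 1 / fact r" for c
  proof -
    show d: "degree (s c) = r" by (simp add: s_def degree_pcompose dq)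
    have "lead_coeff (s c) = lead_coeff q" unfolding s_def by (subst lead_coeff_comp) auto
    then show "coeff (s c) r = 1 / fact r" using d dq q(2) by simp
  qed
  have ps: "poly (s c) x = (c + x) gchoose r" for c x by (simp add: s_def poly_pcompose q(3))
  define Q where "Q = s (of_nat r) + s (of_nat r - 1)"
  have dQ: "degree Q \<le> l" unfolding Q_def using r ds by (intro degree_add_le) auto
  have cQ: "coeff Q r \<noteq> 0" by (simp add: Q_def cs)
  \<comment> \<open>A correction that can be nonzero only on level 0.\<close>
  define E where "E k = level_trace l b k - poly Q (of_nat k)" for k
  have E0: "E k = 0" if k: "k \<ge> 1" for k
  proof -
    have "level_trace l b k = of_nat (((k + r) choose r) + ((k - 1 + r) choose r))"
      using fixed_count_corner_projection[OF k, of r "l - r"] r by (simp add: b_def level_trace_act f_def)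
    also have "\<dots> = (of_nat (k + r) gchoose r) + (of_nat (k - 1 + r) gchoose r)"
      by (simp only: of_nat_add[of "(k + r) choose r"] binomial_gbinomial)
    also have "\<dots> = poly Q (of_nat k)" using k by (simp add: Q_def ps of_nat_diff algebra_simps)
    finally show ?thesis by (simp add: E_def)
  qed
  have E: "rapidly_decaying E"
    unfolding rapidly_decaying_def
  proof (intro allI exI)
    fix m k
    show "cmod (E k) * (1 + real k) ^ m \<le> cmod (E 0)" by (cases "k = 0") (auto simp: E0)
  qed
  have "zeta_extension (H_idx l) (Dirac l) (2 * real l + 4) b (zeta_sum Q E)"
    by (rule zeta_extension_zeta_sum[OF _ E dQ]) (use bA A_inf_subset_B_ops in \<open>auto simp: E_def\<close>)
  moreover have "is_pole (zeta_sum Q E) (of_nat (r + 1))" by (rule zeta_sum_pole(1)[OF E cQ])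
  moreover have "b \<in> delta_algebra (A_inf l) (H_idx l) (Dirac l)" using bA A_inf_subset_delta_algebra by blast
  ultimately show ?thesis by blast
qed

lemma dimension_spectrum_A_inf:
  "has_dimension_spectrum (A_inf l) (H_idx l) (Dirac l) (of_nat ` {1..l + 1})"
  unfolding has_dimension_spectrum_def
proof (intro conjI exI[of _ "2 * real l + 4"] ballI)
  show "regular_triple (A_inf l) (H_idx l) (Dirac l)" by (rule regular_A_inf)
  have "finite (of_nat ` {1..l + 1} :: complex set)" by simp
  then show "discrete (of_nat ` {1..l + 1} :: complex set)"
    by (auto simp: discrete_def isolated_in_islimpt_iff islimpt_finite)
  show "summable_of_order (H_idx l) (Dirac l) (2 * real l + 4)" by (rule summable_of_order_Dirac)
  fix b assume "b \<in> delta_algebra (A_inf l) (H_idx l) (Dirac l)"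
  then have b: "b \<in> B_ops l" using delta_algebra_subset_B_ops by blast
  obtain Q E where QE: "rapidly_decaying E" "degree Q \<le> l" "\<And>k. level_trace l b k = poly Q (of_nat k) + E k"
    using B_ops_level_trace_poly[OF b] by blast
  have "{z. is_pole (zeta_sum Q E) z} \<subseteq> of_nat ` {1..l + 1}"
  proof
    fix z assume "z \<in> {z. is_pole (zeta_sum Q E) z}"
    then obtain i where "i \<le> degree Q" "z = of_nat (i + 1)" using zeta_sum_pole_imp[OF QE(1)] by blast
    then show "z \<in> of_nat ` {1..l + 1}" using QE(2) by (intro image_eqI[of _ _ "i + 1"]) auto
  qed
  then show "\<exists>F. zeta_extension (H_idx l) (Dirac l) (2 * real l + 4) b F \<and> {z. is_pole F z} \<subseteq> of_nat ` {1..l + 1}"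
    using zeta_extension_zeta_sum[OF b QE] by blast
next
  fix s :: complex assume "s \<in> of_nat ` {1..l + 1}"
  then obtain j where "j \<in> {1..l + 1}" "s = of_nat j" by blast
  then have "j - 1 \<le> l" "s = of_nat (j - 1 + 1)" by auto
  then show "\<exists>b\<in>delta_algebra (A_inf l) (H_idx l) (Dirac l). \<exists>F.
      zeta_extension (H_idx l) (Dirac l) (2 * real l + 4) b F \<and> is_pole F s"
    using pole_exists[of "j - 1" l] by simp
qed

text \<open>An extension for any admissible \<open>p\<close> agrees with \<open>zeta_sum\<close> for
  large \<open>Re z\<close>, hence on a punctured neighbourhood of every point; so poles and their
  orders carry over.\<close>

lemma simple_poles_A_inf: "only_simple_poles (A_inf l) (H_idx l) (Dirac l)"
  unfolding only_simple_poles_def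
proof (intro allI impI, elim conjE)
  fix p b F s
  assume "b \<in> delta_algebra (A_inf l) (H_idx l) (Dirac l)" and F: "zeta_extension (H_idx l) (Dirac l) p b F"
    and pole: "is_pole F s"
  then have b: "b \<in> B_ops l" using delta_algebra_subset_B_ops by blast
  obtain Q E where QE: "rapidly_decaying E" "degree Q \<le> l" "\<And>k. level_trace l b k = poly Q (of_nat k) + E k"
    using B_ops_level_trace_poly[OF b] by blast
  have ext: "zeta_extension (H_idx l) (Dirac l) (2 * real l + 4) b (zeta_sum Q E)"
    by (rule zeta_extension_zeta_sum[OF b QE])
  have ev: "\<forall>\<^sub>F z in at s. F z = zeta_sum Q E z"
  proof (rule meromorphic_unique[where R = "max p (2 * real l + 4)"])
    show "F meromorphic_on UNIV" "zeta_sum Q E meromorphic_on UNIV"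
      using F ext by (simp_all add: zeta_extension_def)
    show "F z = zeta_sum Q E z" if "Re z > max p (2 * real l + 4)" for z
      using F ext that by (simp add: zeta_extension_def)
  qed
  have "is_pole (zeta_sum Q E) s" using pole is_pole_cong[OF ev refl] by simp
  then obtain i where "coeff Q i \<noteq> 0" "s = of_nat (i + 1)" using zeta_sum_pole_imp[OF QE(1)] by blast
  then have "zorder (zeta_sum Q E) s = - 1" using zeta_sum_pole(2)[OF QE(1)] by simp
  then show "zorder F s = - 1" using zorder_cong[OF ev refl] by simp
qed

theorem proposition3p9:
  fixes l :: nat
  shows "spectral_triple (A_inf l) (H_idx l) (Dirac l) \<and>
    regular_triple (A_inf l) (H_idx l) (Dirac l) \<and>
    has_dimension_spectrum (A_inf l) (H_idx l) (Dirac l) (of_nat ` {1..l + 1}) \<and>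
    only_simple_poles (A_inf l) (H_idx l) (Dirac l)"
  by (intro conjI spectral_triple_A_inf regular_A_inf dimension_spectrum_A_inf simple_poles_A_inf)

end
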